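(* Let $K$ be a field and $\mathcal{T}$ a $K$-linear Krull-Schmidt essentially small triangulated category. Let $(\mathcal{C},\mathcal{D})$ be an ST-pair on $\mathcal{T}$, let $M=M_1\oplus\cdots\oplus M_n\in\mathcal{C}$ be a basic silting object of $\mathcal{C}$ with $|M|=n$, let $G\in\mathcal{D}$ and let $I\subseteq\{1,\ldots,n\}$. Let $\mu^{L}_{M_I}(M)$ be the left mutation of $M$ at $M_I=\bigoplus_{i\in I}M_i$, and let $\mathcal{X}_{S_I}=\{X\in\mathcal{D}^0_M\mid\mathrm{Hom}_{\mathcal{T}}(X,S_I)=0\}$, where $S_I=\bigoplus_{i\in I}S_i$. Then the diagram $$\begin{array}{ccc} M & \xrightarrow{\ \mu\ } & \mu^L_{M_I}(M)\\ \downarrow & & \downarrow\\ (\mathfrak{G}_G(\mathcal{D}_M^{\leq0}),\mathfrak{G}_G(\mathcal{D}_M^{\geq0})) & \longrightarrow & (\mathfrak{G}_G(\mathcal{D}_{\mu^L_{M_I}(M)}^{\leq0}),\mathfrak{G}_G(\mathcal{D}_{\mu^L_{M_I}(M)}^{\geq0}))\end{array}$$ commutes, where the top arrow is left mutation, the vertical arrows send a silting object $N$ of $\mathcal{C}$ to $(\mathfrak{G}_G(\mathcal{D}_N^{\leq0}),\mathfrak{G}_G(\mathcal{D}_N^{\geq0}))$, and the bottom arrow is the HRS-tilt at $\mathfrak{G}_G(\mathcal{X}_{S_I})$. That is, the $t$-structure $(\mathfrak{G}_G(\mathcal{D}_{\mu^L_{M_I}(M)}^{\leq0}),\mathfrak{G}_G(\mathcal{D}_{\mu^L_{M_I}(M)}^{\geq0}))$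 on $\mathfrak{G}_G(\mathcal{D})$ is the HRS-tilt of the $t$-structure $(\mathfrak{G}_G(\mathcal{D}_M^{\leq0}),\mathfrak{G}_G(\mathcal{D}_M^{\geq0}))$ with respect to the torsion class $\mathfrak{G}_G(\mathcal{X}_{S_I})$ of its heart.
   Context: Let $\Sigma$ denote the shift. Subcategories are considered up to isomorphism of objects. $\mathcal{U}*\mathcal{V}$ is the full subcategory of objects $Z$ admitting a triangle $U\to Z\to V\to\Sigma U$ with $U\in\mathcal{U}$, $V\in\mathcal{V}$. $\mathcal{U}^{\perp_{\mathcal{A}}}=\{A\in\mathcal{A}\mid\mathrm{Hom}(U,A)=0\ \forall U\in\mathcal{U}\}$. Silting and ST-pairs: Krull-Schmidt means every object is a finite direct sum of objects with local endomorphism algebras. An object $M$ is basic if $M\simeq M_1\oplus\cdots\oplus M_n$ with $M_i$ indecomposable and pairwise non-isomorphic; then $|M|=n$. $M$ is presilting if $\mathrm{Hom}(M,\Sigma^iM)=0$ for all $i>0$; it is a silting object of a thick subcategory $\mathcal{C}$ if it is presilting and the smallest thick subcategory containing $M$ is $\mathcal{C}$. For a presilting object $M$, a thick subcategory $\mathcal{S}$ of $\mathcal{T}$ and $i\in\mathbb{Z}$, put $\mathcal{S}_M^{\leq i}=\{X\in\mathcal{S}\mid\mathrm{Hom}_{\mathcal{T}}(M,\Sigma^{j}X)=0\ \forall j>i\}$, $\mathcal{S}_M^{\geq i}=\{X\in\mathcal{S}\mid\mathrm{Hom}_{\mathcal{T}}(M,\Sigma^{j}X)=0\ \forall j<i\}$,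 $\mathcal{S}_M^i=\mathcal{S}_M^{\leq i}\cap\mathcal{S}_M^{\geq i}$. A pair $(\mathcal{C},\mathcal{D})$ of thick subcategories of $\mathcal{T}$ is an ST-pair on $\mathcal{T}$ if there is a silting object $M$ of $\mathcal{C}$ such that (ST1) $\mathrm{Hom}_{\mathcal{T}}(M,T)$ is finite-dimensional over $K$ for all $T\in\mathcal{T}$; (ST2) $(\mathcal{T}_M^{\leq0},\mathcal{T}_M^{\geq0})$ is a $t$-structure on $\mathcal{T}$; (ST3) $\mathcal{T}=\bigcup_{i\in\mathbb{Z}}\mathcal{T}_M^{\leq i}$ and $\mathcal{D}=\bigcup_{i\in\mathbb{Z}}\mathcal{T}_M^{\geq i}$. In this situation $(\mathcal{D}_M^{\leq0},\mathcal{D}_M^{\geq0})$ is a bounded $t$-structure on $\mathcal{D}$. $S_1,\ldots,S_n$ is a complete set of pairwise non-isomorphic simple objects of the heart $\mathcal{D}_M^0$, indexed so that $\mathrm{Hom}_{\mathcal{T}}(M_i,S_j)=0$ for $i\neq j$; $\mathcal{X}_{S_I}$ is a torsion class of $\mathcal{D}_M^0$. The left mutation is $\mu^L_{M_I}(M)=\mathrm{Cone}(f)\oplus\bigoplus_{j\notin I}M_j$, where $f:M_I\to E$ is a minimal left $\mathrm{add}(\bigoplus_{j\notin I}M_j)$-approximation; it is a silting object of $\mathcal{C}$. $t$-structures: a $t$-structure on a triangulated category $\mathcal{S}$ is a pair $(\mathcal{S}^{\leq0},\mathcal{S}^{\geq0})$ of full subcategories such that, with $\mathcal{S}^{\leq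 n}=\Sigma^{-n}\mathcal{S}^{\leq0}$, $\mathcal{S}^{\geq n}=\Sigma^{-n}\mathcal{S}^{\geq0}$, one has $\mathcal{S}^{\leq-1}\subseteq\mathcal{S}^{\leq0}$, $\mathcal{S}^{\geq0}\subseteq\mathcal{S}^{\geq-1}$, $\mathrm{Hom}(\mathcal{S}^{\leq-1},\mathcal{S}^{\geq0})=0$ and $\mathcal{S}=\mathcal{S}^{\leq-1}*\mathcal{S}^{\geq0}$; heart $\mathcal{S}^0=\mathcal{S}^{\leq0}\cap\mathcal{S}^{\geq0}$. A torsion class of an abelian category $\mathcal{A}$ is a full subcategory $\mathcal{X}$ such that every $a\in\mathcal{A}$ has an exact sequence $0\to x\to a\to y\to0$ with $x\in\mathcal{X}$, $y\in\mathcal{X}^{\perp_{\mathcal{A}}}$. The HRS-tilt of $(\mathcal{S}^{\leq0},\mathcal{S}^{\geq0})$ with respect to a torsion class $\mathcal{X}$ of $\mathcal{S}^0$ is the $t$-structure $(\mathcal{S}^{\leq-1}*\mathcal{X},\ \Sigma(\mathcal{X}^{\perp_{\mathcal{S}^0}})*\mathcal{S}^{\geq0})$. Completion of $\mathcal{D}$ with respect to a $G$-good metric: a good metric on $\mathcal{D}$ is a sequence $\mathfrak{B}=\{\mathfrak{B}_n\}_{n\in\mathbb{N}}$ of full subcategories with $0\in\mathfrak{B}_n$, $\mathfrak{B}_n*\mathfrak{B}_n=\mathfrak{B}_n$ and $\Sigma^{-1}\mathfrak{B}_{n+1}\cup\mathfrak{B}_{n+1}\cup\Sigma\mathfrak{B}_{n+1}\subseteq\mathfrak{B}_n$.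 Two metrics $\mathfrak{B},\mathfrak{N}$ are equivalent if for each $n$ there is $m$ with $\mathfrak{B}_m\subseteq\mathfrak{N}_n$ and for each $n$ there is $m$ with $\mathfrak{N}_m\subseteq\mathfrak{B}_n$. Let $G[-\infty,-n]=\{\Sigma^{-j}G\mid j\in\mathbb{Z},\ j\leq-n\}$, $\mathrm{coprod}_1(\mathcal{U})=\mathrm{add}(\mathcal{U})$ (closure under finite direct sums and direct summands), $\mathrm{coprod}_{i+1}(\mathcal{U})=\mathrm{coprod}_1(\mathcal{U})*\mathrm{coprod}_i(\mathcal{U})$, and let $\langle G\rangle^{[-\infty,-n]}$ be the union over $i>0$ of the closures under direct summands of $\mathrm{coprod}_i(G[-\infty,-n])$. A $G$-good metric is a good metric equivalent to $\{\langle G\rangle^{[-\infty,-n]}\}_{n\in\mathbb{N}}$. Fix such a metric $\mathfrak{B}$ on $\mathcal{D}$. A sequence $X_0\xrightarrow{f_1}X_1\xrightarrow{f_2}\cdots$ in $\mathcal{D}$ is Cauchy if for each $i\geq1$ there is $n_i\geq 1$ with $\mathrm{Cone}(f_j)\in\mathfrak{B}_i$ for all $j\geq n_i$. Let $Y:\mathcal{D}\to\text{Mod-}\mathcal{D}$ be the Yoneda embedding into additive contravariant functors from $\mathcal{D}$ to abelian groups. For a full subcategory $\mathcal{U}\subseteq\mathcal{D}$, $\mathfrak{G}_G(\mathcal{U})$ is the full subcategory of functors $F$ such that $F\simeq\operatorname{colim}_nY(X_n)$ for a Cauchy sequence with all $X_n\in\mathcal{U}$, and such that for every $j\in\mathbb{Z}$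 there is $i\in\mathbb{N}$ with $\mathrm{Hom}(Y(\Sigma^jB),F)=0$ for all $B\in\mathfrak{B}_i$. (Equivalent good metrics give the same $\mathfrak{G}_G(\mathcal{U})$.) $\mathfrak{G}_G(\mathcal{D})$ is triangulated with shift $(\Sigma F)(T)=F(\Sigma^{-1}T)$, triangles being the sequences in $\mathfrak{G}_G(\mathcal{D})$ isomorphic to colimits of Yoneda images of Cauchy sequences of triangles in $\mathcal{D}$. *)

theory Defs
  imports "HOL-Algebra.FiniteProduct" "HOL-Library.FuncSet"
begin

section \<open>Preadditive categories and triangulated categories\<close>

text \<open>
  Categories are small: the objects form a set of elements of a type, and the morphisms from \<open>A\<close>
  to \<open>B\<close> form the carrier of an abelian group \<open>hgrp T A B\<close>.  These groups are groups in the sense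
  of HOL-Algebra, hence written multiplicatively: \<open>f \<otimes> g\<close> is the sum of two morphisms, \<open>\<one>\<close> is the
  zero morphism and \<open>inv f\<close> is the morphism \<open>- f\<close>.  \<open>cmp T g f\<close> is ``\<open>g\<close> after \<open>f\<close>''.
  The suspension is \<open>sh\<close> on objects and \<open>shm\<close> on morphisms;
  \<open>tri T X Y Z u v w\<close> says that \<open>X \<rightarrow> Y \<rightarrow> Z \<rightarrow> sh X\<close> is a distinguished triangle.
\<close>

record ('o, 'm) tcat =
  Obj  :: "'o set"
  hgrp :: "'o \<Rightarrow> 'o \<Rightarrow> 'm monoid"
  idn  :: "'o \<Rightarrow> 'm"
  cmp  :: "'m \<Rightarrow> 'm \<Rightarrow> 'm"
  sh   :: "'o \<Rightarrow> 'o"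
  shm  :: "'m \<Rightarrow> 'm"
  tri  :: "'o \<Rightarrow> 'o \<Rightarrow> 'o \<Rightarrow> 'm \<Rightarrow> 'm \<Rightarrow> 'm \<Rightarrow> bool"

record ('o, 'm, 'k) kcat = "('o, 'm) tcat" +
  scl :: "'k \<Rightarrow> 'm \<Rightarrow> 'm"

abbreviation Hom :: "('o, 'm, 'z) tcat_scheme \<Rightarrow> 'o \<Rightarrow> 'o \<Rightarrow> 'm set"
  where "Hom T A B \<equiv> carrier (hgrp T A B)"

definition Arr :: "('o, 'm, 'z) tcat_scheme \<Rightarrow> 'm set"
  where "Arr T = (\<Union>A\<in>Obj T. \<Union>B\<in>Obj T. Hom T A B)"

definition hom_zero :: "('o, 'm, 'z) tcat_scheme \<Rightarrow> 'o \<Rightarrow> 'o \<Rightarrow> bool"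
  where "hom_zero T A B \<longleftrightarrow> Hom T A B = {\<one>\<^bsub>hgrp T A B\<^esub>}"

text \<open>
  The full subcategory on a set of objects.  Its triangles are the triangles of the ambient
  category all of whose objects lie in the given set.
\<close>

definition fullsub :: "('o, 'm, 'z) tcat_scheme \<Rightarrow> 'o set \<Rightarrow> ('o, 'm, 'z) tcat_scheme"
  where "fullsub T U = T\<lparr>Obj := U\<rparr>"

definition is_iso :: "('o, 'm, 'z) tcat_scheme \<Rightarrow> 'o \<Rightarrow> 'o \<Rightarrow> 'm \<Rightarrow> bool"
  where "is_iso T A B f \<longleftrightarrow>
    f \<in> Hom T A B \<and> (\<exists>g\<in>Hom T B A. cmp T g f = idn T A \<and> cmp T f g = idn T B)"

definition isomorphic :: "('o, 'm, 'z) tcat_scheme \<Rightarrow> 'o \<Rightarrow> 'o \<Rightarrow> bool"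
  where "isomorphic T A B \<longleftrightarrow> (\<exists>f. is_iso T A B f)"

definition is_zero :: "('o, 'm, 'z) tcat_scheme \<Rightarrow> 'o \<Rightarrow> bool"
  where "is_zero T Z \<longleftrightarrow> Z \<in> Obj T \<and> (\<forall>A\<in>Obj T. hom_zero T Z A \<and> hom_zero T A Z)"

text \<open>Subcategories are considered up to isomorphism of objects, i.e. they are strictly full.\<close>

definition subcat :: "('o, 'm, 'z) tcat_scheme \<Rightarrow> 'o set \<Rightarrow> bool"
  where "subcat T U \<longleftrightarrow> U \<subseteq> Obj T \<and> (\<forall>A\<in>U. \<forall>B\<in>Obj T. isomorphic T A B \<longrightarrow> B \<in> U)"

definition is_dsum :: "('o, 'm, 'z) tcat_scheme \<Rightarrow> 'i set \<Rightarrow> ('i \<Rightarrow> 'o) \<Rightarrow> 'o \<Rightarrow> bool"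
  where "is_dsum T J Y X \<longleftrightarrow>
    finite J \<and> X \<in> Obj T \<and> (\<forall>k\<in>J. Y k \<in> Obj T) \<and>
    (\<exists>\<iota> \<pi>. (\<forall>k\<in>J. \<iota> k \<in> Hom T (Y k) X \<and> \<pi> k \<in> Hom T X (Y k)) \<and>
      (\<forall>k\<in>J. \<forall>l\<in>J. cmp T (\<pi> k) (\<iota> l) = (if k = l then idn T (Y k) else \<one>\<^bsub>hgrp T (Y l) (Y k)\<^esub>)) \<and>
      finprod (hgrp T X X) (\<lambda>k. cmp T (\<iota> k) (\<pi> k)) J = idn T X)"

definition is_dsum2 :: "('o, 'm, 'z) tcat_scheme \<Rightarrow> 'o \<Rightarrow> 'o \<Rightarrow> 'o \<Rightarrow> bool"
  where "is_dsum2 T A B X \<longleftrightarrow> is_dsum T (UNIV :: bool set) (\<lambda>b. if b then A else B) X"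

definition summand :: "('o, 'm, 'z) tcat_scheme \<Rightarrow> 'o \<Rightarrow> 'o \<Rightarrow> bool"
  where "summand T A X \<longleftrightarrow> (\<exists>B. is_dsum2 T A B X)"

definition indecomposable :: "('o, 'm, 'z) tcat_scheme \<Rightarrow> 'o \<Rightarrow> bool"
  where "indecomposable T X \<longleftrightarrow> X \<in> Obj T \<and> \<not> is_zero T X \<and>
    (\<forall>A B. is_dsum2 T A B X \<longrightarrow> is_zero T A \<or> is_zero T B)"

text \<open>The endomorphism ring is local: it is nonzero and the non-units are closed under addition.\<close>

definition local_end :: "('o, 'm, 'z) tcat_scheme \<Rightarrow> 'o \<Rightarrow> bool"
  where "local_end T X \<longleftrightarrow> idn T X \<noteq> \<one>\<^bsub>hgrp T X X\<^esub> \<and>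
    (\<forall>f\<in>Hom T X X. \<forall>g\<in>Hom T X X. is_iso T X X (f \<otimes>\<^bsub>hgrp T X X\<^esub> g) \<longrightarrow>
      is_iso T X X f \<or> is_iso T X X g)"

definition krull_schmidt :: "('o, 'm, 'z) tcat_scheme \<Rightarrow> bool"
  where "krull_schmidt T \<longleftrightarrow> (\<forall>X\<in>Obj T. \<exists>(n::nat) Y. is_dsum T {1..n} Y X \<and>
    (\<forall>i\<in>{1..n}. local_end T (Y i)))"

locale additive_category =
  fixes T :: "('o, 'm, 'z) tcat_scheme"
  assumes hom_disjoint: "\<lbrakk>A \<in> Obj T; B \<in> Obj T; A' \<in> Obj T; B' \<in> Obj T;
      f \<in> Hom T A B; f \<in> Hom T A' B'\<rbrakk> \<Longrightarrow> A = A' \<and> B = B'"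
    and idn_closed: "A \<in> Obj T \<Longrightarrow> idn T A \<in> Hom T A A"
    and cmp_closed: "\<lbrakk>A \<in> Obj T; B \<in> Obj T; C \<in> Obj T; f \<in> Hom T A B; g \<in> Hom T B C\<rbrakk>
      \<Longrightarrow> cmp T g f \<in> Hom T A C"
    and cmp_assoc: "\<lbrakk>A \<in> Obj T; B \<in> Obj T; C \<in> Obj T; D \<in> Obj T;
      f \<in> Hom T A B; g \<in> Hom T B C; h \<in> Hom T C D\<rbrakk>
      \<Longrightarrow> cmp T h (cmp T g f) = cmp T (cmp T h g) f"
    and cmp_idn_right: "\<lbrakk>A \<in> Obj T; B \<in> Obj T; f \<in> Hom T A B\<rbrakk> \<Longrightarrow> cmp T f (idn T A) = f"
    and cmp_idn_left: "\<lbrakk>A \<in> Obj T; B \<in> Obj T; f \<in> Hom T A B\<rbrakk> \<Longrightarrow> cmp T (idn T B) f = f"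
    and hgrp_comm_group: "\<lbrakk>A \<in> Obj T; B \<in> Obj T\<rbrakk> \<Longrightarrow> comm_group (hgrp T A B)"
    and cmp_add_left: "\<lbrakk>A \<in> Obj T; B \<in> Obj T; C \<in> Obj T;
      f \<in> Hom T A B; g \<in> Hom T B C; g' \<in> Hom T B C\<rbrakk>
      \<Longrightarrow> cmp T (g \<otimes>\<^bsub>hgrp T B C\<^esub> g') f = cmp T g f \<otimes>\<^bsub>hgrp T A C\<^esub> cmp T g' f"
    and cmp_add_right: "\<lbrakk>A \<in> Obj T; B \<in> Obj T; C \<in> Obj T;
      f \<in> Hom T A B; f' \<in> Hom T A B; g \<in> Hom T B C\<rbrakk>
      \<Longrightarrow> cmp T g (f \<otimes>\<^bsub>hgrp T A B\<^esub> f') = cmp T g f \<otimes>\<^bsub>hgrp T A C\<^esub> cmp T g f'"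
    and dsum_exists: "(\<forall>k\<in>{..<n}. Y k \<in> Obj T) \<Longrightarrow> \<exists>X. is_dsum T {..<n::nat} Y X"

text \<open>
  As in Neeman's book the suspension is an automorphism of the category, so that all integer
  powers of it are honest functors.
\<close>

locale triangulated_category = additive_category T for T :: "('o, 'm, 'z) tcat_scheme" +
  assumes sh_bij: "bij_betw (sh T) (Obj T) (Obj T)"
    and shm_bij: "\<lbrakk>A \<in> Obj T; B \<in> Obj T\<rbrakk>
      \<Longrightarrow> bij_betw (shm T) (Hom T A B) (Hom T (sh T A) (sh T B))"
    and shm_add: "\<lbrakk>A \<in> Obj T; B \<in> Obj T\<rbrakk>
      \<Longrightarrow> shm T \<in> hom (hgrp T A B) (hgrp T (sh T A) (sh T B))"
    and shm_idn: "A \<in> Obj T \<Longrightarrow> shm T (idn T A) = idn T (sh T A)"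
    and shm_cmp: "\<lbrakk>A \<in> Obj T; B \<in> Obj T; C \<in> Obj T; f \<in> Hom T A B; g \<in> Hom T B C\<rbrakk>
      \<Longrightarrow> shm T (cmp T g f) = cmp T (shm T g) (shm T f)"
    and tri_hom: "\<lbrakk>X \<in> Obj T; Y \<in> Obj T; Z \<in> Obj T; tri T X Y Z u v w\<rbrakk>
      \<Longrightarrow> u \<in> Hom T X Y \<and> v \<in> Hom T Y Z \<and> w \<in> Hom T Z (sh T X)"
    and tri_iso: "\<lbrakk>X \<in> Obj T; Y \<in> Obj T; Z \<in> Obj T; X' \<in> Obj T; Y' \<in> Obj T; Z' \<in> Obj T;
      tri T X Y Z u v w;
      u' \<in> Hom T X' Y'; v' \<in> Hom T Y' Z'; w' \<in> Hom T Z' (sh T X');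
      is_iso T X X' a; is_iso T Y Y' b; is_iso T Z Z' c;
      cmp T b u = cmp T u' a; cmp T c v = cmp T v' b; cmp T (shm T a) w = cmp T w' c\<rbrakk>
      \<Longrightarrow> tri T X' Y' Z' u' v' w'"
    and tri_idn: "\<lbrakk>X \<in> Obj T; is_zero T Z\<rbrakk>
      \<Longrightarrow> tri T X X Z (idn T X) \<one>\<^bsub>hgrp T X Z\<^esub> \<one>\<^bsub>hgrp T Z (sh T X)\<^esub>"
    and tri_cone: "\<lbrakk>X \<in> Obj T; Y \<in> Obj T; u \<in> Hom T X Y\<rbrakk>
      \<Longrightarrow> \<exists>Z\<in>Obj T. \<exists>v w. tri T X Y Z u v w"
    and tri_rotate: "\<lbrakk>X \<in> Obj T; Y \<in> Obj T; Z \<in> Obj T;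
      u \<in> Hom T X Y; v \<in> Hom T Y Z; w \<in> Hom T Z (sh T X)\<rbrakk>
      \<Longrightarrow> tri T X Y Z u v w \<longleftrightarrow> tri T Y Z (sh T X) v w (inv\<^bsub>hgrp T (sh T X) (sh T Y)\<^esub> (shm T u))"
    and tri_morphism: "\<lbrakk>X \<in> Obj T; Y \<in> Obj T; Z \<in> Obj T; X' \<in> Obj T; Y' \<in> Obj T; Z' \<in> Obj T;
      tri T X Y Z u v w; tri T X' Y' Z' u' v' w';
      a \<in> Hom T X X'; b \<in> Hom T Y Y'; cmp T b u = cmp T u' a\<rbrakk>
      \<Longrightarrow> \<exists>c\<in>Hom T Z Z'. cmp T c v = cmp T v' b \<and> cmp T (shm T a) w = cmp T w' c"
    and octahedral: "\<lbrakk>X \<in> Obj T; Y \<in> Obj T; Z \<in> Obj T; X' \<in> Obj T; Y' \<in> Obj T; Z' \<in> Obj T;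
      tri T X Y Z' u i i'; tri T Y Z X' v j j'; tri T X Z Y' (cmp T v u) k k'\<rbrakk>
      \<Longrightarrow> \<exists>f\<in>Hom T Z' Y'. \<exists>g\<in>Hom T Y' X'.
        tri T Z' Y' X' f g (cmp T (shm T i) j') \<and>
        cmp T f i = cmp T k v \<and> cmp T k' f = i' \<and>
        cmp T g k = j \<and> cmp T j' g = cmp T (shm T u) k'"

locale linear_triangulated_category = triangulated_category T
  for T :: "('o, 'm, 'k::field) kcat" +
  assumes scl_closed: "\<lbrakk>A \<in> Obj T; B \<in> Obj T; f \<in> Hom T A B\<rbrakk> \<Longrightarrow> scl T c f \<in> Hom T A B"
    and scl_one: "\<lbrakk>A \<in> Obj T; B \<in> Obj T; f \<in> Hom T A B\<rbrakk> \<Longrightarrow> scl T 1 f = f"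
    and scl_mult: "\<lbrakk>A \<in> Obj T; B \<in> Obj T; f \<in> Hom T A B\<rbrakk>
      \<Longrightarrow> scl T (c * d) f = scl T c (scl T d f)"
    and scl_add_left: "\<lbrakk>A \<in> Obj T; B \<in> Obj T; f \<in> Hom T A B\<rbrakk>
      \<Longrightarrow> scl T (c + d) f = scl T c f \<otimes>\<^bsub>hgrp T A B\<^esub> scl T d f"
    and scl_add_right: "\<lbrakk>A \<in> Obj T; B \<in> Obj T; f \<in> Hom T A B; g \<in> Hom T A B\<rbrakk>
      \<Longrightarrow> scl T c (f \<otimes>\<^bsub>hgrp T A B\<^esub> g) = scl T c f \<otimes>\<^bsub>hgrp T A B\<^esub> scl T c g"
    and scl_cmp_left: "\<lbrakk>A \<in> Obj T; B \<in> Obj T; C \<in> Obj T; f \<in> Hom T A B; g \<in> Hom T B C\<rbrakk>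
      \<Longrightarrow> cmp T (scl T c g) f = scl T c (cmp T g f)"
    and scl_cmp_right: "\<lbrakk>A \<in> Obj T; B \<in> Obj T; C \<in> Obj T; f \<in> Hom T A B; g \<in> Hom T B C\<rbrakk>
      \<Longrightarrow> cmp T g (scl T c f) = scl T c (cmp T g f)"
    and scl_shm: "\<lbrakk>A \<in> Obj T; B \<in> Obj T; f \<in> Hom T A B\<rbrakk> \<Longrightarrow> shm T (scl T c f) = scl T c (shm T f)"

definition hom_finite_dim :: "('o, 'm, 'k::field) kcat \<Rightarrow> 'o \<Rightarrow> 'o \<Rightarrow> bool"
  where "hom_finite_dim T A B \<longleftrightarrow> (\<exists>S. finite S \<and> S \<subseteq> Hom T A B \<and>
    (\<forall>f\<in>Hom T A B. \<exists>c. f = finprod (hgrp T A B) (\<lambda>s. scl T (c s) s) S))"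

section \<open>Subcategories of a triangulated category\<close>

text \<open>Integer powers of the suspension, and the inverse suspension of a morphism.\<close>

definition shpow :: "('o, 'm, 'z) tcat_scheme \<Rightarrow> int \<Rightarrow> 'o \<Rightarrow> 'o"
  where "shpow T j X = (if 0 \<le> j then (sh T ^^ nat j) X
                         else (inv_into (Obj T) (sh T) ^^ nat (- j)) X)"

definition shm_inv :: "('o, 'm, 'z) tcat_scheme \<Rightarrow> 'm \<Rightarrow> 'm"
  where "shm_inv T f = inv_into (Arr T) (shm T) f"

definition shsub :: "('o, 'm, 'z) tcat_scheme \<Rightarrow> int \<Rightarrow> 'o set \<Rightarrow> 'o set"
  where "shsub T j U = {X \<in> Obj T. \<exists>A\<in>U. isomorphic T X (shpow T j A)}"

definition star :: "('o, 'm, 'z) tcat_scheme \<Rightarrow> 'o set \<Rightarrow> 'o set \<Rightarrow> 'o set"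
  where "star T U V = {Z \<in> Obj T. \<exists>A\<in>U. \<exists>B\<in>V. \<exists>u v w. tri T A Z B u v w}"

definition perp :: "('o, 'm, 'z) tcat_scheme \<Rightarrow> 'o set \<Rightarrow> 'o set \<Rightarrow> 'o set"
  where "perp T \<A> U = {A \<in> \<A>. \<forall>X\<in>U. hom_zero T X A}"

definition smd :: "('o, 'm, 'z) tcat_scheme \<Rightarrow> 'o set \<Rightarrow> 'o set"
  where "smd T U = {X \<in> Obj T. \<exists>Z\<in>U. summand T X Z}"

definition addcl :: "('o, 'm, 'z) tcat_scheme \<Rightarrow> 'o set \<Rightarrow> 'o set"
  where "addcl T U = smd T {Z. \<exists>(m::nat) Y. (\<forall>k\<in>{..<m}. Y k \<in> U) \<and> is_dsum T {..<m} Y Z}"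

definition thick :: "('o, 'm, 'z) tcat_scheme \<Rightarrow> 'o set \<Rightarrow> bool"
  where "thick T C \<longleftrightarrow> subcat T C \<and> C \<noteq> {} \<and>
    (\<forall>X\<in>Obj T. sh T X \<in> C \<longleftrightarrow> X \<in> C) \<and>
    (\<forall>X\<in>C. \<forall>Y\<in>C. \<forall>Z\<in>Obj T. \<forall>u v w. tri T X Y Z u v w \<longrightarrow> Z \<in> C) \<and>
    (\<forall>X\<in>C. \<forall>A\<in>Obj T. summand T A X \<longrightarrow> A \<in> C)"

definition thick_closure :: "('o, 'm, 'z) tcat_scheme \<Rightarrow> 'o \<Rightarrow> 'o set"
  where "thick_closure T M = \<Inter>{C. thick T C \<and> M \<in> C}"

section \<open>Silting objects, t-structures and ST-pairs\<close>

definition presilting :: "('o, 'm, 'z) tcat_scheme \<Rightarrow> 'o \<Rightarrow> bool"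
  where "presilting T M \<longleftrightarrow> M \<in> Obj T \<and> (\<forall>i>0. hom_zero T M (shpow T i M))"

definition silting :: "('o, 'm, 'z) tcat_scheme \<Rightarrow> 'o set \<Rightarrow> 'o \<Rightarrow> bool"
  where "silting T C M \<longleftrightarrow> presilting T M \<and> thick_closure T M = C"

definition basic_decomposition ::
    "('o, 'm, 'z) tcat_scheme \<Rightarrow> nat \<Rightarrow> (nat \<Rightarrow> 'o) \<Rightarrow> 'o \<Rightarrow> bool"
  where "basic_decomposition T n N M \<longleftrightarrow> is_dsum T {1..n} N M \<and>
    (\<forall>i\<in>{1..n}. indecomposable T (N i)) \<and>
    (\<forall>i\<in>{1..n}. \<forall>j\<in>{1..n}. i \<noteq> j \<longrightarrow> \<not> isomorphic T (N i) (N j))"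

definition sub_le :: "('o, 'm, 'z) tcat_scheme \<Rightarrow> 'o set \<Rightarrow> 'o \<Rightarrow> int \<Rightarrow> 'o set"
  where "sub_le T S M i = {X \<in> S. \<forall>j>i. hom_zero T M (shpow T j X)}"

definition sub_ge :: "('o, 'm, 'z) tcat_scheme \<Rightarrow> 'o set \<Rightarrow> 'o \<Rightarrow> int \<Rightarrow> 'o set"
  where "sub_ge T S M i = {X \<in> S. \<forall>j<i. hom_zero T M (shpow T j X)}"

definition sub_eq :: "('o, 'm, 'z) tcat_scheme \<Rightarrow> 'o set \<Rightarrow> 'o \<Rightarrow> int \<Rightarrow> 'o set"
  where "sub_eq T S M i = sub_le T S M i \<inter> sub_ge T S M i"

definition t_structure :: "('o, 'm, 'z) tcat_scheme \<Rightarrow> 'o set \<times> 'o set \<Rightarrow> bool"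
  where "t_structure S = (\<lambda>(L, R). subcat S L \<and> subcat S R \<and>
    shsub S 1 L \<subseteq> L \<and> R \<subseteq> shsub S 1 R \<and>
    (\<forall>X\<in>shsub S 1 L. \<forall>Y\<in>R. hom_zero S X Y) \<and>
    star S (shsub S 1 L) R = Obj S)"

definition heart :: "'o set \<times> 'o set \<Rightarrow> 'o set"
  where "heart = (\<lambda>(L, R). L \<inter> R)"

definition ST_pair :: "('o, 'm, 'k::field) kcat \<Rightarrow> 'o set \<Rightarrow> 'o set \<Rightarrow> bool"
  where "ST_pair T C D \<longleftrightarrow> thick T C \<and> thick T D \<and>
    (\<exists>M. silting T C M \<and>
      (\<forall>X\<in>Obj T. hom_finite_dim T M X) \<and>
      t_structure T (sub_le T (Obj T) M 0, sub_ge T (Obj T) M 0) \<and>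
      Obj T = (\<Union>i. sub_le T (Obj T) M i) \<and>
      D = (\<Union>i. sub_ge T (Obj T) M i))"

section \<open>Torsion classes, simple objects and HRS-tilts\<close>

definition is_kernel :: "('o, 'm, 'z) tcat_scheme \<Rightarrow> 'o \<Rightarrow> 'o \<Rightarrow> 'o \<Rightarrow> 'm \<Rightarrow> 'm \<Rightarrow> bool"
  where "is_kernel \<A> X A Y f g \<longleftrightarrow> cmp \<A> g f = \<one>\<^bsub>hgrp \<A> X Y\<^esub> \<and>
    (\<forall>W\<in>Obj \<A>. \<forall>h\<in>Hom \<A> W A. cmp \<A> g h = \<one>\<^bsub>hgrp \<A> W Y\<^esub> \<longrightarrow>
      (\<exists>!k. k \<in> Hom \<A> W X \<and> cmp \<A> f k = h))"

definition is_cokernel :: "('o, 'm, 'z) tcat_scheme \<Rightarrow> 'o \<Rightarrow> 'o \<Rightarrow> 'o \<Rightarrow> 'm \<Rightarrow> 'm \<Rightarrow> bool"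
  where "is_cokernel \<A> X A Y f g \<longleftrightarrow> cmp \<A> g f = \<one>\<^bsub>hgrp \<A> X Y\<^esub> \<and>
    (\<forall>W\<in>Obj \<A>. \<forall>h\<in>Hom \<A> A W. cmp \<A> h f = \<one>\<^bsub>hgrp \<A> X W\<^esub> \<longrightarrow>
      (\<exists>!k. k \<in> Hom \<A> Y W \<and> cmp \<A> k g = h))"

definition short_exact :: "('o, 'm, 'z) tcat_scheme \<Rightarrow> 'o \<Rightarrow> 'o \<Rightarrow> 'o \<Rightarrow> 'm \<Rightarrow> 'm \<Rightarrow> bool"
  where "short_exact \<A> X A Y f g \<longleftrightarrow>
    X \<in> Obj \<A> \<and> A \<in> Obj \<A> \<and> Y \<in> Obj \<A> \<and> f \<in> Hom \<A> X A \<and> g \<in> Hom \<A> A Y \<and>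
    is_kernel \<A> X A Y f g \<and> is_cokernel \<A> X A Y f g"

definition torsion_class :: "('o, 'm, 'z) tcat_scheme \<Rightarrow> 'o set \<Rightarrow> bool"
  where "torsion_class \<A> \<X> \<longleftrightarrow> subcat \<A> \<X> \<and>
    (\<forall>A\<in>Obj \<A>. \<exists>X\<in>\<X>. \<exists>Y\<in>perp \<A> (Obj \<A>) \<X>. \<exists>f g. short_exact \<A> X A Y f g)"

definition is_mono :: "('o, 'm, 'z) tcat_scheme \<Rightarrow> 'o \<Rightarrow> 'o \<Rightarrow> 'm \<Rightarrow> bool"
  where "is_mono \<A> A B f \<longleftrightarrow> f \<in> Hom \<A> A B \<and>
    (\<forall>W\<in>Obj \<A>. \<forall>h\<in>Hom \<A> W A. \<forall>k\<in>Hom \<A> W A. cmp \<A> f h = cmp \<A> f k \<longrightarrow> h = k)"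

definition simple_object :: "('o, 'm, 'z) tcat_scheme \<Rightarrow> 'o \<Rightarrow> bool"
  where "simple_object \<A> X \<longleftrightarrow> X \<in> Obj \<A> \<and> \<not> is_zero \<A> X \<and>
    (\<forall>A\<in>Obj \<A>. \<forall>f. is_mono \<A> A X f \<longrightarrow> is_zero \<A> A \<or> is_iso \<A> A X f)"

definition complete_simples :: "('o, 'm, 'z) tcat_scheme \<Rightarrow> nat \<Rightarrow> (nat \<Rightarrow> 'o) \<Rightarrow> bool"
  where "complete_simples \<A> n S \<longleftrightarrow>
    (\<forall>i\<in>{1..n}. simple_object \<A> (S i)) \<and>
    (\<forall>i\<in>{1..n}. \<forall>j\<in>{1..n}. i \<noteq> j \<longrightarrow> \<not> isomorphic \<A> (S i) (S j)) \<and>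
    (\<forall>X. simple_object \<A> X \<longrightarrow> (\<exists>i\<in>{1..n}. isomorphic \<A> X (S i)))"

definition HRS_tilt ::
    "('o, 'm, 'z) tcat_scheme \<Rightarrow> 'o set \<times> 'o set \<Rightarrow> 'o set \<Rightarrow> 'o set \<times> 'o set"
  where "HRS_tilt S = (\<lambda>(L, R) \<X>.
    (star S (shsub S 1 L) \<X>, star S (shsub S 1 (perp S (heart (L, R)) \<X>)) R))"

section \<open>Left mutation\<close>

definition minimal_left_approx ::
    "('o, 'm, 'z) tcat_scheme \<Rightarrow> 'o set \<Rightarrow> 'o \<Rightarrow> 'o \<Rightarrow> 'm \<Rightarrow> bool"
  where "minimal_left_approx T U X E f \<longleftrightarrow> E \<in> U \<and> f \<in> Hom T X E \<and>
    (\<forall>E'\<in>U. \<forall>g\<in>Hom T X E'. \<exists>h\<in>Hom T E E'. cmp T h f = g) \<and>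
    (\<forall>h\<in>Hom T E E. cmp T h f = f \<longrightarrow> is_iso T E E h)"

text \<open>\<open>left_mutation T n N I M'\<close>: up to isomorphism, the object \<open>M'\<close> is the left mutation of the direct sum
  of \<open>N 1, \<dots>, N n\<close> at the direct sum of the \<open>N i\<close> with \<open>i \<in> I\<close>.\<close>

definition left_mutation ::
    "('o, 'm, 'z) tcat_scheme \<Rightarrow> nat \<Rightarrow> (nat \<Rightarrow> 'o) \<Rightarrow> nat set \<Rightarrow> 'o \<Rightarrow> bool"
  where "left_mutation T n N I M' \<longleftrightarrow>
    (\<exists>N\<^sub>I N\<^sub>J E f Q v w. is_dsum T I N N\<^sub>I \<and> is_dsum T ({1..n} - I) N N\<^sub>J \<and>
      minimal_left_approx T (addcl T {N\<^sub>J}) N\<^sub>I E f \<and>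
      Q \<in> Obj T \<and> tri T N\<^sub>I E Q f v w \<and> is_dsum2 T Q N\<^sub>J M')"

section \<open>Good metrics\<close>

definition good_metric :: "('o, 'm, 'z) tcat_scheme \<Rightarrow> (nat \<Rightarrow> 'o set) \<Rightarrow> bool"
  where "good_metric D \<BB> \<longleftrightarrow> (\<forall>n. subcat D (\<BB> n) \<and>
    (\<forall>Z. is_zero D Z \<longrightarrow> Z \<in> \<BB> n) \<and>
    star D (\<BB> n) (\<BB> n) = \<BB> n \<and>
    shsub D (- 1) (\<BB> (Suc n)) \<union> \<BB> (Suc n) \<union> shsub D 1 (\<BB> (Suc n)) \<subseteq> \<BB> n)"

definition equivalent_metrics :: "(nat \<Rightarrow> 'o set) \<Rightarrow> (nat \<Rightarrow> 'o set) \<Rightarrow> bool"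
  where "equivalent_metrics \<BB> \<NN> \<longleftrightarrow> (\<forall>n. \<exists>m. \<BB> m \<subseteq> \<NN> n) \<and> (\<forall>n. \<exists>m. \<NN> m \<subseteq> \<BB> n)"

text \<open>\<open>coprod D U i\<close> is \<open>coprod\<^sub>i\<close>, for \<open>i \<ge> 1\<close>; the value at \<open>0\<close> is not used.\<close>

fun coprod :: "('o, 'm, 'z) tcat_scheme \<Rightarrow> 'o set \<Rightarrow> nat \<Rightarrow> 'o set" where
  "coprod D U 0 = {}"
| "coprod D U (Suc 0) = addcl D U"
| "coprod D U (Suc (Suc i)) = star D (addcl D U) (coprod D U (Suc i))"

definition generated_metric :: "('o, 'm, 'z) tcat_scheme \<Rightarrow> 'o \<Rightarrow> nat \<Rightarrow> 'o set"
  where "generated_metric D G n =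
    (\<Union>i\<in>{0<..}. smd D (coprod D {shpow D (- j) G |j. j \<le> - int n} i))"

definition G_good_metric :: "('o, 'm, 'z) tcat_scheme \<Rightarrow> 'o \<Rightarrow> (nat \<Rightarrow> 'o set) \<Rightarrow> bool"
  where "G_good_metric D G \<BB> \<longleftrightarrow>
    good_metric D \<BB> \<and> equivalent_metrics \<BB> (generated_metric D G)"

text \<open>A sequence \<open>X\<^sub>0 \<rightarrow> X\<^sub>1 \<rightarrow> \<dots>\<close> with \<open>f j : X\<^sub>j\<^sub>-\<^sub>1 \<rightarrow> X\<^sub>j\<close> for \<open>j \<ge> 1\<close>; the value \<open>f 0\<close> is not used.\<close>

definition cauchy ::
    "('o, 'm, 'z) tcat_scheme \<Rightarrow> (nat \<Rightarrow> 'o set) \<Rightarrow> (nat \<Rightarrow> 'o) \<Rightarrow> (nat \<Rightarrow> 'm) \<Rightarrow> bool"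
  where "cauchy D \<BB> X f \<longleftrightarrow> (\<forall>n. X n \<in> Obj D) \<and> (\<forall>n. f (Suc n) \<in> Hom D (X n) (X (Suc n))) \<and>
    (\<forall>i\<ge>1. \<exists>n\<ge>1. \<forall>j\<ge>n. \<exists>Q\<in>\<BB> i. \<exists>v w. tri D (X (j - 1)) (X j) Q (f j) v w)"

section \<open>Additive contravariant functors to abelian groups\<close>

text \<open>
  Functors have values in abelian groups with elements in a type \<open>'v\<close>.  Their object and arrow parts
  are extensional, so that two functors which agree on the category are not distinguished by
  their values outside of it.
\<close>

record ('o, 'm, 'v) cfun =
  FO :: "'o \<Rightarrow> 'v monoid"
  FA :: "'m \<Rightarrow> 'v \<Rightarrow> 'v"

definition additive_functor :: "('o, 'm, 'z) tcat_scheme \<Rightarrow> ('o, 'm, 'v) cfun \<Rightarrow> bool"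
  where "additive_functor D F \<longleftrightarrow>
    FO F \<in> extensional (Obj D) \<and> FA F \<in> extensional (Arr D) \<and>
    (\<forall>A\<in>Obj D. comm_group (FO F A)) \<and>
    (\<forall>A\<in>Obj D. \<forall>B\<in>Obj D. \<forall>f\<in>Hom D A B. FA F f \<in> hom (FO F B) (FO F A)) \<and>
    (\<forall>A\<in>Obj D. \<forall>x\<in>carrier (FO F A). FA F (idn D A) x = x) \<and>
    (\<forall>A\<in>Obj D. \<forall>B\<in>Obj D. \<forall>C\<in>Obj D. \<forall>f\<in>Hom D A B. \<forall>g\<in>Hom D B C. \<forall>x\<in>carrier (FO F C).
      FA F (cmp D g f) x = FA F f (FA F g x)) \<and>
    (\<forall>A\<in>Obj D. \<forall>B\<in>Obj D. \<forall>f\<in>Hom D A B. \<forall>g\<in>Hom D A B. \<forall>x\<in>carrier (FO F B).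
      FA F (f \<otimes>\<^bsub>hgrp D A B\<^esub> g) x = FA F f x \<otimes>\<^bsub>FO F A\<^esub> FA F g x)"

definition yoneda :: "('o, 'm, 'z) tcat_scheme \<Rightarrow> 'o \<Rightarrow> ('o, 'm, 'm) cfun"
  where "yoneda D X = \<lparr>FO = (\<lambda>A\<in>Obj D. hgrp D A X), FA = (\<lambda>f\<in>Arr D. \<lambda>g. cmp D g f)\<rparr>"

definition nat_trans :: "('o, 'm, 'z) tcat_scheme \<Rightarrow> ('o, 'm, 'v) cfun \<Rightarrow> ('o, 'm, 'w) cfun
    \<Rightarrow> ('o \<Rightarrow> 'v \<Rightarrow> 'w) \<Rightarrow> bool"
  where "nat_trans D F G \<eta> \<longleftrightarrow> \<eta> \<in> extensional (Obj D) \<and>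
    (\<forall>A\<in>Obj D. \<eta> A \<in> hom (FO F A) (FO G A) \<and> \<eta> A \<in> extensional (carrier (FO F A))) \<and>
    (\<forall>A\<in>Obj D. \<forall>B\<in>Obj D. \<forall>f\<in>Hom D A B. \<forall>x\<in>carrier (FO F B).
      \<eta> A (FA F f x) = FA G f (\<eta> B x))"

definition nat_trans_zero ::
    "('o, 'm, 'z) tcat_scheme \<Rightarrow> ('o, 'm, 'v) cfun \<Rightarrow> ('o, 'm, 'w) cfun \<Rightarrow> bool"
  where "nat_trans_zero D F G \<longleftrightarrow>
    (\<forall>\<eta>. nat_trans D F G \<eta> \<longrightarrow> (\<forall>A\<in>Obj D. \<forall>x\<in>carrier (FO F A). \<eta> A x = \<one>\<^bsub>FO G A\<^esub>))"

definition yoneda_cocone :: "('o, 'm, 'z) tcat_scheme \<Rightarrow> (nat \<Rightarrow> 'o) \<Rightarrow> (nat \<Rightarrow> 'm)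
    \<Rightarrow> ('o, 'm, 'v) cfun \<Rightarrow> (nat \<Rightarrow> 'o \<Rightarrow> 'm \<Rightarrow> 'v) \<Rightarrow> bool"
  where "yoneda_cocone D X f F c \<longleftrightarrow> (\<forall>n. nat_trans D (yoneda D (X n)) F (c n)) \<and>
    (\<forall>n. \<forall>A\<in>Obj D. \<forall>p\<in>Hom D A (X n). c (Suc n) A (cmp D (f (Suc n)) p) = c n A p)"

text \<open>\<open>F\<close> together with the cocone \<open>c\<close> is a colimit of the sequence of the Yoneda functors of
  the \<open>X n\<close>, by its universal property among functors with values in the same type.\<close>

definition yoneda_colimit :: "('o, 'm, 'z) tcat_scheme \<Rightarrow> (nat \<Rightarrow> 'o) \<Rightarrow> (nat \<Rightarrow> 'm)
    \<Rightarrow> ('o, 'm, 'v) cfun \<Rightarrow> (nat \<Rightarrow> 'o \<Rightarrow> 'm \<Rightarrow> 'v) \<Rightarrow> bool"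
  where "yoneda_colimit D X f F c \<longleftrightarrow> additive_functor D F \<and> yoneda_cocone D X f F c \<and>
    (\<forall>(H :: ('o, 'm, 'v) cfun) d. additive_functor D H \<and> yoneda_cocone D X f H d \<longrightarrow>
      (\<exists>!\<theta>. nat_trans D F H \<theta> \<and>
        (\<forall>n. \<forall>A\<in>Obj D. \<forall>p\<in>Hom D A (X n). \<theta> A (c n A p) = d n A p)))"

section \<open>The completion of a triangulated category with a good metric\<close>

text \<open>
  The value groups of the functors in the completion have elements in the type
  \<open>(nat \<times> 'm) set\<close>.  It is large enough: a sequential colimit of groups \<open>Hom (A, X\<^sub>n)\<close> has a model
  whose elements are equivalence classes of pairs \<open>(n, p)\<close> with \<open>p : A \<rightarrow> X\<^sub>n\<close>.
\<close>

type_synonym ('o, 'm) modf = "('o, 'm, (nat \<times> 'm) set) cfun"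

type_synonym ('o, 'm) modm =
  "('o, 'm) modf \<times> ('o \<Rightarrow> (nat \<times> 'm) set \<Rightarrow> (nat \<times> 'm) set) \<times> ('o, 'm) modf"

definition GG :: "('o, 'm, 'z) tcat_scheme \<Rightarrow> (nat \<Rightarrow> 'o set) \<Rightarrow> 'o set \<Rightarrow> ('o, 'm) modf set"
  where "GG D \<BB> U = {F. additive_functor D F \<and>
    (\<exists>X f c. (\<forall>n. X n \<in> U) \<and> cauchy D \<BB> X f \<and> yoneda_colimit D X f F c) \<and>
    (\<forall>j. \<exists>i. \<forall>B\<in>\<BB> i. nat_trans_zero D (yoneda D (shpow D j B)) F)}"

definition sh_functor :: "('o, 'm, 'z) tcat_scheme \<Rightarrow> ('o, 'm, 'v) cfun \<Rightarrow> ('o, 'm, 'v) cfun"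
  where "sh_functor D F =
    \<lparr>FO = (\<lambda>A\<in>Obj D. FO F (shpow D (- 1) A)), FA = (\<lambda>f\<in>Arr D. FA F (shm_inv D f))\<rparr>"

text \<open>
  A triangle \<open>F \<rightarrow> G \<rightarrow> H \<rightarrow> \<Sigma>F\<close> in the completion: \<open>F\<close>, \<open>G\<close>, \<open>H\<close> are colimits of the three Cauchy
  sequences \<open>X\<close>, \<open>Y\<close>, \<open>Z\<close> in a sequence of triangles, and \<open>\<eta>\<close>, \<open>\<theta>\<close>, \<open>\<zeta>\<close> are induced by the maps
  in these triangles.  Since being a colimit is invariant under isomorphism, so is this notion.
  In the last clause, \<open>(\<Sigma>F)(A) = F(\<Sigma>\<^sup>-\<^sup>1A)\<close> receives a map from \<open>Hom (A, \<Sigma>X\<^sub>n)\<close>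
  by identifying the latter with \<open>Hom (\<Sigma>\<^sup>-\<^sup>1A, X\<^sub>n)\<close>.
\<close>

definition colimit_triangle :: "('o, 'm, 'z) tcat_scheme \<Rightarrow> (nat \<Rightarrow> 'o set)
    \<Rightarrow> ('o, 'm, 'v) cfun \<Rightarrow> ('o, 'm, 'v) cfun \<Rightarrow> ('o, 'm, 'v) cfun
    \<Rightarrow> ('o \<Rightarrow> 'v \<Rightarrow> 'v) \<Rightarrow> ('o \<Rightarrow> 'v \<Rightarrow> 'v) \<Rightarrow> ('o \<Rightarrow> 'v \<Rightarrow> 'v) \<Rightarrow> bool"
  where "colimit_triangle D \<BB> F G H \<eta> \<theta> \<zeta> \<longleftrightarrow>
    nat_trans D F G \<eta> \<and> nat_trans D G H \<theta> \<and> nat_trans D H (sh_functor D F) \<zeta> \<and>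
    (\<exists>X Y Z f g h u v w c d e.
      cauchy D \<BB> X f \<and> cauchy D \<BB> Y g \<and> cauchy D \<BB> Z h \<and>
      (\<forall>n. tri D (X n) (Y n) (Z n) (u n) (v n) (w n) \<and>
        cmp D (g (Suc n)) (u n) = cmp D (u (Suc n)) (f (Suc n)) \<and>
        cmp D (h (Suc n)) (v n) = cmp D (v (Suc n)) (g (Suc n)) \<and>
        cmp D (shm D (f (Suc n))) (w n) = cmp D (w (Suc n)) (h (Suc n))) \<and>
      yoneda_colimit D X f F c \<and> yoneda_colimit D Y g G d \<and> yoneda_colimit D Z h H e \<and>
      (\<forall>n. \<forall>A\<in>Obj D.
        (\<forall>p\<in>Hom D A (X n). \<eta> A (c n A p) = d n A (cmp D (u n) p)) \<and>
        (\<forall>p\<in>Hom D A (Y n). \<theta> A (d n A p) = e n A (cmp D (v n) p)) \<and>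
        (\<forall>p\<in>Hom D A (Z n). \<zeta> A (e n A p) =
          c n (shpow D (- 1) A) (shm_inv D (cmp D (w n) p)))))"

text \<open>
  The completion as a category with suspension and triangles.  A morphism \<open>F \<rightarrow> G\<close> is a triple
  \<open>(F, \<eta>, G)\<close> with \<open>\<eta>\<close> a natural transformation.
\<close>

definition completion ::
    "('o, 'm, 'z) tcat_scheme \<Rightarrow> (nat \<Rightarrow> 'o set) \<Rightarrow> (('o, 'm) modf, ('o, 'm) modm) tcat"
  where "completion D \<BB> = \<lparr>
    Obj = GG D \<BB> (Obj D),
    hgrp = (\<lambda>F G. \<lparr>carrier = {(F, \<eta>, G) |\<eta>. nat_trans D F G \<eta>},
      monoid.mult = (\<lambda>(_, \<eta>, _) (_, \<theta>, _).
        (F, \<lambda>A\<in>Obj D. \<lambda>x\<in>carrier (FO F A). \<eta> A x \<otimes>\<^bsub>FO G A\<^esub> \<theta> A x, G)),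
      one = (F, \<lambda>A\<in>Obj D. \<lambda>x\<in>carrier (FO F A). \<one>\<^bsub>FO G A\<^esub>, G)\<rparr>),
    idn = (\<lambda>F. (F, \<lambda>A\<in>Obj D. \<lambda>x\<in>carrier (FO F A). x, F)),
    cmp = (\<lambda>(_, \<theta>, H) (F, \<eta>, _). (F, \<lambda>A\<in>Obj D. \<lambda>x\<in>carrier (FO F A). \<theta> A (\<eta> A x), H)),
    sh = sh_functor D,
    shm = (\<lambda>(F, \<eta>, G). (sh_functor D F, \<lambda>A\<in>Obj D. \<eta> (shpow D (- 1) A), sh_functor D G)),
    tri = (\<lambda>F G H u v w. F \<in> GG D \<BB> (Obj D) \<and> G \<in> GG D \<BB> (Obj D) \<and> H \<in> GG D \<BB> (Obj D) \<and>
      (\<exists>\<eta> \<theta> \<zeta>. u = (F, \<eta>, G) \<and> v = (G, \<theta>, H) \<and> w = (H, \<zeta>, sh_functor D F) \<and>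
        colimit_triangle D \<BB> F G H \<eta> \<theta> \<zeta>))\<rparr>"

end

theory Submission
  imports Defs "HOL-Algebra.Coset"
begin

text \<open>
  All silting objects of one thick subcategory have bounded amplitude with respect to each other.
  Coning off generators of \<open>Hom (M, \<Sigma>\<^sup>-\<^sup>iX)\<close> for finitely many \<open>i\<close> therefore leaves an object that is
  truncated correctly by the t-structure of the silting object given with the ST-pair, and so \<open>M\<close>
  defines a t-structure as well.  The torsion pair of its heart is the one given by the traces of the
  complement \<open>M\<^sub>J\<close> of \<open>M\<^sub>I\<close>: a nonzero object of the heart killed by \<open>M\<^sub>J\<close> has a simple quotient in
  \<open>add S\<^sub>I\<close>.  Testing the tilted aisle and coaisle on the triangle \<open>M\<^sub>I \<rightarrow> E \<rightarrow> Q\<close> shows that the t-structure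
  of the mutation is the HRS-tilt in \<open>\<D>\<close>.

  In the completion, the cones of a Cauchy sequence \<open>X\<^sub>0 \<rightarrow> X\<^sub>1 \<rightarrow> \<dots>\<close> eventually lie so deep in the aisle
  that all the \<open>X\<^sub>n\<close> have the same truncation in the coaisle.  Hence every object of the completion has a
  truncation triangle whose end in the coaisle is representable, the heart of the completion consists of
  the functors represented by the heart of \<open>\<D>\<close>, and the t-structure, the torsion class and
  the tilt are all detected on truncations.
\<close>

section \<open>Additive categories\<close>

text \<open>The ST-pair provides a t-structure for some silting object only, while mutation starts
  from another one; a bound on how far the two see each other's degrees is what makes the passage
  effective, and it fixes the constants used there. All facts about the completion are proved for an
  arbitrary t-structure on the small category that satisfies two compatibilities with the metric:
  some neighbourhood of the metric lies strictly inside the aisle, and every object is orthogonal to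
  some neighbourhood. The first comes from the fact that suspending \<open>G\<close> moves it
  arbitrarily deep, the second from \<open>D\<close> being bounded below. Both hold for the given
  pair and for its tilt, and the tilt in the completion needs both instances: extension closure of
  the new classes gives one inclusion, truncation with respect to the old pair gives the other. A
  colimit given by a universal property has no visible elements. It is therefore compared once with
  an explicit model, after which every argument is a computation with elements represented at a
  finite stage.\<close>

context additive_category
begin

abbreviation comp (infixr "\<cdot>" 70) where "g \<cdot> f \<equiv> cmp T g f"

abbreviation zr where "zr A B \<equiv> \<one>\<^bsub>hgrp T A B\<^esub>"

abbreviation neg where "neg A B f \<equiv> inv\<^bsub>hgrp T A B\<^esub> f"

abbreviation add where "add A B f g \<equiv> f \<otimes>\<^bsub>hgrp T A B\<^esub> g"

text \<open>Carries the membership of both objects along with the morphism, so that one fact per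
  morphism discharges all side conditions when lemmas are chained with \<open>OF\<close>.\<close>

definition arr :: "'o \<Rightarrow> 'o \<Rightarrow> 'm \<Rightarrow> bool"
  where "arr A B f \<longleftrightarrow> A \<in> Obj T \<and> B \<in> Obj T \<and> f \<in> Hom T A B"

lemma arrI: "A \<in> Obj T \<Longrightarrow> B \<in> Obj T \<Longrightarrow> f \<in> Hom T A B \<Longrightarrow> arr A B f"
  by (simp add: arr_def)

lemma arrD:
  assumes "arr A B f"
  shows "A \<in> Obj T" "B \<in> Obj T" "f \<in> Hom T A B"
  using assms by (auto simp: arr_def)

lemma arr_unique: "arr A B f \<Longrightarrow> arr A' B' f \<Longrightarrow> A = A' \<and> B = B'"
  using hom_disjoint unfolding arr_def by blast

lemma hom_comm_group: "A \<in> Obj T \<Longrightarrow> B \<in> Obj T \<Longrightarrow> comm_group (hgrp T A B)"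
  by (rule hgrp_comm_group)

lemma hom_group: "A \<in> Obj T \<Longrightarrow> B \<in> Obj T \<Longrightarrow> group (hgrp T A B)"
  using hgrp_comm_group comm_group.axioms(2) by blast

lemma hom_monoid: "A \<in> Obj T \<Longrightarrow> B \<in> Obj T \<Longrightarrow> monoid (hgrp T A B)"
  using hom_group group.is_monoid by blast

lemma arr_id [simp]: "A \<in> Obj T \<Longrightarrow> arr A A (idn T A)"
  by (simp add: arr_def idn_closed)

lemma arr_comp: "arr A B f \<Longrightarrow> arr B C g \<Longrightarrow> arr A C (g \<cdot> f)"
  unfolding arr_def using cmp_closed by blast

lemma arr_zr [simp]: "A \<in> Obj T \<Longrightarrow> B \<in> Obj T \<Longrightarrow> arr A B (zr A B)"
  by (simp add: arr_def hom_monoid monoid.one_closed)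

lemma arr_neg: "arr A B f \<Longrightarrow> arr A B (neg A B f)"
  by (auto simp: arr_def hom_group group.inv_closed)

lemma arr_add: "arr A B f \<Longrightarrow> arr A B g \<Longrightarrow> arr A B (add A B f g)"
  by (auto simp: arr_def hom_monoid monoid.m_closed)

lemma comp_assoc: "arr A B f \<Longrightarrow> arr B C g \<Longrightarrow> arr C D h \<Longrightarrow> (h \<cdot> g) \<cdot> f = h \<cdot> (g \<cdot> f)"
  unfolding arr_def using cmp_assoc by metis

lemma comp_mid:
  assumes "arr A B f" "arr B C g" "arr C D h" "arr D E k"
  shows "(k \<cdot> h) \<cdot> (g \<cdot> f) = k \<cdot> ((h \<cdot> g) \<cdot> f)"
  using comp_assoc[OF arr_comp[OF assms(1,2)] assms(3,4)] comp_assoc[OF assms(1-3)] by simp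

lemma id_right: "arr A B f \<Longrightarrow> f \<cdot> idn T A = f"
  unfolding arr_def using cmp_idn_right by blast

lemma id_left: "arr A B f \<Longrightarrow> idn T B \<cdot> f = f"
  unfolding arr_def using cmp_idn_left by blast

lemma comp_add_left: "arr A B f \<Longrightarrow> arr B C g \<Longrightarrow> arr B C g' \<Longrightarrow>
    add B C g g' \<cdot> f = add A C (g \<cdot> f) (g' \<cdot> f)"
  unfolding arr_def using cmp_add_left by blast

lemma comp_add_right: "arr A B f \<Longrightarrow> arr A B f' \<Longrightarrow> arr B C g \<Longrightarrow>
    g \<cdot> add A B f f' = add A C (g \<cdot> f) (g \<cdot> f')"
  unfolding arr_def using cmp_add_right by blast

lemma hom_comp_left:
  assumes "A \<in> Obj T" "arr B C g"
  shows "(\<lambda>f. g \<cdot> f) \<in> hom (hgrp T A B) (hgrp T A C)"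
  using assms by (auto simp: hom_def arr_def cmp_closed cmp_add_right)

lemma hom_comp_right:
  assumes "C \<in> Obj T" "arr A B f"
  shows "(\<lambda>g. g \<cdot> f) \<in> hom (hgrp T B C) (hgrp T A C)"
  using assms by (auto simp: hom_def arr_def cmp_closed cmp_add_left)

lemma comp_zr_right: "arr B C g \<Longrightarrow> A \<in> Obj T \<Longrightarrow> g \<cdot> zr A B = zr A C"
  using group_hom.hom_one[of "hgrp T A B" "hgrp T A C" "\<lambda>f. g \<cdot> f"] hom_comp_left[of A B C g]
  by (simp add: group_hom_def group_hom_axioms_def hom_group arr_def)

lemma comp_zr_left: "arr A B f \<Longrightarrow> C \<in> Obj T \<Longrightarrow> zr B C \<cdot> f = zr A C"
  using group_hom.hom_one[of "hgrp T B C" "hgrp T A C" "\<lambda>g. g \<cdot> f"] hom_comp_right[of C A B f]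
  by (simp add: group_hom_def group_hom_axioms_def hom_group arr_def)

lemma comp_neg_right: "arr A B f \<Longrightarrow> arr B C g \<Longrightarrow> g \<cdot> neg A B f = neg A C (g \<cdot> f)"
  using group_hom.hom_inv[of "hgrp T A B" "hgrp T A C" "\<lambda>f. g \<cdot> f" f] hom_comp_left[of A B C g]
  by (simp add: group_hom_def group_hom_axioms_def hom_group arr_def)

lemma comp_neg_left: "arr A B f \<Longrightarrow> arr B C g \<Longrightarrow> neg B C g \<cdot> f = neg A C (g \<cdot> f)"
  using group_hom.hom_inv[of "hgrp T B C" "hgrp T A C" "\<lambda>g. g \<cdot> f" g] hom_comp_right[of C A B f]
  by (simp add: group_hom_def group_hom_axioms_def hom_group arr_def)

lemma neg_neg: "arr A B f \<Longrightarrow> neg A B (neg A B f) = f"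
  by (simp add: arr_def hom_group group.inv_inv)

lemma neg_inj: "arr A B f \<Longrightarrow> arr A B g \<Longrightarrow> neg A B f = neg A B g \<Longrightarrow> f = g"
  by (metis neg_neg)

lemma neg_zr: "A \<in> Obj T \<Longrightarrow> B \<in> Obj T \<Longrightarrow> neg A B (zr A B) = zr A B"
  by (simp add: hom_group group.is_monoid monoid.inv_one)

lemma neg_eq_zr: "arr A B f \<Longrightarrow> neg A B f = zr A B \<longleftrightarrow> f = zr A B"
  by (metis neg_zr neg_neg arrD)

lemma add_neg: "arr A B f \<Longrightarrow> add A B f (neg A B f) = zr A B"
  by (simp add: arr_def hom_group group.r_inv)

lemma add_comm: "arr A B f \<Longrightarrow> arr A B g \<Longrightarrow> add A B f g = add A B g f"
  unfolding arr_def using hom_comm_group comm_group.axioms(1) comm_monoid.m_comm by metis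

lemma add_zr: "arr A B f \<Longrightarrow> add A B f (zr A B) = f" "arr A B f \<Longrightarrow> add A B (zr A B) f = f"
  by (auto simp: arr_def hom_monoid monoid.l_one monoid.r_one)

lemma add_neg_zr_iff: "arr A B f \<Longrightarrow> arr A B g \<Longrightarrow> add A B f (neg A B g) = zr A B \<longleftrightarrow> f = g"
proof -
  assume a: "arr A B f" "arr A B g"
  then interpret group "hgrp T A B" by (simp add: arr_def hom_group)
  have c: "f \<in> carrier (hgrp T A B)" "g \<in> carrier (hgrp T A B)" using a by (auto simp: arr_def)
  have "zr A B = add A B f (neg A B g) \<longleftrightarrow> f = add A B (zr A B) g"
    by (rule inv_solve_right) (use c in auto)
  then show ?thesis using c l_one by metis
qed

text \<open>Turns equality of two composites into vanishing of a composite with a difference, the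
  form to which exactness of triangles applies.\<close>

lemma comp_diff_right: "arr A B f \<Longrightarrow> arr A B f' \<Longrightarrow> arr B C g \<Longrightarrow>
    g \<cdot> add A B f (neg A B f') = zr A C \<longleftrightarrow> g \<cdot> f = g \<cdot> f'"
  by (simp add: comp_add_right[OF _ arr_neg] comp_neg_right add_neg_zr_iff[OF arr_comp arr_comp])

lemma comp_diff_left: "arr A B f \<Longrightarrow> arr B C g \<Longrightarrow> arr B C g' \<Longrightarrow>
    add B C g (neg B C g') \<cdot> f = zr A C \<longleftrightarrow> g \<cdot> f = g' \<cdot> f"
  by (simp add: comp_add_left[OF _ _ arr_neg] comp_neg_left add_neg_zr_iff[OF arr_comp arr_comp])

lemma hom_zeroI:
  assumes "A \<in> Obj T" "B \<in> Obj T" "\<And>f. arr A B f \<Longrightarrow> f = zr A B"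
  shows "hom_zero T A B"
  using assms arr_zr[of A B] unfolding hom_zero_def arr_def by blast

lemma hom_zeroD: "hom_zero T A B \<Longrightarrow> arr A B f \<Longrightarrow> f = zr A B"
  by (auto simp: hom_zero_def arr_def)

lemma is_isoD:
  assumes "is_iso T A B f" "A \<in> Obj T" "B \<in> Obj T"
  obtains g where "arr A B f" "arr B A g" "g \<cdot> f = idn T A" "f \<cdot> g = idn T B"
  using assms unfolding is_iso_def arr_def by blast

lemma is_isoI: "arr A B f \<Longrightarrow> arr B A g \<Longrightarrow> g \<cdot> f = idn T A \<Longrightarrow> f \<cdot> g = idn T B \<Longrightarrow> is_iso T A B f"
  unfolding is_iso_def arr_def by blast

lemma is_iso_id: "A \<in> Obj T \<Longrightarrow> is_iso T A A (idn T A)"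
  by (rule is_isoI[of _ _ _ "idn T A"]) (auto simp: id_left[OF arr_id])

lemma isomorphic_refl: "A \<in> Obj T \<Longrightarrow> isomorphic T A A"
  using is_iso_id isomorphic_def by metis

lemma is_iso_sym: "is_iso T A B f \<Longrightarrow> A \<in> Obj T \<Longrightarrow> B \<in> Obj T \<Longrightarrow>
    \<exists>g. is_iso T B A g \<and> g \<cdot> f = idn T A \<and> f \<cdot> g = idn T B"
  by (metis is_isoD is_isoI)

lemma isomorphic_sym: "isomorphic T A B \<Longrightarrow> A \<in> Obj T \<Longrightarrow> B \<in> Obj T \<Longrightarrow> isomorphic T B A"
  unfolding isomorphic_def using is_iso_sym by blast

lemma is_iso_comp:
  assumes "is_iso T A B f" "is_iso T B C g" "A \<in> Obj T" "B \<in> Obj T" "C \<in> Obj T"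
  shows "is_iso T A C (g \<cdot> f)"
proof -
  obtain f' where f: "arr A B f" "arr B A f'" "f' \<cdot> f = idn T A" "f \<cdot> f' = idn T B"
    using assms is_isoD by metis
  obtain g' where g: "arr B C g" "arr C B g'" "g' \<cdot> g = idn T B" "g \<cdot> g' = idn T C"
    using assms is_isoD by metis
  have 1: "(f' \<cdot> g') \<cdot> (g \<cdot> f) = idn T A"
    using comp_mid[OF f(1) g(1) g(2) f(2)] g(3) f(3) id_left[OF f(1)] by simp
  have 2: "(g \<cdot> f) \<cdot> (f' \<cdot> g') = idn T C"
    using comp_mid[OF g(2) f(2) f(1) g(1)] g(4) f(4) id_left[OF g(2)] by simp
  show ?thesis by (rule is_isoI[OF arr_comp[OF f(1) g(1)] arr_comp[OF g(2) f(2)] 1 2])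
qed

lemma isomorphic_trans: "isomorphic T A B \<Longrightarrow> isomorphic T B C \<Longrightarrow> A \<in> Obj T \<Longrightarrow> B \<in> Obj T \<Longrightarrow>
    C \<in> Obj T \<Longrightarrow> isomorphic T A C"
  unfolding isomorphic_def using is_iso_comp by blast

text \<open>One retract argument that covers isomorphisms, direct summands and the members of a
  direct sum.\<close>

lemma hom_zero_retract_left:
  assumes "arr A B i" "arr B A p" "p \<cdot> i = idn T A" "hom_zero T B W" "W \<in> Obj T"
  shows "hom_zero T A W"
proof (rule hom_zeroI)
  fix f assume f: "arr A W f"
  have "f = (f \<cdot> p) \<cdot> i" using comp_assoc[OF assms(1,2) f] assms(3) id_right[OF f] by simp
  also have "f \<cdot> p = zr B W" using assms f arr_comp hom_zeroD by blast
  finally show "f = zr A W" using assms comp_zr_left by simp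
qed (use assms arrD in auto)

lemma hom_zero_retract_right:
  assumes "arr A B i" "arr B A p" "p \<cdot> i = idn T A" "hom_zero T W B" "W \<in> Obj T"
  shows "hom_zero T W A"
proof (rule hom_zeroI)
  fix f assume f: "arr W A f"
  have "f = p \<cdot> (i \<cdot> f)" using comp_assoc[OF f assms(1,2)] assms(3) id_left[OF f] by simp
  also have "i \<cdot> f = zr W B" using assms f arr_comp hom_zeroD by blast
  finally show "f = zr W A" using assms comp_zr_right by simp
qed (use assms arrD in auto)

lemma hom_zero_iso_left: "isomorphic T A B \<Longrightarrow> A \<in> Obj T \<Longrightarrow> B \<in> Obj T \<Longrightarrow> W \<in> Obj T \<Longrightarrow>
    hom_zero T A W \<longleftrightarrow> hom_zero T B W"
  by (metis hom_zero_retract_left is_isoD isomorphic_def)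

lemma hom_zero_iso_right: "isomorphic T A B \<Longrightarrow> A \<in> Obj T \<Longrightarrow> B \<in> Obj T \<Longrightarrow> W \<in> Obj T \<Longrightarrow>
    hom_zero T W A \<longleftrightarrow> hom_zero T W B"
  by (metis hom_zero_retract_right is_isoD isomorphic_def)

lemma is_zero_Obj: "is_zero T Z \<Longrightarrow> Z \<in> Obj T"
  by (simp add: is_zero_def)

lemma is_zeroI_id: 
  assumes "Z \<in> Obj T" "idn T Z = zr Z Z" shows "is_zero T Z"
proof -
  have "f = zr Z A" if "arr Z A f" for A f
    by (metis arrD assms comp_zr_right id_right that)
  moreover have "f = zr A Z" if "arr A Z f" for A f
    by (metis arrD assms comp_zr_left id_left that)
  ultimately show ?thesis using assms hom_zeroI unfolding is_zero_def by meson
qed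

lemma is_zero_iff: "Z \<in> Obj T \<Longrightarrow> is_zero T Z \<longleftrightarrow> hom_zero T Z Z"
  by (metis arr_id hom_zeroD is_zeroI_id is_zero_def)

lemma is_zeroD: "is_zero T Z \<Longrightarrow> A \<in> Obj T \<Longrightarrow> hom_zero T Z A \<and> hom_zero T A Z"
  by (simp add: is_zero_def)

lemma zero_id: "is_zero T Z \<Longrightarrow> idn T Z = zr Z Z"
  by (rule hom_zeroD) (auto simp: is_zero_def)

lemma is_zero_iso:
  assumes "is_zero T A" "isomorphic T A B" "B \<in> Obj T" shows "is_zero T B"
  by (meson assms hom_zero_iso_left hom_zero_iso_right is_zero_def is_zero_iff)

section \<open>Finite sums of morphisms and direct sums of objects\<close>

lemma finprod_arr:
  assumes "finite J" "A \<in> Obj T" "B \<in> Obj T" "\<And>k. k \<in> J \<Longrightarrow> arr A B (\<phi> k)"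
  shows "arr A B (finprod (hgrp T A B) \<phi> J)"
proof -
  interpret comm_group "hgrp T A B" using assms hom_comm_group by blast
  show ?thesis using assms by (auto simp: arr_def intro!: finprod_closed)
qed

lemma finprod_insert_arr:
  assumes "finite J" "j \<notin> J" "A \<in> Obj T" "B \<in> Obj T" "\<And>k. k \<in> insert j J \<Longrightarrow> arr A B (\<phi> k)"
  shows "finprod (hgrp T A B) \<phi> (insert j J) = add A B (\<phi> j) (finprod (hgrp T A B) \<phi> J)"
proof -
  interpret comm_group "hgrp T A B" using assms hom_comm_group by blast
  show ?thesis using assms by (auto simp: arr_def intro!: finprod_insert)
qed

lemma finprod_cong_arr:
  assumes "A \<in> Obj T" "B \<in> Obj T" "\<And>k. k \<in> J \<Longrightarrow> arr A B (\<phi> k)" "\<And>k. k \<in> J \<Longrightarrow> \<phi> k = \<psi> k"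
  shows "finprod (hgrp T A B) \<phi> J = finprod (hgrp T A B) \<psi> J"
proof -
  interpret comm_group "hgrp T A B" using assms hom_comm_group by blast
  show ?thesis using assms by (intro finprod_cong') (auto simp: arr_def)
qed

lemma finprod_empty_arr: "A \<in> Obj T \<Longrightarrow> B \<in> Obj T \<Longrightarrow> finprod (hgrp T A B) \<phi> {} = zr A B"
  by (simp add: comm_monoid.finprod_empty comm_group.axioms(1) hom_comm_group)

text \<open>The direct sum of the empty family: its identity is an empty sum of morphisms, hence
  zero.\<close>

lemma zero_exists: "\<exists>Z. is_zero T Z"
proof -
  obtain X where X: "is_dsum T {..<0::nat} (\<lambda>_. undefined) X" using dsum_exists[of 0] by auto
  then have "X \<in> Obj T" "idn T X = zr X X" unfolding is_dsum_def by (auto simp: finprod_empty_arr)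
  then show ?thesis using is_zeroI_id by blast
qed

lemma finprod_zr:
  assumes "A \<in> Obj T" "B \<in> Obj T" "\<And>k. k \<in> J \<Longrightarrow> \<phi> k = zr A B"
  shows "finprod (hgrp T A B) \<phi> J = zr A B"
proof -
  interpret comm_group "hgrp T A B" using assms hom_comm_group by blast
  show ?thesis using assms by (intro finprod_one_eqI) auto
qed

lemma finprod_comp_left:
  assumes "finite J" "A \<in> Obj T" "arr B C g" "\<And>k. k \<in> J \<Longrightarrow> arr A B (\<phi> k)"
  shows "g \<cdot> finprod (hgrp T A B) \<phi> J = finprod (hgrp T A C) (\<lambda>k. g \<cdot> \<phi> k) J"
  using assms
proof (induction J rule: finite_induct)
  case empty
  then show ?case by (simp add: finprod_empty_arr comp_zr_right arrD)
next
  case (insert j J)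
  then have g: "\<And>k. k \<in> insert j J \<Longrightarrow> arr A C (g \<cdot> \<phi> k)" using arr_comp by blast
  have "g \<cdot> finprod (hgrp T A B) \<phi> (insert j J) = g \<cdot> add A B (\<phi> j) (finprod (hgrp T A B) \<phi> J)"
    using insert finprod_insert_arr arrD by metis
  also have "\<dots> = add A C (g \<cdot> \<phi> j) (g \<cdot> finprod (hgrp T A B) \<phi> J)"
    using insert comp_add_right finprod_arr arrD by (metis insertCI)
  also have "\<dots> = finprod (hgrp T A C) (\<lambda>k. g \<cdot> \<phi> k) (insert j J)"
    using insert g finprod_insert_arr[of J j A C "\<lambda>k. g \<cdot> \<phi> k"] arrD by simp
  finally show ?case .
qed

lemma finprod_comp_right:
  assumes "finite J" "C \<in> Obj T" "arr A B f" "\<And>k. k \<in> J \<Longrightarrow> arr B C (\<phi> k)"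
  shows "finprod (hgrp T B C) \<phi> J \<cdot> f = finprod (hgrp T A C) (\<lambda>k. \<phi> k \<cdot> f) J"
  using assms
proof (induction J rule: finite_induct)
  case empty
  then show ?case by (simp add: finprod_empty_arr comp_zr_left arrD)
next
  case (insert j J)
  then have g: "\<And>k. k \<in> insert j J \<Longrightarrow> arr A C (\<phi> k \<cdot> f)" using arr_comp by blast
  have "finprod (hgrp T B C) \<phi> (insert j J) \<cdot> f = add B C (\<phi> j) (finprod (hgrp T B C) \<phi> J) \<cdot> f"
    using insert finprod_insert_arr arrD by metis
  also have "\<dots> = add A C (\<phi> j \<cdot> f) (finprod (hgrp T B C) \<phi> J \<cdot> f)"
    using insert comp_add_left finprod_arr arrD by (metis insertCI)
  also have "\<dots> = finprod (hgrp T A C) (\<lambda>k. \<phi> k \<cdot> f) (insert j J)"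
    using insert g finprod_insert_arr[of J j A C "\<lambda>k. \<phi> k \<cdot> f"] arrD by simp
  finally show ?case .
qed

lemma is_dsumE:
  assumes "is_dsum T J Y X"
  obtains \<iota> \<pi> where "finite J" "X \<in> Obj T" "\<And>k. k \<in> J \<Longrightarrow> Y k \<in> Obj T"
    "\<And>k. k \<in> J \<Longrightarrow> arr (Y k) X (\<iota> k)" "\<And>k. k \<in> J \<Longrightarrow> arr X (Y k) (\<pi> k)"
    "\<And>k. k \<in> J \<Longrightarrow> \<pi> k \<cdot> \<iota> k = idn T (Y k)"
    "\<And>k l. k \<in> J \<Longrightarrow> l \<in> J \<Longrightarrow> k \<noteq> l \<Longrightarrow> \<pi> k \<cdot> \<iota> l = zr (Y l) (Y k)"
    "finprod (hgrp T X X) (\<lambda>k. \<iota> k \<cdot> \<pi> k) J = idn T X"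
proof -
  have o: "finite J" "X \<in> Obj T" "\<forall>k\<in>J. Y k \<in> Obj T" using assms unfolding is_dsum_def by auto
  obtain \<iota> \<pi> where a: "\<forall>k\<in>J. \<iota> k \<in> Hom T (Y k) X \<and> \<pi> k \<in> Hom T X (Y k)"
    and b: "\<forall>k\<in>J. \<forall>l\<in>J. \<pi> k \<cdot> \<iota> l = (if k = l then idn T (Y k) else zr (Y l) (Y k))"
    and c: "finprod (hgrp T X X) (\<lambda>k. \<iota> k \<cdot> \<pi> k) J = idn T X"
    using assms unfolding is_dsum_def by auto
  show thesis
    by (rule that[of \<iota> \<pi>]) (use o a b c in \<open>auto simp: arr_def\<close>)
qed

lemma is_dsumI:
  assumes "finite J" "X \<in> Obj T"
    "\<And>k. k \<in> J \<Longrightarrow> arr (Y k) X (\<iota> k)" "\<And>k. k \<in> J \<Longrightarrow> arr X (Y k) (\<pi> k)"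
    "\<And>k. k \<in> J \<Longrightarrow> \<pi> k \<cdot> \<iota> k = idn T (Y k)"
    "\<And>k l. k \<in> J \<Longrightarrow> l \<in> J \<Longrightarrow> k \<noteq> l \<Longrightarrow> \<pi> k \<cdot> \<iota> l = zr (Y l) (Y k)"
    "finprod (hgrp T X X) (\<lambda>k. \<iota> k \<cdot> \<pi> k) J = idn T X"
  shows "is_dsum T J Y X"
proof -
  have "\<forall>k\<in>J. \<iota> k \<in> Hom T (Y k) X \<and> \<pi> k \<in> Hom T X (Y k)" using assms(3,4) by (auto simp: arr_def)
  moreover have "\<forall>k\<in>J. \<forall>l\<in>J. \<pi> k \<cdot> \<iota> l = (if k = l then idn T (Y k) else zr (Y l) (Y k))"
    using assms(5,6) by auto
  moreover have "\<forall>k\<in>J. Y k \<in> Obj T" using assms(3) arrD by blast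
  ultimately show ?thesis using assms(1,2,7) unfolding is_dsum_def by blast
qed

text \<open>A map out of the sum is the sum of its composites with the idempotents
  \<open>\<iota> k \<cdot> \<pi> k\<close>.\<close>

lemma dsum_hom_zero_left:
  assumes "is_dsum T J Y X" "W \<in> Obj T"
  shows "hom_zero T X W \<longleftrightarrow> (\<forall>k\<in>J. hom_zero T (Y k) W)"
proof (rule is_dsumE[OF assms(1)])
  fix \<iota> \<pi>
  assume d: "finite J" "X \<in> Obj T" "\<And>k. k \<in> J \<Longrightarrow> Y k \<in> Obj T"
    "\<And>k. k \<in> J \<Longrightarrow> arr (Y k) X (\<iota> k)" "\<And>k. k \<in> J \<Longrightarrow> arr X (Y k) (\<pi> k)"
    "\<And>k. k \<in> J \<Longrightarrow> \<pi> k \<cdot> \<iota> k = idn T (Y k)"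
    "finprod (hgrp T X X) (\<lambda>k. \<iota> k \<cdot> \<pi> k) J = idn T X"
  show ?thesis
  proof
    assume "hom_zero T X W"
    then show "\<forall>k\<in>J. hom_zero T (Y k) W" using d(4-6) hom_zero_retract_left assms(2) by blast
  next
    assume z: "\<forall>k\<in>J. hom_zero T (Y k) W"
    show "hom_zero T X W"
    proof (rule hom_zeroI)
      fix f assume f: "arr X W f"
      have "f = f \<cdot> finprod (hgrp T X X) (\<lambda>k. \<iota> k \<cdot> \<pi> k) J" using d(7) id_right[OF f] by simp
      also have "\<dots> = finprod (hgrp T X W) (\<lambda>k. f \<cdot> (\<iota> k \<cdot> \<pi> k)) J"
        using d arr_comp by (intro finprod_comp_left[OF d(1,2) f]) blast
      also have "\<dots> = zr X W"
      proof (rule finprod_zr)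
        fix k assume k: "k \<in> J"
        have "f \<cdot> (\<iota> k \<cdot> \<pi> k) = (f \<cdot> \<iota> k) \<cdot> \<pi> k" using comp_assoc[OF d(5)[OF k] d(4)[OF k] f] by simp
        also have "f \<cdot> \<iota> k = zr (Y k) W" using z k arr_comp[OF d(4)[OF k] f] hom_zeroD by blast
        finally show "f \<cdot> (\<iota> k \<cdot> \<pi> k) = zr X W" using comp_zr_left[OF d(5)[OF k] assms(2)] by simp
      qed (use assms d in auto)
      finally show "f = zr X W" .
    qed (use d assms in auto)
  qed
qed

lemma dsum_hom_zero_right:
  assumes "is_dsum T J Y X" "W \<in> Obj T"
  shows "hom_zero T W X \<longleftrightarrow> (\<forall>k\<in>J. hom_zero T W (Y k))"
proof (rule is_dsumE[OF assms(1)])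
  fix \<iota> \<pi>
  assume d: "finite J" "X \<in> Obj T" "\<And>k. k \<in> J \<Longrightarrow> Y k \<in> Obj T"
    "\<And>k. k \<in> J \<Longrightarrow> arr (Y k) X (\<iota> k)" "\<And>k. k \<in> J \<Longrightarrow> arr X (Y k) (\<pi> k)"
    "\<And>k. k \<in> J \<Longrightarrow> \<pi> k \<cdot> \<iota> k = idn T (Y k)"
    "finprod (hgrp T X X) (\<lambda>k. \<iota> k \<cdot> \<pi> k) J = idn T X"
  show ?thesis
  proof
    assume "hom_zero T W X"
    then show "\<forall>k\<in>J. hom_zero T W (Y k)" using d(4-6) hom_zero_retract_right assms(2) by blast
  next
    assume z: "\<forall>k\<in>J. hom_zero T W (Y k)"
    show "hom_zero T W X"
    proof (rule hom_zeroI)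
      fix f assume f: "arr W X f"
      have "f = finprod (hgrp T X X) (\<lambda>k. \<iota> k \<cdot> \<pi> k) J \<cdot> f" using d(7) id_left[OF f] by simp
      also have "\<dots> = finprod (hgrp T W X) (\<lambda>k. (\<iota> k \<cdot> \<pi> k) \<cdot> f) J"
        using d arr_comp by (intro finprod_comp_right[OF d(1,2) f]) blast
      also have "\<dots> = zr W X"
      proof (rule finprod_zr)
        fix k assume k: "k \<in> J"
        have "(\<iota> k \<cdot> \<pi> k) \<cdot> f = \<iota> k \<cdot> (\<pi> k \<cdot> f)" using comp_assoc[OF f d(5)[OF k] d(4)[OF k]] by simp
        also have "\<pi> k \<cdot> f = zr W (Y k)" using z k arr_comp[OF f d(5)[OF k]] hom_zeroD by blast
        finally show "(\<iota> k \<cdot> \<pi> k) \<cdot> f = zr W X" using comp_zr_right[OF d(4)[OF k] assms(2)] by simp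
      qed (use assms d in auto)
      finally show "f = zr W X" .
    qed (use d assms in auto)
  qed
qed

lemma summandE:
  assumes "summand T A X"
  obtains i p where "arr A X i" "arr X A p" "p \<cdot> i = idn T A"
proof -
  obtain B where B: "is_dsum T (UNIV::bool set) (\<lambda>b. if b then A else B) X"
    using assms unfolding summand_def is_dsum2_def by auto
  show thesis
  proof (rule is_dsumE[OF B])
    fix \<iota> \<pi>
    assume "\<And>k::bool. k \<in> UNIV \<Longrightarrow> arr (if k then A else B) X (\<iota> k)"
      "\<And>k::bool. k \<in> UNIV \<Longrightarrow> arr X (if k then A else B) (\<pi> k)"
      "\<And>k. k \<in> UNIV \<Longrightarrow> \<pi> k \<cdot> \<iota> k = idn T (if k then A else B)"
    from this[of True] show thesis using that by simp
  qed
qed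

lemma summand_hom_zero:
  assumes "summand T A X" "W \<in> Obj T"
  shows "hom_zero T X W \<Longrightarrow> hom_zero T A W" "hom_zero T W X \<Longrightarrow> hom_zero T W A"
  by (meson assms hom_zero_retract_left hom_zero_retract_right summandE)+

text \<open>Summands come with an explicit complement; here a zero object serves as
  complement.\<close>

lemma summand_refl:
  assumes "A \<in> Obj T" shows "summand T A A"
proof -
  obtain Z where Z: "is_zero T Z" using zero_exists by blast
  then have ZO: "Z \<in> Obj T" by (rule is_zero_Obj)
  let ?Y = "\<lambda>b. if b then A else Z"
  let ?i = "\<lambda>b. if b then idn T A else zr Z A"
  let ?p = "\<lambda>b. if b then idn T A else zr A Z"
  have un: "(UNIV::bool set) = insert True {False}" by auto
  have zz: "zr A Z \<cdot> idn T A = zr A Z" "idn T A \<cdot> zr Z A = zr Z A" "zr A Z \<cdot> zr Z A = idn T Z"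
    "zr Z A \<cdot> zr A Z = zr A A" "idn T A \<cdot> idn T A = idn T A"
    using assms ZO id_left id_right arr_zr arr_id comp_zr_right is_zeroD[OF Z] hom_zeroD
    by metis+
  have "finprod (hgrp T A A) (\<lambda>k. ?i k \<cdot> ?p k) UNIV = 
    add A A (?i True \<cdot> ?p True) (finprod (hgrp T A A) (\<lambda>k. ?i k \<cdot> ?p k) {False})"
    unfolding un by (rule finprod_insert_arr) (use assms ZO zz in auto)
  also have "finprod (hgrp T A A) (\<lambda>k. ?i k \<cdot> ?p k) {False} = zr A A"
    by (rule finprod_zr) (use assms ZO zz in auto)
  finally have s: "finprod (hgrp T A A) (\<lambda>k. ?i k \<cdot> ?p k) UNIV = idn T A"
    using zz add_zr assms by simp
  have "is_dsum T (UNIV::bool set) ?Y A"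
    by (rule is_dsumI[of _ _ _ ?i ?p]) (use assms ZO zz s in auto)
  then show ?thesis unfolding summand_def is_dsum2_def by blast
qed

lemma addcl_base:
  assumes "A \<in> Obj T" "A \<in> U" shows "A \<in> addcl T U"
proof -
  have s: "finprod (hgrp T A A) (\<lambda>k::nat. idn T A \<cdot> idn T A) {..<1} = idn T A"
  proof -
    have un: "{..<1::nat} = insert 0 {}" by auto
    show ?thesis unfolding un using assms id_left[OF arr_id]
      by (subst finprod_insert_arr) (auto simp: finprod_empty_arr add_zr)
  qed
  have "is_dsum T {..<1::nat} (\<lambda>_. A) A"
    by (rule is_dsumI[of _ _ _ "\<lambda>_. idn T A" "\<lambda>_. idn T A"]) (use assms s id_left[OF arr_id] in auto)
  then have "A \<in> {Z. \<exists>(m::nat) Y. (\<forall>k\<in>{..<m}. Y k \<in> U) \<and> is_dsum T {..<m} Y Z}"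
    using assms(2) by (intro CollectI exI[of _ "1::nat"] exI[of _ "\<lambda>_. A"]) simp
  then show ?thesis using assms(1) summand_refl[OF assms(1)] unfolding addcl_def smd_def by blast
qed

lemma addcl_hom_zero:
  assumes "A \<in> addcl T U" "W \<in> Obj T"
  shows "(\<And>X. X \<in> U \<Longrightarrow> hom_zero T X W) \<Longrightarrow> hom_zero T A W"
    "(\<And>X. X \<in> U \<Longrightarrow> hom_zero T W X) \<Longrightarrow> hom_zero T W A"
proof -
  obtain Z m Y where Z: "summand T A Z" "\<forall>k\<in>{..<m::nat}. Y k \<in> U" "is_dsum T {..<m} Y Z"
    using assms unfolding addcl_def smd_def by auto
  show "hom_zero T A W" if "\<And>X. X \<in> U \<Longrightarrow> hom_zero T X W"
    using that Z(2) dsum_hom_zero_left[OF Z(3) assms(2)] summand_hom_zero(1)[OF Z(1) assms(2)] by simp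
  show "hom_zero T W A" if "\<And>X. X \<in> U \<Longrightarrow> hom_zero T W X"
    using that Z(2) dsum_hom_zero_right[OF Z(3) assms(2)] summand_hom_zero(2)[OF Z(1) assms(2)] by simp
qed

lemma addcl_Obj: "addcl T U \<subseteq> Obj T"
  unfolding addcl_def smd_def by auto

end

section \<open>Triangulated categories\<close>

context triangulated_category
begin

text \<open>The predicate \<open>tri\<close> says nothing about membership of the three objects.
  \<open>dt\<close> adds it, and \<open>tr\<close> forgets the maps where only the existence of a
  triangle counts.\<close>

definition dt :: "'o \<Rightarrow> 'o \<Rightarrow> 'o \<Rightarrow> 'm \<Rightarrow> 'm \<Rightarrow> 'm \<Rightarrow> bool"
  where "dt X Y Z u v w \<longleftrightarrow> X \<in> Obj T \<and> Y \<in> Obj T \<and> Z \<in> Obj T \<and> tri T X Y Z u v w"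

definition tr :: "'o \<Rightarrow> 'o \<Rightarrow> 'o \<Rightarrow> bool"
  where "tr X Y Z \<longleftrightarrow> (\<exists>u v w. dt X Y Z u v w)"

lemma dtD:
  assumes "dt X Y Z u v w"
  shows "X \<in> Obj T" "Y \<in> Obj T" "Z \<in> Obj T" "tri T X Y Z u v w" "sh T X \<in> Obj T"
    "arr X Y u" "arr Y Z v" "arr Z (sh T X) w"
proof -
  show o: "X \<in> Obj T" "Y \<in> Obj T" "Z \<in> Obj T" "tri T X Y Z u v w" using assms by (auto simp: dt_def)
  then show s: "sh T X \<in> Obj T" using sh_bij bij_betwE by blast
  show "arr X Y u" "arr Y Z v" "arr Z (sh T X) w" using o s tri_hom[OF o] by (auto simp: arr_def)
qed

lemma trD: assumes "tr X Y Z" shows "X \<in> Obj T" "Y \<in> Obj T" "Z \<in> Obj T"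
  using assms unfolding tr_def dt_def by auto

lemma trI: "dt X Y Z u v w \<Longrightarrow> tr X Y Z" unfolding tr_def by blast

lemma sh_Obj [simp]: "X \<in> Obj T \<Longrightarrow> sh T X \<in> Obj T"
  using sh_bij bij_betwE by blast

lemma sh_surj: "X \<in> Obj T \<Longrightarrow> \<exists>Y\<in>Obj T. sh T Y = X"
  using sh_bij unfolding bij_betw_def by (metis imageE)

lemma sh_inj: "X \<in> Obj T \<Longrightarrow> Y \<in> Obj T \<Longrightarrow> sh T X = sh T Y \<Longrightarrow> X = Y"
  using sh_bij unfolding bij_betw_def inj_on_def by blast

lemma shm_arr: "arr A B f \<Longrightarrow> arr (sh T A) (sh T B) (shm T f)"
  using shm_bij[of A B] bij_betwE unfolding arr_def by fastforce

lemma shm_surj: "arr (sh T A) (sh T B) g \<Longrightarrow> A \<in> Obj T \<Longrightarrow> B \<in> Obj T \<Longrightarrow> \<exists>f. arr A B f \<and> shm T f = g"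
  using shm_bij[of A B] unfolding bij_betw_def arr_def by (metis imageE)

lemma shm_inj: "arr A B f \<Longrightarrow> arr A B g \<Longrightarrow> shm T f = shm T g \<Longrightarrow> f = g"
  using shm_bij[of A B] unfolding bij_betw_def inj_on_def arr_def by blast

lemma shm_comp: "arr A B f \<Longrightarrow> arr B C g \<Longrightarrow> shm T (g \<cdot> f) = shm T g \<cdot> shm T f"
  unfolding arr_def using shm_cmp by blast

lemma shm_group_hom: "A \<in> Obj T \<Longrightarrow> B \<in> Obj T \<Longrightarrow>
    group_hom (hgrp T A B) (hgrp T (sh T A) (sh T B)) (shm T)"
  by (simp add: group_hom_def group_hom_axioms_def hom_group shm_add)

lemma shm_zr: "A \<in> Obj T \<Longrightarrow> B \<in> Obj T \<Longrightarrow> shm T (zr A B) = zr (sh T A) (sh T B)"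
  using group_hom.hom_one[OF shm_group_hom] by blast

lemma shm_eq_zr: "arr A B f \<Longrightarrow> shm T f = zr (sh T A) (sh T B) \<longleftrightarrow> f = zr A B"
  using shm_inj[of A B f "zr A B"] shm_zr[of A B] arrD[of A B f] arr_zr[of A B] by auto

lemma rotate: "dt X Y Z u v w \<Longrightarrow> dt Y Z (sh T X) v w (neg (sh T X) (sh T Y) (shm T u))"
  using tri_rotate[of X Y Z u v w] dtD[of X Y Z u v w] unfolding dt_def arr_def by auto

text \<open>The suspension is full, so the last map of the rotated triangle is minus the suspension
  of some \<open>u\<close>; the rotation axiom then applies backwards.\<close>

lemma unrotate:
  assumes "dt Y Z (sh T X) v w w'" "X \<in> Obj T"
  shows "\<exists>u. arr X Y u \<and> dt X Y Z u v w \<and> w' = neg (sh T X) (sh T Y) (shm T u)"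
proof -
  note d = dtD[OF assms(1)]
  obtain u where u: "arr X Y u" "shm T u = neg (sh T X) (sh T Y) w'"
    using shm_surj[OF arr_neg[OF d(8)] assms(2) d(1)] by auto
  then have w': "w' = neg (sh T X) (sh T Y) (shm T u)" using neg_neg[OF d(8)] by simp
  then show ?thesis using tri_rotate[of X Y Z u v w] u d assms unfolding dt_def arr_def by auto
qed

lemma dt_id: "X \<in> Obj T \<Longrightarrow> is_zero T Z \<Longrightarrow> dt X X Z (idn T X) (zr X Z) (zr Z (sh T X))"
  using tri_idn unfolding dt_def by (simp add: is_zero_Obj)

lemma is_zero_sh: 
  assumes "is_zero T Z" shows "is_zero T (sh T Z)"
proof (rule is_zeroI_id)
  have o: "Z \<in> Obj T" using assms is_zero_Obj by blast
  show "sh T Z \<in> Obj T" using o by simp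
  show "idn T (sh T Z) = zr (sh T Z) (sh T Z)"
    using shm_idn[OF o] zero_id[OF assms] shm_zr[OF o o] by simp
qed

lemma dt_zero_id:
  assumes "X \<in> Obj T" "is_zero T Z"
  shows "dt Z X X (zr Z X) (idn T X) (zr X (sh T Z))"
proof -
  have o: "Z \<in> Obj T" using assms is_zero_Obj by blast
  obtain u where u: "arr Z X u" "dt Z X X u (idn T X) (zr X (sh T Z))"
    using unrotate[OF dt_id[OF assms(1) is_zero_sh[OF assms(2)]] o] by blast
  then have "u = zr Z X" using hom_zeroD is_zeroD assms by blast
  then show ?thesis using u by simp
qed

section \<open>Exactness properties of triangles\<close>

lemma dt_morphism:
  assumes "dt X Y Z u v w" "dt X' Y' Z' u' v' w'" "arr X X' a" "arr Y Y' b" "b \<cdot> u = u' \<cdot> a"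
  obtains c where "arr Z Z' c" "c \<cdot> v = v' \<cdot> b" "shm T a \<cdot> w = w' \<cdot> c"
  using tri_morphism[OF dtD(1-3)[OF assms(1)] dtD(1-3)[OF assms(2)] dtD(4)[OF assms(1)] dtD(4)[OF assms(2)]
      arrD(3)[OF assms(3)] arrD(3)[OF assms(4)] assms(5)] arrI[OF dtD(3)[OF assms(1)] dtD(3)[OF assms(2)]]
  by blast

text \<open>Compare the triangle of the identity of \<open>X\<close> with the given one along
  \<open>idn T X\<close> and \<open>u\<close>: the third map starts at a zero object, and
  \<open>v \<cdot> u\<close> factors through it.\<close>

lemma tri_comp1:
  assumes "dt X Y Z u v w" shows "v \<cdot> u = zr X Z"
proof -
  note d = dtD[OF assms]
  obtain N where N: "is_zero T N" using zero_exists by blast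
  obtain c where c: "arr N Z c" "c \<cdot> zr X N = v \<cdot> u"
    using dt_morphism[OF dt_id[OF d(1) N] assms arr_id[OF d(1)] d(6)] by auto
  then show ?thesis using comp_zr_right[OF c(1) d(1)] by simp
qed

lemma tri_comp2: "dt X Y Z u v w \<Longrightarrow> w \<cdot> v = zr Y (sh T X)"
  using tri_comp1[OF rotate] .

text \<open>The extension is the third component of a morphism into the triangle formed by a zero
  object and the identity of \<open>W\<close>.\<close>

lemma tri_ext:
  assumes "dt X Y Z u v w" "arr Y W h" "h \<cdot> u = zr X W"
  obtains k where "arr Z W k" "k \<cdot> v = h"
proof -
  note d = dtD[OF assms(1)]
  have W: "W \<in> Obj T" using assms arrD by blast
  obtain N where N: "is_zero T N" using zero_exists by blast
  have XO: "arr X N (zr X N)" using N d is_zero_Obj by simp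
  have "h \<cdot> u = zr N W \<cdot> zr X N" using assms comp_zr_left[OF XO W] by simp
  then obtain c where "arr Z W c" "c \<cdot> v = idn T W \<cdot> h"
    using dt_morphism[OF assms(1) dt_zero_id[OF W N] XO assms(2)] by auto
  then show thesis using that id_left[OF assms(2)] by simp
qed

text \<open>The axiom only fills in the third map. After one rotation of both triangles the wanted
  map is in third position, as a map from \<open>sh T W\<close> to \<open>sh T X\<close>, and is
  then desuspended.\<close>

lemma tri_lift:
  assumes "dt X Y Z u v w" "arr W Y h" "v \<cdot> h = zr W Z"
  obtains k where "arr W X k" "u \<cdot> k = h"
proof -
  note d = dtD[OF assms(1)]
  have W: "W \<in> Obj T" using assms arrD by blast
  obtain N where N: "is_zero T N" using zero_exists by blast
  have NO: "N \<in> Obj T" using N is_zero_Obj by blast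
  have OZ: "arr N Z (zr N Z)" using NO d by simp
  have e: "zr N Z \<cdot> zr W N = v \<cdot> h" using assms comp_zr_right[OF OZ W] by simp
  obtain c where c: "arr (sh T W) (sh T X) c"
    "shm T h \<cdot> neg (sh T W) (sh T W) (shm T (idn T W)) = neg (sh T X) (sh T Y) (shm T u) \<cdot> c"
    using dt_morphism[OF rotate[OF dt_id[OF W N]] rotate[OF assms(1)] assms(2) OZ e] by auto
  obtain k where k: "arr W X k" "shm T k = c" using shm_surj[OF c(1) W d(1)] by blast
  have "neg (sh T W) (sh T Y) (shm T h) = neg (sh T W) (sh T Y) (shm T (u \<cdot> k))"
    using c(2) comp_neg_right[OF shm_arr[OF arr_id[OF W]] shm_arr[OF assms(2)]]
      comp_neg_left[OF c(1) shm_arr[OF d(6)]] shm_comp[OF k(1) d(6)] k(2) shm_comp[OF arr_id[OF W] assms(2)]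
      id_right[OF assms(2)] by simp
  then have "h = u \<cdot> k"
    using neg_inj[OF shm_arr[OF assms(2)] shm_arr[OF arr_comp[OF k(1) d(6)]]]
      shm_inj[OF assms(2) arr_comp[OF k(1) d(6)]] by blast
  then show thesis using that k by blast
qed

lemma tri_lift2:
  assumes "dt X Y Z u v w" "arr W Z h" "w \<cdot> h = zr W (sh T X)"
  obtains k where "arr W Y k" "v \<cdot> k = h"
  using tri_lift[OF rotate[OF assms(1)] assms(2,3)] by blast

lemma tri_ext2:
  assumes "dt X Y Z u v w" "arr Z W h" "h \<cdot> v = zr Y W"
  obtains k where "arr (sh T X) W k" "k \<cdot> w = h"
  using tri_ext[OF rotate[OF assms(1)] assms(2,3)] by blast

text \<open>Two extensions along \<open>v\<close> differ by a map that factors through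
  \<open>w\<close>, hence through a map from \<open>sh T X\<close> to \<open>W\<close>.\<close>

lemma tri_cancel_ext:
  assumes "dt X Y Z u v w" "hom_zero T (sh T X) W" "arr Z W k" "arr Z W k'" "k \<cdot> v = k' \<cdot> v"
  shows "k = k'"
proof -
  note d = dtD[OF assms(1)]
  let ?d = "add Z W k (neg Z W k')"
  have da: "arr Z W ?d" using assms arr_add arr_neg by blast
  have "?d \<cdot> v = zr Y W" using comp_diff_left[OF d(7) assms(3,4)] assms(5) by blast
  then obtain l where l: "arr (sh T X) W l" "l \<cdot> w = ?d" using tri_ext2[OF assms(1) da] by blast
  have "l = zr (sh T X) W" using hom_zeroD assms(2) l by blast
  then have "?d = zr Z W" using l comp_zr_left[OF d(8)] arrD(2)[OF assms(3)] by simp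
  then show ?thesis using add_neg_zr_iff[OF assms(3,4)] by blast
qed

lemma tri_cancel_lift:
  assumes "dt X Y Z u v w" "hom_zero T (sh T W) Z" "arr W X k" "arr W X k'" "u \<cdot> k = u \<cdot> k'"
  shows "k = k'"
proof -
  note d = dtD[OF assms(1)]
  have W: "W \<in> Obj T" using assms arrD by blast
  let ?d = "add W X k (neg W X k')"
  have da: "arr W X ?d" using assms arr_add arr_neg by blast
  have "u \<cdot> ?d = zr W Y" using comp_diff_right[OF assms(3,4) d(6)] assms(5) by blast
  then have "shm T u \<cdot> shm T ?d = zr (sh T W) (sh T Y)"
    using shm_comp[OF da d(6)] shm_zr[OF W d(2)] by simp
  then have "neg (sh T X) (sh T Y) (shm T u) \<cdot> shm T ?d = zr (sh T W) (sh T Y)"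
    using comp_neg_left[OF shm_arr[OF da] shm_arr[OF d(6)]] neg_zr W d by simp
  then obtain l where l: "arr (sh T W) Z l" "w \<cdot> l = shm T ?d"
    using tri_lift[OF rotate[OF rotate[OF assms(1)]] shm_arr[OF da]] by blast
  have "l = zr (sh T W) Z" using hom_zeroD assms(2) l by blast
  then have "shm T ?d = zr (sh T W) (sh T X)" using l comp_zr_right[OF d(8)] W by simp
  then have "?d = zr W X" using shm_eq_zr[OF da] by blast
  then show ?thesis using add_neg_zr_iff[OF assms(3,4)] by blast
qed

lemma cone_exists: "arr X Y u \<Longrightarrow> \<exists>Z v w. dt X Y Z u v w"
  using tri_cone[of X Y u] unfolding dt_def arr_def by blast

lemma cocone_exists: assumes "arr Y Z v" shows "\<exists>X u w. dt X Y Z u v w"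
proof -
  obtain C w w' where c: "dt Y Z C v w w'" using cone_exists[OF assms] by blast
  obtain X where X: "X \<in> Obj T" "C = sh T X" using sh_surj dtD(3)[OF c] by blast
  then show ?thesis using unrotate c by blast
qed

lemma tr_rot: "tr A B C \<Longrightarrow> tr B C (sh T A)"
  unfolding tr_def using rotate by blast

lemma tr_unrot: "tr B C (sh T A) \<Longrightarrow> A \<in> Obj T \<Longrightarrow> tr A B C"
  unfolding tr_def using unrotate by blast

lemma tr_shift: "tr A B C \<Longrightarrow> tr (sh T A) (sh T B) (sh T C)"
  using tr_rot by blast

lemma tr_unshift: "tr (sh T A) (sh T B) (sh T C) \<Longrightarrow> A \<in> Obj T \<Longrightarrow> B \<in> Obj T \<Longrightarrow> C \<in> Obj T \<Longrightarrow> tr A B C"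
  using tr_unrot by blast

lemma hom_zero_mid:
  assumes "tr A B C" "W \<in> Obj T"
  shows "hom_zero T W A \<Longrightarrow> hom_zero T W C \<Longrightarrow> hom_zero T W B"
    "hom_zero T A W \<Longrightarrow> hom_zero T C W \<Longrightarrow> hom_zero T B W"
proof -
  obtain u v w where t: "dt A B C u v w" using assms(1) unfolding tr_def by blast
  note d = dtD[OF t]
  show "hom_zero T W B" if z: "hom_zero T W A" "hom_zero T W C"
  proof (rule hom_zeroI)
    fix f assume f: "arr W B f"
    have "v \<cdot> f = zr W C" using z(2) arr_comp[OF f d(7)] hom_zeroD by blast
    then obtain k where k: "arr W A k" "u \<cdot> k = f" using tri_lift[OF t f] by blast
    then have "k = zr W A" using z(1) hom_zeroD by blast
    then show "f = zr W B" using k comp_zr_right[OF d(6) assms(2)] by simp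
  qed (use assms d in auto)
  show "hom_zero T B W" if z: "hom_zero T A W" "hom_zero T C W"
  proof (rule hom_zeroI)
    fix f assume f: "arr B W f"
    have "f \<cdot> u = zr A W" using z(1) arr_comp[OF d(6) f] hom_zeroD by blast
    then obtain k where k: "arr C W k" "k \<cdot> v = f" using tri_ext[OF t f] by blast
    then have "k = zr C W" using z(2) hom_zeroD by blast
    then show "f = zr B W" using k comp_zr_left[OF d(7) assms(2)] by simp
  qed (use assms d in auto)
qed

lemma hom_zero_sh:
  assumes "A \<in> Obj T" "B \<in> Obj T"
  shows "hom_zero T (sh T A) (sh T B) \<longleftrightarrow> hom_zero T A B"
proof
  assume z: "hom_zero T (sh T A) (sh T B)"
  show "hom_zero T A B"
  proof (rule hom_zeroI)
    fix f assume f: "arr A B f"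
    then show "f = zr A B" using shm_eq_zr[OF f] hom_zeroD[OF z shm_arr[OF f]] by blast
  qed (use assms in auto)
next
  assume z: "hom_zero T A B"
  show "hom_zero T (sh T A) (sh T B)"
  proof (rule hom_zeroI)
    fix f assume f: "arr (sh T A) (sh T B) f"
    then obtain g where "arr A B g" "shm T g = f" using shm_surj assms by blast
    then show "f = zr (sh T A) (sh T B)" using hom_zeroD[OF z] shm_zr assms by metis
  qed (use assms in auto)
qed

text \<open>Lifting the identity along \<open>u\<close> gives a right inverse. It is also a left
  inverse, because liftings along \<open>u\<close> are unique when the cone is zero.\<close>

lemma iso_of_zero_cone:
  assumes "dt X Y Z u v w" "is_zero T Z" shows "is_iso T X Y u"
proof -
  note d = dtD[OF assms(1)]
  have "v \<cdot> idn T Y = zr Y Z" using is_zeroD[OF assms(2) d(2)] arr_comp[OF arr_id[OF d(2)] d(7)] hom_zeroD by blast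
  then obtain k where k: "arr Y X k" "u \<cdot> k = idn T Y" using tri_lift[OF assms(1) arr_id[OF d(2)]] by blast
  have "u \<cdot> (k \<cdot> u) = u \<cdot> idn T X"
    using comp_assoc[OF d(6) k(1) d(6)] k(2) id_left[OF d(6)] id_right[OF d(6)] by simp
  then have "k \<cdot> u = idn T X"
    by (intro tri_cancel_lift[OF assms(1) _ arr_comp[OF d(6) k(1)] arr_id[OF d(1)]])
      (use is_zeroD[OF assms(2)] d in auto)
  then show ?thesis using is_isoI[OF d(6) k(1)] k by blast
qed

section \<open>The octahedral axiom and invariance of triangles under isomorphism\<close>

lemma octa:
  assumes "dt X Y Z' u i i'" "dt Y Z X' v j j'" "dt X Z Y' (v \<cdot> u) k k'"
  obtains f g where "dt Z' Y' X' f g (shm T i \<cdot> j')" "f \<cdot> i = k \<cdot> v" "k' \<cdot> f = i'"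
    "g \<cdot> k = j" "j' \<cdot> g = shm T u \<cdot> k'"
  using octahedral[OF dtD(1,2)[OF assms(1)] dtD(2)[OF assms(2)] dtD(3)[OF assms(2)] dtD(3)[OF assms(3)]
    dtD(3)[OF assms(1)] dtD(4)[OF assms(1)] dtD(4)[OF assms(2)] dtD(4)[OF assms(3)]]
    dtD(3)[OF assms(1)] dtD(3)[OF assms(2)] dtD(3)[OF assms(3)] unfolding dt_def by blast

text \<open>The octahedron on \<open>u\<close> followed by the identity of \<open>Y\<close> puts the
  two cones into a triangle whose third object is zero.\<close>

lemma cone_unique:
  assumes "dt X Y Z u v w" "dt X Y Z' u v' w'" shows "isomorphic T Z Z'"
proof -
  note d = dtD[OF assms(1)]
  obtain N where N: "is_zero T N" using zero_exists by blast
  have "dt X Y Z' (idn T Y \<cdot> u) v' w'" using assms(2) id_left[OF d(6)] by simp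
  from octa[OF assms(1) dt_id[OF d(2) N] this] obtain f g t where "dt Z Z' N f g t" by metis
  then show ?thesis using iso_of_zero_cone N isomorphic_def by metis
qed

lemma tr_zero_left: "tr A B C \<Longrightarrow> is_zero T A \<Longrightarrow> isomorphic T B C"
  using iso_of_zero_cone[OF rotate] is_zero_sh unfolding tr_def isomorphic_def by metis

lemma tr_zero_right: "tr A B C \<Longrightarrow> is_zero T C \<Longrightarrow> isomorphic T A B"
  using iso_of_zero_cone unfolding tr_def isomorphic_def by metis

lemma tr_iso1:
  assumes "tr A B C" "isomorphic T A A'" "A' \<in> Obj T" shows "tr A' B C"
proof -
  obtain u v w where t: "dt A B C u v w" using assms(1) unfolding tr_def by blast
  note d = dtD[OF t]
  obtain a where a: "is_iso T A A' a" using assms(2) isomorphic_def by metis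
  then obtain a' where a': "arr A A' a" "arr A' A a'" "a' \<cdot> a = idn T A" using is_isoD assms(3) d by metis
  have ub: "arr A' B (u \<cdot> a')" by (rule arr_comp[OF a'(2) d(6)])
  have wb: "arr C (sh T A') (shm T a \<cdot> w)" by (rule arr_comp[OF d(8) shm_arr[OF a'(1)]])
  have "tri T A' B C (u \<cdot> a') v (shm T a \<cdot> w)"
    by (rule tri_iso[OF d(1-3) assms(3) d(2,3) d(4) arrD(3)[OF ub] arrD(3)[OF d(7)] arrD(3)[OF wb]
          a is_iso_id[OF d(2)] is_iso_id[OF d(3)]])
      (use comp_assoc[OF a'(1,2) d(6)] a'(3) id_right[OF d(6)] id_left[OF d(6)] id_right[OF d(7)]
        id_left[OF d(7)] id_right[OF wb] in auto)
  then show ?thesis using d assms(3) unfolding tr_def dt_def by blast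
qed

lemma tr_iso2: "tr A B C \<Longrightarrow> isomorphic T B B' \<Longrightarrow> B' \<in> Obj T \<Longrightarrow> tr A B' C"
  using tr_unrot[OF tr_iso1[OF tr_rot]] trD by blast

lemma tr_iso3: "tr A B C \<Longrightarrow> isomorphic T C C' \<Longrightarrow> C' \<in> Obj T \<Longrightarrow> tr A B C'"
  using tr_unrot[OF tr_iso2[OF tr_rot]] trD by blast

lemma isomorphic_sh:
  assumes "isomorphic T A B" "A \<in> Obj T" "B \<in> Obj T" shows "isomorphic T (sh T A) (sh T B)"
proof -
  obtain f g where f: "arr A B f" "arr B A g" "g \<cdot> f = idn T A" "f \<cdot> g = idn T B"
    using assms is_isoD isomorphic_def by metis
  have "is_iso T (sh T A) (sh T B) (shm T f)"
    by (rule is_isoI[OF shm_arr[OF f(1)] shm_arr[OF f(2)]])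
      (use shm_comp[OF f(1,2)] shm_comp[OF f(2,1)] f shm_idn assms in auto)
  then show ?thesis using isomorphic_def by metis
qed

lemma isomorphic_unsh:
  assumes "isomorphic T (sh T A) (sh T B)" "A \<in> Obj T" "B \<in> Obj T" shows "isomorphic T A B"
proof -
  obtain N where N: "is_zero T N" using zero_exists by blast
  have NO: "N \<in> Obj T" using N is_zero_Obj by blast
  have "tr (sh T N) (sh T A) (sh T A)" by (rule trI[OF dt_zero_id[OF sh_Obj[OF assms(2)] is_zero_sh[OF N]]])
  then have "tr (sh T N) (sh T A) (sh T B)" using tr_iso3 assms by simp
  then have "tr N A B" using tr_unshift NO assms by blast
  then show ?thesis using tr_zero_left N by blast
qed

lemma tr_octa_a:
  assumes "tr A B C" "tr B X D" obtains C' where "tr A X C'" "tr C C' D"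
proof -
  obtain u v w where t: "dt A B C u v w" using assms(1) unfolding tr_def by blast
  obtain u' v' w' where t': "dt B X D u' v' w'" using assms(2) unfolding tr_def by blast
  obtain C' k k' where c: "dt A X C' (u' \<cdot> u) k k'"
    using cone_exists[OF arr_comp[OF dtD(6)[OF t] dtD(6)[OF t']]] by blast
  obtain f g where "dt C C' D f g (shm T v \<cdot> w')" using octa[OF t t' c] by blast
  then show thesis using that c trI by blast
qed

text \<open>The octahedral axiom for the rotated triangles, read on cocones: that of the composite
  is an extension of those of the factors. The map \<open>q \<cdot> f\<close> is kept visible
  because the construction of proper quotients computes with it.\<close>

lemma dt_octa_b:
  assumes "dt E A Z e f g" "dt W Z Y p q r"
  obtains x s t where "dt x A Y s (q \<cdot> f) t" "tr E x W"
proof -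
  note d = dtD[OF assms(1)] dtD[OF assms(2)]
  obtain Y' k k' where c: "dt A Y Y' (q \<cdot> f) k k'" using cone_exists[OF arr_comp[OF d(7) d(15)]] by blast
  obtain f' g' t' where o: "dt (sh T E) Y' (sh T W) f' g' t'"
    using octa[OF rotate[OF assms(1)] rotate[OF assms(2)] c] by metis
  obtain x where x: "x \<in> Obj T" "Y' = sh T x" using sh_surj dtD(3)[OF c] by blast
  obtain s where s: "dt x A Y s (q \<cdot> f) k" using unrotate[of A Y x "q \<cdot> f" k k'] c x by blast
  have "tr E x W" using tr_unshift trI[OF o] x d by blast
  then show thesis using that s by blast
qed

lemma tr_octa_b:
  assumes "tr E A Z" "tr W Z Y" obtains x where "tr E x W" "tr x A Y"
  using assms dt_octa_b trI unfolding tr_def[of E A Z] tr_def[of W Z Y] by metis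

lemma tr_zero_id: "X \<in> Obj T \<Longrightarrow> is_zero T Z \<Longrightarrow> tr Z X X" "X \<in> Obj T \<Longrightarrow> is_zero T Z \<Longrightarrow> tr X X Z"
  using dt_zero_id dt_id trI by blast+

section \<open>Integer powers of the suspension\<close>

definition unsh :: "'o \<Rightarrow> 'o" where "unsh X = inv_into (Obj T) (sh T) X"

lemma unsh:
  assumes "X \<in> Obj T" shows "unsh X \<in> Obj T" "sh T (unsh X) = X" "unsh (sh T X) = X"
  using assms sh_bij unfolding unsh_def bij_betw_def
  by (auto simp: inv_into_into f_inv_into_f inv_into_f_f)

lemma shpow_0 [simp]: "shpow T 0 X = X" by (simp add: shpow_def)

lemma shpow_suc_aux: "X \<in> Obj T \<Longrightarrow> shpow T j X \<in> Obj T \<and> shpow T (j + 1) X = sh T (shpow T j X)"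
proof -
  assume X: "X \<in> Obj T"
  have p: "(sh T ^^ k) X \<in> Obj T" for k using X by (induction k) auto
  have n: "(unsh ^^ k) X \<in> Obj T" for k using X unsh by (induction k) auto
  have nn: "(inv_into (Obj T) (sh T) ^^ k) X = (unsh ^^ k) X" for k
    by (induction k) (auto simp: unsh_def)
  show ?thesis
  proof (cases "0 \<le> j")
    case True
    then have "nat (j + 1) = Suc (nat j)" by simp
    then show ?thesis using True p by (simp add: shpow_def)
  next
    case False
    then obtain k where k: "nat (- j) = Suc k" by (metis Suc_pred' zero_less_nat_eq neg_0_less_iff_less not_le)
    have "shpow T j X = (unsh ^^ Suc k) X" using False k nn[of "Suc k"] by (simp only: shpow_def if_False)
    moreover have "shpow T (j + 1) X = (unsh ^^ k) X"
    \<comment> \<open>At \<open>j = - 1\<close> the next power is the zeroth one, which the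
      definition computes in its nonnegative branch.\<close>
    proof (cases k)
      case 0
      then have "j + 1 = 0" using k False by linarith
      then show ?thesis using 0 by simp
    next
      case (Suc l)
      then have "\<not> 0 \<le> j + 1" "nat (- (j + 1)) = k" using k by linarith+
      then show ?thesis using nn[of k] by (simp only: shpow_def if_False)
    qed
    ultimately show ?thesis using unsh(2)[OF n[of k]] n[of "Suc k"] by simp
  qed
qed

lemma shpow_Obj [simp]: "X \<in> Obj T \<Longrightarrow> shpow T j X \<in> Obj T"
  using shpow_suc_aux by blast

lemma shpow_suc: "X \<in> Obj T \<Longrightarrow> shpow T (j + 1) X = sh T (shpow T j X)"
  using shpow_suc_aux by blast

lemma shpow_1: "X \<in> Obj T \<Longrightarrow> shpow T 1 X = sh T X"
  using shpow_suc[of X 0] by simp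

lemma shpow_add: "X \<in> Obj T \<Longrightarrow> shpow T (i + j) X = shpow T i (shpow T j X)"
proof (induction i rule: int_induct[where k = 0])
  case base
  then show ?case by simp
next
  case (step1 i)
  have "i + 1 + j = (i + j) + 1" by simp
  then show ?case using shpow_suc step1 by (metis shpow_Obj)
next
  case (step2 i)
  have a: "sh T (shpow T (i - 1 + j) X) = shpow T (i + j) X"
    using shpow_suc[of X "i - 1 + j"] step2.prems by (simp add: algebra_simps)
  have b: "sh T (shpow T (i - 1) (shpow T j X)) = shpow T i (shpow T j X)"
    using shpow_suc[of "shpow T j X" "i - 1"] step2.prems by simp
  show ?case
    by (rule sh_inj) (use a b step2.IH[OF step2.prems] step2.prems in \<open>simp_all only: shpow_Obj\<close>)
qed

lemma shpow_inv: "X \<in> Obj T \<Longrightarrow> shpow T (- j) (shpow T j X) = X" "X \<in> Obj T \<Longrightarrow> shpow T j (shpow T (- j) X) = X"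
  using shpow_add[of X "- j" j] shpow_add[of X j "- j"] by auto

text \<open>Three objects, so that one induction serves triangles as well as
  \<open>hom_zero\<close>, \<open>isomorphic\<close> and, with the arguments repeated, membership in
  a thick subcategory.\<close>

lemma shpow_rel:
  assumes "A \<in> Obj T" "B \<in> Obj T" "C \<in> Obj T"
    "\<And>A B C. A \<in> Obj T \<Longrightarrow> B \<in> Obj T \<Longrightarrow> C \<in> Obj T \<Longrightarrow> P (sh T A) (sh T B) (sh T C) \<longleftrightarrow> P A B C"
  shows "P (shpow T j A) (shpow T j B) (shpow T j C) \<longleftrightarrow> P A B C"
proof (induction j rule: int_induct[where k = 0])
  case (step1 i)
  then show ?case using assms by (simp add: shpow_suc)
next
  case (step2 i)
  have "P (shpow T i A) (shpow T i B) (shpow T i C) \<longleftrightarrow>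
      P (shpow T (i - 1) A) (shpow T (i - 1) B) (shpow T (i - 1) C)"
    using assms shpow_suc[of _ "i - 1"] by simp
  then show ?case using step2 by simp
qed simp

lemma hom_zero_shpow: "A \<in> Obj T \<Longrightarrow> B \<in> Obj T \<Longrightarrow>
    hom_zero T (shpow T j A) (shpow T j B) \<longleftrightarrow> hom_zero T A B"
  by (rule shpow_rel[of A B B "\<lambda>A B C. hom_zero T A B"]) (auto simp: hom_zero_sh)

lemma tr_shpow: "tr A B C \<Longrightarrow> tr (shpow T j A) (shpow T j B) (shpow T j C)"
  using shpow_rel[of A B C tr j] trD[of A B C] tr_shift tr_unshift by blast

lemma isomorphic_shpow: "A \<in> Obj T \<Longrightarrow> B \<in> Obj T \<Longrightarrow>
    isomorphic T (shpow T j A) (shpow T j B) \<longleftrightarrow> isomorphic T A B"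
  by (rule shpow_rel[of A B B "\<lambda>A B C. isomorphic T A B"]) (use isomorphic_sh isomorphic_unsh in blast)+

lemma hom_zero_shpow2: "A \<in> Obj T \<Longrightarrow> B \<in> Obj T \<Longrightarrow>
    hom_zero T (shpow T i A) (shpow T j B) \<longleftrightarrow> hom_zero T A (shpow T (j - i) B)"
  using hom_zero_shpow[of A "shpow T (j - i) B" i] shpow_add[of B i "j - i"] by simp

end

section \<open>Thick subcategories\<close>

lemma fullsub_simps [simp]:
  "Obj (fullsub T U) = U" "hgrp (fullsub T U) = hgrp T" "idn (fullsub T U) = idn T"
  "cmp (fullsub T U) = cmp T" "sh (fullsub T U) = sh T" "shm (fullsub T U) = shm T"
  "tri (fullsub T U) = tri T"
  by (simp_all add: fullsub_def)

lemma is_iso_fullsub [simp]: "is_iso (fullsub T U) = is_iso T"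
  by (intro ext) (simp add: is_iso_def)

lemma isomorphic_fullsub [simp]: "isomorphic (fullsub T U) = isomorphic T"
  by (intro ext) (simp add: isomorphic_def)

lemma hom_zero_fullsub [simp]: "hom_zero (fullsub T U) = hom_zero T"
  by (intro ext) (simp add: hom_zero_def)

context triangulated_category
begin

text \<open>\<open>shm T u\<close> kills the connecting map and has the left inverse
  \<open>shm T p\<close>, so the connecting map vanishes; then the identity of \<open>Z\<close>
  lifts along \<open>v\<close>.\<close>

lemma split_mono_cone:
  assumes "dt X Y Z u v w" "arr Y X p" "p \<cdot> u = idn T X"
  shows "w = zr Z (sh T X)" "\<exists>s. arr Z Y s \<and> v \<cdot> s = idn T Z"
proof -
  note d = dtD[OF assms(1)]
  have "neg (sh T X) (sh T Y) (shm T u) \<cdot> w = zr Z (sh T Y)"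
    by (rule tri_comp1[OF rotate[OF rotate[OF assms(1)]]])
  then have "shm T u \<cdot> w = zr Z (sh T Y)"
    using comp_neg_left[OF d(8) shm_arr[OF d(6)]] neg_eq_zr[OF arr_comp[OF d(8) shm_arr[OF d(6)]]] by simp
  then have "(shm T p \<cdot> shm T u) \<cdot> w = zr Z (sh T X)"
    using comp_assoc[OF d(8) shm_arr[OF d(6)] shm_arr[OF assms(2)]]
      comp_zr_right[OF shm_arr[OF assms(2)] d(3)] by simp
  then show w: "w = zr Z (sh T X)"
    using shm_comp[OF d(6) assms(2)] assms(3) shm_idn[OF d(1)] id_left[OF d(8)] by simp
  have "w \<cdot> idn T Z = zr Z (sh T X)" using w id_right[OF d(8)] by simp
  then show "\<exists>s. arr Z Y s \<and> v \<cdot> s = idn T Z" using tri_lift2[OF assms(1) arr_id[OF d(3)]] by metis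
qed

text \<open>The other projections vanish on the last summand, hence descend to the cone of its
  inclusion. This drives the induction that puts finite direct sums into a thick
  subcategory.\<close>

lemma dsum_Suc_cone:
  assumes "is_dsum T {..<Suc n} Y X"
  obtains Z where "tr (Y n) X Z" "is_dsum T {..<n} Y Z"
proof (rule is_dsumE[OF assms])
  fix \<iota> \<pi>
  assume d: "finite {..<Suc n}" "X \<in> Obj T" "\<And>k. k \<in> {..<Suc n} \<Longrightarrow> Y k \<in> Obj T"
    "\<And>k. k \<in> {..<Suc n} \<Longrightarrow> arr (Y k) X (\<iota> k)" "\<And>k. k \<in> {..<Suc n} \<Longrightarrow> arr X (Y k) (\<pi> k)"
    "\<And>k. k \<in> {..<Suc n} \<Longrightarrow> \<pi> k \<cdot> \<iota> k = idn T (Y k)"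
    "\<And>k l. k \<in> {..<Suc n} \<Longrightarrow> l \<in> {..<Suc n} \<Longrightarrow> k \<noteq> l \<Longrightarrow> \<pi> k \<cdot> \<iota> l = zr (Y l) (Y k)"
    "finprod (hgrp T X X) (\<lambda>k. \<iota> k \<cdot> \<pi> k) {..<Suc n} = idn T X"
  have \<iota>n: "arr (Y n) X (\<iota> n)" and \<pi>n: "arr X (Y n) (\<pi> n)" "\<pi> n \<cdot> \<iota> n = idn T (Y n)"
    using d(4-6)[of n] by auto
  obtain Z v w where t: "dt (Y n) X Z (\<iota> n) v w" using cone_exists[OF \<iota>n] by blast
  note e = dtD[OF t]
  obtain s where s: "arr Z X s" "v \<cdot> s = idn T Z" using split_mono_cone[OF t \<pi>n] by blast
  have "\<exists>p. arr Z (Y k) p \<and> p \<cdot> v = \<pi> k" if "k < n" for k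
    using tri_ext[OF t d(5)[of k]] d(7)[of k n] that by (metis less_Suc_eq lessThan_iff less_irrefl)
  then obtain p where p: "\<And>k. k < n \<Longrightarrow> arr Z (Y k) (p k)" "\<And>k. k < n \<Longrightarrow> p k \<cdot> v = \<pi> k" by metis
  have \<iota>: "arr (Y k) X (\<iota> k)" "arr X (Y k) (\<pi> k)" if "k < n" for k using d(4,5)[of k] that by auto
  have vi: "arr (Y k) Z (v \<cdot> \<iota> k)" if "k < n" for k using arr_comp[OF \<iota>(1) e(7)] that by simp
  have pv: "p k \<cdot> (v \<cdot> \<iota> l) = \<pi> k \<cdot> \<iota> l" if "k < n" "l < n" for k l
    using comp_assoc[OF \<iota>(1)[OF that(2)] e(7) p(1)[OF that(1)]] p(2)[OF that(1)] by simp
  let ?S = "finprod (hgrp T Z Z) (\<lambda>k. (v \<cdot> \<iota> k) \<cdot> p k) {..<n}"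
  have ip: "arr X X (\<iota> k \<cdot> \<pi> k)" if "k < Suc n" for k
    using arr_comp[OF d(5)[of k] d(4)[of k]] that by auto
  have vp: "arr Z Z ((v \<cdot> \<iota> k) \<cdot> p k)" if "k < n" for k using arr_comp[OF p(1) vi] that by simp
  have Sa: "arr Z Z ?S" by (rule finprod_arr) (use e vp in auto)
  have "?S \<cdot> v = finprod (hgrp T X Z) (\<lambda>k. ((v \<cdot> \<iota> k) \<cdot> p k) \<cdot> v) {..<n}"
    by (rule finprod_comp_right[OF _ e(3) e(7)]) (use vp in auto)
  also have "\<dots> = finprod (hgrp T X Z) (\<lambda>k. v \<cdot> (\<iota> k \<cdot> \<pi> k)) {..<n}"
  proof (rule finprod_cong_arr)
    fix k assume "k \<in> {..<n}"
    then have k: "k < n" by simp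
    show "arr X Z (((v \<cdot> \<iota> k) \<cdot> p k) \<cdot> v)" using arr_comp[OF e(7) arr_comp[OF p(1) vi]] k by simp
    have "((v \<cdot> \<iota> k) \<cdot> p k) \<cdot> v = (v \<cdot> \<iota> k) \<cdot> \<pi> k" using comp_assoc[OF e(7) p(1) vi] p(2) k by simp
    also have "\<dots> = v \<cdot> (\<iota> k \<cdot> \<pi> k)" using comp_assoc[OF \<iota>(2) \<iota>(1) e(7)] k by simp
    finally show "((v \<cdot> \<iota> k) \<cdot> p k) \<cdot> v = v \<cdot> (\<iota> k \<cdot> \<pi> k)" .
  qed (use e in auto)
  also have "\<dots> = v \<cdot> finprod (hgrp T X X) (\<lambda>k. \<iota> k \<cdot> \<pi> k) {..<n}"
    by (rule finprod_comp_left[symmetric, OF _ d(2) e(7)]) (use ip in auto)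
  finally have Sv: "?S \<cdot> v = v \<cdot> finprod (hgrp T X X) (\<lambda>k. \<iota> k \<cdot> \<pi> k) {..<n}" .
  have fa: "arr X X (finprod (hgrp T X X) (\<lambda>k. \<iota> k \<cdot> \<pi> k) {..<n})"
    by (rule finprod_arr) (use d(2) ip in auto)
  have "idn T X = add X X (\<iota> n \<cdot> \<pi> n) (finprod (hgrp T X X) (\<lambda>k. \<iota> k \<cdot> \<pi> k) {..<n})"
    unfolding d(8)[symmetric] lessThan_Suc by (rule finprod_insert_arr) (use d(2) ip in auto)
  then have "v \<cdot> idn T X = add X Z (v \<cdot> (\<iota> n \<cdot> \<pi> n)) (v \<cdot> finprod (hgrp T X X) (\<lambda>k. \<iota> k \<cdot> \<pi> k) {..<n})"
    using comp_add_right[OF ip[of n] fa e(7)] by simp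
  moreover have "v \<cdot> (\<iota> n \<cdot> \<pi> n) = zr X Z"
    using comp_assoc[OF \<pi>n(1) \<iota>n e(7)] tri_comp1[OF t] comp_zr_left[OF \<pi>n(1) e(3)] by simp
  ultimately have v: "?S \<cdot> v = v"
    using Sv id_right[OF e(7)] add_zr(2)[OF arr_comp[OF fa e(7)]] by simp
  \<comment> \<open>\<open>?S\<close> fixes \<open>v\<close>, and \<open>v\<close> has the section
    \<open>s\<close>.\<close>
  have S: "?S = idn T Z"
    using comp_assoc[OF s(1) e(7) Sa] v s(2) id_right[OF Sa] by simp
  have "is_dsum T {..<n} Y Z"
  proof (rule is_dsumI[of _ _ _ "\<lambda>k. v \<cdot> \<iota> k" p])
    fix k assume "k \<in> {..<n}"
    then have k: "k < n" by simp
    show "arr (Y k) Z (v \<cdot> \<iota> k)" "arr Z (Y k) (p k)" using vi[OF k] p(1)[OF k] .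
    show "p k \<cdot> v \<cdot> \<iota> k = idn T (Y k)" using pv[OF k k] d(6)[of k] k by simp
  next
    fix k l assume "k \<in> {..<n}" "l \<in> {..<n}" "k \<noteq> l"
    then show "p k \<cdot> v \<cdot> \<iota> l = zr (Y l) (Y k)" using pv[of k l] d(7)[of k l] by simp
  qed (use e(3) S in simp_all)
  then show thesis by (rule that[OF trI[OF t]])
qed

lemma thickD:
  assumes "thick T D"
  shows "D \<subseteq> Obj T" "\<And>X. X \<in> Obj T \<Longrightarrow> sh T X \<in> D \<longleftrightarrow> X \<in> D"
    "\<And>A B. A \<in> D \<Longrightarrow> isomorphic T A B \<Longrightarrow> B \<in> Obj T \<Longrightarrow> B \<in> D"
    "\<And>A B C. tr A B C \<Longrightarrow> A \<in> D \<Longrightarrow> B \<in> D \<Longrightarrow> C \<in> D"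
    "\<And>A B C. tr A B C \<Longrightarrow> A \<in> D \<Longrightarrow> C \<in> D \<Longrightarrow> B \<in> D"
    "\<And>A B C. tr A B C \<Longrightarrow> B \<in> D \<Longrightarrow> C \<in> D \<Longrightarrow> A \<in> D"
    "\<And>A X. summand T A X \<Longrightarrow> X \<in> D \<Longrightarrow> A \<in> D"
    "\<And>Z. is_zero T Z \<Longrightarrow> Z \<in> D"
proof -
  have s: "subcat T D" "D \<noteq> {}" "\<forall>X\<in>Obj T. sh T X \<in> D \<longleftrightarrow> X \<in> D"
    "\<forall>X\<in>D. \<forall>Y\<in>D. \<forall>Z\<in>Obj T. \<forall>u v w. tri T X Y Z u v w \<longrightarrow> Z \<in> D"
    "\<forall>X\<in>D. \<forall>A\<in>Obj T. summand T A X \<longrightarrow> A \<in> D"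
    using assms unfolding thick_def by - (elim conjE, assumption)+
  show 1: "D \<subseteq> Obj T" using s(1) unfolding subcat_def by blast
  show 2: "\<And>X. X \<in> Obj T \<Longrightarrow> sh T X \<in> D \<longleftrightarrow> X \<in> D" using s(3) by blast
  show 3: "\<And>A B. A \<in> D \<Longrightarrow> isomorphic T A B \<Longrightarrow> B \<in> Obj T \<Longrightarrow> B \<in> D"
    using s(1) unfolding subcat_def by blast
  show 4: "A \<in> D" if "summand T A X" "X \<in> D" for A X
  proof -
    have "A \<in> Obj T" using that(1) by (rule summandE) (rule arrD)
    then show ?thesis using s(5) that by blast
  qed
  show 5: "tr A B C \<Longrightarrow> A \<in> D \<Longrightarrow> B \<in> D \<Longrightarrow> C \<in> D" for A B C
    using s(4) unfolding tr_def dt_def by blast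
  have 6: "tr A B C \<Longrightarrow> B \<in> D \<Longrightarrow> C \<in> D \<Longrightarrow> A \<in> D" for A B C
    using 5[OF tr_rot[of A B C]] 2 trD(1) by blast
  then show "tr A B C \<Longrightarrow> B \<in> D \<Longrightarrow> C \<in> D \<Longrightarrow> A \<in> D" for A B C .
  show "tr A B C \<Longrightarrow> A \<in> D \<Longrightarrow> C \<in> D \<Longrightarrow> B \<in> D" for A B C
    using 6[OF tr_rot[of A B C]] 2 trD(1) by blast
  show "Z \<in> D" if "is_zero T Z" for Z
  proof -
    obtain X where "X \<in> D" using s(2) by blast
    then show ?thesis using 5[OF tr_zero_id(2)[OF _ that]] 1 by blast
  qed
qed

lemma thick_dsum:
  assumes "thick T D" "is_dsum T {..<n::nat} Y X" "\<forall>k\<in>{..<n}. Y k \<in> D"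
  shows "X \<in> D"
  using assms(2,3)
proof (induction n arbitrary: X)
  case 0
  then have "X \<in> Obj T" "idn T X = zr X X" unfolding is_dsum_def by (auto simp: finprod_empty_arr)
  then show ?case using is_zeroI_id thickD(8)[OF assms(1)] by blast
next
  case (Suc n)
  obtain Z where "tr (Y n) X Z" "is_dsum T {..<n} Y Z" using dsum_Suc_cone[OF Suc.prems(1)] by blast
  then show ?case using Suc thickD(5)[OF assms(1)] by simp
qed

lemma thick_shpow:
  assumes "thick T D" "X \<in> Obj T" shows "shpow T j X \<in> D \<longleftrightarrow> X \<in> D"
  by (rule shpow_rel[of X X X "\<lambda>A B C. A \<in> D"]) (use assms thickD(2)[OF assms(1)] in auto)

lemma is_zero_fullsub:
  assumes "D \<subseteq> Obj T" shows "is_zero (fullsub T D) Z \<longleftrightarrow> is_zero T Z \<and> Z \<in> D"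
proof
  assume "is_zero (fullsub T D) Z"
  then have Z: "Z \<in> D" "hom_zero T Z Z" unfolding is_zero_def fullsub_simps hom_zero_fullsub by blast+
  then show "is_zero T Z \<and> Z \<in> D" using is_zero_iff assms by blast
next
  assume "is_zero T Z \<and> Z \<in> D"
  then show "is_zero (fullsub T D) Z"
    using assms unfolding is_zero_def fullsub_simps hom_zero_fullsub by blast
qed

lemma is_dsum_fullsub:
  assumes "D \<subseteq> Obj T"
  shows "is_dsum (fullsub T D) J Y X \<longleftrightarrow> is_dsum T J Y X \<and> X \<in> D \<and> (\<forall>k\<in>J. Y k \<in> D)"
  using assms unfolding is_dsum_def fullsub_simps by blast

text \<open>Only cones and finite direct sums have to be shown to stay in \<open>D\<close>; the
  other axioms restrict. Afterwards all results for \<open>T\<close> can be instantiated for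
  \<open>D\<close>.\<close>

lemma triangulated_fullsub:
  assumes "thick T D" shows "triangulated_category (fullsub T D)"
proof -
  note th = thickD[OF assms]
  have D: "A \<in> D \<Longrightarrow> A \<in> Obj T" for A using th(1) by blast
  have add: "additive_category (fullsub T D)"
  proof (intro additive_category.intro, goal_cases)
    case (1 A B A' B' f) then show ?case using D hom_disjoint[of A B A' B' f] by simp
  next
    case (2 A) then show ?case using D idn_closed[of A] by simp
  next
    case (3 A B C f g) then show ?case using D cmp_closed[of A B C f g] by simp
  next
    case (4 A B C E f g h) then show ?case using D cmp_assoc[of A B C E f g h] by simp
  next
    case (5 A B f) then show ?case using D cmp_idn_right[of A B f] by simp
  next
    case (6 A B f) then show ?case using D cmp_idn_left[of A B f] by simp
  next
    case (7 A B) then show ?case using D hgrp_comm_group[of A B] by simp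
  next
    case (8 A B C f g g') then show ?case using D cmp_add_left[of A B C f g g'] by simp
  next
    case (9 A B C f f' g) then show ?case using D cmp_add_right[of A B C f f' g] by simp
  next
    case (10 n Y)
    then have "\<forall>k\<in>{..<n}. Y k \<in> Obj T" using D by simp
    then obtain X where X: "is_dsum T {..<n} Y X" using dsum_exists by blast
    then have "X \<in> D" using thick_dsum[OF assms X] 10 by simp
    then have "is_dsum (fullsub T D) {..<n} Y X" using X 10 by (simp add: is_dsum_fullsub[OF th(1)])
    then show ?case by blast
  qed
  have bij: "bij_betw (sh T) D D"
    unfolding bij_betw_def
  proof
    show "inj_on (sh T) D" using sh_bij th(1) inj_on_subset unfolding bij_betw_def by blast
    show "sh T ` D = D" using th(2) D sh_surj by (auto simp: image_iff) metis
  qed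
  show ?thesis
  proof (intro triangulated_category.intro add triangulated_category_axioms.intro, goal_cases)
    case 1 show ?case using bij by simp
  next
    case (6 X Y Z u v w) then show ?case using tri_hom[of X Y Z u v w] D by simp
  next
    case (7 X Y Z X' Y' Z' u v w u' v' w' a b c)
    then show ?case using tri_iso[of X Y Z X' Y' Z' u v w u' v' w' a b c] D by simp
  next
    case (8 X Z) then show ?case using tri_idn[of X Z] D is_zero_fullsub[OF th(1)] by simp
  next
    case (9 X Y u)
    then have "arr X Y u" using D by (simp add: arr_def)
    then obtain Z v w where t: "dt X Y Z u v w" using cone_exists by blast
    then have "Z \<in> D" using th(4)[OF trI[OF t]] 9 by simp
    then show ?case using dtD(4)[OF t] by auto
  next
    case (10 X Y Z u v w) then show ?case using tri_rotate[of X Y Z u v w] D by simp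
  next
    case (11 X Y Z X' Y' Z' u v w u' v' w' a b)
    then show ?case using tri_morphism[of X Y Z X' Y' Z' u v w u' v' w' a b] D by simp
  next
    case (12 X Y Z X' Y' Z' u i i' v j j' k k')
    then show ?case using octahedral[of X Y Z X' Y' Z' u i i' v j j' k k'] D by simp
  next
    case (2 A B) then show ?case using D shm_bij[of A B] by simp
  next
    case (3 A B) then show ?case using D shm_add[of A B] by simp
  next
    case (4 A) then show ?case using D shm_idn[of A] by simp
  next
    case (5 A B C f g) then show ?case using D shm_cmp[of A B C f g] by simp
  qed
qed

text \<open>Not definitional for negative exponents: \<open>shpow\<close> inverts the suspension by
  \<open>inv_into\<close> on the object set, which differs for the two categories.\<close>

lemma shpow_fullsub:
  assumes "thick T D" "X \<in> D" shows "shpow (fullsub T D) j X = shpow T j X"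
proof (induction j rule: int_induct[where k = 0])
  case base show ?case by (simp add: shpow_def)
next
  interpret D: triangulated_category "fullsub T D" by (rule triangulated_fullsub[OF assms(1)])
  have X: "X \<in> Obj T" using assms thickD by blast
  case (step1 i)
  then show ?case using D.shpow_suc[of X i] shpow_suc[OF X, of i] assms by simp
next
  interpret D: triangulated_category "fullsub T D" by (rule triangulated_fullsub[OF assms(1)])
  have X: "X \<in> Obj T" using assms thickD by blast
  case (step2 i)
  have a: "sh T (shpow (fullsub T D) (i - 1) X) = shpow (fullsub T D) i X"
    using D.shpow_suc[of X "i - 1"] assms by simp
  have b: "sh T (shpow T (i - 1) X) = shpow T i X" using shpow_suc[OF X, of "i - 1"] by simp
  have o: "shpow (fullsub T D) (i - 1) X \<in> Obj T"
    using D.shpow_Obj[of X "i - 1"] assms(2) thickD(1)[OF assms(1)] by auto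
  show ?case by (rule sh_inj[OF o]) (use a b X step2.IH in simp_all)
qed

end

section \<open>Sequential colimits of Yoneda functors\<close>

abbreviation el :: "('o, 'm, 'v) cfun \<Rightarrow> 'o \<Rightarrow> 'v set" where "el F A \<equiv> carrier (FO F A)"

abbreviation un :: "('o, 'm, 'v) cfun \<Rightarrow> 'o \<Rightarrow> 'v" where "un F A \<equiv> \<one>\<^bsub>FO F A\<^esub>"

context triangulated_category
begin

section \<open>Additive functors and their values\<close>

lemma arr_Arr: "arr A B f \<Longrightarrow> f \<in> Arr T"
  unfolding arr_def Arr_def by blast

lemma Arr_arr: "f \<in> Arr T \<Longrightarrow> \<exists>A B. arr A B f"
  unfolding arr_def Arr_def by blast

lemma afD:
  assumes "additive_functor T F"
  shows "FO F \<in> extensional (Obj T)" "FA F \<in> extensional (Arr T)"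
    "A \<in> Obj T \<Longrightarrow> comm_group (FO F A)"
    "arr A B f \<Longrightarrow> FA F f \<in> hom (FO F B) (FO F A)"
    "A \<in> Obj T \<Longrightarrow> x \<in> el F A \<Longrightarrow> FA F (idn T A) x = x"
    "arr A B f \<Longrightarrow> arr B C g \<Longrightarrow> x' \<in> el F C \<Longrightarrow> FA F (g \<cdot> f) x' = FA F f (FA F g x')"
    "arr A B f \<Longrightarrow> arr A B g' \<Longrightarrow> x'' \<in> el F B \<Longrightarrow>
      FA F (add A B f g') x'' = FA F f x'' \<otimes>\<^bsub>FO F A\<^esub> FA F g' x''"
proof -
  note a = assms[unfolded additive_functor_def]
  show "FO F \<in> extensional (Obj T)" "FA F \<in> extensional (Arr T)"
    using a by - (elim conjE, assumption)+
  show "A \<in> Obj T \<Longrightarrow> comm_group (FO F A)" using a by - (elim conjE, erule bspec)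
  show "arr A B f \<Longrightarrow> FA F f \<in> hom (FO F B) (FO F A)" unfolding arr_def using a by - (elim conjE, blast)
  show "A \<in> Obj T \<Longrightarrow> x \<in> el F A \<Longrightarrow> FA F (idn T A) x = x" using a by - (elim conjE, blast)
  show "arr A B f \<Longrightarrow> arr B C g \<Longrightarrow> x' \<in> el F C \<Longrightarrow> FA F (g \<cdot> f) x' = FA F f (FA F g x')"
    unfolding arr_def using a by - (elim conjE, blast)
  show "arr A B f \<Longrightarrow> arr A B g' \<Longrightarrow> x'' \<in> el F B \<Longrightarrow>
      FA F (add A B f g') x'' = FA F f x'' \<otimes>\<^bsub>FO F A\<^esub> FA F g' x''"
    unfolding arr_def using a by - (elim conjE, blast)
qed

lemma additive_functorI:
  assumes "FO F \<in> extensional (Obj T)" "FA F \<in> extensional (Arr T)"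
    "\<And>A. A \<in> Obj T \<Longrightarrow> comm_group (FO F A)"
    "\<And>A B f. arr A B f \<Longrightarrow> FA F f \<in> hom (FO F B) (FO F A)"
    "\<And>A x. A \<in> Obj T \<Longrightarrow> x \<in> el F A \<Longrightarrow> FA F (idn T A) x = x"
    "\<And>A B C f g x. arr A B f \<Longrightarrow> arr B C g \<Longrightarrow> x \<in> el F C \<Longrightarrow> FA F (g \<cdot> f) x = FA F f (FA F g x)"
    "\<And>A B f g x. arr A B f \<Longrightarrow> arr A B g \<Longrightarrow> x \<in> el F B \<Longrightarrow>
      FA F (add A B f g) x = FA F f x \<otimes>\<^bsub>FO F A\<^esub> FA F g x"
  shows "additive_functor T F"
  unfolding additive_functor_def
proof (intro conjI ballI, goal_cases)
  case (3 A) then show ?case using assms(3) by simp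
next
  case (4 A B f) then show ?case using assms(4)[of A B f] by (simp add: arr_def)
next
  case (5 A x) then show ?case using assms(5)[of A x] by simp
next
  case (6 A B C f g x) then show ?case using assms(6)[of A B f C g x] by (simp add: arr_def)
next
  case (7 A B f g x) then show ?case using assms(7)[of A B f g x] by (simp add: arr_def)
qed (rule assms)+

lemma fa_group_hom:
  assumes "additive_functor T F" "arr A B f"
  shows "group_hom (FO F B) (FO F A) (FA F f)"
  using afD(3,4)[OF assms(1)] assms(2) arrD[OF assms(2)]
  by (simp add: group_hom_def group_hom_axioms_def comm_group.axioms(2))

lemma fa_closed: "additive_functor T F \<Longrightarrow> arr A B f \<Longrightarrow> x \<in> el F B \<Longrightarrow> FA F f x \<in> el F A"
  by (rule group_hom.hom_closed[OF fa_group_hom])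

lemma fa_un: "additive_functor T F \<Longrightarrow> arr A B f \<Longrightarrow> FA F f (un F B) = un F A"
  by (rule group_hom.hom_one[OF fa_group_hom])

lemma el_group: "additive_functor T F \<Longrightarrow> A \<in> Obj T \<Longrightarrow> group (FO F A)"
  using afD(3) comm_group.axioms(2) by blast

lemma un_el: "additive_functor T F \<Longrightarrow> A \<in> Obj T \<Longrightarrow> un F A \<in> el F A"
  using el_group group.is_monoid monoid.one_closed by blast

lemma fa_zr:
  assumes "additive_functor T F" "A \<in> Obj T" "B \<in> Obj T" "x \<in> el F B"
  shows "FA F (zr A B) x = un F A"
proof -
  interpret group "FO F A" using el_group assms by blast
  have z: "arr A B (zr A B)" using assms by simp
  have "FA F (zr A B) x \<otimes>\<^bsub>FO F A\<^esub> FA F (zr A B) x = FA F (zr A B) x"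
    using afD(7)[OF assms(1) z z assms(4)] add_zr(1)[OF z] by simp
  then show ?thesis using fa_closed[OF assms(1) z assms(4)] by (simp add: l_cancel_one)
qed

text \<open>Reduces equality of two values to vanishing of one, the form in which injectivity is
  recorded in \<open>colim\<close> and \<open>represents\<close>.\<close>

lemma fa_diff:
  assumes "additive_functor T F" "arr A B p" "arr A B q" "x \<in> el F B" "FA F p x = FA F q x"
  shows "FA F (add A B p (neg A B q)) x = un F A"
proof -
  note o = arrD[OF assms(2)]
  have n: "arr A B (neg A B q)" using assms(3) arr_neg by blast
  have "FA F (add A B p (neg A B q)) x = FA F q x \<otimes>\<^bsub>FO F A\<^esub> FA F (neg A B q) x"
    using afD(7)[OF assms(1,2) n assms(4)] assms(5) by simp
  also have "\<dots> = FA F (zr A B) x"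
    using afD(7)[OF assms(1,3) n assms(4)] add_neg[OF assms(3)] by simp
  finally show ?thesis using fa_zr[OF assms(1) o(1,2) assms(4)] by simp
qed

section \<open>Natural transformations and the Yoneda lemma\<close>

lemma ntD:
  assumes "nat_trans T F G \<eta>"
  shows "\<eta> \<in> extensional (Obj T)" "A \<in> Obj T \<Longrightarrow> \<eta> A \<in> hom (FO F A) (FO G A)"
    "A \<in> Obj T \<Longrightarrow> \<eta> A \<in> extensional (el F A)"
    "A \<in> Obj T \<Longrightarrow> x \<in> el F A \<Longrightarrow> \<eta> A x \<in> el G A"
    "arr A B f \<Longrightarrow> x' \<in> el F B \<Longrightarrow> \<eta> A (FA F f x') = FA G f (\<eta> B x')"
  using assms unfolding nat_trans_def arr_def hom_def by blast+

lemma nt_un: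
  assumes "nat_trans T F G \<eta>" "additive_functor T F" "additive_functor T G" "A \<in> Obj T"
  shows "\<eta> A (un F A) = un G A"
  using group_hom.hom_one[of "FO F A" "FO G A" "\<eta> A"] ntD(2)[OF assms(1,4)]
    el_group[OF assms(2,4)] el_group[OF assms(3,4)]
  by (simp add: group_hom_def group_hom_axioms_def)

lemma nt_eqI:
  assumes "nat_trans T F G \<eta>" "nat_trans T F G \<theta>"
    "\<And>A x. A \<in> Obj T \<Longrightarrow> x \<in> el F A \<Longrightarrow> \<eta> A x = \<theta> A x"
  shows "\<eta> = \<theta>"
proof (rule extensionalityI[OF ntD(1)[OF assms(1)] ntD(1)[OF assms(2)]])
  fix A assume A: "A \<in> Obj T"
  show "\<eta> A = \<theta> A"
    by (rule extensionalityI[OF ntD(3)[OF assms(1) A] ntD(3)[OF assms(2) A]]) (rule assms(3)[OF A])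
qed

lemma nat_transI:
  assumes "\<eta> \<in> extensional (Obj T)" "\<And>A. A \<in> Obj T \<Longrightarrow> \<eta> A \<in> hom (FO F A) (FO G A)"
    "\<And>A. A \<in> Obj T \<Longrightarrow> \<eta> A \<in> extensional (el F A)"
    "\<And>A B f x. arr A B f \<Longrightarrow> x \<in> el F B \<Longrightarrow> \<eta> A (FA F f x) = FA G f (\<eta> B x)"
  shows "nat_trans T F G \<eta>"
  using assms unfolding nat_trans_def arr_def by blast

lemma yoneda_simps:
  "A \<in> Obj T \<Longrightarrow> FO (yoneda T X) A = hgrp T A X"
  "arr A B f \<Longrightarrow> FA (yoneda T X) f p = p \<cdot> f"
  by (simp_all add: yoneda_def arr_Arr)

definition yoneda_map :: "'o \<Rightarrow> ('o, 'm, 'v) cfun \<Rightarrow> 'v \<Rightarrow> 'o \<Rightarrow> 'm \<Rightarrow> 'v"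
  where "yoneda_map X F x = (\<lambda>A\<in>Obj T. \<lambda>p\<in>Hom T A X. FA F p x)"

lemma yoneda_map_apply: "arr A X p \<Longrightarrow> yoneda_map X F x A p = FA F p x"
  by (simp add: yoneda_map_def arr_def)

lemma yoneda_map_nat_trans:
  assumes "additive_functor T F" "X \<in> Obj T" "x \<in> el F X"
  shows "nat_trans T (yoneda T X) F (yoneda_map X F x)"
proof (rule nat_transI)
  show "yoneda_map X F x \<in> extensional (Obj T)" by (simp add: yoneda_map_def)
next
  fix A assume A: "A \<in> Obj T"
  show "yoneda_map X F x A \<in> extensional (el (yoneda T X) A)" using A by (simp add: yoneda_map_def yoneda_simps)
  show "yoneda_map X F x A \<in> hom (FO (yoneda T X) A) (FO F A)"
  proof (rule homI)
    fix p assume "p \<in> el (yoneda T X) A"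
    then have p: "arr A X p" using A assms by (simp add: yoneda_simps arr_def)
    show "yoneda_map X F x A p \<in> el F A" using fa_closed[OF assms(1) p assms(3)] by (simp add: yoneda_map_apply[OF p])
  next
    fix p q assume "p \<in> el (yoneda T X) A" "q \<in> el (yoneda T X) A"
    then have p: "arr A X p" "arr A X q" using A assms by (simp_all add: yoneda_simps arr_def)
    show "yoneda_map X F x A (p \<otimes>\<^bsub>FO (yoneda T X) A\<^esub> q) = yoneda_map X F x A p \<otimes>\<^bsub>FO F A\<^esub> yoneda_map X F x A q"
      using afD(7)[OF assms(1) p assms(3)] A
      by (simp add: yoneda_simps yoneda_map_apply[OF arr_add[OF p]] yoneda_map_apply[OF p(1)] yoneda_map_apply[OF p(2)])
  qed
next
  fix A B f p assume f: "arr A B f" and "p \<in> el (yoneda T X) B"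
  then have p: "arr B X p" using assms arrD[OF f] by (simp add: yoneda_simps arr_def)
  show "yoneda_map X F x A (FA (yoneda T X) f p) = FA F f (yoneda_map X F x B p)"
    using afD(6)[OF assms(1) f p assms(3)]
    by (simp add: yoneda_map_apply[OF arr_comp[OF f p]] yoneda_map_apply[OF p] yoneda_simps(2)[OF f])
qed

lemma yoneda_lemma:
  assumes "nat_trans T (yoneda T X) F \<eta>" "X \<in> Obj T"
  shows "\<eta> X (idn T X) \<in> el F X" "arr A X p \<Longrightarrow> \<eta> A p = FA F p (\<eta> X (idn T X))"
proof -
  have i: "idn T X \<in> el (yoneda T X) X" using assms arr_id by (simp add: yoneda_simps idn_closed)
  show "\<eta> X (idn T X) \<in> el F X" by (rule ntD(4)[OF assms(1,2) i])
  show "\<eta> A p = FA F p (\<eta> X (idn T X))" if "arr A X p"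
    using ntD(5)[OF assms(1) that i] yoneda_simps(2)[OF that] id_left[OF that] by simp
qed

lemma nat_trans_zero_yoneda:
  assumes "additive_functor T F" "X \<in> Obj T"
  shows "nat_trans_zero T (yoneda T X) F \<longleftrightarrow> el F X = {un F X}"
proof
  assume z: "nat_trans_zero T (yoneda T X) F"
  have "x = un F X" if x: "x \<in> el F X" for x
  proof -
    have i: "idn T X \<in> el (yoneda T X) X" using assms by (simp add: yoneda_simps idn_closed)
    have "yoneda_map X F x X (idn T X) = un F X"
      using z yoneda_map_nat_trans[OF assms x] i assms(2) unfolding nat_trans_zero_def by blast
    then show ?thesis using afD(5)[OF assms(1,2) x] by (simp add: yoneda_map_apply[OF arr_id[OF assms(2)]])
  qed
  then show "el F X = {un F X}" using un_el[OF assms] by blast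
next
  assume z: "el F X = {un F X}"
  show "nat_trans_zero T (yoneda T X) F"
    unfolding nat_trans_zero_def
  proof (intro allI impI ballI)
    fix \<eta> A p assume n: "nat_trans T (yoneda T X) F \<eta>" and A: "A \<in> Obj T" and "p \<in> el (yoneda T X) A"
    then have p: "arr A X p" using assms by (simp add: yoneda_simps arr_def)
    have "\<eta> X (idn T X) = un F X" using yoneda_lemma(1)[OF n assms(2)] z by blast
    then show "\<eta> A p = un F A" using yoneda_lemma(2)[OF n assms(2) p] fa_un[OF assms(1) p] by simp
  qed
qed

section \<open>Sequences and colimits described by elements\<close>

definition seq :: "(nat \<Rightarrow> 'o) \<Rightarrow> (nat \<Rightarrow> 'm) \<Rightarrow> bool"
  where "seq X f \<longleftrightarrow> (\<forall>n. arr (X n) (X (Suc n)) (f (Suc n)))"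

text \<open>The composite of the transition maps from stage \<open>n\<close> to stage
  \<open>N\<close>. The else branch yields the identity when \<open>n = Suc N\<close>, and as a
  default also for larger \<open>n\<close>.\<close>

primrec transit :: "(nat \<Rightarrow> 'o) \<Rightarrow> (nat \<Rightarrow> 'm) \<Rightarrow> nat \<Rightarrow> nat \<Rightarrow> 'm" where
  "transit X f n 0 = idn T (X 0)"
| "transit X f n (Suc N) = (if n \<le> N then f (Suc N) \<cdot> transit X f n N else idn T (X (Suc N)))"

lemma seqD: "seq X f \<Longrightarrow> arr (X n) (X (Suc n)) (f (Suc n))" "seq X f \<Longrightarrow> X n \<in> Obj T"
  unfolding seq_def using arrD by blast+

lemma transit_refl: "transit X f n n = idn T (X n)"
  by (cases n) auto

lemma transit_arr: "seq X f \<Longrightarrow> n \<le> N \<Longrightarrow> arr (X n) (X N) (transit X f n N)"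
proof (induction N)
  case 0
  then show ?case using seqD(2) by simp
next
  case (Suc N)
  show ?case
  proof (cases "n \<le> N")
    case True
    then show ?thesis using arr_comp[OF Suc.IH[OF Suc.prems(1) True] seqD(1)[OF Suc.prems(1)]] by simp
  next
    case False
    then have "n = Suc N" using Suc by simp
    then show ?thesis using seqD(2)[OF Suc.prems(1)] transit_refl[of X f n] by simp
  qed
qed

lemma transit_comp: "seq X f \<Longrightarrow> n \<le> N \<Longrightarrow> N \<le> P \<Longrightarrow> transit X f N P \<cdot> transit X f n N = transit X f n P"
proof (induction P)
  case 0
  then show ?case using id_left[OF transit_arr[of X f n N]] transit_refl[of X f N] by simp
next
  case (Suc P)
  show ?case
  proof (cases "N \<le> P")
    case True
    then show ?thesis
      using Suc.IH[OF Suc.prems(1,2) True] comp_assoc[OF transit_arr[OF Suc.prems(1,2)]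
          transit_arr[OF Suc.prems(1) True] seqD(1)[OF Suc.prems(1)]] Suc.prems(2) by simp
  next
    case False
    then have "N = Suc P" using Suc by simp
    then show ?thesis using id_left[OF transit_arr[OF Suc.prems(1,2)]] transit_refl[of X f N] by simp
  qed
qed

text \<open>By the Yoneda lemma, a cocone on \<open>Y (X n)\<close> with vertex \<open>F\<close> is a compatible family of elements
  \<open>e n\<close> of \<open>F (X n)\<close>.\<close>

definition colim :: "(nat \<Rightarrow> 'o) \<Rightarrow> (nat \<Rightarrow> 'm) \<Rightarrow> ('o, 'm, 'v) cfun \<Rightarrow> (nat \<Rightarrow> 'v) \<Rightarrow> bool"
  where "colim X f F e \<longleftrightarrow> seq X f \<and> (\<forall>n. e n \<in> el F (X n)) \<and>
    (\<forall>n. FA F (f (Suc n)) (e (Suc n)) = e n) \<and>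
    (\<forall>A\<in>Obj T. \<forall>x\<in>el F A. \<exists>n p. arr A (X n) p \<and> x = FA F p (e n)) \<and>
    (\<forall>A n p. arr A (X n) p \<and> FA F p (e n) = un F A \<longrightarrow> (\<exists>N\<ge>n. transit X f n N \<cdot> p = zr A (X N)))"

lemma colimD:
  assumes "colim X f F e"
  shows "seq X f" "e n \<in> el F (X n)" "FA F (f (Suc n)) (e (Suc n)) = e n"
  using assms unfolding colim_def by blast+

lemma colim_surj:
  assumes "colim X f F e" "A \<in> Obj T" "x \<in> el F A"
  obtains n p where "arr A (X n) p" "x = FA F p (e n)"
  using assms unfolding colim_def by blast

lemma colim_inj:
  assumes "colim X f F e" "arr A (X n) p" "FA F p (e n) = un F A"
  obtains N where "n \<le> N" "transit X f n N \<cdot> p = zr A (X N)"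
  using assms unfolding colim_def by blast

lemma fa_tn_compat:
  assumes "additive_functor T F" "seq X f" "\<And>n. e n \<in> el F (X n)"
    "\<And>n. FA F (f (Suc n)) (e (Suc n)) = e n" "n \<le> N"
  shows "FA F (transit X f n N) (e N) = e n"
  using assms(5)
proof (induction N)
  case 0
  then show ?case using afD(5)[OF assms(1) seqD(2)[OF assms(2)] assms(3)] by simp
next
  case (Suc N)
  show ?case
  proof (cases "n \<le> N")
    case True
    then show ?thesis
      using Suc.IH[OF True] afD(6)[OF assms(1) transit_arr[OF assms(2) True] seqD(1)[OF assms(2)] assms(3)]
        assms(4) by simp
  next
    case False
    then have "n = Suc N" using Suc by simp
    then show ?thesis using afD(5)[OF assms(1) seqD(2)[OF assms(2)] assms(3)] transit_refl[of X f n] by simp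
  qed
qed

lemma colim_tn: "additive_functor T F \<Longrightarrow> colim X f F e \<Longrightarrow> n \<le> N \<Longrightarrow> FA F (transit X f n N) (e N) = e n"
  using fa_tn_compat colimD by blast

lemma colim_push:
  assumes "additive_functor T F" "colim X f F e" "n \<le> N" "arr A (X n) p"
  shows "FA F (transit X f n N \<cdot> p) (e N) = FA F p (e n)"
  using afD(6)[OF assms(1,4) transit_arr[OF colimD(1)[OF assms(2)] assms(3)] colimD(2)[OF assms(2)]]
    colim_tn[OF assms(1-3)] by simp

text \<open>Both elements are pushed to the common stage \<open>max n m\<close>, where their
  difference is given by a single morphism with vanishing value.\<close>

lemma colim_eq:
  assumes "additive_functor T F" "colim X f F e" "arr A (X n) p" "arr A (X m) q"
    "FA F p (e n) = FA F q (e m)"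
  obtains N where "n \<le> N" "m \<le> N" "transit X f n N \<cdot> p = transit X f m N \<cdot> q"
proof -
  note s = colimD(1)[OF assms(2)]
  let ?M = "max n m"
  have M: "n \<le> ?M" "m \<le> ?M" by auto
  let ?p = "transit X f n ?M \<cdot> p" and ?q = "transit X f m ?M \<cdot> q"
  have p: "arr A (X ?M) ?p" and q: "arr A (X ?M) ?q"
    using arr_comp[OF assms(3) transit_arr[OF s M(1)]] arr_comp[OF assms(4) transit_arr[OF s M(2)]] by auto
  have "FA F ?p (e ?M) = FA F ?q (e ?M)"
    using colim_push[OF assms(1,2) M(1) assms(3)] colim_push[OF assms(1,2) M(2) assms(4)] assms(5) by simp
  then have "FA F (add A (X ?M) ?p (neg A (X ?M) ?q)) (e ?M) = un F A"
    by (rule fa_diff[OF assms(1) p q colimD(2)[OF assms(2)]])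
  then obtain N where N: "?M \<le> N" "transit X f ?M N \<cdot> add A (X ?M) ?p (neg A (X ?M) ?q) = zr A (X N)"
    using colim_inj[OF assms(2) arr_add[OF p arr_neg[OF q]]] by blast
  then have e: "transit X f ?M N \<cdot> ?p = transit X f ?M N \<cdot> ?q"
    using comp_diff_right[OF p q transit_arr[OF s N(1)]] by blast
  have "transit X f ?M N \<cdot> ?p = transit X f n N \<cdot> p"
    using comp_assoc[OF assms(3) transit_arr[OF s M(1)] transit_arr[OF s N(1)]] transit_comp[OF s M(1) N(1)] by simp
  moreover have "transit X f ?M N \<cdot> ?q = transit X f m N \<cdot> q"
    using comp_assoc[OF assms(4) transit_arr[OF s M(2)] transit_arr[OF s N(1)]] transit_comp[OF s M(2) N(1)] by simp
  ultimately show thesis using that[of N] e M N(1) by simp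
qed

text \<open>Every element of \<open>F\<close> comes from some stage, and two representatives agree
  at a later stage. Hence a value may be chosen through any representative, and the compatible
  family \<open>d\<close> makes it independent of the choice.\<close>

lemma colim_universal:
  assumes "additive_functor T F" "colim X f F e" "additive_functor T H"
    "\<And>n. d n \<in> el H (X n)" "\<And>n. FA H (f (Suc n)) (d (Suc n)) = d n"
  obtains \<eta> where "nat_trans T F H \<eta>" "\<And>n. \<eta> (X n) (e n) = d n"
    "\<And>n A p. arr A (X n) p \<Longrightarrow> \<eta> A (FA F p (e n)) = FA H p (d n)"
proof -
  note s = colimD(1)[OF assms(2)] and eF = colimD(2)[OF assms(2)]
  let ?g = "\<lambda>A x. SOME y. \<exists>n p. arr A (X n) p \<and> x = FA F p (e n) \<and> y = FA H p (d n)"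
  have tnd: "FA H (transit X f n N) (d N) = d n" if "n \<le> N" for n N
    by (rule fa_tn_compat[OF assms(3) s assms(4,5) that])
  have g: "?g A (FA F p (e n)) = FA H p (d n)" if p: "arr A (X n) p" for A n p
  proof -
    have "\<exists>y n' p'. arr A (X n') p' \<and> FA F p (e n) = FA F p' (e n') \<and> y = FA H p' (d n')" using p by blast
    then have "\<exists>n' p'. arr A (X n') p' \<and> FA F p (e n) = FA F p' (e n') \<and> ?g A (FA F p (e n)) = FA H p' (d n')"
      by (rule someI_ex)
    then obtain n' p' where q: "arr A (X n') p'" "FA F p (e n) = FA F p' (e n')"
      "?g A (FA F p (e n)) = FA H p' (d n')" by blast
    obtain N where N: "n \<le> N" "n' \<le> N" "transit X f n N \<cdot> p = transit X f n' N \<cdot> p'"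
      using colim_eq[OF assms(1,2) p q(1,2)] by blast
    have "FA H p (d n) = FA H (transit X f n N \<cdot> p) (d N)"
      using afD(6)[OF assms(3) p transit_arr[OF s N(1)] assms(4)] tnd[OF N(1)] by simp
    also have "\<dots> = FA H p' (d n')"
      using afD(6)[OF assms(3) q(1) transit_arr[OF s N(2)] assms(4)] tnd[OF N(2)] N(3) by simp
    finally show ?thesis using q(3) by simp
  qed
  let ?\<eta> = "\<lambda>A\<in>Obj T. \<lambda>x\<in>el F A. ?g A x"
  have eta: "?\<eta> A (FA F p (e n)) = FA H p (d n)" if p: "arr A (X n) p" for A n p
    using g[OF p] fa_closed[OF assms(1) p eF] arrD[OF p] by simp
  have "nat_trans T F H ?\<eta>"
  proof (rule nat_transI)
    fix A assume A: "A \<in> Obj T"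
    show "?\<eta> A \<in> hom (FO F A) (FO H A)"
    proof (rule homI)
      fix x assume "x \<in> el F A"
      then obtain n p where p: "arr A (X n) p" "x = FA F p (e n)" using colim_surj[OF assms(2) A] by blast
      show "?\<eta> A x \<in> el H A" unfolding p(2) eta[OF p(1)] by (rule fa_closed[OF assms(3) p(1) assms(4)])
    next
      fix x y assume x: "x \<in> el F A" and y: "y \<in> el F A"
      obtain n p where p: "arr A (X n) p" "x = FA F p (e n)" using colim_surj[OF assms(2) A x] by blast
      obtain m q where q: "arr A (X m) q" "y = FA F q (e m)" using colim_surj[OF assms(2) A y] by blast
      let ?M = "max n m"
      have M: "n \<le> ?M" "m \<le> ?M" by auto
      let ?p = "transit X f n ?M \<cdot> p" and ?q = "transit X f m ?M \<cdot> q"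
      have p': "arr A (X ?M) ?p" "x = FA F ?p (e ?M)"
        using arr_comp[OF p(1) transit_arr[OF s M(1)]] colim_push[OF assms(1,2) M(1) p(1)] p(2) by auto
      have q': "arr A (X ?M) ?q" "y = FA F ?q (e ?M)"
        using arr_comp[OF q(1) transit_arr[OF s M(2)]] colim_push[OF assms(1,2) M(2) q(1)] q(2) by auto
      have "?\<eta> A (x \<otimes>\<^bsub>FO F A\<^esub> y) = ?\<eta> A (FA F (add A (X ?M) ?p ?q) (e ?M))"
        using afD(7)[OF assms(1) p'(1) q'(1) eF] p'(2) q'(2) by simp
      also have "\<dots> = FA H (add A (X ?M) ?p ?q) (d ?M)" by (rule eta[OF arr_add[OF p'(1) q'(1)]])
      also have "\<dots> = FA H ?p (d ?M) \<otimes>\<^bsub>FO H A\<^esub> FA H ?q (d ?M)"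
        by (rule afD(7)[OF assms(3) p'(1) q'(1) assms(4)])
      also have "\<dots> = ?\<eta> A x \<otimes>\<^bsub>FO H A\<^esub> ?\<eta> A y"
        using eta[OF p'(1)] eta[OF q'(1)] p'(2) q'(2) by simp
      finally show "?\<eta> A (x \<otimes>\<^bsub>FO F A\<^esub> y) = ?\<eta> A x \<otimes>\<^bsub>FO H A\<^esub> ?\<eta> A y" .
    qed
    show "?\<eta> A \<in> extensional (el F A)" using A by simp
  next
    fix A B h x assume h: "arr A B h" and x: "x \<in> el F B"
    obtain n p where p: "arr B (X n) p" "x = FA F p (e n)" using colim_surj[OF assms(2) arrD(2)[OF h] x] by blast
    have "?\<eta> A (FA F h x) = ?\<eta> A (FA F (p \<cdot> h) (e n))" using afD(6)[OF assms(1) h p(1) eF] p(2) by simp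
    also have "\<dots> = FA H (p \<cdot> h) (d n)" by (rule eta[OF arr_comp[OF h p(1)]])
    also have "\<dots> = FA H h (?\<eta> B x)" using afD(6)[OF assms(3) h p(1) assms(4)] eta[OF p(1)] p(2) by simp
    finally show "?\<eta> A (FA F h x) = FA H h (?\<eta> B x)" .
  qed simp
  moreover have "?\<eta> (X n) (e n) = d n" for n
    using eta[OF arr_id[OF seqD(2)[OF s]], of n] afD(5)[OF assms(1) seqD(2)[OF s] eF]
      afD(5)[OF assms(3) seqD(2)[OF s] assms(4)] by simp
  ultimately show thesis using that[of ?\<eta>] eta by blast
qed

lemma colim_nt_apply:
  assumes "colim X f F e" "nat_trans T F H \<eta>" "arr A (X n) p"
  shows "\<eta> A (FA F p (e n)) = FA H p (\<eta> (X n) (e n))"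
  using ntD(5)[OF assms(2,3) colimD(2)[OF assms(1)]] .

lemma colim_nt_unique:
  assumes "colim X f F e" "nat_trans T F H \<eta>" "nat_trans T F H \<theta>" "\<And>n. \<eta> (X n) (e n) = \<theta> (X n) (e n)"
  shows "\<eta> = \<theta>"
proof (rule nt_eqI[OF assms(2,3)])
  fix A x assume "A \<in> Obj T" "x \<in> el F A"
  then obtain n p where p: "arr A (X n) p" "x = FA F p (e n)" using colim_surj[OF assms(1)] by blast
  show "\<eta> A x = \<theta> A x"
    using colim_nt_apply[OF assms(1,2) p(1)] colim_nt_apply[OF assms(1,3) p(1)] p(2) assms(4) by simp
qed

section \<open>The explicit model of a sequential colimit\<close>

definition germ :: "(nat \<Rightarrow> 'o) \<Rightarrow> (nat \<Rightarrow> 'm) \<Rightarrow> 'o \<Rightarrow> nat \<Rightarrow> 'm \<Rightarrow> (nat \<times> 'm) set"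
  where "germ X f A n p = {(m, q). arr A (X m) q \<and>
    (\<exists>N. n \<le> N \<and> m \<le> N \<and> transit X f n N \<cdot> p = transit X f m N \<cdot> q)}"

text \<open>Has to be an operation on arbitrary sets of pairs, so it collects the classes of sums
  over all representatives at a common stage; \<open>germ_mult_cls\<close> shows that they
  coincide.\<close>

definition germ_mult :: "(nat \<Rightarrow> 'o) \<Rightarrow> (nat \<Rightarrow> 'm) \<Rightarrow> 'o \<Rightarrow> (nat \<times> 'm) set \<Rightarrow> (nat \<times> 'm) set \<Rightarrow> (nat \<times> 'm) set"
  where "germ_mult X f A C C' = {r. \<exists>n p q. arr A (X n) p \<and> arr A (X n) q \<and>
    C = germ X f A n p \<and> C' = germ X f A n q \<and> r \<in> germ X f A n (add A (X n) p q)}"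

definition colim_model :: "(nat \<Rightarrow> 'o) \<Rightarrow> (nat \<Rightarrow> 'm) \<Rightarrow> ('o, 'm) modf"
  where "colim_model X f = \<lparr>
    FO = (\<lambda>A\<in>Obj T. \<lparr>carrier = {germ X f A n p |n p. arr A (X n) p},
      monoid.mult = germ_mult X f A, one = germ X f A 0 (zr A (X 0))\<rparr>),
    FA = (\<lambda>h\<in>Arr T. \<lambda>C. {r. \<exists>A B n p. arr A B h \<and> arr B (X n) p \<and> C = germ X f B n p \<and>
      r \<in> germ X f A n (p \<cdot> h)})\<rparr>"

lemma transit_raise:
  assumes "seq X f" "arr A (X n) p" "arr A (X m) q" "n \<le> N" "m \<le> N" "N \<le> P"
    "transit X f n N \<cdot> p = transit X f m N \<cdot> q"
  shows "transit X f n P \<cdot> p = transit X f m P \<cdot> q"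
  using comp_assoc[OF assms(2) transit_arr[OF assms(1,4)] transit_arr[OF assms(1,6)]] transit_comp[OF assms(1,4,6)]
    comp_assoc[OF assms(3) transit_arr[OF assms(1,5)] transit_arr[OF assms(1,6)]] transit_comp[OF assms(1,5,6)] assms(7)
  by simp

lemma germ_self: "seq X f \<Longrightarrow> arr A (X n) p \<Longrightarrow> (n, p) \<in> germ X f A n p"
  unfolding germ_def by blast

lemma germ_sub:
  assumes "seq X f" "arr A (X n) p" "arr A (X m) q" "n \<le> N" "m \<le> N" "transit X f n N \<cdot> p = transit X f m N \<cdot> q"
  shows "germ X f A n p \<subseteq> germ X f A m q"
proof
  fix r assume "r \<in> germ X f A n p"
  then obtain l s P where r: "r = (l, s)" "arr A (X l) s" "n \<le> P" "l \<le> P" "transit X f n P \<cdot> p = transit X f l P \<cdot> s"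
    unfolding germ_def by blast
  let ?M = "max N P"
  have M: "N \<le> ?M" "P \<le> ?M" by auto
  have "transit X f m ?M \<cdot> q = transit X f l ?M \<cdot> s"
    using transit_raise[OF assms(1-5) M(1) assms(6)] transit_raise[OF assms(1,2) r(2-4) M(2) r(5)] by simp
  moreover have "m \<le> ?M" "l \<le> ?M" using assms(5) r(4) by auto
  ultimately show "r \<in> germ X f A m q" using r(1,2) unfolding germ_def by blast
qed

lemma germ_eq_iff:
  assumes "seq X f" "arr A (X n) p" "arr A (X m) q"
  shows "germ X f A n p = germ X f A m q \<longleftrightarrow> (\<exists>N. n \<le> N \<and> m \<le> N \<and> transit X f n N \<cdot> p = transit X f m N \<cdot> q)"
proof
  assume "germ X f A n p = germ X f A m q"
  then have "(m, q) \<in> germ X f A n p" using germ_self[OF assms(1,3)] by simp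
  then show "\<exists>N. n \<le> N \<and> m \<le> N \<and> transit X f n N \<cdot> p = transit X f m N \<cdot> q" unfolding germ_def by blast
next
  assume "\<exists>N. n \<le> N \<and> m \<le> N \<and> transit X f n N \<cdot> p = transit X f m N \<cdot> q"
  then obtain N where N: "n \<le> N" "m \<le> N" "transit X f n N \<cdot> p = transit X f m N \<cdot> q" by blast
  show "germ X f A n p = germ X f A m q"
    using germ_sub[OF assms N] germ_sub[OF assms(1,3,2) N(2,1) N(3)[symmetric]] by (rule equalityI)
qed

lemma germ_push:
  assumes "seq X f" "arr A (X n) p" "n \<le> N"
  shows "germ X f A N (transit X f n N \<cdot> p) = germ X f A n p"
proof -
  have a: "arr A (X N) (transit X f n N \<cdot> p)" by (rule arr_comp[OF assms(2) transit_arr[OF assms(1,3)]])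
  have "transit X f N N \<cdot> (transit X f n N \<cdot> p) = transit X f n N \<cdot> p" using id_left[OF a] transit_refl[of X f N] by simp
  then show ?thesis using germ_eq_iff[OF assms(1) a assms(2)] assms(3) by blast
qed

lemma germ_mult_cls:
  assumes "seq X f" "arr A (X n) p" "arr A (X n) q"
  shows "germ_mult X f A (germ X f A n p) (germ X f A n q) = germ X f A n (add A (X n) p q)"
proof -
  have "germ X f A m (add A (X m) p' q') = germ X f A n (add A (X n) p q)"
    if a: "arr A (X m) p'" "arr A (X m) q'" "germ X f A n p = germ X f A m p'" "germ X f A n q = germ X f A m q'"
    for m p' q'
  proof -
    obtain N where N: "n \<le> N" "m \<le> N" "transit X f n N \<cdot> p = transit X f m N \<cdot> p'"
      using germ_eq_iff[OF assms(1,2) a(1)] a(3) by blast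
    obtain P where P: "n \<le> P" "m \<le> P" "transit X f n P \<cdot> q = transit X f m P \<cdot> q'"
      using germ_eq_iff[OF assms(1,3) a(2)] a(4) by blast
    let ?M = "max N P"
    have M: "N \<le> ?M" "P \<le> ?M" "n \<le> ?M" "m \<le> ?M" using N P by auto
    have 1: "transit X f n ?M \<cdot> p = transit X f m ?M \<cdot> p'" by (rule transit_raise[OF assms(1,2) a(1) N(1,2) M(1) N(3)])
    have 2: "transit X f n ?M \<cdot> q = transit X f m ?M \<cdot> q'" by (rule transit_raise[OF assms(1,3) a(2) P(1,2) M(2) P(3)])
    have "transit X f m ?M \<cdot> add A (X m) p' q' = transit X f n ?M \<cdot> add A (X n) p q"
      using comp_add_right[OF a(1,2) transit_arr[OF assms(1) M(4)]]
        comp_add_right[OF assms(2,3) transit_arr[OF assms(1) M(3)]] 1 2 by simp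
    then show ?thesis using germ_eq_iff[OF assms(1) arr_add[OF a(1,2)] arr_add[OF assms(2,3)]] M by blast
  qed
  then have sub: "germ_mult X f A (germ X f A n p) (germ X f A n q) \<subseteq> germ X f A n (add A (X n) p q)"
    unfolding germ_mult_def by blast
  have "germ X f A n (add A (X n) p q) \<subseteq> germ_mult X f A (germ X f A n p) (germ X f A n q)"
    unfolding germ_mult_def using assms by blast
  then show ?thesis using sub by blast
qed

lemma germ_zero:
  assumes "seq X f" "A \<in> Obj T"
  shows "germ X f A n (zr A (X n)) = germ X f A 0 (zr A (X 0))"
  using germ_push[OF assms(1) arr_zr[OF assms(2) seqD(2)[OF assms(1)]], of 0 n]
    comp_zr_right[OF transit_arr[OF assms(1), of 0 n] assms(2)] by simp

lemma colim_model_FO: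
  assumes "A \<in> Obj T"
  shows "el (colim_model X f) A = {germ X f A n p |n p. arr A (X n) p}"
    "monoid.mult (FO (colim_model X f) A) = germ_mult X f A" "un (colim_model X f) A = germ X f A 0 (zr A (X 0))"
  using assms by (simp_all add: colim_model_def)

lemma colim_model_el: "seq X f \<Longrightarrow> arr A (X n) p \<Longrightarrow> germ X f A n p \<in> el (colim_model X f) A"
  using colim_model_FO(1)[OF arrD(1)] by blast

lemma colim_model_un: "seq X f \<Longrightarrow> A \<in> Obj T \<Longrightarrow> un (colim_model X f) A = germ X f A n (zr A (X n))"
  using colim_model_FO(3)[of A X f] germ_zero[of X f A n] by simp

lemma colim_model_elE:
  assumes "x \<in> el (colim_model X f) A" "A \<in> Obj T"
  obtains n p where "arr A (X n) p" "x = germ X f A n p"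
proof -
  have "x \<in> {germ X f A n p |n p. arr A (X n) p}" using assms(1) unfolding colim_model_FO(1)[OF assms(2)] .
  then show thesis using that by blast
qed

lemma colim_model_common:
  assumes "seq X f" "A \<in> Obj T" "x \<in> el (colim_model X f) A" "y \<in> el (colim_model X f) A"
  obtains n p q where "arr A (X n) p" "arr A (X n) q" "x = germ X f A n p" "y = germ X f A n q"
proof -
  obtain n p where p: "arr A (X n) p" "x = germ X f A n p" using colim_model_elE[OF assms(3,2)] .
  obtain m q where q: "arr A (X m) q" "y = germ X f A m q" using colim_model_elE[OF assms(4,2)] .
  have M: "n \<le> max n m" "m \<le> max n m" by auto
  show thesis
    by (rule that[OF arr_comp[OF p(1) transit_arr[OF assms(1) M(1)]] arr_comp[OF q(1) transit_arr[OF assms(1) M(2)]]])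
      (use germ_push[OF assms(1) p(1) M(1)] germ_push[OF assms(1) q(1) M(2)] p q in simp_all)
qed

lemma colim_model_comm_group:
  assumes s: "seq X f" and A: "A \<in> Obj T"
  shows "comm_group (FO (colim_model X f) A)"
proof (rule comm_groupI)
  note mm = colim_model_FO(2)[OF A] germ_mult_cls[OF s]
  show "un (colim_model X f) A \<in> el (colim_model X f) A"
    unfolding colim_model_un[OF s A, of 0] by (rule colim_model_el[OF s arr_zr[OF A seqD(2)[OF s]]])
  fix x assume x: "x \<in> el (colim_model X f) A"
  obtain n p where p: "arr A (X n) p" "x = germ X f A n p" using colim_model_elE[OF x A] .
  note nn = arr_neg[OF p(1)]
  show "un (colim_model X f) A \<otimes>\<^bsub>FO (colim_model X f) A\<^esub> x = x"
    unfolding colim_model_un[OF s A, of n] p(2) mm(1) mm(2)[OF arr_zr[OF A seqD(2)[OF s]] p(1)]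
    using add_zr(2)[OF p(1)] by simp
  have "germ X f A n (neg A (X n) p) \<otimes>\<^bsub>FO (colim_model X f) A\<^esub> x = un (colim_model X f) A"
    unfolding p(2) mm(1) mm(2)[OF nn p(1)] colim_model_un[OF s A, of n]
    using add_neg[OF p(1)] add_comm[OF nn p(1)] by simp
  then show "\<exists>y\<in>el (colim_model X f) A. y \<otimes>\<^bsub>FO (colim_model X f) A\<^esub> x = un (colim_model X f) A"
    using colim_model_el[OF s nn] by blast
next
  note mm = colim_model_FO(2)[OF A] germ_mult_cls[OF s]
  fix x y assume xy: "x \<in> el (colim_model X f) A" "y \<in> el (colim_model X f) A"
  obtain n p q where p: "arr A (X n) p" "arr A (X n) q" "x = germ X f A n p" "y = germ X f A n q"
    using colim_model_common[OF s A xy] .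
  show "x \<otimes>\<^bsub>FO (colim_model X f) A\<^esub> y \<in> el (colim_model X f) A"
    unfolding p mm(1) mm(2)[OF p(1,2)] by (rule colim_model_el[OF s arr_add[OF p(1,2)]])
  show "x \<otimes>\<^bsub>FO (colim_model X f) A\<^esub> y = y \<otimes>\<^bsub>FO (colim_model X f) A\<^esub> x"
    unfolding p mm(1) mm(2)[OF p(1,2)] mm(2)[OF p(2,1)] using add_comm[OF p(1,2)] by simp
  fix z assume z: "z \<in> el (colim_model X f) A"
  obtain m r where r: "arr A (X m) r" "z = germ X f A m r" using colim_model_elE[OF z A] .
  let ?M = "max n m"
  have M: "n \<le> ?M" "m \<le> ?M" by auto
  let ?p = "transit X f n ?M \<cdot> p" and ?q = "transit X f n ?M \<cdot> q" and ?r = "transit X f m ?M \<cdot> r"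
  have a: "arr A (X ?M) ?p" "arr A (X ?M) ?q" "arr A (X ?M) ?r"
    using arr_comp[OF p(1) transit_arr[OF s M(1)]] arr_comp[OF p(2) transit_arr[OF s M(1)]]
      arr_comp[OF r(1) transit_arr[OF s M(2)]] .
  have e: "x = germ X f A ?M ?p" "y = germ X f A ?M ?q" "z = germ X f A ?M ?r"
    using germ_push[OF s p(1) M(1)] germ_push[OF s p(2) M(1)] germ_push[OF s r(1) M(2)] p r by simp_all
  interpret H: comm_group "hgrp T A (X ?M)" by (rule hom_comm_group[OF A seqD(2)[OF s]])
  have "add A (X ?M) (add A (X ?M) ?p ?q) ?r = add A (X ?M) ?p (add A (X ?M) ?q ?r)"
    by (rule H.m_assoc[OF arrD(3)[OF a(1)] arrD(3)[OF a(2)] arrD(3)[OF a(3)]])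
  then show "x \<otimes>\<^bsub>FO (colim_model X f) A\<^esub> y \<otimes>\<^bsub>FO (colim_model X f) A\<^esub> z =
    x \<otimes>\<^bsub>FO (colim_model X f) A\<^esub> (y \<otimes>\<^bsub>FO (colim_model X f) A\<^esub> z)"
    unfolding e mm(1) mm(2)[OF a(1,2)] mm(2)[OF a(2,3)] mm(2)[OF arr_add[OF a(1,2)] a(3)]
      mm(2)[OF a(1) arr_add[OF a(2,3)]] by simp
qed

lemma colim_model_FA:
  assumes s: "seq X f" and h: "arr A B h" and p: "arr B (X n) p"
  shows "FA (colim_model X f) h (germ X f B n p) = germ X f A n (p \<cdot> h)"
proof -
  have "germ X f A' m (p' \<cdot> h) = germ X f A n (p \<cdot> h)"
    if a: "arr A' B' h" "arr B' (X m) p'" "germ X f B n p = germ X f B' m p'" for A' B' m p'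
  proof -
    \<comment> \<open>The action in the model quantifies over source and target of \<open>h\<close>;
      morphism sets are disjoint, so these can only be \<open>A\<close> and
      \<open>B\<close>.\<close>
    have AB: "A' = A" "B' = B" using arr_unique[OF a(1) h] by auto
    note q = a(2)[unfolded AB] and e = a(3)[unfolded AB]
    obtain N where N: "n \<le> N" "m \<le> N" "transit X f n N \<cdot> p = transit X f m N \<cdot> p'"
      using germ_eq_iff[OF s p q] e by blast
    have "transit X f m N \<cdot> (p' \<cdot> h) = transit X f n N \<cdot> (p \<cdot> h)"
      using comp_assoc[OF h p transit_arr[OF s N(1)]] comp_assoc[OF h q transit_arr[OF s N(2)]] N(3) by simp
    then show ?thesis using germ_eq_iff[OF s arr_comp[OF h q] arr_comp[OF h p]] N AB by blast
  qed
  then have "{r. \<exists>A' B' m p'. arr A' B' h \<and> arr B' (X m) p' \<and> germ X f B n p = germ X f B' m p' \<and>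
      r \<in> germ X f A' m (p' \<cdot> h)} = germ X f A n (p \<cdot> h)" using h p by blast
  then show ?thesis using arr_Arr[OF h] by (simp add: colim_model_def)
qed

lemma colim_model_additive:
  assumes s: "seq X f" shows "additive_functor T (colim_model X f)"
proof (rule additive_functorI)
  show "FO (colim_model X f) \<in> extensional (Obj T)" "FA (colim_model X f) \<in> extensional (Arr T)"
    by (simp_all add: colim_model_def)
  show "\<And>A. A \<in> Obj T \<Longrightarrow> comm_group (FO (colim_model X f) A)" by (rule colim_model_comm_group[OF s])
next
  fix A B h assume h: "arr A B h"
  note o = arrD[OF h]
  show "FA (colim_model X f) h \<in> hom (FO (colim_model X f) B) (FO (colim_model X f) A)"
  proof (rule homI)
    fix x assume "x \<in> el (colim_model X f) B"
    then obtain n p where p: "arr B (X n) p" "x = germ X f B n p" using colim_model_elE o(2) by blast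
    show "FA (colim_model X f) h x \<in> el (colim_model X f) A"
      unfolding p(2) colim_model_FA[OF s h p(1)] by (rule colim_model_el[OF s arr_comp[OF h p(1)]])
  next
    fix x y assume "x \<in> el (colim_model X f) B" "y \<in> el (colim_model X f) B"
    then obtain n p q where p: "arr B (X n) p" "arr B (X n) q" "x = germ X f B n p" "y = germ X f B n q"
      by (rule colim_model_common[OF s o(2)])
    show "FA (colim_model X f) h (x \<otimes>\<^bsub>FO (colim_model X f) B\<^esub> y) =
      FA (colim_model X f) h x \<otimes>\<^bsub>FO (colim_model X f) A\<^esub> FA (colim_model X f) h y"
      unfolding p(3,4) colim_model_FO(2)[OF o(1)] colim_model_FO(2)[OF o(2)] germ_mult_cls[OF s p(1,2)]
        colim_model_FA[OF s h p(1)] colim_model_FA[OF s h p(2)] colim_model_FA[OF s h arr_add[OF p(1,2)]]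
        germ_mult_cls[OF s arr_comp[OF h p(1)] arr_comp[OF h p(2)]]
      using comp_add_left[OF h p(1,2)] by simp
  qed
next
  fix A x assume A: "A \<in> Obj T" and "x \<in> el (colim_model X f) A"
  then obtain n p where p: "arr A (X n) p" "x = germ X f A n p" using colim_model_elE by blast
  show "FA (colim_model X f) (idn T A) x = x"
    unfolding p(2) colim_model_FA[OF s arr_id[OF A] p(1)] using id_right[OF p(1)] by simp
next
  fix A B C h g x assume h: "arr A B h" and g: "arr B C g" and "x \<in> el (colim_model X f) C"
  then obtain n p where p: "arr C (X n) p" "x = germ X f C n p" using colim_model_elE arrD by blast
  show "FA (colim_model X f) (g \<cdot> h) x = FA (colim_model X f) h (FA (colim_model X f) g x)"
    unfolding p(2) colim_model_FA[OF s g p(1)] colim_model_FA[OF s h arr_comp[OF g p(1)]]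
      colim_model_FA[OF s arr_comp[OF h g] p(1)] using comp_assoc[OF h g p(1)] by simp
next
  fix A B h g x assume h: "arr A B h" and g: "arr A B g" and "x \<in> el (colim_model X f) B"
  then obtain n p where p: "arr B (X n) p" "x = germ X f B n p" using colim_model_elE arrD by blast
  show "FA (colim_model X f) (add A B h g) x = FA (colim_model X f) h x \<otimes>\<^bsub>FO (colim_model X f) A\<^esub> FA (colim_model X f) g x"
    unfolding p(2) colim_model_FO(2)[OF arrD(1)[OF h]] colim_model_FA[OF s h p(1)] colim_model_FA[OF s g p(1)]
      colim_model_FA[OF s arr_add[OF h g] p(1)] germ_mult_cls[OF s arr_comp[OF h p(1)] arr_comp[OF g p(1)]]
    using comp_add_right[OF h g p(1)] by simp
qed

lemma colim_model_exists:
  assumes s: "seq X f"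
  obtains F :: "('o, 'm) modf" and e where "additive_functor T F" "colim X f F e"
proof -
  define e where "e n = germ X f (X n) n (idn T (X n))" for n
  note o = seqD(2)[OF s]
  have E: "FA (colim_model X f) p (e n) = germ X f A n p" if "arr A (X n) p" for A n p
    unfolding e_def colim_model_FA[OF s that arr_id[OF o]] using id_left[OF that] by simp
  have "colim X f (colim_model X f) e"
    unfolding colim_def
  proof (intro conjI allI ballI impI s)
    fix n show "e n \<in> el (colim_model X f) (X n)" unfolding e_def by (rule colim_model_el[OF s arr_id[OF o]])
    have "FA (colim_model X f) (f (Suc n)) (e (Suc n)) = germ X f (X n) (Suc n) (f (Suc n))"
      by (rule E[OF seqD(1)[OF s]])
    also have "\<dots> = e n"
      using germ_push[OF s arr_id[OF o], of n "Suc n"] transit_refl[of X f n] id_right[OF seqD(1)[OF s]]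
        id_right[OF transit_arr[OF s, of n "Suc n"]]
      unfolding e_def by simp
    finally show "FA (colim_model X f) (f (Suc n)) (e (Suc n)) = e n" .
  next
    fix A x assume A: "A \<in> Obj T" and x: "x \<in> el (colim_model X f) A"
    obtain n p where "arr A (X n) p" "x = germ X f A n p" using colim_model_elE[OF x A] .
    then show "\<exists>n p. arr A (X n) p \<and> x = FA (colim_model X f) p (e n)" using E by metis
  next
    fix A n p assume a: "arr A (X n) p \<and> FA (colim_model X f) p (e n) = un (colim_model X f) A"
    then have p: "arr A (X n) p" by blast
    note A = arrD(1)[OF p]
    have "germ X f A n p = germ X f A n (zr A (X n))" using a E[OF p] colim_model_un[OF s A] by simp
    then obtain N where N: "n \<le> N" "transit X f n N \<cdot> p = transit X f n N \<cdot> zr A (X n)"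
      using germ_eq_iff[OF s p arr_zr[OF A o]] by blast
    then have "transit X f n N \<cdot> p = zr A (X N)" using comp_zr_right[OF transit_arr[OF s N(1)] A] by simp
    then show "\<exists>N\<ge>n. transit X f n N \<cdot> p = zr A (X N)" using N(1) by blast
  qed
  then show thesis by (rule that[OF colim_model_additive[OF s]])
qed

section \<open>Colimits by elements and colimits by universal property\<close>

lemma colim_yoneda_colimit:
  assumes F: "additive_functor T F" and c: "colim X f F e"
  shows "yoneda_colimit T X f F (\<lambda>n. yoneda_map (X n) F (e n))"
  unfolding yoneda_colimit_def
proof (intro conjI allI impI F)
  note s = colimD(1)[OF c] and o = seqD(2)[OF colimD(1)[OF c]] and eF = colimD(2)[OF c]
  have ap: "yoneda_map (X n) F (e n) A p = FA F p (e n)" if "arr A (X n) p" for A n p by (rule yoneda_map_apply[OF that])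
  show "yoneda_cocone T X f F (\<lambda>n. yoneda_map (X n) F (e n))"
    unfolding yoneda_cocone_def
  proof (intro conjI allI ballI)
    show "nat_trans T (yoneda T (X n)) F (yoneda_map (X n) F (e n))" for n by (rule yoneda_map_nat_trans[OF F o eF])
    fix n A p assume "A \<in> Obj T" "p \<in> Hom T A (X n)"
    then have p: "arr A (X n) p" using o by (simp add: arr_def)
    show "yoneda_map (X (Suc n)) F (e (Suc n)) A (f (Suc n) \<cdot> p) = yoneda_map (X n) F (e n) A p"
      unfolding ap[OF p] ap[OF arr_comp[OF p seqD(1)[OF s]]]
      using afD(6)[OF F p seqD(1)[OF s] eF] colimD(3)[OF c] by simp
  qed
  fix H :: "('o, 'm, 'c) cfun" and d
  assume Hd: "additive_functor T H \<and> yoneda_cocone T X f H d"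
  then have H: "additive_functor T H" and dn: "\<And>n. nat_trans T (yoneda T (X n)) H (d n)"
    and dc: "\<And>n A p. A \<in> Obj T \<Longrightarrow> p \<in> Hom T A (X n) \<Longrightarrow> d (Suc n) A (f (Suc n) \<cdot> p) = d n A p"
    unfolding yoneda_cocone_def by blast+
  define d' where "d' n = d n (X n) (idn T (X n))" for n
  have d'H: "d' n \<in> el H (X n)" for n unfolding d'_def by (rule yoneda_lemma(1)[OF dn o])
  have dd: "d n A p = FA H p (d' n)" if "arr A (X n) p" for n A p
    unfolding d'_def by (rule yoneda_lemma(2)[OF dn o that])
  have d'c: "FA H (f (Suc n)) (d' (Suc n)) = d' n" for n
    using dc[OF o idn_closed[OF o], of n] dd[OF seqD(1)[OF s], of n] id_right[OF seqD(1)[OF s], of n]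
    unfolding d'_def by simp
  obtain \<eta> where \<eta>: "nat_trans T F H \<eta>" "\<And>n. \<eta> (X n) (e n) = d' n"
    "\<And>n A p. arr A (X n) p \<Longrightarrow> \<eta> A (FA F p (e n)) = FA H p (d' n)"
    using colim_universal[where d = d', OF F c H d'H d'c] by blast
  show "\<exists>!\<theta>. nat_trans T F H \<theta> \<and>
        (\<forall>n. \<forall>A\<in>Obj T. \<forall>p\<in>Hom T A (X n). \<theta> A (yoneda_map (X n) F (e n) A p) = d n A p)"
  proof (rule ex1I[of _ \<eta>])
    show "nat_trans T F H \<eta> \<and>
        (\<forall>n. \<forall>A\<in>Obj T. \<forall>p\<in>Hom T A (X n). \<eta> A (yoneda_map (X n) F (e n) A p) = d n A p)"
    proof (intro conjI allI ballI \<eta>(1))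
      fix n A p assume "A \<in> Obj T" "p \<in> Hom T A (X n)"
      then have p: "arr A (X n) p" using o by (simp add: arr_def)
      show "\<eta> A (yoneda_map (X n) F (e n) A p) = d n A p" unfolding ap[OF p] dd[OF p] by (rule \<eta>(3)[OF p])
    qed
    fix \<theta> assume t: "nat_trans T F H \<theta> \<and>
        (\<forall>n. \<forall>A\<in>Obj T. \<forall>p\<in>Hom T A (X n). \<theta> A (yoneda_map (X n) F (e n) A p) = d n A p)"
    show "\<theta> = \<eta>"
    proof (rule colim_nt_unique[OF c conjunct1[OF t] \<eta>(1)])
      fix n
      have "\<theta> (X n) (yoneda_map (X n) F (e n) (X n) (idn T (X n))) = d n (X n) (idn T (X n))"
        using t o idn_closed[OF o] by blast
      then show "\<theta> (X n) (e n) = \<eta> (X n) (e n)"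
        unfolding ap[OF arr_id[OF o]] afD(5)[OF F o eF] \<eta>(2) d'_def .
    qed
  qed
qed

definition id_nt :: "('o, 'm, 'v) cfun \<Rightarrow> 'o \<Rightarrow> 'v \<Rightarrow> 'v"
  where "id_nt F = (\<lambda>A\<in>Obj T. \<lambda>x\<in>el F A. x)"

definition comp_nt :: "('o, 'm, 'v) cfun \<Rightarrow> ('o \<Rightarrow> 'v2 \<Rightarrow> 'v3) \<Rightarrow> ('o \<Rightarrow> 'v \<Rightarrow> 'v2) \<Rightarrow> 'o \<Rightarrow> 'v \<Rightarrow> 'v3"
  where "comp_nt F \<theta> \<eta> = (\<lambda>A\<in>Obj T. \<lambda>x\<in>el F A. \<theta> A (\<eta> A x))"

lemma id_nt_apply [simp]: "A \<in> Obj T \<Longrightarrow> x \<in> el F A \<Longrightarrow> id_nt F A x = x"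
  by (simp add: id_nt_def)

lemma comp_nt_apply [simp]: "A \<in> Obj T \<Longrightarrow> x \<in> el F A \<Longrightarrow> comp_nt F \<theta> \<eta> A x = \<theta> A (\<eta> A x)"
  by (simp add: comp_nt_def)

lemma id_nt: 
  assumes "additive_functor T F" shows "nat_trans T F F (id_nt F)"
proof (rule nat_transI)
  fix A assume A: "A \<in> Obj T"
  show "id_nt F A \<in> extensional (el F A)" using A by (simp add: id_nt_def)
  show "id_nt F A \<in> hom (FO F A) (FO F A)"
    using A monoid.m_closed[OF group.is_monoid[OF el_group[OF assms A]]] by (intro homI) simp_all
next
  fix A B f x assume f: "arr A B f" "x \<in> el F B"
  show "id_nt F A (FA F f x) = FA F f (id_nt F B x)"
    using f fa_closed[OF assms f] arrD[OF f(1)] by simp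
qed (simp add: id_nt_def)

lemma comp_nt:
  assumes "additive_functor T F" "nat_trans T F G \<eta>" "nat_trans T G H \<theta>"
  shows "nat_trans T F H (comp_nt F \<theta> \<eta>)"
proof (rule nat_transI)
  fix A assume A: "A \<in> Obj T"
  show "comp_nt F \<theta> \<eta> A \<in> extensional (el F A)" using A by (simp add: comp_nt_def)
  have m: "\<And>x y. x \<in> el F A \<Longrightarrow> y \<in> el F A \<Longrightarrow> x \<otimes>\<^bsub>FO F A\<^esub> y \<in> el F A"
    by (rule monoid.m_closed[OF group.is_monoid[OF el_group[OF assms(1) A]]])
  show "comp_nt F \<theta> \<eta> A \<in> hom (FO F A) (FO H A)"
  proof (rule homI)
    fix x assume x: "x \<in> el F A"
    show "comp_nt F \<theta> \<eta> A x \<in> el H A"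
      using A x ntD(4)[OF assms(3) A ntD(4)[OF assms(2) A x]] by simp
    fix y assume y: "y \<in> el F A"
    show "comp_nt F \<theta> \<eta> A (x \<otimes>\<^bsub>FO F A\<^esub> y) = comp_nt F \<theta> \<eta> A x \<otimes>\<^bsub>FO H A\<^esub> comp_nt F \<theta> \<eta> A y"
      using A x y m[OF x y] hom_mult[OF ntD(2)[OF assms(2) A] x y]
        hom_mult[OF ntD(2)[OF assms(3) A] ntD(4)[OF assms(2) A x] ntD(4)[OF assms(2) A y]] by simp
  qed
next
  fix A B f x assume f: "arr A B f" "x \<in> el F B"
  show "comp_nt F \<theta> \<eta> A (FA F f x) = FA H f (comp_nt F \<theta> \<eta> B x)"
    using f fa_closed[OF assms(1) f] arrD[OF f(1)] ntD(5)[OF assms(2) f]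
      ntD(5)[OF assms(3) f(1) ntD(4)[OF assms(2) arrD(2)[OF f(1)] f(2)]] by simp
qed (simp add: comp_nt_def)

lemma colim_transport:
  assumes c: "colim X f F e" and n: "nat_trans T F G \<eta>"
    and F: "additive_functor T F" and G: "additive_functor T G"
    and b: "\<And>A. A \<in> Obj T \<Longrightarrow> bij_betw (\<eta> A) (el F A) (el G A)"
  shows "colim X f G (\<lambda>n. \<eta> (X n) (e n))"
  unfolding colim_def
proof (intro conjI allI ballI impI colimD(1)[OF c])
  note s = colimD(1)[OF c] and o = seqD(2)[OF colimD(1)[OF c]] and eF = colimD(2)[OF c]
  fix m show "\<eta> (X m) (e m) \<in> el G (X m)" by (rule ntD(4)[OF n o eF])
  show "FA G (f (Suc m)) (\<eta> (X (Suc m)) (e (Suc m))) = \<eta> (X m) (e m)"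
    using ntD(5)[OF n seqD(1)[OF s, of m] eF[of "Suc m"]] colimD(3)[OF c, of m] by metis
next
  fix A y assume A: "A \<in> Obj T" and y: "y \<in> el G A"
  then obtain x where x: "x \<in> el F A" "y = \<eta> A x" using b[OF A] unfolding bij_betw_def by blast
  obtain m p where p: "arr A (X m) p" "x = FA F p (e m)" using colim_surj[OF c A x(1)] .
  show "\<exists>n p. arr A (X n) p \<and> y = FA G p (\<eta> (X n) (e n))"
    using p x colim_nt_apply[OF c n p(1)] by blast
next
  fix A m p assume a: "arr A (X m) p \<and> FA G p (\<eta> (X m) (e m)) = un G A"
  then have p: "arr A (X m) p" by blast
  note A = arrD(1)[OF p]
  have "\<eta> A (FA F p (e m)) = \<eta> A (un F A)"
    using a colim_nt_apply[OF c n p] nt_un[OF n F G A] by simp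
  then have "FA F p (e m) = un F A"
    using b[OF A] fa_closed[OF F p colimD(2)[OF c]] un_el[OF F A] unfolding bij_betw_def inj_on_def by blast
  then show "\<exists>N\<ge>m. transit X f m N \<cdot> p = zr A (X N)" using colim_inj[OF c p] by blast
qed

text \<open>The universal property is tested against the explicit model, which is available as a
  test object because \<open>F\<close> is a \<open>modf\<close> and so has the same value type. The
  resulting isomorphism transports the description by elements to \<open>F\<close>.\<close>

lemma yoneda_colimit_colim:
  fixes F :: "('o, 'm) modf"
  assumes yc: "yoneda_colimit T X f F c" and s: "seq X f"
  shows "colim X f F (\<lambda>n. c n (X n) (idn T (X n)))"
proof -
  note o = seqD(2)[OF s]
  have F: "additive_functor T F" and cc: "yoneda_cocone T X f F c"
    using yc unfolding yoneda_colimit_def by blast+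
  have cn: "nat_trans T (yoneda T (X n)) F (c n)" for n using cc unfolding yoneda_cocone_def by blast
  obtain M e where M: "additive_functor T M" "colim X f (M :: ('o, 'm) modf) e" using colim_model_exists[OF s] .
  let ?k = "\<lambda>n. yoneda_map (X n) M (e n)"
  have y0: "yoneda_colimit T X f M ?k" by (rule colim_yoneda_colimit[OF M])
  have cm: "yoneda_cocone T X f M ?k" using y0 unfolding yoneda_colimit_def by blast
  have u1: "\<exists>!\<theta>. nat_trans T F H \<theta> \<and>
        (\<forall>n. \<forall>A\<in>Obj T. \<forall>p\<in>Hom T A (X n). \<theta> A (c n A p) = d n A p)"
    if "additive_functor T H" "yoneda_cocone T X f H d" for H :: "('o, 'm) modf" and d
    using yc that unfolding yoneda_colimit_def by blast
  have u2: "\<exists>!\<theta>. nat_trans T M H \<theta> \<and>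
        (\<forall>n. \<forall>A\<in>Obj T. \<forall>p\<in>Hom T A (X n). \<theta> A (?k n A p) = d n A p)"
    if "additive_functor T H" "yoneda_cocone T X f H d" for H :: "('o, 'm) modf" and d
    using y0 that unfolding yoneda_colimit_def by blast
  obtain \<theta> where t: "nat_trans T F M \<theta>"
    "\<And>n A p. A \<in> Obj T \<Longrightarrow> p \<in> Hom T A (X n) \<Longrightarrow> \<theta> A (c n A p) = ?k n A p"
    using u1[OF M(1) cm] by blast
  obtain \<theta>' where t': "nat_trans T M F \<theta>'"
    "\<And>n A p. A \<in> Obj T \<Longrightarrow> p \<in> Hom T A (X n) \<Longrightarrow> \<theta>' A (?k n A p) = c n A p"
    using u2[OF F cc] by blast
  have cel: "c n A p \<in> el F A" if "A \<in> Obj T" "p \<in> Hom T A (X n)" for n A p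
    using ntD(4)[OF cn that(1)] that by (simp add: yoneda_simps)
  have kel: "?k n A p \<in> el M A" if "A \<in> Obj T" "p \<in> Hom T A (X n)" for n A p
    using ntD(4)[OF yoneda_map_nat_trans[OF M(1) o colimD(2)[OF M(2)]] that(1)] that by (simp add: yoneda_simps)
  have "comp_nt F \<theta>' \<theta> = id_nt F"
  proof -
    \<comment> \<open>Both sides are endomorphisms compatible with the cocone, and the universal
      property admits only one such.\<close>
    define P where "P \<psi> \<longleftrightarrow> nat_trans T F F \<psi> \<and>
        (\<forall>n. \<forall>A\<in>Obj T. \<forall>p\<in>Hom T A (X n). \<psi> A (c n A p) = c n A p)" for \<psi>
    have "nat_trans T F F (comp_nt F \<theta>' \<theta>)" "nat_trans T F F (id_nt F)"
      using comp_nt[OF F t(1) t'(1)] id_nt[OF F] .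
    moreover have "comp_nt F \<theta>' \<theta> A (c n A p) = c n A p" "id_nt F A (c n A p) = c n A p"
      if "A \<in> Obj T" "p \<in> Hom T A (X n)" for n A p
      using that cel[OF that] t(2)[OF that] t'(2)[OF that] by simp_all
    ultimately have P: "P (comp_nt F \<theta>' \<theta>)" "P (id_nt F)" unfolding P_def by simp_all
    have "\<exists>!\<theta>. P \<theta>" unfolding P_def by (rule u1[OF F cc])
    then show ?thesis using P by blast
  qed
  then have 1: "\<theta>' A (\<theta> A x) = x" if "A \<in> Obj T" "x \<in> el F A" for A x
    using comp_nt_apply[OF that, of \<theta>' \<theta>] id_nt_apply[OF that] by simp
  have "comp_nt M \<theta> \<theta>' = id_nt M"
  proof -
    define P where "P \<psi> \<longleftrightarrow> nat_trans T M M \<psi> \<and>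
        (\<forall>n. \<forall>A\<in>Obj T. \<forall>p\<in>Hom T A (X n). \<psi> A (?k n A p) = ?k n A p)" for \<psi>
    have "nat_trans T M M (comp_nt M \<theta> \<theta>')" "nat_trans T M M (id_nt M)"
      using comp_nt[OF M(1) t'(1) t(1)] id_nt[OF M(1)] .
    moreover have "comp_nt M \<theta> \<theta>' A (?k n A p) = ?k n A p" "id_nt M A (?k n A p) = ?k n A p"
      if "A \<in> Obj T" "p \<in> Hom T A (X n)" for n A p
      using that kel[OF that] t(2)[OF that] t'(2)[OF that] by simp_all
    ultimately have P: "P (comp_nt M \<theta> \<theta>')" "P (id_nt M)" unfolding P_def by simp_all
    have "\<exists>!\<theta>. P \<theta>" unfolding P_def by (rule u2[OF M(1) cm])
    then show ?thesis using P by blast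
  qed
  then have 2: "\<theta> A (\<theta>' A x) = x" if "A \<in> Obj T" "x \<in> el M A" for A x
    using comp_nt_apply[OF that, of \<theta> \<theta>'] id_nt_apply[OF that] by simp
  have "bij_betw (\<theta>' A) (el M A) (el F A)" if A: "A \<in> Obj T" for A
    by (rule bij_betw_byWitness[where f' = "\<theta> A"])
      (use 1[OF A] 2[OF A] ntD(4)[OF t(1) A] ntD(4)[OF t'(1) A] in blast)+
  then have "colim X f F (\<lambda>n. \<theta>' (X n) (e n))" by (rule colim_transport[OF M(2) t'(1) M(1) F])
  moreover have "\<theta>' (X n) (e n) = c n (X n) (idn T (X n))" for n
    using t'(2)[OF o idn_closed[OF o], of n] yoneda_map_apply[OF arr_id[OF o], of n M "e n"]
      afD(5)[OF M(1) o colimD(2)[OF M(2)], of n] by simp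
  ultimately show ?thesis by simp
qed

section \<open>The shift of an additive functor\<close>

lemma shpow_m1: assumes "A \<in> Obj T" shows "shpow T (- 1) A = unsh A"
proof (rule sh_inj)
  show "sh T (shpow T (- 1) A) = sh T (unsh A)"
    using shpow_suc[OF assms, of "- 1"] unsh(2)[OF assms] by simp
qed (use assms unsh(1) in simp_all)

lemma shm_inj_Arr:
  assumes "arr A B f" "arr A' B' g" "shm T f = shm T g" shows "f = g"
proof -
  have "arr (sh T A) (sh T B) (shm T f)" "arr (sh T A') (sh T B') (shm T f)"
    using shm_arr[OF assms(1)] shm_arr[OF assms(2)] assms(3) by simp_all
  then have "sh T A = sh T A'" "sh T B = sh T B'" using arr_unique by blast+
  then have "A = A'" "B = B'" using sh_inj arrD[OF assms(1)] arrD[OF assms(2)] by blast+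
  then show ?thesis using shm_inj assms by blast
qed

lemma shm_inv_shm: assumes "arr A B g" shows "shm_inv T (shm T g) = g"
proof -
  have "inj_on (shm T) (Arr T)"
  proof (rule inj_onI)
    fix x y assume "x \<in> Arr T" "y \<in> Arr T" and e: "shm T x = shm T y"
    then obtain A B A' B' where "arr A B x" "arr A' B' y" using Arr_arr by blast
    then show "x = y" using shm_inj_Arr e by blast
  qed
  then show ?thesis unfolding shm_inv_def by (rule inv_into_f_f[OF _ arr_Arr[OF assms]])
qed

lemma shm_inv:
  assumes "arr A B f" shows "arr (unsh A) (unsh B) (shm_inv T f)" "shm T (shm_inv T f) = f"
proof -
  note o = arrD[OF assms]
  have "arr (sh T (unsh A)) (sh T (unsh B)) f" using assms unsh(2) o by simp
  then obtain g where g: "arr (unsh A) (unsh B) g" "shm T g = f" using shm_surj unsh(1) o by blast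
  then show "arr (unsh A) (unsh B) (shm_inv T f)" "shm T (shm_inv T f) = f"
    using shm_inv_shm[OF g(1)] by simp_all
qed

lemma shm_inv_comp:
  assumes "arr A B f" "arr B C g" shows "shm_inv T (g \<cdot> f) = shm_inv T g \<cdot> shm_inv T f"
proof (rule shm_inj)
  show "arr (unsh A) (unsh C) (shm_inv T (g \<cdot> f))" by (rule shm_inv(1)[OF arr_comp[OF assms]])
  show "arr (unsh A) (unsh C) (shm_inv T g \<cdot> shm_inv T f)"
    by (rule arr_comp[OF shm_inv(1)[OF assms(1)] shm_inv(1)[OF assms(2)]])
  show "shm T (shm_inv T (g \<cdot> f)) = shm T (shm_inv T g \<cdot> shm_inv T f)"
    using shm_inv(2)[OF arr_comp[OF assms]] shm_inv(2)[OF assms(1)] shm_inv(2)[OF assms(2)]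
      shm_comp[OF shm_inv(1)[OF assms(1)] shm_inv(1)[OF assms(2)]] by simp
qed

lemma shm_inv_idn:
  assumes "A \<in> Obj T" shows "shm_inv T (idn T A) = idn T (unsh A)"
  using shm_inv_shm[OF arr_id[OF unsh(1)[OF assms]]] shm_idn[OF unsh(1)[OF assms]] unsh(2)[OF assms] by simp

lemma shm_inv_add:
  assumes "arr A B f" "arr A B g"
  shows "shm_inv T (add A B f g) = add (unsh A) (unsh B) (shm_inv T f) (shm_inv T g)"
proof -
  note o = unsh(1,2)[OF arrD(1)[OF assms(1)]] unsh(1,2)[OF arrD(2)[OF assms(1)]]
  note i = shm_inv[OF assms(1)] shm_inv[OF assms(2)]
  have "shm T (add (unsh A) (unsh B) (shm_inv T f) (shm_inv T g)) = add A B f g"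
    using hom_mult[OF shm_add[OF o(1,3)] arrD(3)[OF i(1)] arrD(3)[OF i(3)]] i o by simp
  then show ?thesis using shm_inv_shm[OF arr_add[OF i(1,3)]] by simp
qed

lemma sh_functor_simps:
  "A \<in> Obj T \<Longrightarrow> FO (sh_functor T F) A = FO F (unsh A)"
  "arr A B f \<Longrightarrow> FA (sh_functor T F) f = FA F (shm_inv T f)"
  by (simp_all add: sh_functor_def shpow_m1 arr_Arr)

lemma sh_functor_additive:
  assumes F: "additive_functor T F" shows "additive_functor T (sh_functor T F)"
proof (rule additive_functorI)
  show "FO (sh_functor T F) \<in> extensional (Obj T)" "FA (sh_functor T F) \<in> extensional (Arr T)"
    by (simp_all add: sh_functor_def)
next
  fix A assume A: "A \<in> Obj T"
  show "comm_group (FO (sh_functor T F) A)"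
    unfolding sh_functor_simps(1)[OF A] by (rule afD(3)[OF F unsh(1)[OF A]])
next
  fix A B f assume f: "arr A B f"
  show "FA (sh_functor T F) f \<in> hom (FO (sh_functor T F) B) (FO (sh_functor T F) A)"
    unfolding sh_functor_simps(1)[OF arrD(1)[OF f]] sh_functor_simps(1)[OF arrD(2)[OF f]]
      sh_functor_simps(2)[OF f] by (rule afD(4)[OF F shm_inv(1)[OF f]])
next
  fix A x assume A: "A \<in> Obj T" and x: "x \<in> el (sh_functor T F) A"
  show "FA (sh_functor T F) (idn T A) x = x"
    unfolding sh_functor_simps(2)[OF arr_id[OF A]] shm_inv_idn[OF A]
    by (rule afD(5)[OF F unsh(1)[OF A] x[unfolded sh_functor_simps(1)[OF A]]])
next
  fix A B C f g x assume f: "arr A B f" "arr B C g" and x: "x \<in> el (sh_functor T F) C"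
  show "FA (sh_functor T F) (g \<cdot> f) x = FA (sh_functor T F) f (FA (sh_functor T F) g x)"
    unfolding sh_functor_simps(2)[OF arr_comp[OF f]] sh_functor_simps(2)[OF f(1)]
      sh_functor_simps(2)[OF f(2)] shm_inv_comp[OF f]
    by (rule afD(6)[OF F shm_inv(1)[OF f(1)] shm_inv(1)[OF f(2)]
          x[unfolded sh_functor_simps(1)[OF arrD(2)[OF f(2)]]]])
next
  fix A B f g x assume f: "arr A B f" "arr A B g" and x: "x \<in> el (sh_functor T F) B"
  show "FA (sh_functor T F) (add A B f g) x =
    FA (sh_functor T F) f x \<otimes>\<^bsub>FO (sh_functor T F) A\<^esub> FA (sh_functor T F) g x"
    unfolding sh_functor_simps(2)[OF arr_add[OF f]] sh_functor_simps(2)[OF f(1)]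
      sh_functor_simps(2)[OF f(2)] shm_inv_add[OF f] sh_functor_simps(1)[OF arrD(1)[OF f(1)]]
    by (rule afD(7)[OF F shm_inv(1)[OF f(1)] shm_inv(1)[OF f(2)]
          x[unfolded sh_functor_simps(1)[OF arrD(2)[OF f(2)]]]])
qed

lemma seq_sh: "seq X f \<Longrightarrow> seq (\<lambda>n. sh T (X n)) (\<lambda>n. shm T (f n))"
  unfolding seq_def using shm_arr by blast

lemma transit_sh:
  assumes s: "seq X f"
  shows "n \<le> N \<Longrightarrow> transit (\<lambda>n. sh T (X n)) (\<lambda>n. shm T (f n)) n N = shm T (transit X f n N)"
proof (induction N)
  case 0
  then show ?case using shm_idn seqD(2)[OF s] by simp
next
  case (Suc N)
  then show ?case
    using shm_comp[OF transit_arr[OF s, of n N] seqD(1)[OF s]] shm_idn seqD(2)[OF s]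
    by (cases "n \<le> N") simp_all
qed

text \<open>The shifted functor takes at \<open>sh T (X n)\<close> the value of \<open>F\<close> at
  \<open>X n\<close>, so the same elements \<open>e\<close> are universal again.\<close>

lemma colim_sh:
  assumes F: "additive_functor T F" and c: "colim X f F e"
  shows "colim (\<lambda>n. sh T (X n)) (\<lambda>n. shm T (f n)) (sh_functor T F) e"
  unfolding colim_def
proof (intro conjI allI ballI impI)
  note s = colimD(1)[OF c] and o = seqD(2)[OF colimD(1)[OF c]]
  show "seq (\<lambda>n. sh T (X n)) (\<lambda>n. shm T (f n))" by (rule seq_sh[OF s])
  fix n show "e n \<in> el (sh_functor T F) (sh T (X n))"
    using unsh(3)[OF o] colimD(2)[OF c] by (simp add: sh_functor_simps(1)[OF sh_Obj[OF o]])
  show "FA (sh_functor T F) (shm T (f (Suc n))) (e (Suc n)) = e n"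
    using shm_inv_shm[OF seqD(1)[OF s]] colimD(3)[OF c] by (simp add: sh_functor_simps(2)[OF shm_arr[OF seqD(1)[OF s]]])
next
  note s = colimD(1)[OF c] and o = seqD(2)[OF colimD(1)[OF c]]
  fix A x assume A: "A \<in> Obj T" and "x \<in> el (sh_functor T F) A"
  then have x: "x \<in> el F (unsh A)" by (simp add: sh_functor_simps(1)[OF A])
  obtain n p where p: "arr (unsh A) (X n) p" "x = FA F p (e n)" using colim_surj[OF c unsh(1)[OF A] x] .
  have "arr A (sh T (X n)) (shm T p)" using shm_arr[OF p(1)] unsh(2)[OF A] by simp
  moreover have "x = FA (sh_functor T F) (shm T p) (e n)"
    using p shm_inv_shm[OF p(1)] by (simp add: sh_functor_simps(2)[OF calculation])
  ultimately show "\<exists>n p. arr A (sh T (X n)) p \<and> x = FA (sh_functor T F) p (e n)" by blast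
next
  note s = colimD(1)[OF c] and o = seqD(2)[OF colimD(1)[OF c]]
  fix A n p assume a: "arr A (sh T (X n)) p \<and> FA (sh_functor T F) p (e n) = un (sh_functor T F) A"
  then have p: "arr A (sh T (X n)) p" by blast
  note A = arrD(1)[OF p]
  have q: "arr (unsh A) (X n) (shm_inv T p)" using shm_inv(1)[OF p] unsh(3)[OF o] by simp
  have "FA F (shm_inv T p) (e n) = un F (unsh A)"
    using a by (simp add: sh_functor_simps(2)[OF p] sh_functor_simps(1)[OF A])
  then obtain N where N: "n \<le> N" "transit X f n N \<cdot> shm_inv T p = zr (unsh A) (X N)"
    using colim_inj[OF c q] by blast
  have "transit (\<lambda>n. sh T (X n)) (\<lambda>n. shm T (f n)) n N \<cdot> p = zr A (sh T (X N))"
    using shm_comp[OF q transit_arr[OF s N(1)]] N(2) shm_inv(2)[OF p] transit_sh[OF s N(1)]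
      shm_zr[OF unsh(1)[OF A] o[of N]] unsh(2)[OF A] by simp
  then show "\<exists>N\<ge>n. transit (\<lambda>n. sh T (X n)) (\<lambda>n. shm T (f n)) n N \<cdot> p = zr A (sh T (X N))" using N(1) by blast
qed

lemma colim_iso:
  assumes F: "additive_functor T F" and G: "additive_functor T G"
    and c: "colim X f F e" and d: "colim X f G d"
  obtains \<eta> where "nat_trans T F G \<eta>" "\<And>A. A \<in> Obj T \<Longrightarrow> bij_betw (\<eta> A) (el F A) (el G A)"
proof -
  note o = seqD(2)[OF colimD(1)[OF c]]
  obtain \<eta> where \<eta>: "nat_trans T F G \<eta>" "\<And>n. \<eta> (X n) (e n) = d n"
    "\<And>n A p. arr A (X n) p \<Longrightarrow> \<eta> A (FA F p (e n)) = FA G p (d n)"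
    by (rule colim_universal[where d = d, OF F c G colimD(2)[OF d] colimD(3)[OF d]]) blast
  obtain \<theta> where \<theta>: "nat_trans T G F \<theta>" "\<And>n. \<theta> (X n) (d n) = e n"
    "\<And>n A p. arr A (X n) p \<Longrightarrow> \<theta> A (FA G p (d n)) = FA F p (e n)"
    by (rule colim_universal[where d = e, OF G d F colimD(2)[OF c] colimD(3)[OF c]]) blast
  have 1: "\<theta> A (\<eta> A x) = x" if A: "A \<in> Obj T" and x: "x \<in> el F A" for A x
  proof -
    obtain n p where p: "arr A (X n) p" "x = FA F p (e n)" using colim_surj[OF c A x] .
    show ?thesis unfolding p(2) \<eta>(3)[OF p(1)] \<theta>(3)[OF p(1)] ..
  qed
  have 2: "\<eta> A (\<theta> A x) = x" if A: "A \<in> Obj T" and x: "x \<in> el G A" for A x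
  proof -
    obtain n p where p: "arr A (X n) p" "x = FA G p (d n)" using colim_surj[OF d A x] .
    show ?thesis unfolding p(2) \<theta>(3)[OF p(1)] \<eta>(3)[OF p(1)] ..
  qed
  have "bij_betw (\<eta> A) (el F A) (el G A)" if A: "A \<in> Obj T" for A
    by (rule bij_betw_byWitness[where f' = "\<theta> A"])
      (use 1[OF A] 2[OF A] ntD(4)[OF \<theta>(1) A] ntD(4)[OF \<eta>(1) A] in blast)+
  then show thesis using that \<eta>(1) by blast
qed

lemma nt_inverse:
  assumes n: "nat_trans T F G \<eta>" and F: "additive_functor T F" and G: "additive_functor T G"
    and b: "\<And>A. A \<in> Obj T \<Longrightarrow> bij_betw (\<eta> A) (el F A) (el G A)"
  obtains \<theta> where "nat_trans T G F \<theta>" "\<And>A. A \<in> Obj T \<Longrightarrow> bij_betw (\<theta> A) (el G A) (el F A)"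
    "comp_nt F \<theta> \<eta> = id_nt F" "comp_nt G \<eta> \<theta> = id_nt G"
proof -
  let ?\<theta> = "\<lambda>A\<in>Obj T. \<lambda>y\<in>el G A. inv_into (el F A) (\<eta> A) y"
  have i: "?\<theta> A y \<in> el F A" "\<eta> A (?\<theta> A y) = y" if "A \<in> Obj T" "y \<in> el G A" for A y
    using b[OF that(1)] that unfolding bij_betw_def
    by (auto intro: inv_into_into f_inv_into_f)
  have inj: "x = y" if "A \<in> Obj T" "x \<in> el F A" "y \<in> el F A" "\<eta> A x = \<eta> A y" for A x y
    using b[OF that(1)] that(2-) unfolding bij_betw_def inj_on_def by blast
  have j: "?\<theta> A (\<eta> A x) = x" if "A \<in> Obj T" "x \<in> el F A" for A x
    using inj[OF that(1) i(1)[OF that(1) ntD(4)[OF n that]] that(2)]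
      i(2)[OF that(1) ntD(4)[OF n that]] by blast
  have m: "x \<otimes>\<^bsub>FO F A\<^esub> y \<in> el F A" if "A \<in> Obj T" "x \<in> el F A" "y \<in> el F A" for A x y
    by (rule monoid.m_closed[OF group.is_monoid[OF el_group[OF F that(1)]] that(2,3)])
  have m': "x \<otimes>\<^bsub>FO G A\<^esub> y \<in> el G A" if "A \<in> Obj T" "x \<in> el G A" "y \<in> el G A" for A x y
    by (rule monoid.m_closed[OF group.is_monoid[OF el_group[OF G that(1)]] that(2,3)])
  have t: "nat_trans T G F ?\<theta>"
  proof (rule nat_transI)
    fix A assume A: "A \<in> Obj T"
    show "?\<theta> A \<in> extensional (el G A)" using A by simp
    show "?\<theta> A \<in> hom (FO G A) (FO F A)"
    proof (rule homI)
      fix x assume x: "x \<in> el G A" show "?\<theta> A x \<in> el F A" by (rule i(1)[OF A x])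
      fix y assume y: "y \<in> el G A"
      note ii = i(1)[OF A x] i(1)[OF A y]
      show "?\<theta> A (x \<otimes>\<^bsub>FO G A\<^esub> y) = ?\<theta> A x \<otimes>\<^bsub>FO F A\<^esub> ?\<theta> A y"
      proof (rule inj[OF A i(1)[OF A m'[OF A x y]] m[OF A ii]])
        show "\<eta> A (?\<theta> A (x \<otimes>\<^bsub>FO G A\<^esub> y)) = \<eta> A (?\<theta> A x \<otimes>\<^bsub>FO F A\<^esub> ?\<theta> A y)"
          unfolding i(2)[OF A m'[OF A x y]] hom_mult[OF ntD(2)[OF n A] ii] i(2)[OF A x] i(2)[OF A y] ..
      qed
    qed
  next
    fix A B f x assume f: "arr A B f" and x: "x \<in> el G B"
    note A = arrD(1)[OF f] and B = arrD(2)[OF f]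
    note fx = fa_closed[OF G f x]
    show "?\<theta> A (FA G f x) = FA F f (?\<theta> B x)"
    proof (rule inj[OF A i(1)[OF A fx] fa_closed[OF F f i(1)[OF B x]]])
      show "\<eta> A (?\<theta> A (FA G f x)) = \<eta> A (FA F f (?\<theta> B x))"
        unfolding i(2)[OF A fx] ntD(5)[OF n f i(1)[OF B x]] i(2)[OF B x] ..
    qed
  qed simp
  show thesis
  proof (rule that[OF t])
    show "bij_betw (?\<theta> A) (el G A) (el F A)" if A: "A \<in> Obj T" for A
      by (rule bij_betw_byWitness[where f' = "\<eta> A"])
        (use i[OF A] j[OF A] ntD(4)[OF n A] ntD(4)[OF t A] in blast)+
    show "comp_nt F ?\<theta> \<eta> = id_nt F"
      by (rule nt_eqI[OF comp_nt[OF F n t] id_nt[OF F]]) (use j in simp)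
    show "comp_nt G \<eta> ?\<theta> = id_nt G"
      by (rule nt_eqI[OF comp_nt[OF G t n] id_nt[OF G]]) (use i(2) in simp)
  qed
qed

definition zero_nt :: "('o, 'm, 'v) cfun \<Rightarrow> ('o, 'm, 'w) cfun \<Rightarrow> 'o \<Rightarrow> 'v \<Rightarrow> 'w"
  where "zero_nt F G = (\<lambda>A\<in>Obj T. \<lambda>x\<in>el F A. un G A)"

lemma zero_nt:
  assumes F: "additive_functor T F" and G: "additive_functor T G"
  shows "nat_trans T F G (zero_nt F G)"
proof (rule nat_transI)
  fix A assume A: "A \<in> Obj T"
  show "zero_nt F G A \<in> extensional (el F A)" using A by (simp add: zero_nt_def)
  have m: "x \<otimes>\<^bsub>FO F A\<^esub> y \<in> el F A" if "x \<in> el F A" "y \<in> el F A" for x y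
    by (rule monoid.m_closed[OF group.is_monoid[OF el_group[OF F A]] that])
  show "zero_nt F G A \<in> hom (FO F A) (FO G A)"
    by (rule homI) (use A un_el[OF G A] m monoid.l_one[OF group.is_monoid[OF el_group[OF G A]]]
        in \<open>simp_all add: zero_nt_def\<close>)
next
  fix A B f x assume f: "arr A B f" and x: "x \<in> el F B"
  show "zero_nt F G A (FA F f x) = FA G f (zero_nt F G B x)"
    using fa_un[OF G f] fa_closed[OF F f x] x arrD[OF f] by (simp add: zero_nt_def)
qed (simp add: zero_nt_def)

text \<open>The automorphism minus identity of \<open>X\<close> absorbs the sign, at the cost of a
  different last map.\<close>

lemma tri_neg_first:
  assumes t: "dt X Y Z (neg X Y u) v w" and u: "arr X Y u"
  obtains w' where "dt X Y Z u v w'"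
proof -
  note d = dtD[OF t]
  let ?a = "neg X X (idn T X)"
  have a: "arr X X ?a" by (rule arr_neg[OF arr_id[OF d(1)]])
  have aa: "?a \<cdot> ?a = idn T X"
    using comp_neg_left[OF a arr_id[OF d(1)]] id_left[OF a] neg_neg[OF arr_id[OF d(1)]] by simp
  have ia: "is_iso T X X ?a" by (rule is_isoI[OF a a aa aa])
  have w': "arr Z (sh T X) (shm T ?a \<cdot> w)" by (rule arr_comp[OF d(8) shm_arr[OF a]])
  have "tri T X Y Z u v (shm T ?a \<cdot> w)"
    by (rule tri_iso[OF d(1-3) d(1-4) arrD(3)[OF u] arrD(3)[OF d(7)] arrD(3)[OF w'] ia
          is_iso_id[OF d(2)] is_iso_id[OF d(3)]])
      (use id_left[OF d(6)] comp_neg_right[OF arr_id[OF d(1)] u] id_right[OF u] id_left[OF d(7)]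
        id_right[OF d(7)] id_right[OF w'] in simp_all)
  then show thesis using that d unfolding dt_def by blast
qed

text \<open>Three rotations suspend the triangle and negate its three maps. Only the sign of the
  first one is repaired, which is enough to speak of its cone.\<close>

lemma dt_shift:
  assumes t: "dt X Y Z u v w"
  obtains v' w' where "dt (sh T X) (sh T Y) (sh T Z) (shm T u) v' w'"
  using tri_neg_first[OF rotate[OF rotate[OF rotate[OF t]]] shm_arr[OF dtD(6)[OF t]]] by blast

lemma dt_iso3:
  assumes t: "dt X Y Z u v w" and i: "isomorphic T Z Z'" and Z': "Z' \<in> Obj T"
  obtains v' w' where "dt X Y Z' u v' w'"
proof -
  note d = dtD[OF t]
  obtain c where c: "is_iso T Z Z' c" using i unfolding isomorphic_def by blast
  then obtain c' where c': "arr Z Z' c" "arr Z' Z c'" "c' \<cdot> c = idn T Z" using is_isoD d(3) Z' by metis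
  have v': "arr Y Z' (c \<cdot> v)" by (rule arr_comp[OF d(7) c'(1)])
  have w': "arr Z' (sh T X) (w \<cdot> c')" by (rule arr_comp[OF c'(2) d(8)])
  have "tri T X Y Z' u (c \<cdot> v) (w \<cdot> c')"
    by (rule tri_iso[OF d(1-3) d(1,2) Z' d(4) arrD(3)[OF d(6)] arrD(3)[OF v'] arrD(3)[OF w']
          is_iso_id[OF d(1)] is_iso_id[OF d(2)] c])
      (use id_left[OF d(6)] id_right[OF d(6)] id_right[OF v'] comp_assoc[OF c'(1,2) d(8)] c'(3)
        id_right[OF d(8)] shm_idn[OF d(1)] id_left[OF d(8)] in simp_all)
  then show thesis using that d Z' unfolding dt_def by blast
qed

text \<open>The suspended cone of \<open>u\<close> is a cone of \<open>shm T u\<close>; uniqueness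
  of cones identifies it with the suspension of \<open>Z\<close>.\<close>

lemma dt_unshift:
  assumes t: "dt (sh T X) (sh T Y) (sh T Z) (shm T u) v w" and u: "arr X Y u" and Z: "Z \<in> Obj T"
  obtains v' w' where "dt X Y Z u v' w'"
proof -
  obtain C v1 w1 where c: "dt X Y C u v1 w1" using cone_exists[OF u] by blast
  obtain v2 w2 where "dt (sh T X) (sh T Y) (sh T C) (shm T u) v2 w2" by (rule dt_shift[OF c])
  then have "isomorphic T (sh T C) (sh T Z)" using cone_unique t by blast
  then have "isomorphic T C Z" using isomorphic_unsh dtD(3)[OF c] Z by blast
  then show thesis using dt_iso3[OF c _ Z] that by blast
qed

lemma transit_tail: "n \<le> m \<Longrightarrow> transit (\<lambda>n. X (n + N)) (\<lambda>n. f (n + N)) n m = transit X f (n + N) (m + N)"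
proof (induction m)
  case 0
  then show ?case by (simp add: transit_refl)
next
  case (Suc m)
  then show ?case by (cases "n \<le> m") (simp_all add: transit_refl)
qed

lemma colim_tail:
  assumes F: "additive_functor T F" and c: "colim X f F e"
  shows "colim (\<lambda>n. X (n + N)) (\<lambda>n. f (n + N)) F (\<lambda>n. e (n + N))"
  unfolding colim_def
proof (intro conjI allI ballI impI)
  note s = colimD(1)[OF c] and o = seqD(2)[OF colimD(1)[OF c]]
  show "seq (\<lambda>n. X (n + N)) (\<lambda>n. f (n + N))" using seqD(1)[OF s] unfolding seq_def by simp
  fix n show "e (n + N) \<in> el F (X (n + N))" by (rule colimD(2)[OF c])
  show "FA F (f (Suc n + N)) (e (Suc n + N)) = e (n + N)" using colimD(3)[OF c, of "n + N"] by simp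
next
  note s = colimD(1)[OF c]
  fix A x assume A: "A \<in> Obj T" and x: "x \<in> el F A"
  obtain n p where p: "arr A (X n) p" "x = FA F p (e n)" using colim_surj[OF c A x] .
  have "arr A (X (n + N)) (transit X f n (n + N) \<cdot> p)" by (rule arr_comp[OF p(1) transit_arr[OF s]]) simp
  moreover have "x = FA F (transit X f n (n + N) \<cdot> p) (e (n + N))"
    using colim_push[OF F c _ p(1), of "n + N"] p(2) by simp
  ultimately show "\<exists>n p. arr A (X (n + N)) p \<and> x = FA F p (e (n + N))" by blast
next
  note s = colimD(1)[OF c]
  fix A n p assume a: "arr A (X (n + N)) p \<and> FA F p (e (n + N)) = un F A"
  then have p: "arr A (X (n + N)) p" by blast
  obtain M where M: "n + N \<le> M" "transit X f (n + N) M \<cdot> p = zr A (X M)" using colim_inj[OF c p] a by blast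
  then obtain m where m: "M = m + N" "n \<le> m" by (metis add.commute add_le_cancel_left le_Suc_ex le_add2 trans_le_add2 le_add_diff_inverse le_trans)
  then show "\<exists>m\<ge>n. transit (\<lambda>n. X (n + N)) (\<lambda>n. f (n + N)) n m \<cdot> p = zr A (X (m + N))"
    using M(2) transit_tail[OF m(2), of X N f] by auto
qed

end

section \<open>The completion\<close>

locale metric_category = triangulated_category T for T :: "('o, 'm, 'z) tcat_scheme" +
  fixes \<BB> :: "nat \<Rightarrow> 'o set"
  assumes good: "good_metric T \<BB>"
begin

lemma metricD:
  shows "\<BB> n \<subseteq> Obj T" "A \<in> \<BB> n \<Longrightarrow> isomorphic T A B \<Longrightarrow> B \<in> Obj T \<Longrightarrow> B \<in> \<BB> n"
    "is_zero T Z \<Longrightarrow> Z \<in> \<BB> n" "tr A X C \<Longrightarrow> A \<in> \<BB> n \<Longrightarrow> C \<in> \<BB> n \<Longrightarrow> X \<in> \<BB> n"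
    "\<BB> (Suc n) \<subseteq> \<BB> n" "A \<in> \<BB> (Suc n) \<Longrightarrow> sh T A \<in> \<BB> n" "A \<in> \<BB> (Suc n) \<Longrightarrow> unsh A \<in> \<BB> n"
proof -
  have g: "subcat T (\<BB> n)" "\<forall>Z. is_zero T Z \<longrightarrow> Z \<in> \<BB> n" "star T (\<BB> n) (\<BB> n) = \<BB> n"
    "shsub T (- 1) (\<BB> (Suc n)) \<union> \<BB> (Suc n) \<union> shsub T 1 (\<BB> (Suc n)) \<subseteq> \<BB> n" for n
    using good unfolding good_metric_def by blast+
  have sub: "\<BB> n \<subseteq> Obj T" for n using g(1) unfolding subcat_def by blast
  show "\<BB> n \<subseteq> Obj T" by (rule sub)
  show "A \<in> \<BB> n \<Longrightarrow> isomorphic T A B \<Longrightarrow> B \<in> Obj T \<Longrightarrow> B \<in> \<BB> n"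
    using g(1)[of n] unfolding subcat_def by blast
  show "is_zero T Z \<Longrightarrow> Z \<in> \<BB> n" using g(2) by blast
  show "tr A X C \<Longrightarrow> A \<in> \<BB> n \<Longrightarrow> C \<in> \<BB> n \<Longrightarrow> X \<in> \<BB> n"
    using g(3)[of n] unfolding star_def tr_def dt_def by blast
  show "\<BB> (Suc n) \<subseteq> \<BB> n" using g(4) by blast
  assume A: "A \<in> \<BB> (Suc n)"
  then have AO: "A \<in> Obj T" using sub by blast
  have "sh T A \<in> shsub T 1 (\<BB> (Suc n))" "unsh A \<in> shsub T (- 1) (\<BB> (Suc n))"
    unfolding shsub_def mem_Collect_eq
    using A isomorphic_refl[OF sh_Obj[OF AO]] isomorphic_refl[OF unsh(1)[OF AO]]
      sh_Obj[OF AO] unsh(1)[OF AO] bexI[OF _ A, of "\<lambda>B. isomorphic T (sh T A) (shpow T 1 B)"]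
      bexI[OF _ A, of "\<lambda>B. isomorphic T (unsh A) (shpow T (- 1) B)"]
    unfolding shpow_1[OF AO] shpow_m1[OF AO] by blast+
  then show "sh T A \<in> \<BB> n" "unsh A \<in> \<BB> n" using g(4) by blast+
qed

lemma metricD_mono: "m \<le> n \<Longrightarrow> \<BB> n \<subseteq> \<BB> m"
  by (rule lift_Suc_antimono_le[of \<BB>]) (use metricD(5) in auto)

lemma cauchyD:
  assumes "cauchy T \<BB> X f"
  shows "seq X f" "\<exists>n. \<forall>j\<ge>n. \<exists>Q\<in>\<BB> i. \<exists>v w. dt (X j) (X (Suc j)) Q (f (Suc j)) v w"
proof -
  have o: "\<And>n. X n \<in> Obj T" "\<And>n. f (Suc n) \<in> Hom T (X n) (X (Suc n))"
    and c: "\<forall>i\<ge>1. \<exists>n\<ge>1. \<forall>j\<ge>n. \<exists>Q\<in>\<BB> i. \<exists>v w. tri T (X (j - 1)) (X j) Q (f j) v w"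
    using assms unfolding cauchy_def by blast+
  show "seq X f" using o unfolding seq_def arr_def by blast
  \<comment> \<open>The Cauchy condition controls the levels from 1 on; level \<open>Suc i\<close>
    also covers \<open>i = 0\<close>, since the metric decreases.\<close>
  obtain n where n: "\<forall>j\<ge>n. \<exists>Q\<in>\<BB> (Suc i). \<exists>v w. tri T (X (j - 1)) (X j) Q (f j) v w"
    using c[rule_format, of "Suc i"] by auto
  have "\<exists>Q\<in>\<BB> i. \<exists>v w. dt (X j) (X (Suc j)) Q (f (Suc j)) v w" if "n \<le> j" for j
  proof -
    obtain Q v w where Q: "Q \<in> \<BB> (Suc i)" "tri T (X j) (X (Suc j)) Q (f (Suc j)) v w"
      using n[rule_format, of "Suc j"] \<open>n \<le> j\<close> unfolding diff_Suc_1 by (meson le_SucI)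
    have "Q \<in> Obj T" "Q \<in> \<BB> i" using Q(1) metricD(1,5) by blast+
    then show ?thesis using Q(2) o(1) unfolding dt_def by blast
  qed
  then show "\<exists>n. \<forall>j\<ge>n. \<exists>Q\<in>\<BB> i. \<exists>v w. dt (X j) (X (Suc j)) Q (f (Suc j)) v w" by blast
qed

lemma cauchyI:
  assumes s: "seq X f"
    and c: "\<And>i. \<exists>n. \<forall>j\<ge>n. \<exists>Q\<in>\<BB> i. \<exists>v w. dt (X j) (X (Suc j)) Q (f (Suc j)) v w"
  shows "cauchy T \<BB> X f"
  unfolding cauchy_def
proof (intro conjI allI impI)
  fix n show "X n \<in> Obj T" by (rule seqD(2)[OF s])
  show "f (Suc n) \<in> Hom T (X n) (X (Suc n))" using seqD(1)[OF s] arrD by blast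
next
  fix i :: nat
  obtain n where n: "\<forall>j\<ge>n. \<exists>Q\<in>\<BB> i. \<exists>v w. dt (X j) (X (Suc j)) Q (f (Suc j)) v w" using c by blast
  have "\<exists>Q\<in>\<BB> i. \<exists>v w. tri T (X (j - 1)) (X j) Q (f j) v w" if "Suc n \<le> j" for j
  proof -
    obtain l where l: "j = Suc l" "n \<le> l" using \<open>Suc n \<le> j\<close> by (cases j) auto
    obtain Q v w where "Q \<in> \<BB> i" "dt (X l) (X (Suc l)) Q (f (Suc l)) v w" using n l(2) by blast
    then show ?thesis unfolding l(1) diff_Suc_1 dt_def by blast
  qed
  then show "\<exists>n\<ge>1. \<forall>j\<ge>n. \<exists>Q\<in>\<BB> i. \<exists>v w. tri T (X (j - 1)) (X j) Q (f j) v w"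
    by (intro exI[of _ "Suc n"]) auto
qed

lemma cauchy_tail: assumes c: "cauchy T \<BB> X f" shows "cauchy T \<BB> (\<lambda>n. X (n + N)) (\<lambda>n. f (n + N))"
proof (rule cauchyI)
  show "seq (\<lambda>n. X (n + N)) (\<lambda>n. f (n + N))" using seqD(1)[OF cauchyD(1)[OF c]] unfolding seq_def by simp
  fix i
  obtain n where "\<forall>j\<ge>n. \<exists>Q\<in>\<BB> i. \<exists>v w. dt (X j) (X (Suc j)) Q (f (Suc j)) v w" using cauchyD(2)[OF c] by blast
  then show "\<exists>n. \<forall>j\<ge>n. \<exists>Q\<in>\<BB> i. \<exists>v w. dt (X (j + N)) (X (Suc j + N)) Q (f (Suc j + N)) v w"
    by (intro exI[of _ n]) auto
qed

lemma cauchy_sh: assumes c: "cauchy T \<BB> X f" shows "cauchy T \<BB> (\<lambda>n. sh T (X n)) (\<lambda>n. shm T (f n))"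
proof (rule cauchyI[OF seq_sh[OF cauchyD(1)[OF c]]])
  fix i
  obtain n where n: "\<forall>j\<ge>n. \<exists>Q\<in>\<BB> (Suc i). \<exists>v w. dt (X j) (X (Suc j)) Q (f (Suc j)) v w"
    using cauchyD(2)[OF c] by blast
  have "\<exists>Q\<in>\<BB> i. \<exists>v w. dt (sh T (X j)) (sh T (X (Suc j))) Q (shm T (f (Suc j))) v w" if "n \<le> j" for j
  proof -
    obtain Q v w where Q: "Q \<in> \<BB> (Suc i)" "dt (X j) (X (Suc j)) Q (f (Suc j)) v w" using n \<open>n \<le> j\<close> by blast
    obtain v' w' where "dt (sh T (X j)) (sh T (X (Suc j))) (sh T Q) (shm T (f (Suc j))) v' w'"
      by (rule dt_shift[OF Q(2)])
    then show ?thesis using metricD(6)[OF Q(1)] by blast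
  qed
  then show "\<exists>n. \<forall>j\<ge>n. \<exists>Q\<in>\<BB> i. \<exists>v w. dt (sh T (X j)) (sh T (X (Suc j))) Q (shm T (f (Suc j))) v w" by blast
qed

lemma cauchy_unsh:
  assumes c: "cauchy T \<BB> (\<lambda>n. sh T (X n)) (\<lambda>n. shm T (f n))" and s: "seq X f"
  shows "cauchy T \<BB> X f"
proof (rule cauchyI[OF s])
  fix i
  obtain n where n: "\<forall>j\<ge>n. \<exists>Q\<in>\<BB> (Suc i). \<exists>v w. dt (sh T (X j)) (sh T (X (Suc j))) Q (shm T (f (Suc j))) v w"
    using cauchyD(2)[OF c, of "Suc i"] by blast
  have "\<exists>Q\<in>\<BB> i. \<exists>v w. dt (X j) (X (Suc j)) Q (f (Suc j)) v w" if "n \<le> j" for j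
  proof -
    obtain Q v w where Q: "Q \<in> \<BB> (Suc i)" "dt (sh T (X j)) (sh T (X (Suc j))) Q (shm T (f (Suc j))) v w"
      using n \<open>n \<le> j\<close> by blast
    have QO: "Q \<in> Obj T" using Q(1) metricD(1) by blast
    obtain v' w' where "dt (X j) (X (Suc j)) (unsh Q) (f (Suc j)) v' w'"
      by (rule dt_unshift[OF _ seqD(1)[OF s] unsh(1)[OF QO]]) (use Q(2) unsh(2)[OF QO] in simp)
    then show ?thesis using metricD(7)[OF Q(1)] by blast
  qed
  then show "\<exists>n. \<forall>j\<ge>n. \<exists>Q\<in>\<BB> i. \<exists>v w. dt (X j) (X (Suc j)) Q (f (Suc j)) v w" by blast
qed

text \<open>The vanishing condition of \<open>GG\<close>, rewritten by the Yoneda lemma as a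
  condition on values.\<close>

definition comp_supp :: "('o, 'm, 'v) cfun \<Rightarrow> bool"
  where "comp_supp F \<longleftrightarrow> (\<forall>j. \<exists>i. \<forall>B\<in>\<BB> i. el F (shpow T j B) = {un F (shpow T j B)})"

lemma GG_iff:
  "F \<in> GG T \<BB> U \<longleftrightarrow> additive_functor T F \<and>
    (\<exists>X f e. (\<forall>n. X n \<in> U) \<and> cauchy T \<BB> X f \<and> colim X f F e) \<and> comp_supp F"
proof -
  have "(\<forall>j. \<exists>i. \<forall>B\<in>\<BB> i. nat_trans_zero T (yoneda T (shpow T j B)) F) \<longleftrightarrow> comp_supp F"
    if F: "additive_functor T F"
  proof -
    have z: "nat_trans_zero T (yoneda T (shpow T j B)) F \<longleftrightarrow> el F (shpow T j B) = {un F (shpow T j B)}"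
      if "B \<in> \<BB> i" for j i B
    proof -
      have "B \<in> Obj T" using that metricD(1) by blast
      then show ?thesis by (rule nat_trans_zero_yoneda[OF F shpow_Obj])
    qed
    then show ?thesis unfolding comp_supp_def by (intro iff_allI iff_exI ball_cong refl)
  qed
  moreover have "(\<exists>c. yoneda_colimit T X f F c) \<longleftrightarrow> (\<exists>e. colim X f F e)"
    if "additive_functor T F" "cauchy T \<BB> X f" for X f
    using yoneda_colimit_colim[OF _ cauchyD(1)[OF that(2)]] colim_yoneda_colimit[OF that(1)] by blast
  ultimately show ?thesis unfolding GG_def by blast
qed

lemma GGE:
  assumes "F \<in> GG T \<BB> U"
  obtains X f e where "additive_functor T F" "comp_supp F" "\<And>n. X n \<in> U" "cauchy T \<BB> X f" "colim X f F e"
  using assms unfolding GG_iff by blast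

lemma GGI: "additive_functor T F \<Longrightarrow> comp_supp F \<Longrightarrow> (\<And>n. X n \<in> U) \<Longrightarrow> cauchy T \<BB> X f \<Longrightarrow> colim X f F e \<Longrightarrow>
    F \<in> GG T \<BB> U"
  unfolding GG_iff by blast

lemma GG_mono: "U \<subseteq> V \<Longrightarrow> GG T \<BB> U \<subseteq> GG T \<BB> V"
  unfolding subset_iff[of "GG T \<BB> U"] GG_iff by blast

lemma GG_additive: "F \<in> GG T \<BB> U \<Longrightarrow> additive_functor T F"
  unfolding GG_iff by blast

lemma comp_supp_transport:
  assumes n: "nat_trans T F G \<eta>" and F: "additive_functor T F" and G: "additive_functor T G"
    and b: "\<And>A. A \<in> Obj T \<Longrightarrow> bij_betw (\<eta> A) (el F A) (el G A)" and c: "comp_supp F"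
  shows "comp_supp G"
  unfolding comp_supp_def
proof
  fix j
  obtain i where i: "\<forall>B\<in>\<BB> i. el F (shpow T j B) = {un F (shpow T j B)}" using c unfolding comp_supp_def by blast
  have "el G (shpow T j B) = {un G (shpow T j B)}" if B: "B \<in> \<BB> i" for B
  proof -
    have o: "shpow T j B \<in> Obj T" using B metricD(1)[of i] by auto
    have "el G (shpow T j B) = \<eta> (shpow T j B) ` {un F (shpow T j B)}"
      using b[OF o] i B unfolding bij_betw_def by simp
    then show ?thesis using nt_un[OF n F G o] by simp
  qed
  then show "\<exists>i. \<forall>B\<in>\<BB> i. el G (shpow T j B) = {un G (shpow T j B)}" by blast
qed

lemma GG_transport:
  assumes n: "nat_trans T F G \<eta>" and F: "F \<in> GG T \<BB> U" and G: "additive_functor T G"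
    and b: "\<And>A. A \<in> Obj T \<Longrightarrow> bij_betw (\<eta> A) (el F A) (el G A)"
  shows "G \<in> GG T \<BB> U"
proof -
  obtain X f e where X: "additive_functor T F" "comp_supp F" "\<And>n. X n \<in> U" "cauchy T \<BB> X f" "colim X f F e"
    using GGE[OF F] by blast
  show ?thesis
    by (rule GGI[OF G comp_supp_transport[OF n X(1) G b X(2)] X(3,4) colim_transport[OF X(5) n X(1) G b]])
qed

section \<open>The completion as a category with suspension\<close>

abbreviation "CC \<equiv> completion T \<BB>"

lemma CC_simps:
  "Obj CC = GG T \<BB> (Obj T)" "Hom CC F G = {(F, \<eta>, G) |\<eta>. nat_trans T F G \<eta>}"
  "\<one>\<^bsub>hgrp CC F G\<^esub> = (F, zero_nt F G, G)" "idn CC F = (F, id_nt F, F)"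
  "cmp CC (G, \<theta>, H) (F, \<eta>, G') = (F, comp_nt F \<theta> \<eta>, H)" "sh CC F = sh_functor T F"
  "tri CC F G H u v w \<longleftrightarrow> F \<in> GG T \<BB> (Obj T) \<and> G \<in> GG T \<BB> (Obj T) \<and> H \<in> GG T \<BB> (Obj T) \<and>
      (\<exists>\<eta> \<theta> \<zeta>. u = (F, \<eta>, G) \<and> v = (G, \<theta>, H) \<and> w = (H, \<zeta>, sh_functor T F) \<and>
        colimit_triangle T \<BB> F G H \<eta> \<theta> \<zeta>)"
  by (simp_all add: completion_def zero_nt_def id_nt_def comp_nt_def)

lemma CC_hom_zero:
  assumes F: "additive_functor T F" and G: "additive_functor T G"
  shows "hom_zero CC F G \<longleftrightarrow> (\<forall>\<eta>. nat_trans T F G \<eta> \<longrightarrow> \<eta> = zero_nt F G)"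
  unfolding hom_zero_def CC_simps using zero_nt[OF F G] by blast

lemma CC_isomorphic:
  assumes F: "additive_functor T F" and G: "additive_functor T G"
  shows "isomorphic CC F G \<longleftrightarrow>
    (\<exists>\<eta>. nat_trans T F G \<eta> \<and> (\<forall>A\<in>Obj T. bij_betw (\<eta> A) (el F A) (el G A)))"
proof
  assume "isomorphic CC F G"
  then obtain \<eta> \<theta> where n: "nat_trans T F G \<eta>" and t: "nat_trans T G F \<theta>"
    and i: "comp_nt F \<theta> \<eta> = id_nt F" "comp_nt G \<eta> \<theta> = id_nt G"
    unfolding isomorphic_def is_iso_def CC_simps by (auto simp: CC_simps)
  have 1: "\<theta> A (\<eta> A x) = x" if "A \<in> Obj T" "x \<in> el F A" for A x
    using comp_nt_apply[OF that, of \<theta> \<eta>] id_nt_apply[OF that] i(1) by simp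
  have 2: "\<eta> A (\<theta> A x) = x" if "A \<in> Obj T" "x \<in> el G A" for A x
    using comp_nt_apply[OF that, of \<eta> \<theta>] id_nt_apply[OF that] i(2) by simp
  have "bij_betw (\<eta> A) (el F A) (el G A)" if A: "A \<in> Obj T" for A
    by (rule bij_betw_byWitness[where f' = "\<theta> A"])
      (use 1[OF A] 2[OF A] ntD(4)[OF n A] ntD(4)[OF t A] in blast)+
  then show "\<exists>\<eta>. nat_trans T F G \<eta> \<and> (\<forall>A\<in>Obj T. bij_betw (\<eta> A) (el F A) (el G A))" using n by blast
next
  assume "\<exists>\<eta>. nat_trans T F G \<eta> \<and> (\<forall>A\<in>Obj T. bij_betw (\<eta> A) (el F A) (el G A))"
  then obtain \<eta> where n: "nat_trans T F G \<eta>" "\<And>A. A \<in> Obj T \<Longrightarrow> bij_betw (\<eta> A) (el F A) (el G A)" by blast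
  obtain \<theta> where t: "nat_trans T G F \<theta>" "comp_nt F \<theta> \<eta> = id_nt F" "comp_nt G \<eta> \<theta> = id_nt G"
    by (rule nt_inverse[OF n(1) F G n(2)]) blast+
  have "is_iso CC F G (F, \<eta>, G)"
    unfolding is_iso_def CC_simps
    using n(1) t by (intro conjI bexI[of _ "(G, \<theta>, F)"]) (auto simp: CC_simps)
  then show "isomorphic CC F G" unfolding isomorphic_def by blast
qed

lemma subcat_GG: "U \<subseteq> Obj T \<Longrightarrow> subcat CC (GG T \<BB> U)"
  unfolding subcat_def CC_simps
proof (intro conjI ballI impI)
  assume "U \<subseteq> Obj T" then show "GG T \<BB> U \<subseteq> GG T \<BB> (Obj T)" by (rule GG_mono)
next
  fix F G assume F: "F \<in> GG T \<BB> U" and G: "G \<in> GG T \<BB> (Obj T)" and "isomorphic CC F G"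
  then obtain \<eta> where "nat_trans T F G \<eta>" "\<And>A. A \<in> Obj T \<Longrightarrow> bij_betw (\<eta> A) (el F A) (el G A)"
    using CC_isomorphic[OF GG_additive[OF F] GG_additive[OF G]] by blast
  then show "G \<in> GG T \<BB> U" using GG_transport[OF _ F GG_additive[OF G]] by blast
qed

text \<open>Shifting the functor shifts the degree \<open>j\<close> by one, and the condition
  quantifies over all degrees.\<close>

lemma comp_supp_sh:
  assumes F: "additive_functor T F" shows "comp_supp (sh_functor T F) \<longleftrightarrow> comp_supp F"
proof -
  have e: "FO (sh_functor T F) (shpow T j B) = FO F (shpow T (j - 1) B)" if "B \<in> \<BB> i" for i j B
  proof -
    have o: "B \<in> Obj T" using that metricD(1) by blast
    show ?thesis
      using shpow_m1[OF shpow_Obj[OF o], of j] shpow_add[OF o, of "- 1" j]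
      by (simp add: sh_functor_simps(1)[OF shpow_Obj[OF o]])
  qed
  have 1: "(\<exists>i. \<forall>B\<in>\<BB> i. el (sh_functor T F) (shpow T j B) = {un (sh_functor T F) (shpow T j B)}) \<longleftrightarrow>
      (\<exists>i. \<forall>B\<in>\<BB> i. el F (shpow T (j - 1) B) = {un F (shpow T (j - 1) B)})" for j
    by (intro iff_exI ball_cong refl) (simp only: e)
  define P where "P j \<longleftrightarrow> (\<exists>i. \<forall>B\<in>\<BB> i. el F (shpow T j B) = {un F (shpow T j B)})" for j
  have "(\<forall>j. P (j - 1)) \<longleftrightarrow> (\<forall>j. P j)" by (metis add_diff_cancel_right')
  then show ?thesis unfolding comp_supp_def 1 P_def .
qed

lemma shpow_CC: "shpow CC 1 F = sh_functor T F"
  by (simp add: shpow_def CC_simps)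

lemma sh_functor_GG:
  assumes "F \<in> GG T \<BB> V" "V \<subseteq> Obj T" shows "sh_functor T F \<in> GG T \<BB> (shsub T 1 V)"
proof -
  obtain X f e where X: "additive_functor T F" "comp_supp F" "\<And>n. X n \<in> V" "cauchy T \<BB> X f" "colim X f F e"
    using GGE[OF assms(1)] by blast
  have "sh T (X n) \<in> shsub T 1 V" for n
  proof -
    have "X n \<in> Obj T" using X(3) assms(2) by blast
    then show ?thesis unfolding shsub_def
      using bexI[OF _ X(3), of "\<lambda>B. isomorphic T (sh T (X n)) (shpow T 1 B)" n] isomorphic_refl[OF sh_Obj]
      by (simp add: shpow_1)
  qed
  then show ?thesis
    using GGI[OF sh_functor_additive[OF X(1)] _ _ cauchy_sh[OF X(4)] colim_sh[OF X(1,5)]] comp_supp_sh[OF X(1)] X(2)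
    by blast
qed

text \<open>For the second inclusion a Cauchy sequence in the suspended class is desuspended term by
  term. The shift of the new colimit and \<open>F\<close> are colimits of the same sequence, hence
  isomorphic.\<close>

lemma shsub_GG:
  assumes V: "subcat T V" shows "shsub CC 1 (GG T \<BB> V) = GG T \<BB> (shsub T 1 V)"
proof
  have VO: "V \<subseteq> Obj T" using V unfolding subcat_def by blast
  show "shsub CC 1 (GG T \<BB> V) \<subseteq> GG T \<BB> (shsub T 1 V)"
  proof
    fix F assume "F \<in> shsub CC 1 (GG T \<BB> V)"
    then obtain A where F: "F \<in> GG T \<BB> (Obj T)" and A: "A \<in> GG T \<BB> V" "isomorphic CC F (sh_functor T A)"
      unfolding shsub_def CC_simps shpow_CC by blast
    note Fa = GG_additive[OF F] and sA = sh_functor_additive[OF GG_additive[OF A(1)]]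
    obtain \<eta> where n: "nat_trans T F (sh_functor T A) \<eta>"
      "\<And>B. B \<in> Obj T \<Longrightarrow> bij_betw (\<eta> B) (el F B) (el (sh_functor T A) B)"
      using A(2) CC_isomorphic[OF Fa sA] by blast
    obtain \<theta> where t: "nat_trans T (sh_functor T A) F \<theta>"
      "\<And>B. B \<in> Obj T \<Longrightarrow> bij_betw (\<theta> B) (el (sh_functor T A) B) (el F B)"
      by (rule nt_inverse[OF n(1) Fa sA n(2)]) blast+
    show "F \<in> GG T \<BB> (shsub T 1 V)" by (rule GG_transport[OF t(1) sh_functor_GG[OF A(1) VO] Fa t(2)])
  qed
  show "GG T \<BB> (shsub T 1 V) \<subseteq> shsub CC 1 (GG T \<BB> V)"
  proof
    fix F assume F: "F \<in> GG T \<BB> (shsub T 1 V)"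
    obtain X f e where X: "additive_functor T F" "comp_supp F" "\<And>n. X n \<in> shsub T 1 V" "cauchy T \<BB> X f" "colim X f F e"
      using GGE[OF F] by blast
    note s = cauchyD(1)[OF X(4)] and o = seqD(2)[OF cauchyD(1)[OF X(4)]]
    \<comment> \<open>Nothing is known about \<open>f 0\<close>; the index
      \<open>Suc (n - 1)\<close> reads \<open>f 1\<close> in its place.\<close>
    let ?X = "\<lambda>n. unsh (X n)" and ?f = "\<lambda>n. shm_inv T (f (Suc (n - 1)))"
    have XV: "?X n \<in> V" for n
    proof -
      obtain A where A: "A \<in> V" "isomorphic T (X n) (shpow T 1 A)" using X(3)[of n] unfolding shsub_def by blast
      then have AO: "A \<in> Obj T" using VO by blast
      have "isomorphic T (sh T (?X n)) (sh T A)" using A(2) shpow_1[OF AO] unsh(2)[OF o] by simp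
      then have "isomorphic T A (?X n)"
        using isomorphic_unsh isomorphic_sym unsh(1)[OF o] AO by blast
      then show ?thesis using V A(1) unsh(1)[OF o] unfolding subcat_def by blast
    qed
    have sX: "seq ?X ?f" unfolding seq_def using shm_inv(1)[OF seqD(1)[OF s]] by simp
    have e1: "(\<lambda>n. sh T (?X n)) = X" using unsh(2)[OF o] by simp
    \<comment> \<open>\<open>g\<close> agrees with \<open>f\<close> only at successors, so the
      Cauchy and colimit properties are carried over through these values.\<close>
    define g where "g n = shm T (?f n)" for n
    have gS: "g (Suc n) = f (Suc n)" for n unfolding g_def using shm_inv(2)[OF seqD(1)[OF s]] by simp
    have tg: "transit X g n N = transit X f n N" for n N by (induction N) (simp_all add: gS)
    have cg: "cauchy T \<BB> X g" using X(4) cauchyI[of X g] cauchyD[OF X(4)] gS unfolding seq_def by simp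
    have colg: "colim X g F e" using X(5) unfolding colim_def seq_def gS tg .
    have "cauchy T \<BB> ?X ?f" by (rule cauchy_unsh[OF _ sX]) (use cg in \<open>simp add: e1 g_def[abs_def]\<close>)
    moreover obtain A d where A: "additive_functor T A" "colim ?X ?f (A :: ('o, 'm) modf) d"
      using colim_model_exists[OF sX] .
    have colA: "colim X g (sh_functor T A) d" using colim_sh[OF A] by (simp add: e1 g_def[abs_def])
    obtain \<eta> where n: "nat_trans T F (sh_functor T A) \<eta>"
      "\<And>B. B \<in> Obj T \<Longrightarrow> bij_betw (\<eta> B) (el F B) (el (sh_functor T A) B)"
      by (rule colim_iso[OF X(1) sh_functor_additive[OF A(1)] colg colA]) blast+
    have "comp_supp A" using comp_supp_transport[OF n(1) X(1) sh_functor_additive[OF A(1)] n(2) X(2)] comp_supp_sh[OF A(1)] by blast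
    ultimately have "A \<in> GG T \<BB> V" using GGI[OF A(1) _ XV _ A(2)] by blast
    moreover have "isomorphic CC F (sh_functor T A)"
      using CC_isomorphic[OF X(1) sh_functor_additive[OF A(1)]] n by blast
    moreover have "F \<in> GG T \<BB> (Obj T)"
      using GG_mono[of "shsub T 1 V" "Obj T"] F unfolding shsub_def by blast
    ultimately show "F \<in> shsub CC 1 (GG T \<BB> V)" unfolding shsub_def CC_simps shpow_CC by blast
  qed
qed

end

context triangulated_category
begin

section \<open>Maps of colimits induced by maps of sequences, and representable functors\<close>

lemma transit_nat:
  assumes s: "seq X f" and t: "seq Y g" and u: "\<And>n. arr (X n) (Y n) (u n)"
    and c: "\<And>n. g (Suc n) \<cdot> u n = u (Suc n) \<cdot> f (Suc n)" and "n \<le> N"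
  shows "u N \<cdot> transit X f n N = transit Y g n N \<cdot> u n"
  using \<open>n \<le> N\<close>
proof (induction N)
  case 0
  then show ?case using id_left[OF u] id_right[OF u] by simp
next
  case (Suc N)
  show ?case
  proof (cases "n \<le> N")
    case True
    have "u (Suc N) \<cdot> (f (Suc N) \<cdot> transit X f n N) = (g (Suc N) \<cdot> u N) \<cdot> transit X f n N"
      using comp_assoc[OF transit_arr[OF s True] seqD(1)[OF s] u] c by simp
    also have "\<dots> = g (Suc N) \<cdot> (transit Y g n N \<cdot> u n)"
      using comp_assoc[OF transit_arr[OF s True] u seqD(1)[OF t]] Suc.IH[OF True] by simp
    also have "\<dots> = (g (Suc N) \<cdot> transit Y g n N) \<cdot> u n"
      using comp_assoc[OF u transit_arr[OF t True] seqD(1)[OF t]] by simp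
    finally show ?thesis using True by simp
  next
    case False
    then have "n = Suc N" using Suc by simp
    then show ?thesis using id_left[OF u] id_right[OF u] transit_refl[of X f n] transit_refl[of Y g n] by simp
  qed
qed

lemma colim_map:
  assumes F: "additive_functor T F" and G: "additive_functor T G"
    and cF: "colim X f F e" and cG: "colim Y g G d" and u: "\<And>n. arr (X n) (Y n) (u n)"
    and c: "\<And>n. g (Suc n) \<cdot> u n = u (Suc n) \<cdot> f (Suc n)"
  obtains \<eta> where "nat_trans T F G \<eta>" "\<And>n A p. arr A (X n) p \<Longrightarrow> \<eta> A (FA F p (e n)) = FA G (u n \<cdot> p) (d n)"
proof -
  define k where "k n = FA G (u n) (d n)" for n
  have k: "k n \<in> el G (X n)" for n unfolding k_def by (rule fa_closed[OF G u colimD(2)[OF cG]])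
  have kc: "FA G (f (Suc n)) (k (Suc n)) = k n" for n
    using afD(6)[OF G seqD(1)[OF colimD(1)[OF cF], of n] u[of "Suc n"] colimD(2)[OF cG, of "Suc n"]]
      afD(6)[OF G u[of n] seqD(1)[OF colimD(1)[OF cG], of n] colimD(2)[OF cG, of "Suc n"]] c[of n] colimD(3)[OF cG, of n]
    unfolding k_def by metis
  obtain \<eta> where n: "nat_trans T F G \<eta>" "\<And>n A p. arr A (X n) p \<Longrightarrow> \<eta> A (FA F p (e n)) = FA G p (k n)"
    by (rule colim_universal[where d = k, OF F cF G k kc]) blast
  have "\<eta> A (FA F p (e n)) = FA G (u n \<cdot> p) (d n)" if p: "arr A (X n) p" for n A p
    unfolding n(2)[OF p] k_def by (rule afD(6)[OF G p u colimD(2)[OF cG], symmetric])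
  then show thesis using that n(1) by blast
qed

lemma seq_const: "A \<in> Obj T \<Longrightarrow> seq (\<lambda>_. A) (\<lambda>_. idn T A)"
  unfolding seq_def by simp

lemma transit_const: "A \<in> Obj T \<Longrightarrow> transit (\<lambda>_. A) (\<lambda>_. idn T A) n N = idn T A"
  by (induction N) (simp_all add: id_left[OF arr_id])

text \<open>\<open>e\<close> is a universal element: evaluation at \<open>e\<close> identifies maps
  into \<open>A\<close> with elements of \<open>F\<close>, injectivity being phrased as triviality
  of the kernel. Such functors are the colimits of the constant sequence at
  \<open>A\<close>.\<close>

definition represents :: "('o, 'm, 'v) cfun \<Rightarrow> 'o \<Rightarrow> 'v \<Rightarrow> bool"
  where "represents F A e \<longleftrightarrow> A \<in> Obj T \<and> e \<in> el F A \<and>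
    (\<forall>W\<in>Obj T. \<forall>x\<in>el F W. \<exists>p. arr W A p \<and> x = FA F p e) \<and>
    (\<forall>W p. arr W A p \<and> FA F p e = un F W \<longrightarrow> p = zr W A)"

lemma represents_col:
  assumes F: "additive_functor T F" and A: "A \<in> Obj T"
  shows "colim (\<lambda>_. A) (\<lambda>_. idn T A) F (\<lambda>_. e) \<longleftrightarrow> represents F A e"
proof
  assume c: "colim (\<lambda>_. A) (\<lambda>_. idn T A) F (\<lambda>_. e)"
  show "represents F A e"
    unfolding represents_def
  proof (intro conjI ballI allI impI A)
    show "e \<in> el F A" using colimD(2)[OF c] .
    fix W x assume W: "W \<in> Obj T" "x \<in> el F W"
    show "\<exists>p. arr W A p \<and> x = FA F p e" using colim_surj[OF c W] by blast
  next
    fix W p assume p: "arr W A p \<and> FA F p e = un F W"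
    then obtain N where "transit (\<lambda>_. A) (\<lambda>_. idn T A) 0 N \<cdot> p = zr W A" using colim_inj[OF c, where A = W and n = 0 and p = p] by blast
    then show "p = zr W A" using transit_const[OF A] id_left p by metis
  qed
next
  assume r: "represents F A e"
  then have e: "e \<in> el F A" unfolding represents_def by blast
  show "colim (\<lambda>_. A) (\<lambda>_. idn T A) F (\<lambda>_. e)"
    unfolding colim_def
  proof (intro conjI ballI allI impI seq_const[OF A] e)
    show "FA F (idn T A) e = e" by (rule afD(5)[OF F A e])
    fix W x assume "W \<in> Obj T" "x \<in> el F W"
    then show "\<exists>n p. arr W A p \<and> x = FA F p e" using r unfolding represents_def by blast
  next
    fix W n p assume p: "arr W A p \<and> FA F p e = un F W"
    then have "p = zr W A" using r unfolding represents_def by blast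
    then have "transit (\<lambda>_. A) (\<lambda>_. idn T A) n n \<cdot> p = zr W A" using transit_const[OF A] id_left p by metis
    then show "\<exists>N\<ge>n. transit (\<lambda>_. A) (\<lambda>_. idn T A) n N \<cdot> p = zr W A" by blast
  qed
qed

lemma represents_exists:
  assumes A: "A \<in> Obj T"
  obtains F :: "('o, 'm) modf" and e where "additive_functor T F" "represents F A e"
proof -
  obtain F :: "('o, 'm) modf" and e where F: "additive_functor T F" "colim (\<lambda>_. A) (\<lambda>_. idn T A) F e"
    using colim_model_exists[OF seq_const[OF A]] .
  have "e (Suc n) = e n" for n
    using colimD(3)[OF F(2), of n] afD(5)[OF F(1) A colimD(2)[OF F(2)]] by simp
  then have "e n = e 0" for n by (induction n) simp_all
  then have "e = (\<lambda>_. e 0)" by (rule ext)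
  then have "colim (\<lambda>_. A) (\<lambda>_. idn T A) F (\<lambda>_. e 0)" using F(2) by simp
  then show thesis using that F(1) represents_col[OF F(1) A] by blast
qed

lemma representsD:
  assumes "represents F A e"
  shows "A \<in> Obj T" "e \<in> el F A" "arr W A p \<Longrightarrow> FA F p e = un F W \<Longrightarrow> p = zr W A"
  using assms unfolding represents_def by blast+

lemma represents_surj:
  assumes "represents F A e" "W \<in> Obj T" "x \<in> el F W" obtains p where "arr W A p" "x = FA F p e"
  using assms unfolding represents_def by blast

end

context metric_category
begin

lemma cauchy_const: assumes "A \<in> Obj T" shows "cauchy T \<BB> (\<lambda>_. A) (\<lambda>_. idn T A)"
proof (rule cauchyI[OF seq_const[OF assms]])
  fix i
  obtain Z where "is_zero T Z" using zero_exists by blast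
  then show "\<exists>n. \<forall>j\<ge>n. \<exists>Q\<in>\<BB> i. \<exists>v w. dt A A Q (idn T A) v w"
    using dt_id[OF assms] metricD(3) by blast
qed

end

section \<open>t-structures on the completion\<close>

text \<open>\<open>deep\<close> makes the transition maps of a Cauchy sequence eventually invisible
  to the coaisle; \<open>bounded\<close> makes the functors represented by objects compactly
  supported, so that they belong to the completion.\<close>

locale tstr_metric = metric_category T \<BB> for T :: "('o, 'm, 'z) tcat_scheme" and \<BB> +
  fixes L R :: "'o set"
  assumes t_str: "t_structure T (L, R)"
    and deep: "\<exists>m. \<BB> m \<subseteq> shsub T 1 L"
    and bounded: "\<And>X. X \<in> Obj T \<Longrightarrow> \<exists>i. \<forall>B\<in>\<BB> i. hom_zero T B X"
begin

text \<open>The part of the aisle in degrees at most -1, which is what \<open>R\<close> is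
  orthogonal to.\<close>

definition "U = shsub T 1 L"

lemma L_sub: "L \<subseteq> Obj T" and R_sub: "R \<subseteq> Obj T" and L_subcat: "subcat T L" and R_subcat: "subcat T R"
  and U_L: "U \<subseteq> L" and R_shR: "R \<subseteq> shsub T 1 R"
  and orth: "X \<in> U \<Longrightarrow> Y \<in> R \<Longrightarrow> hom_zero T X Y"
  using t_str unfolding t_structure_def U_def subcat_def by auto

lemma U_sub: "U \<subseteq> Obj T" using U_L L_sub by blast

lemma decomp:
  assumes "X \<in> Obj T" obtains A B u v w where "A \<in> U" "B \<in> R" "dt A X B u v w"
proof -
  have "X \<in> star T U R" using assms t_str unfolding t_structure_def U_def by auto
  then show thesis using that U_sub R_sub assms unfolding star_def dt_def by blast
qed

lemma sh_in_U: assumes "X \<in> Obj T" shows "sh T X \<in> U \<longleftrightarrow> X \<in> L"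
proof
  assume "sh T X \<in> U"
  then obtain A where A: "A \<in> L" "isomorphic T (sh T X) (shpow T 1 A)" unfolding U_def shsub_def by blast
  then have "A \<in> Obj T" using L_sub by blast
  then have "isomorphic T A X"
    using A(2) isomorphic_unsh[of X A] assms isomorphic_sym unfolding shpow_1[OF \<open>A \<in> Obj T\<close>] by blast
  then show "X \<in> L" using L_subcat A(1) assms unfolding subcat_def by blast
next
  assume "X \<in> L"
  then show "sh T X \<in> U"
    unfolding U_def shsub_def mem_Collect_eq
    using bexI[of "\<lambda>A. isomorphic T (sh T X) (shpow T 1 A)" X L] isomorphic_refl[OF sh_Obj[OF assms]] assms
    by (simp add: shpow_1)
qed

lemma shU: "X \<in> U \<Longrightarrow> sh T X \<in> U"
  using sh_in_U U_L U_sub by blast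

text \<open>In the truncation triangle of \<open>X\<close> the end \<open>B\<close> has only the
  zero endomorphism, so \<open>X\<close> is isomorphic to \<open>A\<close>. Since \<open>U\<close>
  is given through \<open>L\<close>, closure under this isomorphism is checked after
  desuspending.\<close>

lemma in_U:
  assumes X: "X \<in> Obj T" and o: "\<And>Y. Y \<in> R \<Longrightarrow> hom_zero T X Y" shows "X \<in> U"
proof -
  obtain A B u v w where d: "A \<in> U" "B \<in> R" "dt A X B u v w" using decomp[OF X] .
  have B: "B \<in> Obj T" using d(2) R_sub by blast
  have "hom_zero T B B" by (rule hom_zero_mid(2)[OF tr_rot[OF trI[OF d(3)]] B o[OF d(2)] orth[OF shU[OF d(1)] d(2)]])
  then have "isomorphic T A X" using tr_zero_right[OF trI[OF d(3)]] is_zero_iff[OF B] by blast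
  then obtain Y where Y: "X = sh T Y" "Y \<in> Obj T" using sh_surj[OF X] by blast
  obtain A' where A': "A = sh T A'" "A' \<in> Obj T" using sh_surj d(1) U_sub by blast
  have "A' \<in> L" using sh_in_U A' d(1) by blast
  moreover have "isomorphic T A' Y" using isomorphic_unsh \<open>isomorphic T A X\<close> A' Y by blast
  ultimately have "Y \<in> L" using L_subcat Y unfolding subcat_def by blast
  then show ?thesis using sh_in_U Y by blast
qed

lemma in_R:
  assumes X: "X \<in> Obj T" and o: "\<And>Y. Y \<in> U \<Longrightarrow> hom_zero T Y X" shows "X \<in> R"
proof -
  obtain A B u v w where d: "A \<in> U" "B \<in> R" "dt A X B u v w" using decomp[OF X] .
  have A: "A \<in> Obj T" using d(1) U_sub by blast
  have t: "tr B (sh T A) (sh T X)" using tr_rot[OF tr_rot[OF trI[OF d(3)]]] .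
  have "hom_zero T (sh T A) (sh T A)"
    by (rule hom_zero_mid(1)[OF t sh_Obj[OF A] orth[OF shU[OF d(1)] d(2)]]) (use hom_zero_sh A X o d(1) in simp)
  then have "is_zero T A" using hom_zero_sh[OF A A] is_zero_iff[OF A] by blast
  then have "isomorphic T X B" using tr_zero_left[OF trI[OF d(3)]] by blast
  then have "isomorphic T B X" using isomorphic_sym X d(2) R_sub by blast
  then show ?thesis using R_subcat d(2) X unfolding subcat_def by blast
qed

lemma U_ext: "tr A X B \<Longrightarrow> A \<in> U \<Longrightarrow> B \<in> U \<Longrightarrow> X \<in> U"
  using in_U[OF trD(2)] hom_zero_mid(2) orth R_sub by blast

lemma L_ext:
  assumes "tr A X B" "A \<in> L" "B \<in> L" shows "X \<in> L"
  using U_ext[OF tr_shift[OF assms(1)]] sh_in_U trD[OF assms(1)] assms(2,3) by blast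

lemma in_L:
  assumes X: "X \<in> Obj T" and o: "\<And>Y. Y \<in> R \<Longrightarrow> hom_zero T X (unsh Y)" shows "X \<in> L"
proof -
  have "sh T X \<in> U"
  proof (rule in_U)
    fix Y assume Y: "Y \<in> R"
    then have YO: "Y \<in> Obj T" using R_sub by blast
    show "hom_zero T (sh T X) Y" using hom_zero_sh[OF X unsh(1)[OF YO]] unsh(2)[OF YO] o[OF Y] by simp
  qed (use X in simp)
  then show ?thesis using sh_in_U[OF X] by blast
qed

lemma L_orth: "X \<in> L \<Longrightarrow> Y \<in> R \<Longrightarrow> hom_zero T X (unsh Y)"
  using hom_zero_sh[of X "unsh Y"] unsh(1,2)[of Y] orth[of "sh T X" Y] sh_in_U[of X] subsetD[OF L_sub, of X]
    subsetD[OF R_sub, of Y] by simp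

lemma trunc_unique:
  assumes "tr A X B" "tr A' X B'" "A \<in> U" "A' \<in> U" "B \<in> R" "B' \<in> R"
  shows "isomorphic T A A'" "isomorphic T B B'"
proof -
  obtain u v w where t: "dt A X B u v w" using assms(1) unfolding tr_def by blast
  obtain u' v' w' where t': "dt A' X B' u' v' w'" using assms(2) unfolding tr_def by blast
  note d = dtD[OF t] and d' = dtD[OF t']
  have ex: "\<exists>k. arr A1 A2 k \<and> u2 \<cdot> k = u1"
    if "dt A1 X B1 u1 v1 w1" "dt A2 X B2 u2 v2 w2" "A1 \<in> U" "B2 \<in> R" for A1 A2 B1 B2 u1 u2 v1 v2 w1 w2
    using tri_lift[OF that(2) dtD(6)[OF that(1)]] hom_zeroD[OF orth[OF that(3,4)] arr_comp[OF dtD(6)[OF that(1)] dtD(7)[OF that(2)]]] by blast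
  obtain k where k: "arr A A' k" "u' \<cdot> k = u" using ex[OF t t' assms(3,6)] by blast
  obtain k' where k': "arr A' A k'" "u \<cdot> k' = u'" using ex[OF t' t assms(4,5)] by blast
  have "k' \<cdot> k = idn T A"
    by (rule tri_cancel_lift[OF t orth[OF shU[OF assms(3)] assms(5)] arr_comp[OF k(1) k'(1)] arr_id[OF d(1)]])
      (use comp_assoc[OF k(1) k'(1) d(6)] k(2) k'(2) id_right[OF d(6)] in simp)
  moreover have "k \<cdot> k' = idn T A'"
    by (rule tri_cancel_lift[OF t' orth[OF shU[OF assms(4)] assms(6)] arr_comp[OF k'(1) k(1)] arr_id[OF d'(1)]])
      (use comp_assoc[OF k'(1) k(1) d'(6)] k(2) k'(2) id_right[OF d'(6)] in simp)
  ultimately have i: "is_iso T A A' k" using is_isoI[OF k(1) k'(1)] by blast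
  then show "isomorphic T A A'" unfolding isomorphic_def by blast
  have s: "is_iso T (sh T A) (sh T A') (shm T k)"
    by (rule is_isoI[OF shm_arr[OF k(1)] shm_arr[OF k'(1)]])
      (use shm_comp[OF k(1) k'(1)] shm_comp[OF k'(1) k(1)] \<open>k' \<cdot> k = idn T A\<close> \<open>k \<cdot> k' = idn T A'\<close>
        shm_idn d(1) d'(1) in simp_all)
  obtain C x y where c: "dt A' X C u' x y" using t' by blast
  \<comment> \<open>The second triangle is transported along \<open>k'\<close> so that both begin
    with \<open>u\<close>; then their cones are isomorphic.\<close>
  obtain v2 w2 where "dt A X B' u v2 w2"
  proof -
    have ob: "arr B' (sh T A) (shm T k' \<cdot> w')" by (rule arr_comp[OF d'(8) shm_arr[OF k'(1)]])
    have "tri T A X B' u v' (shm T k' \<cdot> w')"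
      by (rule tri_iso[OF d'(1-3) d(1,2) d'(3) d'(4) arrD(3)[OF d(6)] arrD(3)[OF d'(7)] arrD(3)[OF ob]
            is_isoI[OF k'(1) k(1) \<open>k \<cdot> k' = idn T A'\<close> \<open>k' \<cdot> k = idn T A\<close>]
            is_iso_id[OF d(2)] is_iso_id[OF d'(3)]])
        (use k'(2) id_left[OF d'(6)] id_left[OF d'(7)] id_right[OF d'(7)] id_right[OF ob] in simp_all)
    then show thesis using that d d' unfolding dt_def by blast
  qed
  then show "isomorphic T B B'" using cone_unique[OF t] by blast
qed

text \<open>Objects of the coaisle receive no maps from \<open>Q\<close> and from \<open>\<Sigma>\<^sup>-\<^sup>1Q\<close>, so that maps to the coaisle
  extend uniquely along a map with cone \<open>Q\<close>.\<close>

definition deep_object :: "'o \<Rightarrow> bool" where "deep_object Q \<longleftrightarrow> Q \<in> U \<and> unsh Q \<in> U"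

definition deep_seq :: "(nat \<Rightarrow> 'o) \<Rightarrow> (nat \<Rightarrow> 'm) \<Rightarrow> bool"
  where "deep_seq X f \<longleftrightarrow> seq X f \<and> (\<forall>n. \<exists>Q v w. dt (X n) (X (Suc n)) Q (f (Suc n)) v w \<and> deep_object Q)"

text \<open>One further step in the metric, so that the desuspension of \<open>Q\<close> still lies
  in the neighbourhood contained in \<open>U\<close>.\<close>

lemma deep_index: "\<exists>m. \<forall>Q\<in>\<BB> m. deep_object Q"
proof -
  obtain m where m: "\<BB> m \<subseteq> U" using deep unfolding U_def by blast
  have "deep_object Q" if "Q \<in> \<BB> (Suc m)" for Q
    unfolding deep_object_def using m metricD(5)[of m] metricD(7)[OF that] that by blast
  then show ?thesis by blast
qed

lemma deep_tail:
  assumes c: "cauchy T \<BB> X f"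
  shows "\<exists>N. \<forall>n\<ge>N. \<exists>Q v w. dt (X n) (X (Suc n)) Q (f (Suc n)) v w \<and> deep_object Q"
proof -
  obtain m where m: "\<forall>Q\<in>\<BB> m. deep_object Q" using deep_index by blast
  obtain N where "\<forall>j\<ge>N. \<exists>Q\<in>\<BB> m. \<exists>v w. dt (X j) (X (Suc j)) Q (f (Suc j)) v w" using cauchyD(2)[OF c] by blast
  then have "\<exists>Q v w. dt (X n) (X (Suc n)) Q (f (Suc n)) v w \<and> deep_object Q" if "N \<le> n" for n using that m by blast
  then show ?thesis by blast
qed

lemma GGE_deep:
  assumes "F \<in> GG T \<BB> V"
  obtains X f e where "additive_functor T F" "comp_supp F" "\<And>n. X n \<in> V" "cauchy T \<BB> X f" "colim X f F e" "deep_seq X f"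
proof -
  obtain X f e where X: "additive_functor T F" "comp_supp F" "\<And>n. X n \<in> V" "cauchy T \<BB> X f" "colim X f F e"
    using GGE[OF assms] by blast
  obtain N where N: "\<forall>n\<ge>N. \<exists>Q v w. dt (X n) (X (Suc n)) Q (f (Suc n)) v w \<and> deep_object Q"
    using deep_tail[OF X(4)] by blast
  let ?X = "\<lambda>n. X (n + N)" and ?f = "\<lambda>n. f (n + N)"
  have c: "cauchy T \<BB> ?X ?f" by (rule cauchy_tail[OF X(4)])
  have "deep_seq ?X ?f" unfolding deep_seq_def using cauchyD(1)[OF c] N by simp
  then show thesis using that[OF X(1,2) _ c colim_tail[OF X(1,5)]] X(3) by blast
qed

lemma deep_ext:
  assumes t: "dt X X' Q u v w" and h: "arr X Y h" and z: "hom_zero T (unsh Q) Y"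
  obtains h' where "arr X' Y h'" "h' \<cdot> u = h"
proof -
  have Q: "Q \<in> Obj T" using dtD(3)[OF t] .
  obtain p where p: "dt (unsh Q) X X' p u v"
    using unrotate[of X X' "unsh Q" u v w] t unsh(1,2)[OF Q] by auto
  have "h \<cdot> p = zr (unsh Q) Y" using hom_zeroD[OF z arr_comp[OF dtD(6)[OF p] h]] .
  then show thesis using tri_ext[OF p h] that by blast
qed

text \<open>The octahedron on \<open>X\<close> to \<open>X'\<close> to \<open>B\<close>: when both
  truncations have the same coaisle end \<open>B\<close>, the induced map of aisle parts has the
  same cone \<open>Q\<close> as \<open>f\<close>. This is why truncating a Cauchy sequence leaves it
  Cauchy.\<close>

lemma trunc_step:
  assumes t: "dt X X' Q f i i'" and t1: "dt A X B a (b' \<cdot> f) w" and t2: "dt A' X' B a' b' w'"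
  obtains g v2 w2 where "dt A A' Q g v2 w2" "a' \<cdot> g = f \<cdot> a" "shm T g \<cdot> w = w'"
proof -
  note d = dtD[OF t] and d1 = dtD[OF t1] and d2 = dtD[OF t2]
  obtain ff gg t' where o: "dt Q (sh T A) (sh T A') ff gg t'" "gg \<cdot> w = w'"
    "neg (sh T A') (sh T X') (shm T a') \<cdot> gg = shm T f \<cdot> neg (sh T A) (sh T X) (shm T a)"
    using octa[OF t rotate[OF t2] rotate[OF t1]] by metis
  obtain g where g: "arr A A' g" "shm T g = gg" using shm_surj[OF dtD(7)[OF o(1)] d1(1) d2(1)] by blast
  have "neg (sh T A) (sh T X') (shm T (a' \<cdot> g)) = neg (sh T A) (sh T X') (shm T (f \<cdot> a))"
    using o(3) comp_neg_left[OF shm_arr[OF g(1)] shm_arr[OF d2(6)]]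
      comp_neg_right[OF shm_arr[OF d1(6)] shm_arr[OF d(6)]] shm_comp[OF g(1) d2(6)]
      shm_comp[OF d1(6) d(6)] g(2) by simp
  then have e: "a' \<cdot> g = f \<cdot> a"
    using neg_inj[OF shm_arr[OF arr_comp[OF g(1) d2(6)]] shm_arr[OF arr_comp[OF d1(6) d(6)]]]
      shm_inj[OF arr_comp[OF g(1) d2(6)] arr_comp[OF d1(6) d(6)]] by blast
  have r: "dt (sh T A) (sh T A') (sh T Q) (shm T g) t' (neg (sh T Q) (sh T (sh T A)) (shm T ff))"
    using rotate[OF o(1)] g(2) by simp
  obtain v2 w2 where "dt A A' Q g v2 w2" using dt_unshift[OF r g(1) d(3)] .
  then show thesis using that e o(2) g(2) by blast
qed

text \<open>\<open>B\<close> is fixed by truncating \<open>X 0\<close>; the map to it is extended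
  along the deep transition maps, and \<open>A n\<close> is the cocone of the extended map.
  \<open>A n\<close> stays in \<open>U\<close> because it arises from \<open>A 0\<close> by
  extensions with deep cones.\<close>

lemma trunc_seq:
  assumes c: "cauchy T \<BB> X f" and ds: "deep_seq X f"
  obtains B A a b w g where "B \<in> R" "\<And>n. A n \<in> U" "\<And>n. dt (A n) (X n) B (a n) (b n) (w n)"
    "\<And>n. b (Suc n) \<cdot> f (Suc n) = b n" "\<And>n. a (Suc n) \<cdot> g (Suc n) = f (Suc n) \<cdot> a n"
    "\<And>n. shm T (g (Suc n)) \<cdot> w n = w (Suc n)" "cauchy T \<BB> A g"
proof -
  have s: "seq X f" and dd: "\<And>n. \<exists>Q v w. dt (X n) (X (Suc n)) Q (f (Suc n)) v w \<and> deep_object Q"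
    using ds unfolding deep_seq_def by blast+
  obtain A0 B a0 b0 w0 where B: "A0 \<in> U" "B \<in> R" "dt A0 (X 0) B a0 b0 w0" using decomp[OF seqD(2)[OF s]] .
  have step: "\<exists>h'. arr (X (Suc n)) B h' \<and> h' \<cdot> f (Suc n) = h" if "arr (X n) B h" for n h
  proof -
    obtain Q v w where Q: "dt (X n) (X (Suc n)) Q (f (Suc n)) v w" "deep_object Q" using dd by blast
    have "hom_zero T (unsh Q) B" using orth Q(2) B(2) unfolding deep_object_def by blast
    then show ?thesis using deep_ext[OF Q(1) that] by metis
  qed
  have "\<exists>b. \<forall>n. (arr (X n) B (b n) \<and> (n = 0 \<longrightarrow> b n = b0)) \<and> b (Suc n) \<cdot> f (Suc n) = b n"
  proof (rule dependent_nat_choice)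
    show "\<exists>x. arr (X 0) B x \<and> (0 = (0::nat) \<longrightarrow> x = b0)" using dtD(7)[OF B(3)] by blast
    fix x and n :: nat assume "arr (X n) B x \<and> (n = 0 \<longrightarrow> x = b0)"
    then show "\<exists>y. (arr (X (Suc n)) B y \<and> (Suc n = 0 \<longrightarrow> y = b0)) \<and> y \<cdot> f (Suc n) = x" using step by blast
  qed
  then obtain b where b: "\<And>n. arr (X n) B (b n)" "b 0 = b0" "\<And>n. b (Suc n) \<cdot> f (Suc n) = b n" by blast
  \<comment> \<open>For positive \<open>n\<close> any cocone will do; that it lies in
    \<open>U\<close> is proved afterwards by induction.\<close>
  have "\<exists>x. case x of (A, a, w) \<Rightarrow> dt A (X n) B a (b n) w \<and> (n = 0 \<longrightarrow> A \<in> U)" for n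
  proof (cases n)
    case 0
    then show ?thesis using B(1,3) b(2) by (intro exI[of _ "(A0, a0, w0)"]) simp
  next
    case (Suc k)
    then show ?thesis using cocone_exists[OF b(1)[of n]] by auto
  qed
  then have "\<forall>n. \<exists>x. case x of (A, a, w) \<Rightarrow> dt A (X n) B a (b n) w \<and> (n = 0 \<longrightarrow> A \<in> U)" ..
  from choice[OF this] obtain S
    where S: "\<And>n. case S n of (A, a, w) \<Rightarrow> dt A (X n) B a (b n) w \<and> (n = 0 \<longrightarrow> A \<in> U)" by blast
  define A where "A n = fst (S n)" for n
  define a where "a n = fst (snd (S n))" for n
  define w where "w n = snd (snd (S n))" for n
  have t: "dt (A n) (X n) B (a n) (b n) (w n)" and A0: "A 0 \<in> U" for n
    using S[of n] S[of 0] unfolding A_def a_def w_def by (auto split: prod.splits)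
  define P where "P n g Q \<longleftrightarrow> a (Suc n) \<cdot> g = f (Suc n) \<cdot> a n \<and> shm T g \<cdot> w n = w (Suc n) \<and> deep_object Q \<and>
      (\<exists>v2 w2. dt (A n) (A (Suc n)) Q g v2 w2) \<and> (\<exists>v w. dt (X n) (X (Suc n)) Q (f (Suc n)) v w)" for n g Q
  have "\<exists>g Q. a (Suc n) \<cdot> g = f (Suc n) \<cdot> a n \<and> shm T g \<cdot> w n = w (Suc n) \<and> deep_object Q \<and>
      (\<exists>v2 w2. dt (A n) (A (Suc n)) Q g v2 w2) \<and> (\<exists>v w. dt (X n) (X (Suc n)) Q (f (Suc n)) v w)" for n
  proof -
    obtain Q v w' where Q: "dt (X n) (X (Suc n)) Q (f (Suc n)) v w'" "deep_object Q" using dd by blast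
    have t1: "dt (A n) (X n) B (a n) (b (Suc n) \<cdot> f (Suc n)) (w n)" using t b(3) by simp
    obtain g v2 w2 where "dt (A n) (A (Suc n)) Q g v2 w2" "a (Suc n) \<cdot> g = f (Suc n) \<cdot> a n"
      "shm T g \<cdot> w n = w (Suc n)" using trunc_step[OF Q(1) t1 t] .
    then show ?thesis using Q by blast
  qed
  then have "\<forall>n. \<exists>g Q. P n g Q" unfolding P_def ..
  then obtain g0 Q where "\<And>n. P n (g0 n) (Q n)" by metis
  then have g0: "\<And>n. a (Suc n) \<cdot> g0 n = f (Suc n) \<cdot> a n" "\<And>n. shm T (g0 n) \<cdot> w n = w (Suc n)"
    "\<And>n. deep_object (Q n)" "\<And>n. \<exists>v2 w2. dt (A n) (A (Suc n)) (Q n) (g0 n) v2 w2"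
    "\<And>n. \<exists>v w. dt (X n) (X (Suc n)) (Q n) (f (Suc n)) v w" unfolding P_def by blast+
  define g where "g n = g0 (n - 1)" for n
  have gS: "g (Suc n) = g0 n" for n by (simp add: g_def)
  have AU: "A n \<in> U" for n
  proof (induction n)
    case (Suc n)
    have "tr (A n) (A (Suc n)) (Q n)" using g0(4) unfolding tr_def by blast
    then show ?case using U_ext Suc g0(3) unfolding deep_object_def by blast
  qed (rule A0)
  have sA: "seq A g" unfolding seq_def gS using g0(4) dtD(6) by blast
  have "cauchy T \<BB> A g"
  proof (rule cauchyI[OF sA])
    fix i
    obtain N where N: "\<forall>j\<ge>N. \<exists>Q\<in>\<BB> i. \<exists>v w. dt (X j) (X (Suc j)) Q (f (Suc j)) v w" using cauchyD(2)[OF c] by blast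
    have "\<exists>Q\<in>\<BB> i. \<exists>v w. dt (A j) (A (Suc j)) Q (g (Suc j)) v w" if "N \<le> j" for j
    proof -
      \<comment> \<open>\<open>Q'\<close> from the Cauchy condition and the deep cone
        \<open>Q j\<close> are cones of the same map, hence isomorphic, and the neighbourhood is
        closed under isomorphism.\<close>
      obtain Q' v w where Q': "Q' \<in> \<BB> i" "dt (X j) (X (Suc j)) Q' (f (Suc j)) v w" using N \<open>N \<le> j\<close> by blast
      obtain v1 w1 where "dt (X j) (X (Suc j)) (Q j) (f (Suc j)) v1 w1" using g0(5) by blast
      then have "isomorphic T Q' (Q j)" by (rule cone_unique[OF Q'(2)])
      moreover obtain v2 w2 where "dt (A j) (A (Suc j)) (Q j) (g (Suc j)) v2 w2" using g0(4) gS by metis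
      ultimately show ?thesis using metricD(2)[OF Q'(1)] dtD(3) by blast
    qed
    then show "\<exists>n. \<forall>j\<ge>n. \<exists>Q\<in>\<BB> i. \<exists>v w. dt (A j) (A (Suc j)) Q (g (Suc j)) v w" by blast
  qed
  then show thesis using that[OF B(2) AU t b(3), of g] g0(1,2) gS by simp
qed

text \<open>Elements at a shifted metric object are maps to \<open>B\<close>; moving the shift to
  \<open>B\<close> makes \<open>bounded\<close> applicable.\<close>

lemma comp_supp_rep:
  assumes F: "additive_functor T F" and r: "represents F B e" shows "comp_supp F"
  unfolding comp_supp_def
proof
  fix j
  have B: "B \<in> Obj T" using representsD(1)[OF r] .
  obtain i where i: "\<forall>W\<in>\<BB> i. hom_zero T W (shpow T (- j) B)" using bounded[OF shpow_Obj[OF B]] by blast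
  have "el F (shpow T j W) = {un F (shpow T j W)}" if W: "W \<in> \<BB> i" for W
  proof -
    have WO: "W \<in> Obj T" using W metricD(1)[of i] by blast
    have z: "hom_zero T (shpow T j W) B"
      using hom_zero_shpow2[OF WO B, of j 0] i W by simp
    have "x = un F (shpow T j W)" if x: "x \<in> el F (shpow T j W)" for x
    proof -
      obtain p where p: "arr (shpow T j W) B p" "x = FA F p e" using represents_surj[OF r shpow_Obj[OF WO] x] .
      then show ?thesis using hom_zeroD[OF z p(1)] fa_zr[OF F shpow_Obj[OF WO] B representsD(2)[OF r]] by simp
    qed
    then show ?thesis using un_el[OF F shpow_Obj[OF WO]] by blast
  qed
  then show "\<exists>i. \<forall>W\<in>\<BB> i. el F (shpow T j W) = {un F (shpow T j W)}" by blast
qed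

lemma represents_GG:
  assumes F: "additive_functor T F" and r: "represents F B e" and B: "B \<in> V" shows "F \<in> GG T \<BB> V"
  by (rule GGI[OF F comp_supp_rep[OF F r] B cauchy_const[OF representsD(1)[OF r]]])
    (use represents_col[OF F representsD(1)[OF r]] r in blast)

text \<open>Assembles the truncation triangles of the stages into a triangle of the completion whose
  third sequence is constant at \<open>B\<close>. The point that is not formal is that the colimit
  of the \<open>A n\<close> is compactly supported.\<close>

lemma trunc_star:
  assumes F: "F \<in> GG T \<BB> (Obj T)" and c: "cauchy T \<BB> X f" and cF: "colim X f F e"
    and BV: "B \<in> W" and AV: "\<And>n. A n \<in> V" and BR: "B \<in> R" and WO: "W \<subseteq> Obj T" and VO: "V \<subseteq> Obj T"
    and t: "\<And>n. dt (A n) (X n) B (a n) (b n) (w n)" and bf: "\<And>n. b (Suc n) \<cdot> f (Suc n) = b n"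
    and ag: "\<And>n. a (Suc n) \<cdot> g (Suc n) = f (Suc n) \<cdot> a n" and gw: "\<And>n. shm T (g (Suc n)) \<cdot> w n = w (Suc n)"
    and cA: "cauchy T \<BB> A g"
  shows "F \<in> star CC (GG T \<BB> V) (GG T \<BB> W)"
proof -
  note Fa = GG_additive[OF F] and sX = cauchyD(1)[OF c] and sA = cauchyD(1)[OF cA]
  have csF: "comp_supp F" using F unfolding GG_iff by blast
  have B: "B \<in> Obj T" using BV WO by blast
  obtain F1 :: "('o, 'm) modf" and e1 where F1: "additive_functor T F1" "colim A g F1 e1" using colim_model_exists[OF sA] .
  obtain F2 :: "('o, 'm) modf" and e2 where F2: "additive_functor T F2" "represents F2 B e2" using represents_exists[OF B] .
  have c2: "colim (\<lambda>_. B) (\<lambda>_. idn T B) F2 (\<lambda>_. e2)" using represents_col[OF F2(1) B] F2(2) by blast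
  note a = dtD(6)[OF t] and b = dtD(7)[OF t] and w = dtD(8)[OF t]
  have bi: "idn T B \<cdot> b n = b (Suc n) \<cdot> f (Suc n)" for n using id_left[OF b] bf by simp
  have wi: "shm T (g (Suc n)) \<cdot> w n = w (Suc n) \<cdot> idn T B" for n using id_right[OF w] gw by simp
  obtain \<eta> where \<eta>: "nat_trans T F1 F \<eta>"
    "\<And>n W p. arr W (A n) p \<Longrightarrow> \<eta> W (FA F1 p (e1 n)) = FA F (a n \<cdot> p) (e n)"
    by (rule colim_map[OF F1(1) Fa F1(2) cF a ag[symmetric]]) blast
  obtain \<theta> where \<theta>: "nat_trans T F F2 \<theta>"
    "\<And>n W p. arr W (X n) p \<Longrightarrow> \<theta> W (FA F p (e n)) = FA F2 (b n \<cdot> p) e2"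
    by (rule colim_map[OF Fa F2(1) cF c2 b bi]) blast
  obtain \<zeta> where \<zeta>: "nat_trans T F2 (sh_functor T F1) \<zeta>"
    "\<And>n W p. arr W B p \<Longrightarrow> \<zeta> W (FA F2 p e2) = FA (sh_functor T F1) (w n \<cdot> p) (e1 n)"
    by (rule colim_map[OF F2(1) sh_functor_additive[OF F1(1)] c2 colim_sh[OF F1] w wi]) blast
  have tri: "colimit_triangle T \<BB> F1 F F2 \<eta> \<theta> \<zeta>"
    unfolding colimit_triangle_def
  proof (intro conjI \<eta>(1) \<theta>(1) \<zeta>(1))
    show "\<exists>X Y Z f g h u v w c d e.
      cauchy T \<BB> X f \<and> cauchy T \<BB> Y g \<and> cauchy T \<BB> Z h \<and>
      (\<forall>n. tri T (X n) (Y n) (Z n) (u n) (v n) (w n) \<and>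
        g (Suc n) \<cdot> u n = u (Suc n) \<cdot> f (Suc n) \<and>
        h (Suc n) \<cdot> v n = v (Suc n) \<cdot> g (Suc n) \<and>
        shm T (f (Suc n)) \<cdot> w n = w (Suc n) \<cdot> h (Suc n)) \<and>
      yoneda_colimit T X f F1 c \<and> yoneda_colimit T Y g F d \<and> yoneda_colimit T Z h F2 e \<and>
      (\<forall>n. \<forall>A\<in>Obj T.
        (\<forall>p\<in>Hom T A (X n). \<eta> A (c n A p) = d n A (u n \<cdot> p)) \<and>
        (\<forall>p\<in>Hom T A (Y n). \<theta> A (d n A p) = e n A (v n \<cdot> p)) \<and>
        (\<forall>p\<in>Hom T A (Z n). \<zeta> A (e n A p) =
          c n (shpow T (- 1) A) (shm_inv T (w n \<cdot> p))))"
    proof (rule exI[of _ A], rule exI[of _ X], rule exI[of _ "\<lambda>_. B"], rule exI[of _ g], rule exI[of _ f],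
        rule exI[of _ "\<lambda>_. idn T B"], rule exI[of _ a], rule exI[of _ b], rule exI[of _ w],
        rule exI[of _ "\<lambda>n. yoneda_map (A n) F1 (e1 n)"], rule exI[of _ "\<lambda>n. yoneda_map (X n) F (e n)"],
        rule exI[of _ "\<lambda>n. yoneda_map B F2 e2"], intro conjI allI ballI)
      show "cauchy T \<BB> A g" "cauchy T \<BB> X f" "cauchy T \<BB> (\<lambda>_. B) (\<lambda>_. idn T B)"
        using cA c cauchy_const[OF B] .
      show "yoneda_colimit T A g F1 (\<lambda>n. yoneda_map (A n) F1 (e1 n))" by (rule colim_yoneda_colimit[OF F1])
      show "yoneda_colimit T X f F (\<lambda>n. yoneda_map (X n) F (e n))" by (rule colim_yoneda_colimit[OF Fa cF])
      show "yoneda_colimit T (\<lambda>_. B) (\<lambda>_. idn T B) F2 (\<lambda>n. yoneda_map B F2 e2)"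
        by (rule colim_yoneda_colimit[OF F2(1) c2])
      fix n
      show "tri T (A n) (X n) B (a n) (b n) (w n)" by (rule dtD(4)[OF t])
      show "f (Suc n) \<cdot> a n = a (Suc n) \<cdot> g (Suc n)" using ag by simp
      show "idn T B \<cdot> b n = b (Suc n) \<cdot> f (Suc n)" by (rule bi)
      show "shm T (g (Suc n)) \<cdot> w n = w (Suc n) \<cdot> idn T B" by (rule wi)
      fix V assume V: "V \<in> Obj T"
      show "\<eta> V (yoneda_map (A n) F1 (e1 n) V p) = yoneda_map (X n) F (e n) V (a n \<cdot> p)" if "p \<in> Hom T V (A n)" for p
      proof -
        have p: "arr V (A n) p" using that V dtD(1)[OF t] by (simp add: arr_def)
        show ?thesis unfolding yoneda_map_apply[OF p] yoneda_map_apply[OF arr_comp[OF p a]] by (rule \<eta>(2)[OF p])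
      qed
      show "\<theta> V (yoneda_map (X n) F (e n) V p) = yoneda_map B F2 e2 V (b n \<cdot> p)" if "p \<in> Hom T V (X n)" for p
      proof -
        have p: "arr V (X n) p" using that V dtD(2)[OF t] by (simp add: arr_def)
        show ?thesis unfolding yoneda_map_apply[OF p] yoneda_map_apply[OF arr_comp[OF p b]] by (rule \<theta>(2)[OF p])
      qed
      show "\<zeta> V (yoneda_map B F2 e2 V p) = yoneda_map (A n) F1 (e1 n) (shpow T (- 1) V) (shm_inv T (w n \<cdot> p))"
        if "p \<in> Hom T V B" for p
      proof -
        have p: "arr V B p" using that V B by (simp add: arr_def)
        note wp = arr_comp[OF p w[of n]]
        have q: "arr (unsh V) (A n) (shm_inv T (w n \<cdot> p))"
          using shm_inv(1)[OF wp] unsh(3)[OF dtD(1)[OF t]] by simp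
        show ?thesis
          unfolding yoneda_map_apply[OF p] \<zeta>(2)[OF p, of n] sh_functor_simps(2)[OF wp] shpow_m1[OF V] yoneda_map_apply[OF q] ..
      qed
    qed
  qed
  have cs1: "comp_supp F1"
    unfolding comp_supp_def
  proof
    fix j
    obtain i1 where i1: "\<forall>B'\<in>\<BB> i1. el F (shpow T j B') = {un F (shpow T j B')}" using csF unfolding comp_supp_def by blast
    \<comment> \<open>An element of \<open>F1\<close> over a metric object that dies in
      \<open>F\<close> is controlled by maps from the suspension of that object to \<open>B\<close>;
      hence the degree \<open>j + 1\<close>.\<close>
    obtain i2 where i2: "\<forall>B'\<in>\<BB> i2. hom_zero T B' (shpow T (- (j + 1)) B)" using bounded[OF shpow_Obj[OF B]] by blast
    let ?i = "max i1 i2"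
    have sub: "\<BB> ?i \<subseteq> \<BB> i1" "\<BB> ?i \<subseteq> \<BB> i2" using metricD_mono[of i1 ?i] metricD_mono[of i2 ?i] by auto
    have "el F1 (shpow T j B') = {un F1 (shpow T j B')}" if B': "B' \<in> \<BB> ?i" for B'
    proof -
      have BO: "B' \<in> Obj T" using B' metricD(1)[of ?i] by blast
      let ?W = "shpow T j B'"
      have WOb: "?W \<in> Obj T" using BO by simp
      have z: "hom_zero T (sh T ?W) B"
        using hom_zero_shpow2[OF BO B, of "j + 1" 0] i2 B' sub(2) shpow_suc[OF BO, of j] by auto
      have "x = un F1 ?W" if x: "x \<in> el F1 ?W" for x
      proof -
        obtain n p where p: "arr ?W (A n) p" "x = FA F1 p (e1 n)" using colim_surj[OF F1(2) WOb x] .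
        have "\<eta> ?W x \<in> el F ?W" by (rule ntD(4)[OF \<eta>(1) WOb x])
        then have "FA F (a n \<cdot> p) (e n) = un F ?W" using i1 B' sub(1) \<eta>(2)[OF p(1)] p(2) by auto
        then obtain N where N: "n \<le> N" "transit X f n N \<cdot> (a n \<cdot> p) = zr ?W (X N)"
          using colim_inj[OF cF arr_comp[OF p(1) a]] by blast
        have gp: "arr ?W (A N) (transit A g n N \<cdot> p)" by (rule arr_comp[OF p(1) transit_arr[OF sA N(1)]])
        have "a N \<cdot> (transit A g n N \<cdot> p) = transit X f n N \<cdot> (a n \<cdot> p)"
          using comp_assoc[OF p(1) transit_arr[OF sA N(1)] a] comp_assoc[OF p(1) a transit_arr[OF sX N(1)]]
            transit_nat[where u = a, OF sA sX a ag[symmetric] N(1)] by simp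
        then have "a N \<cdot> (transit A g n N \<cdot> p) = a N \<cdot> zr ?W (A N)"
          using N(2) comp_zr_right[OF a WOb] by simp
        then have "transit A g n N \<cdot> p = zr ?W (A N)"
          by (rule tri_cancel_lift[OF t z gp arr_zr[OF WOb dtD(1)[OF t]]])
        then have "FA F1 (zr ?W (A N)) (e1 N) = x" using colim_push[OF F1 N(1) p(1)] p(2) by simp
        then show ?thesis using fa_zr[OF F1(1) WOb dtD(1)[OF t] colimD(2)[OF F1(2)]] by simp
      qed
      then show ?thesis using un_el[OF F1(1) WOb] by blast
    qed
    then show "\<exists>i. \<forall>B'\<in>\<BB> i. el F1 (shpow T j B') = {un F1 (shpow T j B')}" by blast
  qed
  have G1: "F1 \<in> GG T \<BB> V" by (rule GGI[OF F1(1) cs1 AV cA F1(2)])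
  have G2: "F2 \<in> GG T \<BB> W" by (rule represents_GG[OF F2 BV])
  have "tri CC F1 F F2 (F1, \<eta>, F) (F, \<theta>, F2) (F2, \<zeta>, sh_functor T F1)"
    unfolding CC_simps using tri F GG_mono[OF VO] GG_mono[OF WO] G1 G2 by blast
  then show ?thesis unfolding star_def CC_simps using F G1 G2 by blast
qed

text \<open>Holds for every Cauchy sequence with colimit \<open>F\<close>, not just for one chosen
  in \<open>L\<close>. Once the cones are deep, a map from \<open>X n\<close> to the desuspended
  coaisle extends to all later stages; at some stage the transition map factors through an object of
  \<open>L\<close>, so the map vanishes.\<close>

lemma GG_L:
  assumes F: "F \<in> GG T \<BB> L" and c: "cauchy T \<BB> X f" and cF: "colim X f F e"
  obtains N where "\<And>n. N \<le> n \<Longrightarrow> X n \<in> L"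
proof -
  obtain X' f' e' where X': "additive_functor T F" "\<And>n. X' n \<in> L" "colim X' f' F e'" using GGE[OF F] by metis
  note s = cauchyD(1)[OF c] and s' = colimD(1)[OF X'(3)]
  note o = seqD(2)[OF s]
  obtain N where N: "\<forall>n\<ge>N. \<exists>Q v w. dt (X n) (X (Suc n)) Q (f (Suc n)) v w \<and> deep_object Q"
    using deep_tail[OF c] by blast
  have "X n \<in> L" if n: "N \<le> n" for n
  proof (rule in_L[OF o])
    fix Y assume Y: "Y \<in> R"
    then have YO: "Y \<in> Obj T" using R_sub by blast
    note uY = unsh(1)[OF YO]
    have ext: "\<exists>h'. arr (X M) (unsh Y) h' \<and> h' \<cdot> transit X f n M = h" if h: "arr (X n) (unsh Y) h" and "n \<le> M" for h M
      using \<open>n \<le> M\<close>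
    proof (induction M)
      case 0
      then show ?case using h id_right[OF h] by (intro exI[of _ h]) simp
    next
      case (Suc M)
      show ?case
      proof (cases "n \<le> M")
        case True
        then obtain h' where h': "arr (X M) (unsh Y) h'" "h' \<cdot> transit X f n M = h" using Suc.IH by blast
        obtain Q v w where Q: "dt (X M) (X (Suc M)) Q (f (Suc M)) v w" "deep_object Q" using N n True by (meson le_trans)
        have QO: "Q \<in> Obj T" using dtD(3)[OF Q(1)] .
        have "hom_zero T (unsh Q) (unsh Y)"
          using hom_zero_sh[OF unsh(1)[OF QO] uY] unsh(2)[OF QO] unsh(2)[OF YO] orth Q(2) Y unfolding deep_object_def by simp
        then obtain h2 where h2: "arr (X (Suc M)) (unsh Y) h2" "h2 \<cdot> f (Suc M) = h'"
          using deep_ext[OF Q(1) h'(1)] by blast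
        have "h2 \<cdot> transit X f n (Suc M) = h"
          using True comp_assoc[OF transit_arr[OF s True] seqD(1)[OF s] h2(1)] h2(2) h'(2) by simp
        then show ?thesis using h2(1) by blast
      next
        case False
        then have "n = Suc M" using Suc.prems by simp
        then show ?thesis using h id_right[OF h] transit_refl[of X f n] by (intro exI[of _ h]) simp
      qed
    qed
    show "hom_zero T (X n) (unsh Y)"
    proof (rule hom_zeroI[OF o uY])
      fix h assume h: "arr (X n) (unsh Y) h"
      obtain m p where p: "arr (X n) (X' m) p" "e n = FA F p (e' m)"
        using colim_surj[OF X'(3) o colimD(2)[OF cF]] .
      obtain n' q where q: "arr (X' m) (X n') q" "e' m = FA F q (e n')"
        using colim_surj[OF cF seqD(2)[OF s'] colimD(2)[OF X'(3)]] .
      note qp = arr_comp[OF p(1) q(1)]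
      \<comment> \<open>In the colimit the identity of \<open>X n\<close> factors through
        \<open>X' m\<close>; equality in the colimit already holds at a finite stage
        \<open>M\<close>.\<close>
      have "FA F (idn T (X n)) (e n) = FA F (q \<cdot> p) (e n')"
        unfolding afD(5)[OF X'(1) o colimD(2)[OF cF]] using afD(6)[OF X'(1) p(1) q(1) colimD(2)[OF cF]] p(2) q(2) by simp
      then obtain M where M: "n \<le> M" "n' \<le> M" "transit X f n M \<cdot> idn T (X n) = transit X f n' M \<cdot> (q \<cdot> p)"
        using colim_eq[OF X'(1) cF arr_id[OF o] qp] by blast
      obtain h' where h': "arr (X M) (unsh Y) h'" "h' \<cdot> transit X f n M = h" using ext[OF h M(1)] by blast
      note tq = arr_comp[OF q(1) transit_arr[OF s M(2)]]
      have "h = h' \<cdot> (transit X f n' M \<cdot> (q \<cdot> p))" using h'(2) M(3) id_right[OF transit_arr[OF s M(1)]] by simp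
      also have "\<dots> = (h' \<cdot> (transit X f n' M \<cdot> q)) \<cdot> p"
        using comp_assoc[OF p(1) q(1) transit_arr[OF s M(2)]] comp_assoc[OF p(1) tq h'(1)] by simp
      also have "h' \<cdot> (transit X f n' M \<cdot> q) = zr (X' m) (unsh Y)"
        by (rule hom_zeroD[OF L_orth[OF X'(2) Y] arr_comp[OF tq h'(1)]])
      finally show "h = zr (X n) (unsh Y)" using comp_zr_left[OF p(1) uY] by simp
    qed
  qed
  then show thesis using that by blast
qed

lemma GG_R_vanish:
  assumes F: "F \<in> GG T \<BB> R" and W: "W \<in> U" shows "el F W = {un F W}"
proof -
  obtain X f e where X: "additive_functor T F" "\<And>n. X n \<in> R" "colim X f F e" using GGE[OF F] by metis
  have WO: "W \<in> Obj T" using W U_sub by blast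
  have "x = un F W" if x: "x \<in> el F W" for x
  proof -
    obtain n p where p: "arr W (X n) p" "x = FA F p (e n)" using colim_surj[OF X(3) WO x] .
    show ?thesis
      using p(2) hom_zeroD[OF orth[OF W X(2)] p(1)] fa_zr[OF X(1) WO arrD(2)[OF p(1)] colimD(2)[OF X(3)]] by simp
  qed
  then show ?thesis using un_el[OF X(1) WO] by blast
qed

text \<open>The truncation map from \<open>F\<close> to the functor of \<open>B\<close> is
  bijective: elements of its kernel come from the \<open>A n\<close>, where \<open>F\<close>
  vanishes.\<close>

lemma GG_R:
  assumes F: "F \<in> GG T \<BB> (Obj T)" and v: "\<And>W. W \<in> U \<Longrightarrow> el F W = {un F W}"
  shows "F \<in> GG T \<BB> R"
proof -
  obtain X f e where X: "additive_functor T F" "comp_supp F" "cauchy T \<BB> X f" "colim X f F e" "deep_seq X f"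
    using GGE_deep[OF F] by metis
  note Fa = X(1) and cF = X(4) and s = cauchyD(1)[OF X(3)]
  obtain B A a b w g where t: "B \<in> R" "\<And>n. A n \<in> U" "\<And>n. dt (A n) (X n) B (a n) (b n) (w n)"
    "\<And>n. b (Suc n) \<cdot> f (Suc n) = b n" using trunc_seq[OF X(3,5)] by metis
  have B: "B \<in> Obj T" using t(1) R_sub by blast
  note a = dtD(6)[OF t(3)] and b = dtD(7)[OF t(3)]
  obtain F2 :: "('o, 'm) modf" and e2 where F2: "additive_functor T F2" "represents F2 B e2" using represents_exists[OF B] .
  have c2: "colim (\<lambda>_. B) (\<lambda>_. idn T B) F2 (\<lambda>_. e2)" using represents_col[OF F2(1) B] F2(2) by blast
  have bi: "idn T B \<cdot> b n = b (Suc n) \<cdot> f (Suc n)" for n using id_left[OF b] t(4) by simp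
  have bt: "b N \<cdot> transit X f n N = b n" if "n \<le> N" for n N
    using transit_nat[where u = b, OF s seq_const[OF B] b bi that] transit_const[OF B] id_left[OF b] by simp
  obtain \<theta> where \<theta>: "nat_trans T F F2 \<theta>"
    "\<And>n W p. arr W (X n) p \<Longrightarrow> \<theta> W (FA F p (e n)) = FA F2 (b n \<cdot> p) e2"
    by (rule colim_map[OF Fa F2(1) cF c2 b bi]) blast
  have Fa0: "FA F (a n) (e n) = un F (A n)" for n
    using fa_closed[OF Fa a colimD(2)[OF cF]] v[OF t(2)] by blast
  have bij: "bij_betw (\<theta> W) (el F W) (el F2 W)" if W: "W \<in> Obj T" for W
  proof -
    interpret gh: group_hom "FO F W" "FO F2 W" "\<theta> W"
      using ntD(2)[OF \<theta>(1) W] el_group[OF Fa W] el_group[OF F2(1) W]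
      by (simp add: group_hom_def group_hom_axioms_def)
    have "x = un F W" if x: "x \<in> el F W" "\<theta> W x = un F2 W" for x
    proof -
      obtain n p where p: "arr W (X n) p" "x = FA F p (e n)" using colim_surj[OF cF W x(1)] .
      have "b n \<cdot> p = zr W B"
        using representsD(3)[OF F2(2) arr_comp[OF p(1) b]] \<theta>(2)[OF p(1)] p(2) x(2) by simp
      then obtain q where q: "arr W (A n) q" "a n \<cdot> q = p" using tri_lift[OF t(3) p(1)] by blast
      have "x = FA F q (FA F (a n) (e n))" using afD(6)[OF Fa q(1) a colimD(2)[OF cF]] q(2) p(2) by simp
      then show ?thesis using Fa0 fa_un[OF Fa q(1)] by simp
    qed
    then have "inj_on (\<theta> W) (el F W)" using gh.inj_on_one_iff by blast
    moreover have "y \<in> \<theta> W ` el F W" if y: "y \<in> el F2 W" for y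
    proof -
      obtain p where p: "arr W B p" "y = FA F2 p e2" using represents_surj[OF F2(2) W y] .
      \<comment> \<open>The element of \<open>F\<close> given by \<open>a 0\<close> is trivial, so
        \<open>a 0\<close> dies at a stage \<open>N\<close>. The transition map then factors through
        \<open>b 0\<close>, which yields a section \<open>s'\<close> of \<open>b N\<close>.\<close>
      obtain N where N: "0 \<le> N" "transit X f 0 N \<cdot> a 0 = zr (A 0) (X N)" using colim_inj[OF cF a Fa0] .
      obtain s' where s': "arr B (X N) s'" "s' \<cdot> b 0 = transit X f 0 N"
        using tri_ext[OF t(3) transit_arr[OF s N(1)] N(2)] .
      have "b N \<cdot> s' = idn T B"
        by (rule tri_cancel_ext[OF t(3)[of 0] orth[OF shU[OF t(2)] t(1)] arr_comp[OF s'(1) b] arr_id[OF B]])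
          (use comp_assoc[OF b s'(1) b] s'(2) bt[OF N(1)] id_left[OF b] in simp)
      then have "b N \<cdot> (s' \<cdot> p) = p" using comp_assoc[OF p(1) s'(1) b] id_left[OF p(1)] by simp
      then have "\<theta> W (FA F (s' \<cdot> p) (e N)) = y" using \<theta>(2)[OF arr_comp[OF p(1) s'(1)]] p(2) by simp
      then show ?thesis using fa_closed[OF Fa arr_comp[OF p(1) s'(1)] colimD(2)[OF cF]] by blast
    qed
    ultimately show ?thesis using ntD(4)[OF \<theta>(1) W] unfolding bij_betw_def by blast
  qed
  obtain \<psi> where "nat_trans T F2 F \<psi>" "\<And>A. A \<in> Obj T \<Longrightarrow> bij_betw (\<psi> A) (el F2 A) (el F A)"
    by (rule nt_inverse[OF \<theta>(1) Fa F2(1) bij]) blast+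
  then show ?thesis using GG_transport[OF _ represents_GG[OF F2 t(1)] Fa] by blast
qed

text \<open>A sequence in the coaisle with deep cones consists of isomorphisms: the boundary map of
  such a cone vanishes by orthogonality, and so does the section this produces, so the cone is
  zero.\<close>

lemma GG_rep:
  assumes F: "F \<in> GG T \<BB> V" and V: "V \<subseteq> R" obtains A e where "A \<in> V" "represents F A e"
proof -
  obtain X f e where X: "additive_functor T F" "\<And>n. X n \<in> V" "cauchy T \<BB> X f" "colim X f F e" "deep_seq X f"
    using GGE_deep[OF F] by metis
  note Fa = X(1) and cF = X(4) and s = cauchyD(1)[OF X(3)]
  note o = seqD(2)[OF s]
  have iso: "is_iso T (X n) (X (Suc n)) (f (Suc n))" for n
  proof -
    obtain Q v w where Q: "dt (X n) (X (Suc n)) Q (f (Suc n)) v w" "deep_object Q" using X(5) unfolding deep_seq_def by blast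
    note d = dtD[OF Q(1)]
    have XR: "X n \<in> R" "X (Suc n) \<in> R" using X(2) V by blast+
    have "hom_zero T Q (sh T (X n))"
      using hom_zero_sh[OF unsh(1)[OF d(3)] d(1)] unsh(2)[OF d(3)] orth XR Q(2) unfolding deep_object_def by simp
    then have "w \<cdot> idn T Q = zr Q (sh T (X n))" using hom_zeroD[OF _ d(8)] id_right[OF d(8)] by simp
    then obtain k where k: "arr Q (X (Suc n)) k" "v \<cdot> k = idn T Q" using tri_lift2[OF Q(1) arr_id[OF d(3)]] by blast
    have "hom_zero T Q (X (Suc n))" using orth XR(2) Q(2) unfolding deep_object_def by blast
    then have "k = zr Q (X (Suc n))" using hom_zeroD k(1) by blast
    then have "is_zero T Q" using is_zeroI_id[OF d(3)] k(2) comp_zr_right[OF d(7) d(3)] by simp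
    then show ?thesis by (rule iso_of_zero_cone[OF Q(1)])
  qed
  have tiso: "is_iso T (X 0) (X n) (transit X f 0 n)" for n
  proof (induction n)
    case 0 then show ?case using is_iso_id[OF o] by simp
  next
    case (Suc n) then show ?case using is_iso_comp[OF Suc iso o o o] by simp
  qed
  have "represents F (X 0) (e 0)"
    unfolding represents_def
  proof (intro conjI ballI allI impI o colimD(2)[OF cF])
    fix W x assume W: "W \<in> Obj T" "x \<in> el F W"
    obtain n p where p: "arr W (X n) p" "x = FA F p (e n)" using colim_surj[OF cF W] .
    obtain i where i: "arr (X n) (X 0) i" "transit X f 0 n \<cdot> i = idn T (X n)" using is_isoD[OF tiso o o] by metis
    note tt = transit_arr[OF s le0, of n]
    have "x = FA F (transit X f 0 n \<cdot> (i \<cdot> p)) (e n)" using comp_assoc[OF p(1) i(1) tt] i(2) id_left[OF p(1)] p(2) by simp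
    also have "\<dots> = FA F (i \<cdot> p) (e 0)" by (rule colim_push[OF Fa cF le0 arr_comp[OF p(1) i(1)]])
    finally show "\<exists>p. arr W (X 0) p \<and> x = FA F p (e 0)" using arr_comp[OF p(1) i(1)] by blast
  next
    fix W p assume a: "arr W (X 0) p \<and> FA F p (e 0) = un F W"
    then have p: "arr W (X 0) p" by blast
    obtain N where N: "0 \<le> N" "transit X f 0 N \<cdot> p = zr W (X N)" using colim_inj[OF cF p conjunct2[OF a]] .
    obtain i where i: "arr (X N) (X 0) i" "i \<cdot> transit X f 0 N = idn T (X 0)" using is_isoD[OF tiso o o] by metis
    have "p = i \<cdot> (transit X f 0 N \<cdot> p)" using comp_assoc[OF p transit_arr[OF s N(1)] i(1)] i(2) id_left[OF p] by simp
    then show "p = zr W (X 0)" using N(2) comp_zr_right[OF i(1) arrD(1)[OF p]] by simp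
  qed
  then show thesis using that X(2) by blast
qed

end

context metric_category
begin

text \<open>A transformation is determined by the images of the universal elements, and each image
  comes from a map between stages of the two sequences.\<close>

lemma hom_zero_GG:
  assumes F: "F \<in> GG T \<BB> V" and G: "G \<in> GG T \<BB> W"
    and z: "\<And>A B. A \<in> V \<Longrightarrow> B \<in> W \<Longrightarrow> hom_zero T A B"
  shows "hom_zero CC F G"
proof -
  note Fa = GG_additive[OF F] and Ga = GG_additive[OF G]
  obtain X f e where X: "\<And>n. X n \<in> V" "colim X f F e" using GGE[OF F] by metis
  obtain Y g d where Y: "\<And>n. Y n \<in> W" "colim Y g G d" using GGE[OF G] by metis
  note oX = seqD(2)[OF colimD(1)[OF X(2)]] and oY = seqD(2)[OF colimD(1)[OF Y(2)]]
  have "\<eta> = zero_nt F G" if n: "nat_trans T F G \<eta>" for \<eta>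
  proof (rule colim_nt_unique[OF X(2) n zero_nt[OF Fa Ga]])
    fix k
    have "\<eta> (X k) (e k) \<in> el G (X k)" by (rule ntD(4)[OF n oX colimD(2)[OF X(2)]])
    then obtain m p where p: "arr (X k) (Y m) p" "\<eta> (X k) (e k) = FA G p (d m)"
      using colim_surj[OF Y(2) oX] by blast
    have "p = zr (X k) (Y m)" by (rule hom_zeroD[OF z[OF X(1) Y(1)] p(1)])
    then show "\<eta> (X k) (e k) = zero_nt F G (X k) (e k)"
      using p(2) fa_zr[OF Ga oX oY colimD(2)[OF Y(2)]] oX colimD(2)[OF X(2)] by (simp add: zero_nt_def)
  qed
  then show ?thesis using CC_hom_zero[OF Fa Ga] by blast
qed

lemma represents_inj:
  assumes F: "additive_functor T F" and r: "represents F A e" and p: "arr W A p" "arr W A q"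
    and e: "FA F p e = FA F q e"
  shows "p = q"
proof -
  have "FA F (add W A p (neg W A q)) e = un F W" by (rule fa_diff[OF F p representsD(2)[OF r] e])
  then have "add W A p (neg W A q) = zr W A" by (rule representsD(3)[OF r arr_add[OF p(1) arr_neg[OF p(2)]]])
  then show ?thesis using add_neg_zr_iff[OF p] by blast
qed

lemma represents_map:
  assumes F: "additive_functor T F" and G: "additive_functor T G" and r: "represents F A e" "represents G B d" and p: "arr A B p"
  obtains \<eta> where "nat_trans T F G \<eta>" "\<And>W q. arr W A q \<Longrightarrow> \<eta> W (FA F q e) = FA G (p \<cdot> q) d"
    "\<eta> A e = FA G p d"
proof -
  note A = arrD(1)[OF p] and B = arrD(2)[OF p]
  have c: "colim (\<lambda>_. A) (\<lambda>_. idn T A) F (\<lambda>_. e)" "colim (\<lambda>_. B) (\<lambda>_. idn T B) G (\<lambda>_. d)"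
    using represents_col[OF F A] represents_col[OF G B] r by blast+
  have i: "idn T B \<cdot> p = p \<cdot> idn T A" using id_left[OF p] id_right[OF p] by simp
  obtain \<eta> where n: "nat_trans T F G \<eta>" "\<And>(n::nat) W q. arr W A q \<Longrightarrow> \<eta> W (FA F q e) = FA G (p \<cdot> q) d"
    by (rule colim_map[OF F G c p i]) blast
  have "\<eta> A e = FA G p d"
    using n(2)[OF arr_id[OF A]] afD(5)[OF F A representsD(2)[OF r(1)]] id_right[OF p] by simp
  then show thesis using that n by blast
qed

lemma represents_nt_eq:
  assumes F: "additive_functor T F" and r: "represents F A e" and n: "nat_trans T F G \<eta>" "nat_trans T F G \<theta>"
    and e: "\<eta> A e = \<theta> A e"
  shows "\<eta> = \<theta>"
  using colim_nt_unique[OF _ n, of "\<lambda>_. A" "\<lambda>_. idn T A" "\<lambda>_. e"] represents_col[OF F representsD(1)[OF r]] r e by blast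

lemma represents_nt_apply:
  assumes "nat_trans T F G \<eta>" "represents F A e" "arr W A q"
  shows "\<eta> W (FA F q e) = FA G q (\<eta> A e)"
  using ntD(5)[OF assms(1,3) representsD(2)[OF assms(2)]] .

end

context tstr_metric
begin

text \<open>Uniqueness of truncations carries a decomposition known for each object of
  \<open>V\<close> separately over to the coherent sequence of truncations.\<close>

lemma trunc_GG:
  assumes F: "F \<in> GG T \<BB> V" and V: "V \<subseteq> Obj T"
    and d: "\<And>X. X \<in> V \<Longrightarrow> \<exists>A\<in>VA. \<exists>B\<in>VB. tr A X B"
    and VA: "VA \<subseteq> U" "subcat T VA" and VB: "VB \<subseteq> R" "subcat T VB"
  shows "F \<in> star CC (GG T \<BB> VA) (GG T \<BB> VB)"
proof -
  obtain X f e where X: "\<And>n. X n \<in> V" "cauchy T \<BB> X f" "colim X f F e" "deep_seq X f"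
    using GGE_deep[OF F] by metis
  obtain B A a b w g where t: "B \<in> R" "\<And>n. A n \<in> U" "\<And>n. dt (A n) (X n) B (a n) (b n) (w n)"
    "\<And>n. b (Suc n) \<cdot> f (Suc n) = b n" "\<And>n. a (Suc n) \<cdot> g (Suc n) = f (Suc n) \<cdot> a n"
    "\<And>n. shm T (g (Suc n)) \<cdot> w n = w (Suc n)" "cauchy T \<BB> A g" by (rule trunc_seq[OF X(2,4)]) blast
  have u: "A n \<in> VA \<and> B \<in> VB" for n
  proof -
    obtain A' B' where A': "A' \<in> VA" "B' \<in> VB" "tr A' (X n) B'" using d[OF X(1)] by blast
    have i: "isomorphic T A' (A n)" "isomorphic T B' B"
      using trunc_unique[OF A'(3) trI[OF t(3)]] A'(1,2) VA(1) VB(1) t(1,2) by blast+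
    show ?thesis using i A'(1,2) VA(2) VB(2) dtD(1,3)[OF t(3)] unfolding subcat_def by blast
  qed
  have FO: "F \<in> GG T \<BB> (Obj T)" using F GG_mono[OF V] by blast
  have s: "VA \<subseteq> Obj T" "VB \<subseteq> Obj T" using VA(2) VB(2) unfolding subcat_def by blast+
  show ?thesis
    by (rule trunc_star[OF FO X(2,3) _ _ t(1) s(2) s(1) t(3,4,5,6,7)]) (use u in blast)+
qed

lemma U_subcat: "subcat T U"
  unfolding subcat_def
proof (intro conjI ballI impI U_sub)
  fix A B assume A: "A \<in> U" "B \<in> Obj T" "isomorphic T A B"
  show "B \<in> U"
  proof (rule in_U[OF A(2)])
    fix Y assume Y: "Y \<in> R"
    then show "hom_zero T B Y" using hom_zero_iso_left[OF A(3) _ A(2)] orth[OF A(1) Y] A(1) U_sub R_sub by blast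
  qed
qed

lemma shsub_GG_L: "shsub CC 1 (GG T \<BB> L) = GG T \<BB> U"
  unfolding U_def by (rule shsub_GG[OF L_subcat])

theorem GG_t_structure: "t_structure CC (GG T \<BB> L, GG T \<BB> R)"
proof -
  have "subcat CC (GG T \<BB> L)" "subcat CC (GG T \<BB> R)" using subcat_GG L_sub R_sub by blast+
  moreover have "GG T \<BB> U \<subseteq> GG T \<BB> L" by (rule GG_mono[OF U_L])
  moreover have "GG T \<BB> R \<subseteq> shsub CC 1 (GG T \<BB> R)"
    unfolding shsub_GG[OF R_subcat] by (rule GG_mono[OF R_shR])
  moreover have "\<forall>X\<in>GG T \<BB> U. \<forall>Y\<in>GG T \<BB> R. hom_zero CC X Y"
    using hom_zero_GG orth by blast
  moreover have "star CC (GG T \<BB> U) (GG T \<BB> R) = Obj CC"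
  proof
    show "star CC (GG T \<BB> U) (GG T \<BB> R) \<subseteq> Obj CC" unfolding star_def by blast
    show "Obj CC \<subseteq> star CC (GG T \<BB> U) (GG T \<BB> R)"
    proof
      fix F assume "F \<in> Obj CC"
      then have F: "F \<in> GG T \<BB> (Obj T)" by (simp add: CC_simps)
      have d: "\<exists>A\<in>U. \<exists>B\<in>R. tr A X B" if "X \<in> Obj T" for X
      proof -
        obtain A B u v w where "A \<in> U" "B \<in> R" "dt A X B u v w" using decomp[OF \<open>X \<in> Obj T\<close>] .
        then show ?thesis using trI by blast
      qed
      show "F \<in> star CC (GG T \<BB> U) (GG T \<BB> R)"
        by (rule trunc_GG[OF F subset_refl d subset_refl U_subcat subset_refl R_subcat])
    qed
  qed
  ultimately show ?thesis unfolding t_structure_def case_prod_conv shsub_GG_L by blast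
qed

text \<open>A sequence in \<open>R\<close> whose colimit lies in the completed aisle is eventually
  in \<open>L\<close> by \<open>GG_L\<close>, and a tail has the same colimit.\<close>

lemma GG_heart: "GG T \<BB> L \<inter> GG T \<BB> R = GG T \<BB> (L \<inter> R)"
proof
  show "GG T \<BB> (L \<inter> R) \<subseteq> GG T \<BB> L \<inter> GG T \<BB> R" using GG_mono[of "L \<inter> R"] by blast
  show "GG T \<BB> L \<inter> GG T \<BB> R \<subseteq> GG T \<BB> (L \<inter> R)"
  proof
    fix F assume F: "F \<in> GG T \<BB> L \<inter> GG T \<BB> R"
    then obtain X f e where X: "additive_functor T F" "comp_supp F" "\<And>n. X n \<in> R" "cauchy T \<BB> X f" "colim X f F e"
      using GGE[of F R] by (metis IntE)
    obtain N where N: "\<And>n. N \<le> n \<Longrightarrow> X n \<in> L" using GG_L[OF _ X(4,5)] F by blast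
    show "F \<in> GG T \<BB> (L \<inter> R)"
      by (rule GGI[OF X(1,2) _ cauchy_tail[OF X(4), of N] colim_tail[OF X(1,5), of N]]) (use N X(3) in simp)
  qed
qed

lemma heart_eq: "heart (GG T \<BB> L, GG T \<BB> R) = GG T \<BB> (L \<inter> R)"
  unfolding heart_def case_prod_conv by (rule GG_heart)

text \<open>Objects of the completed heart are representable, and every object of
  \<open>\<X>\<close> represents an object of the completed class, so orthogonality can be tested on
  representing objects.\<close>

lemma GG_perp:
  assumes X: "\<X> \<subseteq> L \<inter> R"
  shows "perp CC (GG T \<BB> (L \<inter> R)) (GG T \<BB> \<X>) = GG T \<BB> (perp T (L \<inter> R) \<X>)"
proof
  show "GG T \<BB> (perp T (L \<inter> R) \<X>) \<subseteq> perp CC (GG T \<BB> (L \<inter> R)) (GG T \<BB> \<X>)"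
  proof
    fix F assume F: "F \<in> GG T \<BB> (perp T (L \<inter> R) \<X>)"
    have "perp T (L \<inter> R) \<X> \<subseteq> L \<inter> R" unfolding perp_def by blast
    then have "F \<in> GG T \<BB> (L \<inter> R)" using F GG_mono by blast
    moreover have "hom_zero CC H F" if "H \<in> GG T \<BB> \<X>" for H
      by (rule hom_zero_GG[OF that F]) (auto simp: perp_def)
    ultimately show "F \<in> perp CC (GG T \<BB> (L \<inter> R)) (GG T \<BB> \<X>)" unfolding perp_def by blast
  qed
  show "perp CC (GG T \<BB> (L \<inter> R)) (GG T \<BB> \<X>) \<subseteq> GG T \<BB> (perp T (L \<inter> R) \<X>)"
  proof
    fix F assume "F \<in> perp CC (GG T \<BB> (L \<inter> R)) (GG T \<BB> \<X>)"
    then have F: "F \<in> GG T \<BB> (L \<inter> R)" and z: "\<And>H. H \<in> GG T \<BB> \<X> \<Longrightarrow> hom_zero CC H F"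
      unfolding perp_def by blast+
    note Fa = GG_additive[OF F]
    obtain A e where A: "A \<in> L \<inter> R" "represents F A e" using GG_rep[OF F] by blast
    note AO = representsD(1)[OF A(2)]
    have "hom_zero T X A" if XX: "X \<in> \<X>" for X
    proof (rule hom_zeroI)
      show XO: "X \<in> Obj T" using XX X L_sub by blast
      show "A \<in> Obj T" by (rule AO)
      fix p assume p: "arr X A p"
      obtain H :: "('o, 'm) modf" and d where H: "additive_functor T H" "represents H X d" using represents_exists[OF XO] .
      obtain \<eta> where n: "nat_trans T H F \<eta>" "\<eta> X d = FA F p e" using represents_map[OF H(1) Fa H(2) A(2) p] by metis
      have "\<eta> = zero_nt H F" using z[OF represents_GG[OF H XX]] CC_hom_zero[OF H(1) Fa] n(1) by blast
      then have "FA F p e = un F X" using n(2) XO representsD(2)[OF H(2)] by (simp add: zero_nt_def)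
      then show "p = zr X A" by (rule representsD(3)[OF A(2) p])
    qed
    then have "A \<in> perp T (L \<inter> R) \<X>" using A(1) unfolding perp_def by blast
    then show "F \<in> GG T \<BB> (perp T (L \<inter> R) \<X>)" by (rule represents_GG[OF Fa A(2)])
  qed
qed

text \<open>Transformations out of a represented functor are determined by the image of the
  universal element, so the kernel and cokernel properties reduce to liftings and extensions along
  the triangle.\<close>

lemma heart_short_exact:
  assumes x: "x \<in> L \<inter> R" and A: "A \<in> L \<inter> R" and y: "y \<in> L \<inter> R" and t: "dt x A y a b w"
    and F: "additive_functor T F" "represents F A e" and F1: "additive_functor T F1" "represents F1 x e1"
    and F2: "additive_functor T F2" "represents F2 y e2"
  shows "\<exists>f g. short_exact (fullsub CC (GG T \<BB> (L \<inter> R))) F1 F F2 f g"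
proof -
  note d = dtD[OF t]
  obtain \<eta> where n: "nat_trans T F1 F \<eta>" "\<And>W q. arr W x q \<Longrightarrow> \<eta> W (FA F1 q e1) = FA F (a \<cdot> q) e"
    "\<eta> x e1 = FA F a e" by (rule represents_map[OF F1(1) F(1) F1(2) F(2) d(6)]) blast
  obtain \<theta> where t: "nat_trans T F F2 \<theta>" "\<And>W q. arr W A q \<Longrightarrow> \<theta> W (FA F q e) = FA F2 (b \<cdot> q) e2"
    "\<theta> A e = FA F2 b e2" by (rule represents_map[OF F(1) F2(1) F(2) F2(2) d(7)]) blast
  have "comp_nt F1 \<theta> \<eta> = zero_nt F1 F2"
  proof (rule represents_nt_eq[OF F1 comp_nt[OF F1(1) n(1) t(1)] zero_nt[OF F1(1) F2(1)]])
    have "\<theta> x (\<eta> x e1) = un F2 x"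
      unfolding n(3) t(2)[OF d(6)] tri_comp1[OF \<open>dt x A y a b w\<close>] by (rule fa_zr[OF F2(1) d(1,3) representsD(2)[OF F2(2)]])
    then show "comp_nt F1 \<theta> \<eta> x e1 = zero_nt F1 F2 x e1"
      using d(1) representsD(2)[OF F1(2)] by (simp add: zero_nt_def)
  qed
  then have z: "cmp CC (F, \<theta>, F2) (F1, \<eta>, F) = \<one>\<^bsub>hgrp CC F1 F2\<^esub>" by (simp add: CC_simps)
  have ker: "is_kernel (fullsub CC (GG T \<BB> (L \<inter> R))) F1 F F2 (F1, \<eta>, F) (F, \<theta>, F2)"
    unfolding is_kernel_def fullsub_simps
  proof (intro conjI ballI impI z)
    fix W h assume W: "W \<in> GG T \<BB> (L \<inter> R)" and "h \<in> Hom CC W F" and "cmp CC (F, \<theta>, F2) h = \<one>\<^bsub>hgrp CC W F2\<^esub>"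
    then obtain \<chi> where h: "h = (W, \<chi>, F)" "nat_trans T W F \<chi>" and 0: "comp_nt W \<theta> \<chi> = zero_nt W F2"
      by (auto simp: CC_simps)
    note Wa = GG_additive[OF W]
    obtain C k where C: "C \<in> L \<inter> R" "represents W C k" using GG_rep[OF W] by blast
    note CO = representsD(1)[OF C(2)] and kC = representsD(2)[OF C(2)]
    obtain p where p: "arr C A p" "\<chi> C k = FA F p e" using represents_surj[OF F(2) CO ntD(4)[OF h(2) CO kC]] .
    have "\<theta> C (\<chi> C k) = un F2 C"
      using comp_nt_apply[OF CO kC, of \<theta> \<chi>] CO kC unfolding 0 by (simp add: zero_nt_def)
    then have "FA F2 (b \<cdot> p) e2 = un F2 C" using t(2)[OF p(1)] p(2) by simp
    then have "b \<cdot> p = zr C y" by (rule representsD(3)[OF F2(2) arr_comp[OF p(1) d(7)]])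
    then obtain q where q: "arr C x q" "a \<cdot> q = p" using tri_lift[OF \<open>dt x A y a b w\<close> p(1)] by blast
    obtain \<psi> where s: "nat_trans T W F1 \<psi>" "\<psi> C k = FA F1 q e1" using represents_map[OF Wa F1(1) C(2) F1(2) q(1)] by metis
    show "\<exists>!k. k \<in> Hom CC W F1 \<and> cmp CC (F1, \<eta>, F) k = h"
    proof (rule ex1I[of _ "(W, \<psi>, F1)"])
      have "comp_nt W \<eta> \<psi> = \<chi>"
        by (rule represents_nt_eq[OF Wa C(2) comp_nt[OF Wa s(1) n(1)] h(2)])
          (use CO kC s(2) n(2)[OF q(1)] q(2) p(2) in simp)
      then show "(W, \<psi>, F1) \<in> Hom CC W F1 \<and> cmp CC (F1, \<eta>, F) (W, \<psi>, F1) = h"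
        using s(1) h(1) by (simp add: CC_simps)
      fix l assume l: "l \<in> Hom CC W F1 \<and> cmp CC (F1, \<eta>, F) l = h"
      then obtain \<psi>' where l': "l = (W, \<psi>', F1)" "nat_trans T W F1 \<psi>'" "comp_nt W \<eta> \<psi>' = \<chi>"
        using h(1) by (auto simp: CC_simps)
      obtain q' where q': "arr C x q'" "\<psi>' C k = FA F1 q' e1"
        using represents_surj[OF F1(2) CO ntD(4)[OF l'(2) CO kC]] .
      have "\<eta> C (\<psi>' C k) = \<chi> C k" using comp_nt_apply[OF CO kC, of \<eta> \<psi>'] l'(3) by simp
      then have "FA F (a \<cdot> q') e = FA F (a \<cdot> q) e" using n(2)[OF q'(1)] q'(2) q(2) p(2) by simp
      then have e: "a \<cdot> q' = a \<cdot> q" by (rule represents_inj[OF F arr_comp[OF q'(1) d(6)] arr_comp[OF q(1) d(6)]])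
      \<comment> \<open>Liftings along \<open>a\<close> are unique because the suspension of
        \<open>C\<close> lies in degrees at most -1 and has no maps to \<open>y\<close>.\<close>
      have "sh T C \<in> U" using sh_in_U[OF CO] C(1) by blast
      then have "q' = q" using tri_cancel_lift[OF \<open>dt x A y a b w\<close> orth q'(1) q(1) e] y by blast
      then have "\<psi>' = \<psi>" using represents_nt_eq[OF Wa C(2) l'(2) s(1)] q'(2) s(2) by simp
      then show "l = (W, \<psi>, F1)" using l'(1) by simp
    qed
  qed
  have coker: "is_cokernel (fullsub CC (GG T \<BB> (L \<inter> R))) F1 F F2 (F1, \<eta>, F) (F, \<theta>, F2)"
    unfolding is_cokernel_def fullsub_simps
  proof (intro conjI ballI impI z)
    fix W h assume W: "W \<in> GG T \<BB> (L \<inter> R)" and "h \<in> Hom CC F W" and "cmp CC h (F1, \<eta>, F) = \<one>\<^bsub>hgrp CC F1 W\<^esub>"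
    then obtain \<chi> where h: "h = (F, \<chi>, W)" "nat_trans T F W \<chi>" and 0: "comp_nt F1 \<chi> \<eta> = zero_nt F1 W"
      by (auto simp: CC_simps)
    note Wa = GG_additive[OF W]
    obtain C k where C: "C \<in> L \<inter> R" "represents W C k" using GG_rep[OF W] by blast
    note CO = representsD(1)[OF C(2)] and eA = representsD(2)[OF F(2)] and e1x = representsD(2)[OF F1(2)] and e2y = representsD(2)[OF F2(2)]
    obtain p where p: "arr A C p" "\<chi> A e = FA W p k" using represents_surj[OF C(2) d(2) ntD(4)[OF h(2) d(2) eA]] .
    have "\<chi> x (\<eta> x e1) = un W x"
      using comp_nt_apply[OF d(1) e1x, of \<chi> \<eta>] d(1) e1x unfolding 0 by (simp add: zero_nt_def)
    then have "FA W (p \<cdot> a) k = un W x"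
      using n(3) represents_nt_apply[OF h(2) F(2) d(6)] p(2) afD(6)[OF Wa d(6) p(1) representsD(2)[OF C(2)]] by simp
    then have "p \<cdot> a = zr x C" by (rule representsD(3)[OF C(2) arr_comp[OF d(6) p(1)]])
    then obtain q where q: "arr y C q" "q \<cdot> b = p" using tri_ext[OF \<open>dt x A y a b w\<close> p(1)] by blast
    obtain \<psi> where s: "nat_trans T F2 W \<psi>" "\<And>V r. arr V y r \<Longrightarrow> \<psi> V (FA F2 r e2) = FA W (q \<cdot> r) k" "\<psi> y e2 = FA W q k"
      by (rule represents_map[OF F2(1) Wa F2(2) C(2) q(1)]) blast
    show "\<exists>!k. k \<in> Hom CC F2 W \<and> cmp CC k (F, \<theta>, F2) = h"
    proof (rule ex1I[of _ "(F2, \<psi>, W)"])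
      have "comp_nt F \<psi> \<theta> = \<chi>"
        by (rule represents_nt_eq[OF F comp_nt[OF F(1) t(1) s(1)] h(2)])
          (use d(2) eA t(3) s(2)[OF d(7)] q(2) p(2) in simp)
      then show "(F2, \<psi>, W) \<in> Hom CC F2 W \<and> cmp CC (F2, \<psi>, W) (F, \<theta>, F2) = h"
        using s(1) h(1) by (simp add: CC_simps)
      fix l assume l: "l \<in> Hom CC F2 W \<and> cmp CC l (F, \<theta>, F2) = h"
      then obtain \<psi>' where l': "l = (F2, \<psi>', W)" "nat_trans T F2 W \<psi>'" "comp_nt F \<psi>' \<theta> = \<chi>"
        using h(1) by (auto simp: CC_simps)
      obtain q' where q': "arr y C q'" "\<psi>' y e2 = FA W q' k"
        using represents_surj[OF C(2) d(3) ntD(4)[OF l'(2) d(3) e2y]] .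
      have "\<psi>' A (\<theta> A e) = \<chi> A e" using comp_nt_apply[OF d(2) eA, of \<psi>' \<theta>] l'(3) by simp
      then have "FA W (q' \<cdot> b) k = FA W (q \<cdot> b) k"
        using t(3) represents_nt_apply[OF l'(2) F2(2) d(7)] q'(2) afD(6)[OF Wa d(7) q'(1) representsD(2)[OF C(2)]] q(2) p(2) by simp
      then have e: "q' \<cdot> b = q \<cdot> b" by (rule represents_inj[OF Wa C(2) arr_comp[OF d(7) q'(1)] arr_comp[OF d(7) q(1)]])
      have "sh T x \<in> U" using sh_in_U[OF d(1)] x by blast
      then have "q' = q" using tri_cancel_ext[OF \<open>dt x A y a b w\<close> orth q'(1) q(1) e] C(1) by blast
      then have "\<psi>' = \<psi>" using represents_nt_eq[OF F2 l'(2) s(1)] q'(2) s(3) by simp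
      then show "l = (F2, \<psi>, W)" using l'(1) by simp
    qed
  qed
  have "short_exact (fullsub CC (GG T \<BB> (L \<inter> R))) F1 F F2 (F1, \<eta>, F) (F, \<theta>, F2)"
    unfolding short_exact_def
    using ker coker represents_GG[OF F1 x] represents_GG[OF F A] represents_GG[OF F2 y] n(1) t(1) by (simp add: CC_simps)
  then show ?thesis by blast
qed

theorem GG_torsion:
  assumes X: "\<X> \<subseteq> L \<inter> R"
    and d: "\<And>A. A \<in> L \<inter> R \<Longrightarrow> \<exists>x\<in>\<X>. \<exists>y\<in>perp T (L \<inter> R) \<X>. tr x A y"
  shows "torsion_class (fullsub CC (heart (GG T \<BB> L, GG T \<BB> R))) (GG T \<BB> \<X>)"
  unfolding torsion_class_def heart_eq fullsub_simps
proof (intro conjI ballI)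
  let ?H = "GG T \<BB> (L \<inter> R)"
  have sub: "GG T \<BB> \<X> \<subseteq> ?H" by (rule GG_mono[OF X])
  have hO: "?H \<subseteq> GG T \<BB> (Obj T)" using GG_mono[of "L \<inter> R" "Obj T"] L_sub by blast
  have XO: "\<X> \<subseteq> Obj T" using X L_sub by blast
  show "subcat (fullsub CC ?H) (GG T \<BB> \<X>)"
    using subcat_GG[OF XO] sub hO unfolding subcat_def fullsub_simps isomorphic_fullsub CC_simps by blast
  fix F assume F: "F \<in> ?H"
  note Fa = GG_additive[OF F]
  obtain A e where A: "A \<in> L \<inter> R" "represents F A e" using GG_rep[OF F] by blast
  obtain x y where xy: "x \<in> \<X>" "y \<in> perp T (L \<inter> R) \<X>" "tr x A y" using d[OF A(1)] by blast
  then obtain a b w where t: "dt x A y a b w" unfolding tr_def by blast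
  have y: "y \<in> L \<inter> R" using xy(2) unfolding perp_def by blast
  obtain F1 :: "('o, 'm) modf" and e1 where F1: "additive_functor T F1" "represents F1 x e1" using represents_exists[OF dtD(1)[OF t]] .
  obtain F2 :: "('o, 'm) modf" and e2 where F2: "additive_functor T F2" "represents F2 y e2" using represents_exists[OF dtD(3)[OF t]] .
  have "F2 \<in> perp (fullsub CC ?H) ?H (GG T \<BB> \<X>)"
    using represents_GG[OF F2 xy(2)] GG_perp[OF X] unfolding perp_def hom_zero_fullsub by blast
  moreover have "F1 \<in> GG T \<BB> \<X>" by (rule represents_GG[OF F1 xy(1)])
  moreover have "\<exists>f g. short_exact (fullsub CC ?H) F1 F F2 f g"
    by (rule heart_short_exact[OF _ A(1) y t Fa A(2) F1 F2]) (use xy(1) X in blast)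
  ultimately show "\<exists>X\<in>GG T \<BB> \<X>. \<exists>Y\<in>perp (fullsub CC ?H) ?H (GG T \<BB> \<X>).
      \<exists>f g. short_exact (fullsub CC ?H) X F Y f g" by blast
qed

end

context metric_category
begin

lemma star_CCE:
  assumes "F \<in> star CC P Q"
  obtains A B X Y Z f g h u v w c d e where "F \<in> GG T \<BB> (Obj T)" "A \<in> P" "B \<in> Q"
    "cauchy T \<BB> X f" "cauchy T \<BB> Y g" "cauchy T \<BB> Z h"
    "\<And>n. dt (X n) (Y n) (Z n) (u n) (v n) (w n)"
    "\<And>n. g (Suc n) \<cdot> u n = u (Suc n) \<cdot> f (Suc n)" "\<And>n. h (Suc n) \<cdot> v n = v (Suc n) \<cdot> g (Suc n)"
    "colim X f A c" "colim Y g F d" "colim Z h B e"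
proof -
  obtain A B p q r where F: "F \<in> GG T \<BB> (Obj T)" "A \<in> P" "B \<in> Q" "tri CC A F B p q r"
    using assms unfolding star_def CC_simps by blast
  obtain \<eta> \<theta> \<zeta> where ct: "colimit_triangle T \<BB> A F B \<eta> \<theta> \<zeta>" using F(4) unfolding CC_simps by blast
  obtain X Y Z f g h u v w c d e where
    t0: "cauchy T \<BB> X f" "cauchy T \<BB> Y g" "cauchy T \<BB> Z h"
      "\<forall>n. tri T (X n) (Y n) (Z n) (u n) (v n) (w n) \<and>
        g (Suc n) \<cdot> u n = u (Suc n) \<cdot> f (Suc n) \<and>
        h (Suc n) \<cdot> v n = v (Suc n) \<cdot> g (Suc n) \<and>
        shm T (f (Suc n)) \<cdot> w n = w (Suc n) \<cdot> h (Suc n)"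
      "yoneda_colimit T X f A c" "yoneda_colimit T Y g F d" "yoneda_colimit T Z h B e"
    using ct unfolding colimit_triangle_def by (elim conjE exE) (rule that)
  note t = t0(1-3) t0(4)[rule_format, THEN conjunct1] t0(4)[rule_format, THEN conjunct2, THEN conjunct1]
    t0(4)[rule_format, THEN conjunct2, THEN conjunct2, THEN conjunct1] t0(5-7)
  have "dt (X n) (Y n) (Z n) (u n) (v n) (w n)" for n
    using t(4) seqD(2)[OF cauchyD(1)[OF t(1)]] seqD(2)[OF cauchyD(1)[OF t(2)]] seqD(2)[OF cauchyD(1)[OF t(3)]]
    unfolding dt_def by blast
  then show thesis
    by (rule that[OF F(1-3) t(1-3) _ t(5,6) yoneda_colimit_colim[OF t(7) cauchyD(1)[OF t(1)]]
          yoneda_colimit_colim[OF t(8) cauchyD(1)[OF t(2)]] yoneda_colimit_colim[OF t(9) cauchyD(1)[OF t(3)]]])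
qed

end

context tstr_metric
begin

text \<open>\<open>GG_L\<close> applies to whatever sequences the triangle comes with, so extension
  closure of \<open>L\<close> can be used stage by stage.\<close>

lemma star_GG_L:
  assumes "F \<in> star CC (GG T \<BB> L) (GG T \<BB> L)" shows "F \<in> GG T \<BB> L"
  using assms
proof (rule star_CCE)
  fix A B X Y Z f g h u v w c d e
  assume F: "F \<in> GG T \<BB> (Obj T)" and A: "A \<in> GG T \<BB> L" and B: "B \<in> GG T \<BB> L"
    and X: "cauchy T \<BB> X f" and Y: "cauchy T \<BB> Y g" and Z: "cauchy T \<BB> Z h"
    and t: "\<And>n. dt (X n) (Y n) (Z n) (u n) (v n) (w n)"
    and c: "colim X f A c" "colim Y g F d" "colim Z h B e"
  obtain N1 where N1: "\<And>n. N1 \<le> n \<Longrightarrow> X n \<in> L" by (rule GG_L[OF A X c(1)]) blast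
  obtain N2 where N2: "\<And>n. N2 \<le> n \<Longrightarrow> Z n \<in> L" by (rule GG_L[OF B Z c(3)]) blast
  let ?N = "max N1 N2"
  have YL: "Y (n + ?N) \<in> L" for n
    by (rule L_ext[OF trI[OF t] N1 N2]) simp_all
  show "F \<in> GG T \<BB> L"
    by (rule GGI[OF GG_additive[OF F] _ YL cauchy_tail[OF Y] colim_tail[OF GG_additive[OF F] c(2)]])
      (use F in \<open>simp add: GG_iff\<close>)
qed

text \<open>Membership is tested by vanishing on \<open>U\<close>. An element is chased through the
  three sequences: exactness in the middle survives the passage to the colimit.\<close>

lemma star_GG_R:
  assumes "F \<in> star CC (GG T \<BB> R) (GG T \<BB> R)" shows "F \<in> GG T \<BB> R"
  using assms
proof (rule star_CCE)
  fix A B X Y Z f g h u v w c d e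
  assume F: "F \<in> GG T \<BB> (Obj T)" and A: "A \<in> GG T \<BB> R" and B: "B \<in> GG T \<BB> R"
    and X: "cauchy T \<BB> X f" and Y: "cauchy T \<BB> Y g" and Z: "cauchy T \<BB> Z h"
    and t: "\<And>n. dt (X n) (Y n) (Z n) (u n) (v n) (w n)"
    and gu: "\<And>n. g (Suc n) \<cdot> u n = u (Suc n) \<cdot> f (Suc n)" and hv: "\<And>n. h (Suc n) \<cdot> v n = v (Suc n) \<cdot> g (Suc n)"
    and c: "colim X f A c" "colim Y g F d" "colim Z h B e"
  note Fa = GG_additive[OF F]
  note sX = cauchyD(1)[OF X] and sY = cauchyD(1)[OF Y] and sZ = cauchyD(1)[OF Z]
  note u = dtD(6)[OF t] and v = dtD(7)[OF t]
  show "F \<in> GG T \<BB> R"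
  proof (rule GG_R[OF F])
    fix W assume W: "W \<in> U"
    then have WO: "W \<in> Obj T" using U_sub by blast
    note zA = GG_R_vanish[OF A W] and zB = GG_R_vanish[OF B W]
    have "y = un F W" if y: "y \<in> el F W" for y
    proof -
      obtain n p where p: "arr W (Y n) p" "y = FA F p (d n)" using colim_surj[OF c(2) WO y] .
      note vp = arr_comp[OF p(1) v]
      have "FA B (v n \<cdot> p) (e n) = un B W"
        using fa_closed[OF GG_additive[OF B] vp colimD(2)[OF c(3)]] zB by blast
      then obtain N where N: "n \<le> N" "transit Z h n N \<cdot> (v n \<cdot> p) = zr W (Z N)" using colim_inj[OF c(3) vp] by blast
      note tp = arr_comp[OF p(1) transit_arr[OF sY N(1)]]
      have "v N \<cdot> (transit Y g n N \<cdot> p) = zr W (Z N)"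
        using comp_assoc[OF p(1) transit_arr[OF sY N(1)] v] comp_assoc[OF p(1) v transit_arr[OF sZ N(1)]]
          transit_nat[where u = v, OF sY sZ v hv N(1)] N(2) by simp
      then obtain q where q: "arr W (X N) q" "u N \<cdot> q = transit Y g n N \<cdot> p" using tri_lift[OF t tp] by blast
      have "FA A q (c N) = un A W"
        using fa_closed[OF GG_additive[OF A] q(1) colimD(2)[OF c(1)]] zA by blast
      then obtain M where M: "N \<le> M" "transit X f N M \<cdot> q = zr W (X M)" using colim_inj[OF c(1) q(1)] by blast
      have "transit Y g N M \<cdot> (u N \<cdot> q) = u M \<cdot> (transit X f N M \<cdot> q)"
        using comp_assoc[OF q(1) u transit_arr[OF sY M(1)]] comp_assoc[OF q(1) transit_arr[OF sX M(1)] u]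
          transit_nat[where u = u, OF sX sY u gu M(1)] by simp
      also have "\<dots> = zr W (Y M)" using M(2) comp_zr_right[OF u WO] by simp
      finally have z: "transit Y g N M \<cdot> (transit Y g n N \<cdot> p) = zr W (Y M)" using q(2) by simp
      have "y = FA F (transit Y g N M \<cdot> (transit Y g n N \<cdot> p)) (d M)"
        using colim_push[OF Fa c(2) M(1) tp] colim_push[OF Fa c(2) N(1) p(1)] p(2) by simp
      then show ?thesis using z fa_zr[OF Fa WO seqD(2)[OF sY] colimD(2)[OF c(2)]] by simp
    qed
    then show "el F W = {un F W}" using un_el[OF Fa WO] by blast
  qed
qed

end

section \<open>HRS-tilts on the completion\<close>

lemma star_mono: "P \<subseteq> P' \<Longrightarrow> Q \<subseteq> Q' \<Longrightarrow> star S P Q \<subseteq> star S P' Q'"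
  unfolding star_def by blast

text \<open>The stars lie in the new classes because these are closed under extensions in the
  completion. Conversely, in both decompositions the left term lies in \<open>U\<close> and the
  right term in \<open>R\<close>, so they are truncations for the old pair and
  \<open>trunc_GG\<close> produces the triangle.\<close>

theorem GG_HRS_tilt:
  assumes t: "tstr_metric T \<BB> L R" and t': "tstr_metric T \<BB> L' R'"
    and X: "\<X> \<subseteq> L \<inter> R" "subcat T \<X>" and X0: "\<And>Z. is_zero T Z \<Longrightarrow> Z \<in> \<X>"
    and L': "L' = star T (shsub T 1 L) \<X>" and R': "R' = star T (shsub T 1 (perp T (L \<inter> R) \<X>)) R"
  shows "(GG T \<BB> L', GG T \<BB> R') = HRS_tilt (completion T \<BB>) (GG T \<BB> L, GG T \<BB> R) (GG T \<BB> \<X>)"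
proof -
  interpret t: tstr_metric T \<BB> L R by (rule t)
  interpret t': tstr_metric T \<BB> L' R' by (rule t')
  let ?Y = "perp T (L \<inter> R) \<X>"
  let ?\<Sigma>Y = "shsub T 1 ?Y"
  have star_tr: "star T P Q = {Z \<in> Obj T. \<exists>A\<in>P. \<exists>B\<in>Q. t.tr A Z B}" if "P \<subseteq> Obj T" "Q \<subseteq> Obj T" for P Q
    using that unfolding star_def t.tr_def t.dt_def by blast
  have XO: "\<X> \<subseteq> Obj T" using X(2) unfolding subcat_def by blast
  have Ysub: "?Y \<subseteq> L \<inter> R" unfolding perp_def by blast
  have Ysc: "subcat T ?Y"
    unfolding subcat_def
  proof (intro conjI ballI impI)
    show "?Y \<subseteq> Obj T" using Ysub t.L_sub by blast
    fix A B assume A: "A \<in> ?Y" "B \<in> Obj T" "isomorphic T A B"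
    have "B \<in> L \<inter> R" using A Ysub t.L_subcat t.R_subcat unfolding subcat_def by blast
    moreover have "hom_zero T W B" if "W \<in> \<X>" for W
    proof -
      have "A \<in> Obj T" "W \<in> Obj T" "hom_zero T W A" using A(1) that Ysub t.L_sub XO unfolding perp_def by blast+
      then show ?thesis using t.hom_zero_iso_right[OF A(3) _ A(2)] by blast
    qed
    ultimately show "B \<in> ?Y" unfolding perp_def by blast
  qed
  \<comment> \<open>A zero object, in suitable degree, exhibits each factor of a star inside that
    star.\<close>
  obtain Z where Z: "is_zero T Z" using t.zero_exists by blast
  have ZO: "Z \<in> Obj T" using Z t.is_zero_Obj by blast
  have ZU: "Z \<in> t.U" using t.in_U[OF ZO] t.is_zeroD[OF Z] t.R_sub by blast
  have ZR: "Z \<in> R" using t.in_R[OF ZO] t.is_zeroD[OF Z] t.U_sub by blast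
  have ZY: "Z \<in> ?Y" unfolding perp_def using ZU ZR t.U_L t.is_zeroD[OF Z] XO by blast
  have \<Sigma>YO: "?\<Sigma>Y \<subseteq> Obj T" unfolding shsub_def by blast
  have \<Sigma>Z: "sh T Z \<in> ?\<Sigma>Y"
    unfolding shsub_def mem_Collect_eq
    using bexI[of "\<lambda>A. isomorphic T (sh T Z) (shpow T 1 A)" Z ?Y] ZY t.isomorphic_refl[OF t.sh_Obj[OF ZO]] ZO
    by (simp add: t.shpow_1)
  have \<Sigma>YU: "?\<Sigma>Y \<subseteq> t.U" unfolding t.U_def shsub_def using Ysub by blast
  have \<Sigma>Ysc: "subcat T ?\<Sigma>Y"
    unfolding subcat_def
  proof (intro conjI ballI impI \<Sigma>YO)
    fix A B assume A: "A \<in> ?\<Sigma>Y" "B \<in> Obj T" "isomorphic T A B"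
    then obtain C where C: "A \<in> Obj T" "C \<in> ?Y" "isomorphic T A (shpow T 1 C)" unfolding shsub_def by blast
    have CO: "C \<in> Obj T" using C(2) Ysub t.L_sub by blast
    have "isomorphic T B (shpow T 1 C)"
      using t.isomorphic_trans[OF t.isomorphic_sym[OF A(3) C(1) A(2)] C(3) A(2) C(1) t.shpow_Obj[OF CO]] .
    then show "B \<in> ?\<Sigma>Y" using C(2) A(2) unfolding shsub_def by blast
  qed
  have L'e: "L' = {W \<in> Obj T. \<exists>A\<in>t.U. \<exists>B\<in>\<X>. t.tr A W B}"
    unfolding L' t.U_def[symmetric] by (rule star_tr[OF t.U_sub XO])
  have R'e: "R' = {W \<in> Obj T. \<exists>A\<in>?\<Sigma>Y. \<exists>B\<in>R. t.tr A W B}"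
    unfolding R' by (rule star_tr[OF \<Sigma>YO t.R_sub])
  have s1: "t.U \<subseteq> L'"
  proof
    fix A assume A: "A \<in> t.U"
    then have "A \<in> Obj T" using t.U_sub by blast
    then show "A \<in> L'" unfolding L'e using A X0[OF Z] t.tr_zero_id(2)[OF _ Z] by blast
  qed
  have s2: "\<X> \<subseteq> L'"
  proof
    fix A assume A: "A \<in> \<X>"
    then have "A \<in> Obj T" using XO by blast
    then show "A \<in> L'" unfolding L'e using A ZU t.tr_zero_id(1)[OF _ Z] by blast
  qed
  have s3: "?\<Sigma>Y \<subseteq> R'"
  proof
    fix A assume A: "A \<in> ?\<Sigma>Y"
    then have "A \<in> Obj T" using \<Sigma>YO by blast
    then show "A \<in> R'" unfolding R'e using A ZR t.tr_zero_id(2)[OF _ Z] by blast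
  qed
  have s4: "R \<subseteq> R'"
  proof
    fix A assume A: "A \<in> R"
    then have AO: "A \<in> Obj T" using t.R_sub by blast
    have "t.tr (sh T Z) A A" using t.tr_zero_id(1)[OF AO t.is_zero_sh[OF Z]] .
    then show "A \<in> R'" unfolding R'e using A AO \<Sigma>Z by blast
  qed
  have "star t.CC (GG T \<BB> t.U) (GG T \<BB> \<X>) = GG T \<BB> L'"
  proof
    show "star t.CC (GG T \<BB> t.U) (GG T \<BB> \<X>) \<subseteq> GG T \<BB> L'"
      using star_mono[OF t.GG_mono[OF s1] t.GG_mono[OF s2]] t'.star_GG_L by blast
    show "GG T \<BB> L' \<subseteq> star t.CC (GG T \<BB> t.U) (GG T \<BB> \<X>)"
    proof
      fix F assume F: "F \<in> GG T \<BB> L'"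
      have d: "\<exists>A\<in>t.U. \<exists>B\<in>\<X>. t.tr A W B" if "W \<in> L'" for W using that L'e by blast
      have XR: "\<X> \<subseteq> R" using X(1) by blast
      show "F \<in> star t.CC (GG T \<BB> t.U) (GG T \<BB> \<X>)"
        by (rule t.trunc_GG[OF F t'.L_sub d subset_refl t.U_subcat XR X(2)])
    qed
  qed
  moreover have "star t.CC (GG T \<BB> ?\<Sigma>Y) (GG T \<BB> R) = GG T \<BB> R'"
  proof
    show "star t.CC (GG T \<BB> ?\<Sigma>Y) (GG T \<BB> R) \<subseteq> GG T \<BB> R'"
      using star_mono[OF t.GG_mono[OF s3] t.GG_mono[OF s4]] t'.star_GG_R by blast
    show "GG T \<BB> R' \<subseteq> star t.CC (GG T \<BB> ?\<Sigma>Y) (GG T \<BB> R)"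
    proof
      fix F assume F: "F \<in> GG T \<BB> R'"
      have d: "\<exists>A\<in>?\<Sigma>Y. \<exists>B\<in>R. t.tr A W B" if "W \<in> R'" for W using that R'e by blast
      show "F \<in> star t.CC (GG T \<BB> ?\<Sigma>Y) (GG T \<BB> R)"
        by (rule t.trunc_GG[OF F t'.R_sub d \<Sigma>YU \<Sigma>Ysc subset_refl t.R_subcat])
    qed
  qed
  ultimately show ?thesis
    unfolding HRS_tilt_def case_prod_conv t.shsub_GG_L t.heart_eq t.GG_perp[OF X(1)] t.shsub_GG[OF Ysc] by simp
qed

section \<open>Finitely generated morphism spaces\<close>

text \<open>A vector space whose scalars form a type and whose vectors form the carrier of a group,
  the shape in which morphism spaces occur.\<close>

locale kspace = comm_group G for G (structure) +
  fixes sc :: "'k::field \<Rightarrow> 'a \<Rightarrow> 'a"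
  assumes sc_closed [simp]: "x \<in> carrier G \<Longrightarrow> sc c x \<in> carrier G"
    and sc_1: "x \<in> carrier G \<Longrightarrow> sc 1 x = x"
    and sc_mult: "x \<in> carrier G \<Longrightarrow> sc (c * d) x = sc c (sc d x)"
    and sc_plus: "x \<in> carrier G \<Longrightarrow> sc (c + d) x = sc c x \<otimes> sc d x"
    and sc_add: "x \<in> carrier G \<Longrightarrow> y \<in> carrier G \<Longrightarrow> sc c (x \<otimes> y) = sc c x \<otimes> sc c y"
begin

inductive_set span for S where
  span_one: "\<one> \<in> span S"
| span_step: "x \<in> span S \<Longrightarrow> s \<in> S \<Longrightarrow> x \<otimes> sc c s \<in> span S"

definition subspace :: "'a set \<Rightarrow> bool"
  where "subspace W \<longleftrightarrow> W \<subseteq> carrier G \<and> \<one> \<in> W \<and> (\<forall>x\<in>W. \<forall>y\<in>W. x \<otimes> y \<in> W) \<and> (\<forall>x\<in>W. \<forall>c. sc c x \<in> W)"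

lemma sc_one: "sc c \<one> = \<one>"
  using sc_add[of \<one> \<one> c] by (simp add: l_cancel_one)

lemma sc_0: "x \<in> carrier G \<Longrightarrow> sc 0 x = \<one>"
  using sc_plus[of x 0 0] by (simp add: l_cancel_one)

lemma sc_inverse: "x \<in> carrier G \<Longrightarrow> sc c x \<otimes> sc (- c) x = \<one>"
  using sc_plus[of x c "- c"] sc_0 by simp

lemma span_closed: "x \<in> span S \<Longrightarrow> S \<subseteq> carrier G \<Longrightarrow> x \<in> carrier G"
  by (induction rule: span.induct) auto

lemma span_mult:
  assumes "y \<in> span S" "x \<in> span S" "S \<subseteq> carrier G" shows "x \<otimes> y \<in> span S"
  using assms(1)
proof (induction rule: span.induct)
  case span_one then show ?case using assms span_closed by simp
next
  case (span_step y s c)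
  have "x \<otimes> (y \<otimes> sc c s) = (x \<otimes> y) \<otimes> sc c s"
    using span_step assms span_closed m_assoc[of x y "sc c s"] by auto
  then show ?case using span.span_step[OF span_step.IH span_step(2)] by simp
qed

lemma span_sc:
  assumes "x \<in> span S" "S \<subseteq> carrier G" shows "sc c x \<in> span S"
  using assms(1)
proof (induction rule: span.induct)
  case span_one then show ?case using sc_one span.span_one by simp
next
  case (span_step x s d)
  have "sc c (x \<otimes> sc d s) = sc c x \<otimes> sc (c * d) s"
    using span_step assms span_closed by (simp add: sc_add sc_mult subset_iff)
  then show ?case using span.span_step[OF span_step.IH span_step(2)] by simp
qed

lemma subspace_span: "S \<subseteq> carrier G \<Longrightarrow> subspace (span S)"
  unfolding subspace_def using span_closed[of _ S] span_one[of S] span_mult[of _ S] span_sc[of _ S]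
  by (intro conjI ballI allI subsetI)

lemma span_base: "s \<in> S \<Longrightarrow> S \<subseteq> carrier G \<Longrightarrow> s \<in> span S"
  using span_step[OF span_one, of s S 1] sc_1[of s] by auto

lemma span_least: "subspace W \<Longrightarrow> S \<subseteq> W \<Longrightarrow> span S \<subseteq> W"
proof
  fix x assume W: "subspace W" "S \<subseteq> W" and "x \<in> span S"
  from this(3) show "x \<in> W" by (induction rule: span.induct) (use W in \<open>auto simp: subspace_def\<close>)
qed

lemma span_mono: "S \<subseteq> S' \<Longrightarrow> S' \<subseteq> carrier G \<Longrightarrow> span S \<subseteq> span S'"
  by (rule span_least[OF subspace_span]) (auto intro: span_base)

lemma span_insert:
  assumes "x \<in> span (insert s S)" "insert s S \<subseteq> carrier G"
  shows "\<exists>v\<in>span S. \<exists>c. x = v \<otimes> sc c s"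
  using assms(1)
proof (induction rule: span.induct)
  case span_one
  then show ?case using assms sc_0 by (intro bexI[OF _ span.span_one] exI[of _ 0]) simp
next
  case (span_step x t d)
  then obtain v c where v: "v \<in> span S" "x = v \<otimes> sc c s" by blast
  have S: "S \<subseteq> carrier G" "s \<in> carrier G" using assms by auto
  have vc: "v \<in> carrier G" using v S span_closed by blast
  show ?case
  proof (cases "t = s")
    case True
    have "x \<otimes> sc d t = v \<otimes> sc (c + d) s" using v(2) True vc S by (simp add: sc_plus m_assoc)
    then show ?thesis using v(1) by blast
  next
    case False
    then have t: "t \<in> S" "t \<in> carrier G" using span_step S by auto
    have "x \<otimes> sc d t = (v \<otimes> sc d t) \<otimes> sc c s" using v(2) vc S t by (simp add: m_ac)
    then show ?thesis using span.span_step[OF v(1) t(1)] by blast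
  qed
qed

text \<open>Gaussian elimination: an element \<open>w\<close> of \<open>W\<close> outside the span
  of \<open>S\<close> involves the new generator \<open>s\<close> and reduces all other elements of
  \<open>W\<close> to that span.\<close>

lemma subspace_fg:
  assumes "finite S" "S \<subseteq> carrier G" "subspace W" "W \<subseteq> span S"
  shows "\<exists>S'. finite S' \<and> S' \<subseteq> W \<and> W \<subseteq> span S'"
  using assms
proof (induction S arbitrary: W rule: finite_induct)
  case empty
  have "span {} \<subseteq> span ({} :: 'a set)" by simp
  then show ?case using empty by (intro exI[of _ "{}"]) auto
next
  case (insert s S)
  have S: "S \<subseteq> carrier G" "s \<in> carrier G" using insert by auto
  have W: "W \<subseteq> carrier G" using insert.prems unfolding subspace_def by blast
  have "subspace (W \<inter> span S)" using insert.prems(2) subspace_span[OF S(1)] unfolding subspace_def by auto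
  then obtain S' where S': "finite S'" "S' \<subseteq> W \<inter> span S" "W \<inter> span S \<subseteq> span S'"
    using insert.IH[OF S(1), of "W \<inter> span S"] by blast
  show ?case
  proof (cases "W \<subseteq> span S")
    case True
    then show ?thesis using S' by blast
  next
    case False
    then obtain w where w: "w \<in> W" "w \<notin> span S" by blast
    then obtain v c where v: "v \<in> span S" "w = v \<otimes> sc c s" using span_insert[of w s S] insert.prems by blast
    have vc: "v \<in> carrier G" "w \<in> carrier G" using v S span_closed w W by blast+
    have c: "c \<noteq> 0" using v w(2) sc_0[OF S(2)] vc by auto
    have iS': "insert w S' \<subseteq> W" using w S' by blast
    have "W \<subseteq> span (insert w S')"
    proof
      fix x assume x: "x \<in> W"
      then obtain v2 c2 where v2: "v2 \<in> span S" "x = v2 \<otimes> sc c2 s" using span_insert[of x s S] insert.prems by blast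
      have v2c: "v2 \<in> carrier G" using v2 S span_closed by blast
      \<comment> \<open>Cancels the coefficient \<open>c2\<close> of \<open>s\<close> in
        \<open>x\<close> against the coefficient \<open>c\<close> of \<open>s\<close> in
        \<open>w\<close>.\<close>
      let ?k = "- (c2 / c)"
      have "sc ?k w = sc ?k v \<otimes> sc (- c2) s" using v(2) vc S c by (simp add: sc_add sc_mult[symmetric])
      then have "x \<otimes> sc ?k w = (v2 \<otimes> sc ?k v) \<otimes> (sc c2 s \<otimes> sc (- c2) s)"
        using v2(2) v2c vc S by (simp add: m_ac)
      also have "\<dots> = v2 \<otimes> sc ?k v" using sc_inverse[OF S(2)] v2c vc by simp
      finally have e: "x \<otimes> sc ?k w = v2 \<otimes> sc ?k v" .
      have "x \<otimes> sc ?k w \<in> W" using x w(1) insert.prems(2) unfolding subspace_def by blast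
      moreover have "x \<otimes> sc ?k w \<in> span S" unfolding e using span_mult[OF span_sc[OF v(1) S(1)] v2(1) S(1)] .
      ultimately have "x \<otimes> sc ?k w \<in> span S'" using S' by blast
      then have "(x \<otimes> sc ?k w) \<otimes> sc (c2 / c) w \<in> span (insert w S')"
        using span_step[of _ "insert w S'" w] span_mono[of S' "insert w S'"] iS' W by blast
      moreover have "(x \<otimes> sc ?k w) \<otimes> sc (c2 / c) w = x"
        using sc_inverse[OF vc(2), of ?k] x W vc by (simp add: m_assoc subset_iff)
      ultimately show "x \<in> span (insert w S')" by simp
    qed
    then show ?thesis using iS' S'(1) by (intro exI[of _ "insert w S'"]) simp
  qed
qed

text \<open>Finds a generator that can be eliminated as soon as \<open>a\<close> is mapped to zero,
  because its coefficient is invertible.\<close>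

lemma span_nonzero:
  assumes "finite S" "S \<subseteq> carrier G" "a \<in> span S" "a \<noteq> \<one>"
  shows "\<exists>s\<in>S. \<exists>c x. c \<noteq> 0 \<and> x \<in> span (S - {s}) \<and> a = x \<otimes> sc c s"
  using assms
proof (induction S rule: finite_induct)
  case empty
  from empty.prems(2) have "a = \<one>" by (cases rule: span.cases) auto
  then show ?case using empty by blast
next
  case (insert s S)
  have S: "S \<subseteq> carrier G" "s \<in> carrier G" using insert by auto
  obtain x c where x: "x \<in> span S" "a = x \<otimes> sc c s" using span_insert[OF insert.prems(2,1)] by blast
  show ?case
  proof (cases "c = 0")
    case False
    then show ?thesis using x insert(2) by (intro bexI[of _ s] exI[of _ c] exI[of _ x]) auto
  next
    case True
    then have "a = x" using x S sc_0 span_closed by simp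
    then obtain t d y where t: "t \<in> S" "d \<noteq> 0" "y \<in> span (S - {t})" "a = y \<otimes> sc d t"
      using insert.IH[OF S(1)] x(1) insert.prems(3) by blast
    have "y \<in> span (insert s S - {t})" using t(3) span_mono[of "S - {t}" "insert s S - {t}"] insert.prems(1) by blast
    then show ?thesis using t by blast
  qed
qed

end

lemma kspace_hom_span:
  assumes G: "kspace G sc" and H: "kspace H sc'" and S: "S \<subseteq> carrier G"
    and h: "\<phi> \<in> hom G H" and l: "\<And>c x. x \<in> carrier G \<Longrightarrow> \<phi> (sc c x) = sc' c (\<phi> x)"
    and x: "x \<in> kspace.span G sc S"
  shows "\<phi> x \<in> kspace.span H sc' (\<phi> ` S)"
proof -
  interpret G: kspace G sc by (rule G)
  interpret H: kspace H sc' by (rule H)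
  interpret gh: group_hom G H \<phi>
    by (simp add: group_hom_def group_hom_axioms_def h G.is_group H.is_group)
  from x show ?thesis
  proof (induction rule: G.span.induct)
    case span_one then show ?case using H.span_one by simp
  next
    case (span_step x s c)
    have "\<phi> (x \<otimes>\<^bsub>G\<^esub> sc c s) = \<phi> x \<otimes>\<^bsub>H\<^esub> sc' c (\<phi> s)"
      using span_step G.span_closed[OF _ S] S l by auto
    then show ?case using H.span_step[OF span_step.IH, of "\<phi> s" c] span_step(2) by simp
  qed
qed

context linear_triangulated_category
begin

section \<open>Generating sets of morphism spaces\<close>

lemma hom_kspace: "A \<in> Obj T \<Longrightarrow> B \<in> Obj T \<Longrightarrow> kspace (hgrp T A B) (scl T)"
  by (simp add: kspace_def kspace_axioms_def hom_comm_group scl_closed scl_one scl_mult scl_add_left scl_add_right)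

text \<open>Bounds the dimension by the size of a generating set; the bound later serves as
  induction measure.\<close>

definition fgn :: "nat \<Rightarrow> 'o \<Rightarrow> 'o \<Rightarrow> bool"
  where "fgn n A X \<longleftrightarrow> A \<in> Obj T \<and> X \<in> Obj T \<and> (\<exists>S. finite S \<and> card S \<le> n \<and> S \<subseteq> Hom T A X \<and>
    Hom T A X \<subseteq> kspace.span (hgrp T A X) (scl T) S)"

definition fg :: "'o \<Rightarrow> 'o \<Rightarrow> bool" where "fg A X \<longleftrightarrow> (\<exists>n. fgn n A X)"

lemma fgI:
  assumes "A \<in> Obj T" "X \<in> Obj T" "finite S" "S \<subseteq> Hom T A X" "Hom T A X \<subseteq> kspace.span (hgrp T A X) (scl T) S"
  shows "fg A X"
  unfolding fg_def fgn_def using assms by blast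

lemma fgE:
  assumes "fg A X"
  obtains S where "A \<in> Obj T" "X \<in> Obj T" "finite S" "S \<subseteq> Hom T A X"
    "Hom T A X \<subseteq> kspace.span (hgrp T A X) (scl T) S"
  using assms unfolding fg_def fgn_def by blast

lemma hom_finite_dim_fg:
  assumes A: "A \<in> Obj T" "X \<in> Obj T" and h: "hom_finite_dim T A X" shows "fg A X"
proof -
  interpret kspace "hgrp T A X" "scl T" by (rule hom_kspace[OF A])
  obtain S where S: "finite S" "S \<subseteq> Hom T A X"
    "\<forall>f\<in>Hom T A X. \<exists>c. f = finprod (hgrp T A X) (\<lambda>s. scl T (c s) s) S"
    using h unfolding hom_finite_dim_def by blast
  have "finprod (hgrp T A X) (\<lambda>s. scl T (c s) s) F \<in> span S" if "F \<subseteq> S" for F c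
  proof -
    have "finite F" using S(1) that finite_subset by blast
    then show ?thesis using that
    proof (induction F rule: finite_induct)
      case empty then show ?case using span_one by simp
    next
      case (insert s F)
      have p: "(\<lambda>s. scl T (c s) s) \<in> F \<rightarrow> Hom T A X" "scl T (c s) s \<in> Hom T A X" using insert S(2) by auto
      have "finprod (hgrp T A X) (\<lambda>s. scl T (c s) s) (insert s F) =
        finprod (hgrp T A X) (\<lambda>s. scl T (c s) s) F \<otimes>\<^bsub>hgrp T A X\<^esub> scl T (c s) s"
        using finprod_insert[OF insert(1,2) p] m_comm[OF p(2) finprod_closed[OF p(1)]] by simp
      then show ?case using span_step[of _ S s "c s"] insert by simp
    qed
  qed
  note sp = this[OF subset_refl]
  have "f \<in> span S" if "f \<in> Hom T A X" for f
    using bspec[OF S(3) that] sp by (elim exE) (simp only:)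
  then show ?thesis using fgI[OF A S(1,2)] by blast
qed

lemma fgn_quotient:
  assumes f: "fgn n A X" and g: "arr X Y g" and l: "\<And>h. arr A Y h \<Longrightarrow> \<exists>k. arr A X k \<and> g \<cdot> k = h"
    and a: "arr A X a" "a \<noteq> zr A X" "g \<cdot> a = zr A Y"
  shows "\<exists>m<n. fgn m A Y"
proof -
  obtain S where S: "A \<in> Obj T" "finite S" "card S \<le> n" "S \<subseteq> Hom T A X"
    "Hom T A X \<subseteq> kspace.span (hgrp T A X) (scl T) S" using f unfolding fgn_def by blast
  note o = S(1) arrD(1,2)[OF g]
  interpret X: kspace "hgrp T A X" "scl T" by (rule hom_kspace[OF o(1,2)])
  interpret Y: kspace "hgrp T A Y" "scl T" by (rule hom_kspace[OF o(1,3)])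
  obtain s c x where s: "s \<in> S" "c \<noteq> 0" "x \<in> X.span (S - {s})" "a = add A X x (scl T c s)"
    using X.span_nonzero[OF S(2,4) _ a(2)] S(5) arrD(3)[OF a(1)] by blast
  let ?\<phi> = "\<lambda>f. g \<cdot> f"
  let ?S = "S - {s}"
  have sS: "?S \<subseteq> Hom T A X" using S(4) by blast
  have im: "?\<phi> ` ?S \<subseteq> Hom T A Y" using sS cmp_closed[OF o _ arrD(3)[OF g]] by blast
  have sp: "?\<phi> y \<in> Y.span (?\<phi> ` R)" if "y \<in> X.span R" "R \<subseteq> Hom T A X" for y R
    by (rule kspace_hom_span[OF X.kspace_axioms Y.kspace_axioms that(2) hom_comp_left[OF o(1) g] _ that(1)])
      (use scl_cmp_right[OF o _ arrD(3)[OF g]] in simp)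
  have xa: "arr A X x" using X.span_closed[OF s(3) sS] o by (simp add: arr_def)
  have sa: "arr A X s" using s(1) S(4) o by (auto simp: arr_def)
  have gs: "g \<cdot> s \<in> Hom T A Y" and gx: "g \<cdot> x \<in> Hom T A Y"
    using arrD(3)[OF arr_comp[OF sa g]] arrD(3)[OF arr_comp[OF xa g]] .
  have csa: "arr A X (scl T c s)" using scl_closed[OF arrD[OF sa]] o by (simp add: arr_def)
  have "add A Y (g \<cdot> x) (scl T c (g \<cdot> s)) = zr A Y"
    using a(3) s(4) comp_add_right[OF xa csa g] scl_cmp_right[OF o arrD(3)[OF sa] arrD(3)[OF g]] by simp
  \<comment> \<open>Solves the relation for the image of \<open>s\<close>, whose coefficient
    \<open>c\<close> is invertible.\<close>
  then have "scl T (- (1 / c)) (add A Y (g \<cdot> x) (scl T c (g \<cdot> s))) = zr A Y" using Y.sc_one by simp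
  then have "add A Y (scl T (- (1 / c)) (g \<cdot> x)) (scl T (- 1) (g \<cdot> s)) = zr A Y"
    using Y.sc_add[OF gx Y.sc_closed[OF gs]] Y.sc_mult[OF gs, of "- (1 / c)" c, symmetric] s(2) by simp
  then have "add A Y (add A Y (scl T (- (1 / c)) (g \<cdot> x)) (scl T (- 1) (g \<cdot> s))) (g \<cdot> s) = g \<cdot> s"
    using gs by simp
  then have "g \<cdot> s = scl T (- (1 / c)) (g \<cdot> x)"
    using Y.sc_inverse[OF gs, of "- 1"] Y.sc_1[OF gs] gs gx by (simp add: Y.m_assoc)
  then have gsp: "g \<cdot> s \<in> Y.span (?\<phi> ` ?S)" using Y.span_sc[OF sp[OF s(3) sS] im] by simp
  have "?\<phi> ` S \<subseteq> Y.span (?\<phi> ` ?S)" using gsp Y.span_base[OF _ im] by blast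
  then have sub: "Y.span (?\<phi> ` S) \<subseteq> Y.span (?\<phi> ` ?S)" by (rule Y.span_least[OF Y.subspace_span[OF im]])
  have "Hom T A Y \<subseteq> Y.span (?\<phi> ` ?S)"
  proof
    fix h assume "h \<in> Hom T A Y"
    then obtain k where k: "arr A X k" "g \<cdot> k = h" using l[OF arrI[OF o(1,3)]] by blast
    then show "h \<in> Y.span (?\<phi> ` ?S)" using sp[of k S] S(4,5) arrD(3)[OF k(1)] sub by blast
  qed
  moreover have "card ?S < n" using S(2,3) s(1) card_Diff1_less[OF S(2) s(1)] by linarith
  moreover have "card (?\<phi> ` ?S) \<le> card ?S" using card_image_le[of ?S ?\<phi>] S(2) by simp
  ultimately show ?thesis using o S(2) im unfolding fgn_def by (metis finite_Diff finite_imageI)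
qed

lemma fg_retract:
  assumes f: "fg B X" and r: "arr A B i" "arr B A p" "p \<cdot> i = idn T A" shows "fg A X"
proof -
  obtain S where S: "B \<in> Obj T" "X \<in> Obj T" "finite S" "S \<subseteq> Hom T B X"
    "Hom T B X \<subseteq> kspace.span (hgrp T B X) (scl T) S" using fgE[OF f] .
  note A = arrD(1)[OF r(1)]
  let ?\<phi> = "\<lambda>f. f \<cdot> i"
  have im: "?\<phi> ` S \<subseteq> Hom T A X" using S(4) cmp_closed[OF A S(1,2) arrD(3)[OF r(1)]] by blast
  have "Hom T A X \<subseteq> kspace.span (hgrp T A X) (scl T) (?\<phi> ` S)"
  proof
    fix h assume "h \<in> Hom T A X"
    then have h: "arr A X h" using A S(2) by (simp add: arr_def)
    have "?\<phi> (h \<cdot> p) \<in> kspace.span (hgrp T A X) (scl T) (?\<phi> ` S)"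
      by (rule kspace_hom_span[OF hom_kspace[OF S(1,2)] hom_kspace[OF A S(2)] S(4) hom_comp_right[OF S(2) r(1)]])
        (use scl_cmp_left[OF A S(1,2) arrD(3)[OF r(1)]] S(5) arrD(3)[OF arr_comp[OF r(2) h]] in auto)
    then show "h \<in> kspace.span (hgrp T A X) (scl T) (?\<phi> ` S)"
      using comp_assoc[OF r(1,2) h] r(3) id_right[OF h] by simp
  qed
  then show ?thesis using fgI[OF A S(2) _ im] S(3) by blast
qed

lemma fg_sh:
  assumes X: "X \<in> Obj T" and A: "A \<in> Obj T" shows "fg (sh T A) (sh T X) \<longleftrightarrow> fg A X"
proof
  note o = sh_Obj[OF A] sh_Obj[OF X]
  have hm: "shm T \<in> hom (hgrp T A X) (hgrp T (sh T A) (sh T X))" by (rule shm_add[OF A X])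
  assume "fg A X"
  then obtain S where S: "finite S" "S \<subseteq> Hom T A X" "Hom T A X \<subseteq> kspace.span (hgrp T A X) (scl T) S"
    by (rule fgE)
  have "Hom T (sh T A) (sh T X) \<subseteq> kspace.span (hgrp T (sh T A) (sh T X)) (scl T) (shm T ` S)"
  proof
    fix h assume "h \<in> Hom T (sh T A) (sh T X)"
    then obtain k where k: "arr A X k" "shm T k = h" using shm_surj[OF arrI[OF o] A X] by blast
    have "shm T k \<in> kspace.span (hgrp T (sh T A) (sh T X)) (scl T) (shm T ` S)"
      by (rule kspace_hom_span[OF hom_kspace[OF A X] hom_kspace[OF o] S(2) hm])
        (use scl_shm[OF A X] S(3) arrD(3)[OF k(1)] in auto)
    then show "h \<in> kspace.span (hgrp T (sh T A) (sh T X)) (scl T) (shm T ` S)" using k(2) by simp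
  qed
  moreover have "shm T ` S \<subseteq> Hom T (sh T A) (sh T X)" using hom_in_carrier[OF hm] S(2) by blast
  ultimately show "fg (sh T A) (sh T X)" using fgI[OF o] S(1) by blast
next
  note o = sh_Obj[OF A] sh_Obj[OF X]
  let ?i = "\<lambda>g. inv_into (Hom T A X) (shm T) g"
  have b: "bij_betw (shm T) (Hom T A X) (Hom T (sh T A) (sh T X))" by (rule shm_bij[OF A X])
  have ii: "?i g \<in> Hom T A X" "shm T (?i g) = g" if "g \<in> Hom T (sh T A) (sh T X)" for g
    using b that unfolding bij_betw_def by (auto intro: inv_into_into f_inv_into_f)
  have si: "?i (shm T k) = k" if "k \<in> Hom T A X" for k
    using b that unfolding bij_betw_def by (auto intro: inv_into_f_f)
  interpret A: kspace "hgrp T A X" "scl T" by (rule hom_kspace[OF A X])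
  interpret B: kspace "hgrp T (sh T A) (sh T X)" "scl T" by (rule hom_kspace[OF o])
  have hm: "?i \<in> hom (hgrp T (sh T A) (sh T X)) (hgrp T A X)"
  proof (rule homI)
    fix x y assume x: "x \<in> Hom T (sh T A) (sh T X)" and y: "y \<in> Hom T (sh T A) (sh T X)"
    show "?i x \<in> Hom T A X" by (rule ii(1)[OF x])
    have "shm T (add A X (?i x) (?i y)) = add (sh T A) (sh T X) x y"
      using hom_mult[OF shm_add[OF A X] ii(1)[OF x] ii(1)[OF y]] ii(2)[OF x] ii(2)[OF y] by simp
    then show "?i (add (sh T A) (sh T X) x y) = add A X (?i x) (?i y)"
      using si[OF A.m_closed[OF ii(1)[OF x] ii(1)[OF y]]] by simp
  qed
  have sl: "?i (scl T c x) = scl T c (?i x)" if "x \<in> Hom T (sh T A) (sh T X)" for c x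
    using scl_shm[OF A X ii(1)[OF that], of c] ii(2)[OF that] si[OF A.sc_closed[OF ii(1)[OF that]], of c] by simp
  assume "fg (sh T A) (sh T X)"
  then obtain S where S: "finite S" "S \<subseteq> Hom T (sh T A) (sh T X)"
    "Hom T (sh T A) (sh T X) \<subseteq> kspace.span (hgrp T (sh T A) (sh T X)) (scl T) S" by (rule fgE)
  have "Hom T A X \<subseteq> A.span (?i ` S)"
  proof
    fix k assume k: "k \<in> Hom T A X"
    have "?i (shm T k) \<in> A.span (?i ` S)"
      by (rule kspace_hom_span[OF B.kspace_axioms A.kspace_axioms S(2) hm])
        (use sl S(3) b k in \<open>auto simp: bij_betw_def\<close>)
    then show "k \<in> A.span (?i ` S)" using si[OF k] by simp
  qed
  moreover have "?i ` S \<subseteq> Hom T A X" using ii(1) S(2) by blast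
  ultimately show "fg A X" using fgI[OF A X] S(1) by blast
qed

text \<open>Exactness of the sequence of maps into \<open>X\<close> from \<open>sh T A\<close>,
  \<open>C\<close> and \<open>B\<close>: the image in the last term is a subspace, hence finitely
  generated; its generators are lifted to \<open>C\<close>, and the kernel comes from
  \<open>sh T A\<close>.\<close>

lemma fg_cone:
  assumes t: "tr A B C" and f: "fg (sh T A) X" "fg B X" shows "fg C X"
proof -
  obtain u v w where t: "dt A B C u v w" using t unfolding tr_def by blast
  note d = dtD[OF t]
  obtain S1 where S1: "sh T A \<in> Obj T" "X \<in> Obj T" "finite S1" "S1 \<subseteq> Hom T (sh T A) X"
    "Hom T (sh T A) X \<subseteq> kspace.span (hgrp T (sh T A) X) (scl T) S1" using fgE[OF f(1)] .
  obtain S2 where S2: "finite S2" "S2 \<subseteq> Hom T B X" "Hom T B X \<subseteq> kspace.span (hgrp T B X) (scl T) S2"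
    by (rule fgE[OF f(2)])
  note X = S1(2)
  interpret C: kspace "hgrp T C X" "scl T" by (rule hom_kspace[OF d(3) X])
  interpret B: kspace "hgrp T B X" "scl T" by (rule hom_kspace[OF d(2) X])
  let ?\<phi> = "\<lambda>k. k \<cdot> v"
  have \<phi>: "?\<phi> \<in> hom (hgrp T C X) (hgrp T B X)" by (rule hom_comp_right[OF X d(7)])
  have \<phi>l: "?\<phi> (scl T c k) = scl T c (?\<phi> k)" if "k \<in> Hom T C X" for c k
    by (rule scl_cmp_left[OF d(2,3) X arrD(3)[OF d(7)] that])
  let ?W = "?\<phi> ` Hom T C X"
  have W1: "B.subspace ?W"
    unfolding B.subspace_def
  proof (intro conjI ballI allI)
    show "?W \<subseteq> Hom T B X" using hom_in_carrier[OF \<phi>] by blast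
    show "zr B X \<in> ?W" using comp_zr_left[OF d(7) X] C.one_closed by (metis image_eqI)
    fix x assume "x \<in> ?W"
    then obtain k where k: "k \<in> Hom T C X" "x = ?\<phi> k" by blast
    show "scl T c x \<in> ?W" for c unfolding k(2) \<phi>l[OF k(1), symmetric] using C.sc_closed[OF k(1)] by blast
    fix y assume "y \<in> ?W"
    then obtain l where l: "l \<in> Hom T C X" "y = ?\<phi> l" by blast
    show "add B X x y \<in> ?W"
      unfolding k(2) l(2) hom_mult[OF \<phi> k(1) l(1), symmetric] using C.m_closed[OF k(1) l(1)] by blast
  qed
  have W2: "?W \<subseteq> B.span S2" using hom_in_carrier[OF \<phi>] S2(3) by blast
  obtain S3 where S3: "finite S3" "S3 \<subseteq> ?W" "?W \<subseteq> B.span S3"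
    using B.subspace_fg[OF S2(1,2) W1 W2] by (elim exE conjE) (rule that)
  obtain S4 where S4: "S4 \<subseteq> Hom T C X" "finite S4" "S3 = ?\<phi> ` S4"
    using finite_subset_image[OF S3(1,2)] by (elim exE conjE) (rule that)
  let ?S1 = "(\<lambda>k. k \<cdot> w) ` S1"
  have \<psi>: "(\<lambda>k. k \<cdot> w) \<in> hom (hgrp T (sh T A) X) (hgrp T C X)" by (rule hom_comp_right[OF X d(8)])
  have S1C: "?S1 \<subseteq> Hom T C X" using hom_in_carrier[OF \<psi>] S1(4) by blast
  let ?S = "?S1 \<union> S4"
  have SC: "?S \<subseteq> Hom T C X" using S1C S4(1) by blast
  have "Hom T C X \<subseteq> C.span ?S"
  proof
    fix k assume k: "k \<in> Hom T C X"
    have sub: "B.span S3 \<subseteq> ?\<phi> ` C.span S4"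
    proof (rule B.span_least)
      show "S3 \<subseteq> ?\<phi> ` C.span S4" using S4 C.span_base by blast
      show "B.subspace (?\<phi> ` C.span S4)"
        unfolding B.subspace_def
      proof (intro conjI ballI allI)
        have cl: "C.span S4 \<subseteq> Hom T C X" using C.span_closed S4(1) by blast
        show "?\<phi> ` C.span S4 \<subseteq> Hom T B X" using hom_in_carrier[OF \<phi>] cl by blast
        show "zr B X \<in> ?\<phi> ` C.span S4" using comp_zr_left[OF d(7) X] C.span_one by (metis image_eqI)
        fix x assume "x \<in> ?\<phi> ` C.span S4"
        then obtain k where k: "k \<in> C.span S4" "x = ?\<phi> k" by blast
        then have kC: "k \<in> Hom T C X" using cl by blast
        show "scl T c x \<in> ?\<phi> ` C.span S4" for c
          unfolding k(2) \<phi>l[OF kC, symmetric] using C.span_sc[OF k(1) S4(1)] by blast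
        fix y assume "y \<in> ?\<phi> ` C.span S4"
        then obtain l where l: "l \<in> C.span S4" "y = ?\<phi> l" by blast
        then have lC: "l \<in> Hom T C X" using cl by blast
        show "add B X x y \<in> ?\<phi> ` C.span S4"
          unfolding k(2) l(2) hom_mult[OF \<phi> kC lC, symmetric] using C.span_mult[OF l(1) k(1) S4(1)] by blast
      qed
    qed
    obtain l where l: "l \<in> C.span S4" "k \<cdot> v = l \<cdot> v" using sub S3(3) k by blast
    have lC: "l \<in> Hom T C X" using C.span_closed[OF l(1) S4(1)] .
    have ka: "arr C X k" and la: "arr C X l" using k lC d(3) X by (simp_all add: arr_def)
    let ?d = "add C X k (neg C X l)"
    have "?d \<cdot> v = zr B X" using comp_diff_left[OF d(7) ka la] l(2) by blast
    then obtain m where m: "arr (sh T A) X m" "m \<cdot> w = ?d" using tri_ext2[OF t arr_add[OF ka arr_neg[OF la]]] by blast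
    have "m \<cdot> w \<in> C.span ?S1"
      by (rule kspace_hom_span[OF hom_kspace[OF S1(1) X] C.kspace_axioms S1(4) \<psi>])
        (use scl_cmp_left[OF d(3) S1(1) X arrD(3)[OF d(8)]] S1(5) arrD(3)[OF m(1)] in auto)
    then have "?d \<in> C.span ?S" using C.span_mono[of ?S1 ?S] SC m(2) by auto
    moreover have "l \<in> C.span ?S" using C.span_mono[of S4 ?S] SC l(1) by auto
    ultimately have "add C X ?d l \<in> C.span ?S" using C.span_mult[OF _ _ SC] by blast
    moreover have "add C X ?d l = k" using k lC by (simp add: C.m_assoc)
    ultimately show "k \<in> C.span ?S" by simp
  qed
  then show ?thesis using fgI[OF d(3) X _ SC] S1(3) S4(2) by simp
qed

end

section \<open>Silting objects and t-structures\<close>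

context triangulated_category
begin

text \<open>The long exact sequence of the triangle; the degree changes by one belong to the
  connecting maps.\<close>

lemma hom_zero_tr:
  assumes t: "tr A X B" and W: "W \<in> Obj T"
  shows "hom_zero T W (shpow T j A) \<Longrightarrow> hom_zero T W (shpow T j B) \<Longrightarrow> hom_zero T W (shpow T j X)"
    "hom_zero T W (shpow T j X) \<Longrightarrow> hom_zero T W (shpow T (j + 1) A) \<Longrightarrow> hom_zero T W (shpow T j B)"
    "hom_zero T W (shpow T j X) \<Longrightarrow> hom_zero T W (shpow T (j - 1) B) \<Longrightarrow> hom_zero T W (shpow T j A)"
proof -
  note o = trD[OF t]
  have tj: "tr (shpow T j A) (shpow T j X) (shpow T j B)" by (rule tr_shpow[OF t])
  show "hom_zero T W (shpow T j A) \<Longrightarrow> hom_zero T W (shpow T j B) \<Longrightarrow> hom_zero T W (shpow T j X)"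
    by (rule hom_zero_mid(1)[OF tj W])
  show "hom_zero T W (shpow T j X) \<Longrightarrow> hom_zero T W (shpow T (j + 1) A) \<Longrightarrow> hom_zero T W (shpow T j B)"
    using hom_zero_mid(1)[OF tr_rot[OF tj] W] shpow_suc[OF o(1), of j] by simp
  have tm: "tr (shpow T (j - 1) B) (shpow T j A) (shpow T j X)"
  proof (rule tr_unrot)
    have "tr (shpow T j A) (shpow T j X) (shpow T j B)" by (rule tj)
    then show "tr (shpow T j A) (shpow T j X) (sh T (shpow T (j - 1) B))"
      using shpow_suc[OF o(3), of "j - 1"] by simp
  qed (use o in simp)
  show "hom_zero T W (shpow T j X) \<Longrightarrow> hom_zero T W (shpow T (j - 1) B) \<Longrightarrow> hom_zero T W (shpow T j A)"
    using hom_zero_mid(1)[OF tm W] by blast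
qed

section \<open>Vanishing by degree, iterated extensions and amplitude\<close>

definition le :: "'o \<Rightarrow> int \<Rightarrow> 'o \<Rightarrow> bool"
  where "le M i X \<longleftrightarrow> X \<in> Obj T \<and> (\<forall>j>i. hom_zero T M (shpow T j X))"

definition ge :: "'o \<Rightarrow> int \<Rightarrow> 'o \<Rightarrow> bool"
  where "ge M i X \<longleftrightarrow> X \<in> Obj T \<and> (\<forall>j<i. hom_zero T M (shpow T j X))"

lemma leD: "le M i X \<Longrightarrow> X \<in> Obj T" "le M i X \<Longrightarrow> i < j \<Longrightarrow> hom_zero T M (shpow T j X)"
  and geD: "ge M i X \<Longrightarrow> X \<in> Obj T" "ge M i X \<Longrightarrow> j < i \<Longrightarrow> hom_zero T M (shpow T j X)"
  unfolding le_def ge_def by blast+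

lemma leI: "X \<in> Obj T \<Longrightarrow> (\<And>j. i < j \<Longrightarrow> hom_zero T M (shpow T j X)) \<Longrightarrow> le M i X"
  and geI: "X \<in> Obj T \<Longrightarrow> (\<And>j. j < i \<Longrightarrow> hom_zero T M (shpow T j X)) \<Longrightarrow> ge M i X"
  unfolding le_def ge_def by blast+

lemma le_mono: "le M i X \<Longrightarrow> i \<le> i' \<Longrightarrow> le M i' X"
  and ge_mono: "ge M i X \<Longrightarrow> i' \<le> i \<Longrightarrow> ge M i' X"
  unfolding le_def ge_def by auto

lemma le_shpow: assumes X: "X \<in> Obj T" shows "le M i (shpow T k X) \<longleftrightarrow> le M (i + k) X"
proof
  assume a: "le M i (shpow T k X)"
  show "le M (i + k) X"
  proof (rule leI[OF X])
    fix j assume "i + k < j"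
    then show "hom_zero T M (shpow T j X)" using leD(2)[OF a, of "j - k"] shpow_add[OF X, of "j - k" k] by simp
  qed
next
  assume a: "le M (i + k) X"
  show "le M i (shpow T k X)"
  proof (rule leI[OF shpow_Obj[OF X]])
    fix j assume "i < j"
    then show "hom_zero T M (shpow T j (shpow T k X))" using leD(2)[OF a, of "j + k"] shpow_add[OF X, of j k] by simp
  qed
qed

lemma ge_shpow: assumes X: "X \<in> Obj T" shows "ge M i (shpow T k X) \<longleftrightarrow> ge M (i + k) X"
proof
  assume a: "ge M i (shpow T k X)"
  show "ge M (i + k) X"
  proof (rule geI[OF X])
    fix j assume "j < i + k"
    then show "hom_zero T M (shpow T j X)" using geD(2)[OF a, of "j - k"] shpow_add[OF X, of "j - k" k] by simp
  qed
next
  assume a: "ge M (i + k) X"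
  show "ge M i (shpow T k X)"
  proof (rule geI[OF shpow_Obj[OF X]])
    fix j assume "j < i"
    then show "hom_zero T M (shpow T j (shpow T k X))" using geD(2)[OF a, of "j + k"] shpow_add[OF X, of j k] by simp
  qed
qed

lemma le_ge_tr:
  assumes M: "M \<in> Obj T" and t: "tr A X B"
  shows "le M i A \<Longrightarrow> le M i B \<Longrightarrow> le M i X" "le M i X \<Longrightarrow> le M (i + 1) A \<Longrightarrow> le M i B"
    "le M i X \<Longrightarrow> le M (i - 1) B \<Longrightarrow> le M i A"
    "ge M i A \<Longrightarrow> ge M i B \<Longrightarrow> ge M i X" "ge M i X \<Longrightarrow> ge M (i + 1) A \<Longrightarrow> ge M i B"
    "ge M i X \<Longrightarrow> ge M (i - 1) B \<Longrightarrow> ge M i A"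
  unfolding le_def ge_def using hom_zero_tr[OF t M] trD[OF t] by simp_all

lemma le_ge_iso:
  assumes M: "M \<in> Obj T" and i: "isomorphic T X Y" and Y: "Y \<in> Obj T"
  shows "le M k X \<Longrightarrow> le M k Y" "ge M k X \<Longrightarrow> ge M k Y"
proof -
  show "le M k Y" if a: "le M k X"
  proof (rule leI[OF Y])
    fix j assume "k < j"
    then show "hom_zero T M (shpow T j Y)"
      using leD[OF a] hom_zero_iso_right[of "shpow T j X" "shpow T j Y" M] isomorphic_shpow[OF leD(1)[OF a] Y, of j] i M Y
      by simp
  qed
  show "ge M k Y" if a: "ge M k X"
  proof (rule geI[OF Y])
    fix j assume "j < k"
    then show "hom_zero T M (shpow T j Y)"
      using geD[OF a] hom_zero_iso_right[of "shpow T j X" "shpow T j Y" M] isomorphic_shpow[OF geD(1)[OF a] Y, of j] i M Y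
      by simp
  qed
qed

lemma is_zero_shpow: "is_zero T Z \<Longrightarrow> is_zero T (shpow T j Z)"
  using is_zero_iff[of Z] is_zero_iff[of "shpow T j Z"] hom_zero_shpow[of Z Z j] is_zero_Obj[of Z] by simp

lemma le_ge_zero:
  assumes M: "M \<in> Obj T" and Z: "is_zero T Z" shows "le M i Z" "ge M i Z"
  unfolding le_def ge_def using is_zeroD[OF is_zero_shpow[OF Z] M] is_zero_Obj[OF Z] by blast+

text \<open>Finite iterated extensions of copies of \<open>M\<close>, the new copy always on the
  right: the cocones of successive approximations by \<open>M\<close> have this shape.\<close>

inductive_set filt for M where
  filt_zero: "is_zero T Z \<Longrightarrow> Z \<in> filt M"
| filt_step: "E \<in> filt M \<Longrightarrow> tr E E' M \<Longrightarrow> E' \<in> filt M"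

lemma filt_Obj: "E \<in> filt M \<Longrightarrow> E \<in> Obj T"
  by (induction rule: filt.induct) (auto dest: is_zero_Obj trD)

lemma filt_hom_zero_right:
  assumes "E \<in> filt M" "W \<in> Obj T" "hom_zero T W (shpow T j M)" shows "hom_zero T W (shpow T j E)"
  using assms(1)
proof (induction rule: filt.induct)
  case (filt_zero Z)
  then show ?case using is_zeroD[OF is_zero_shpow assms(2)] by blast
next
  case (filt_step E E')
  then show ?case using hom_zero_tr(1)[OF filt_step(2) assms(2)] assms(3) by blast
qed

lemma filt_hom_zero_left:
  assumes "E \<in> filt M" "W \<in> Obj T" "hom_zero T M W" shows "hom_zero T E W"
  using assms(1)
proof (induction rule: filt.induct)
  case (filt_zero Z)
  then show ?case using is_zeroD[OF _ assms(2)] by blast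
next
  case (filt_step E E')
  then show ?case using hom_zero_mid(2)[OF filt_step(2) assms(2)] assms(3) by blast
qed

text \<open>Degree \<open>j\<close> as seen by \<open>Y\<close> is controlled by the degrees within
  distance \<open>a\<close> of \<open>j\<close> as seen by \<open>M\<close>. Uniformity in
  \<open>X\<close> and \<open>j\<close> makes the condition stable under cones, at the cost of a
  larger \<open>a\<close>.\<close>

definition amplitude :: "int \<Rightarrow> 'o \<Rightarrow> 'o \<Rightarrow> bool"
  where "amplitude a M Y \<longleftrightarrow> Y \<in> Obj T \<and> (\<forall>X\<in>Obj T. \<forall>j. (\<forall>i. \<bar>i - j\<bar> \<le> a \<longrightarrow> hom_zero T M (shpow T i X)) \<longrightarrow>
    hom_zero T Y (shpow T j X))"

lemma amplitudeD: "amplitude a M Y \<Longrightarrow> X \<in> Obj T \<Longrightarrow> (\<And>i. \<bar>i - j\<bar> \<le> a \<Longrightarrow> hom_zero T M (shpow T i X)) \<Longrightarrow>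
    hom_zero T Y (shpow T j X)"
  unfolding amplitude_def by blast

lemma amplitudeI: "Y \<in> Obj T \<Longrightarrow> (\<And>X j. X \<in> Obj T \<Longrightarrow> (\<And>i. \<bar>i - j\<bar> \<le> a \<Longrightarrow> hom_zero T M (shpow T i X)) \<Longrightarrow>
    hom_zero T Y (shpow T j X)) \<Longrightarrow> amplitude a M Y"
  unfolding amplitude_def by blast

lemma amplitude_mono: assumes "amplitude a M Y" "a \<le> b" shows "amplitude b M Y"
proof (rule amplitudeI)
  show "Y \<in> Obj T" using assms unfolding amplitude_def by blast
  fix X j assume X: "X \<in> Obj T" and h: "\<And>i. \<bar>i - j\<bar> \<le> b \<Longrightarrow> hom_zero T M (shpow T i X)"
  show "hom_zero T Y (shpow T j X)" by (rule amplitudeD[OF assms(1) X]) (use h assms(2) in auto)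
qed

lemma thickI:
  assumes "C \<subseteq> Obj T" "C \<noteq> {}" "\<And>A B. A \<in> C \<Longrightarrow> isomorphic T A B \<Longrightarrow> B \<in> Obj T \<Longrightarrow> B \<in> C"
    "\<And>X. X \<in> C \<Longrightarrow> sh T X \<in> C" "\<And>X. X \<in> Obj T \<Longrightarrow> sh T X \<in> C \<Longrightarrow> X \<in> C"
    "\<And>X Y Z. tr X Y Z \<Longrightarrow> X \<in> C \<Longrightarrow> Y \<in> C \<Longrightarrow> Z \<in> C"
    "\<And>A X. X \<in> C \<Longrightarrow> A \<in> Obj T \<Longrightarrow> summand T A X \<Longrightarrow> A \<in> C"
  shows "thick T C"
  unfolding thick_def
proof (intro conjI)
  show "subcat T C" using assms(1,3) unfolding subcat_def by blast
  show "\<forall>X\<in>Obj T. sh T X \<in> C \<longleftrightarrow> X \<in> C" using assms(4,5) by blast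
  show "\<forall>X\<in>C. \<forall>Y\<in>C. \<forall>Z\<in>Obj T. \<forall>u v w. tri T X Y Z u v w \<longrightarrow> Z \<in> C"
  proof (intro ballI allI impI)
    fix X Y Z u v w assume a: "X \<in> C" "Y \<in> C" "Z \<in> Obj T" "tri T X Y Z u v w"
    then have "tr X Y Z" using assms(1) unfolding tr_def dt_def by blast
    then show "Z \<in> C" using assms(6) a by blast
  qed
  show "\<forall>X\<in>C. \<forall>A\<in>Obj T. summand T A X \<longrightarrow> A \<in> C" using assms(7) by blast
qed (rule assms(2))

lemma thick_closure_least: "Y \<in> thick_closure T M \<Longrightarrow> thick T C \<Longrightarrow> M \<in> C \<Longrightarrow> Y \<in> C"
  unfolding thick_closure_def by blast

text \<open>The objects of finite amplitude form a thick subcategory containing \<open>M\<close>. A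
  suspension costs 1; for a cone, \<open>a + b\<close> dominates both bounds and the connecting map
  costs 1 more.\<close>

lemma amplitude_closure:
  assumes M: "M \<in> Obj T" and Y: "Y \<in> thick_closure T M" shows "\<exists>a\<ge>0. amplitude a M Y"
proof -
  let ?C = "{Y. \<exists>a\<ge>0. amplitude a M Y}"
  have am: "amplitude 0 M M" by (rule amplitudeI[OF M]) auto
  have "thick T ?C"
  proof (rule thickI)
    show "?C \<subseteq> Obj T" unfolding amplitude_def by blast
    show "?C \<noteq> {}" using am by blast
    fix A B assume "A \<in> ?C" and B: "isomorphic T A B" "B \<in> Obj T"
    then obtain a where a: "0 \<le> a" "amplitude a M A" by blast
    then have A: "A \<in> Obj T" unfolding amplitude_def by blast
    have "amplitude a M B"
    proof (rule amplitudeI[OF B(2)])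
      fix X j assume X: "X \<in> Obj T" and h: "\<And>i. \<bar>i - j\<bar> \<le> a \<Longrightarrow> hom_zero T M (shpow T i X)"
      show "hom_zero T B (shpow T j X)"
        using amplitudeD[OF a(2) X h] hom_zero_iso_left[OF B(1) A B(2) shpow_Obj[OF X]] by blast
    qed
    then show "B \<in> ?C" using a by blast
  next
    fix A assume "A \<in> ?C"
    then obtain a where a: "0 \<le> a" "amplitude a M A" by blast
    then have A: "A \<in> Obj T" unfolding amplitude_def by blast
    have "amplitude (a + 1) M (sh T A)"
    proof (rule amplitudeI[OF sh_Obj[OF A]])
      fix X j assume X: "X \<in> Obj T" and h: "\<And>i. \<bar>i - j\<bar> \<le> a + 1 \<Longrightarrow> hom_zero T M (shpow T i X)"
      have "hom_zero T A (shpow T (j - 1) X)" by (rule amplitudeD[OF a(2) X]) (rule h, simp)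
      then show "hom_zero T (sh T A) (shpow T j X)"
        using hom_zero_sh[OF A shpow_Obj[OF X], of "j - 1"] shpow_suc[OF X, of "j - 1"] by simp
    qed
    then show "sh T A \<in> ?C" using a(1) by (intro CollectI exI[of _ "a + 1"]) simp
  next
    fix A assume A: "A \<in> Obj T" and "sh T A \<in> ?C"
    then obtain a where a: "0 \<le> a" "amplitude a M (sh T A)" by blast
    have "amplitude (a + 1) M A"
    proof (rule amplitudeI[OF A])
      fix X j assume X: "X \<in> Obj T" and h: "\<And>i. \<bar>i - j\<bar> \<le> a + 1 \<Longrightarrow> hom_zero T M (shpow T i X)"
      have "hom_zero T (sh T A) (shpow T (j + 1) X)" by (rule amplitudeD[OF a(2) X]) (rule h, simp)
      then show "hom_zero T A (shpow T j X)"
        using hom_zero_sh[OF A shpow_Obj[OF X], of j] shpow_suc[OF X, of j] by simp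
    qed
    then show "A \<in> ?C" using a(1) by (intro CollectI exI[of _ "a + 1"]) simp
  next
    fix A B D assume t: "tr A B D" and "A \<in> ?C" "B \<in> ?C"
    then obtain a b where a: "0 \<le> a" "amplitude a M A" and b: "0 \<le> b" "amplitude b M B" by blast
    have "amplitude (a + b + 1) M D"
    proof (rule amplitudeI[OF trD(3)[OF t]])
      fix X j assume X: "X \<in> Obj T" and h: "\<And>i. \<bar>i - j\<bar> \<le> a + b + 1 \<Longrightarrow> hom_zero T M (shpow T i X)"
      have 1: "hom_zero T A (shpow T (j - 1) X)" by (rule amplitudeD[OF a(2) X]) (rule h, use b(1) in simp)
      have 2: "hom_zero T B (shpow T j X)" by (rule amplitudeD[OF b(2) X]) (rule h, use a(1) in simp)
      have 3: "hom_zero T (sh T A) (shpow T j X)"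
        using 1 hom_zero_sh[OF trD(1)[OF t] shpow_Obj[OF X], of "j - 1"] shpow_suc[OF X, of "j - 1"] by simp
      show "hom_zero T D (shpow T j X)" by (rule hom_zero_mid(2)[OF tr_rot[OF t] shpow_Obj[OF X] 2 3])
    qed
    then show "D \<in> ?C" using a(1) b(1) by (intro CollectI exI[of _ "a + b + 1"]) simp
  next
    fix A B assume "B \<in> ?C" and A: "A \<in> Obj T" "summand T A B"
    then obtain a where a: "0 \<le> a" "amplitude a M B" by blast
    have "amplitude a M A"
    proof (rule amplitudeI[OF A(1)])
      fix X j assume X: "X \<in> Obj T" and h: "\<And>i. \<bar>i - j\<bar> \<le> a \<Longrightarrow> hom_zero T M (shpow T i X)"
      show "hom_zero T A (shpow T j X)" by (rule summand_hom_zero(1)[OF A(2) shpow_Obj[OF X] amplitudeD[OF a(2) X h]])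
    qed
    then show "A \<in> ?C" using a by blast
  qed
  then show ?thesis using thick_closure_least[OF Y, of ?C] am by blast
qed

lemma amplitude_le:
  assumes a: "amplitude a M N" and l: "le M i X" shows "le N (i + a) X"
proof (rule leI[OF leD(1)[OF l]])
  fix j assume j: "i + a < j"
  show "hom_zero T N (shpow T j X)" by (rule amplitudeD[OF a leD(1)[OF l]]) (rule leD(2)[OF l], use j in linarith)
qed

lemma amplitude_ge:
  assumes a: "amplitude a M N" and l: "ge M i X" shows "ge N (i - a) X"
proof (rule geI[OF geD(1)[OF l]])
  fix j assume j: "j < i - a"
  show "hom_zero T N (shpow T j X)" by (rule amplitudeD[OF a geD(1)[OF l]]) (rule geD(2)[OF l], use j in linarith)
qed

text \<open>The t-structure of \<open>M\<close> on all of \<open>T\<close>, normalised to degrees at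
  most 0 and at least 1 so that no suspended classes appear.\<close>

definition tstr :: "'o \<Rightarrow> bool"
  where "tstr M \<longleftrightarrow> M \<in> Obj T \<and> (\<forall>X Y. le M 0 X \<longrightarrow> ge M 1 Y \<longrightarrow> hom_zero T X Y) \<and>
    (\<forall>X\<in>Obj T. \<exists>A B. le M 0 A \<and> ge M 1 B \<and> tr A X B)"

lemma tstr_orth:
  assumes t: "tstr M" and X: "le M i X" and Y: "ge M (i + 1) Y" shows "hom_zero T X Y"
proof -
  have "le M 0 (shpow T i X)" using X le_shpow[OF leD(1)[OF X], of M 0 i] by simp
  moreover have "ge M 1 (shpow T i Y)" using Y ge_shpow[OF geD(1)[OF Y], of M 1 i] by (simp add: add.commute)
  ultimately have "hom_zero T (shpow T i X) (shpow T i Y)" using t unfolding tstr_def by blast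
  then show ?thesis using hom_zero_shpow[OF leD(1)[OF X] geD(1)[OF Y]] by blast
qed

lemma tstr_decomp:
  assumes t: "tstr M" and X: "X \<in> Obj T" obtains A B where "le M i A" "ge M (i + 1) B" "tr A X B"
proof -
  obtain A B where A: "le M 0 A" "ge M 1 B" "tr A (shpow T i X) B" using t shpow_Obj[OF X] unfolding tstr_def by blast
  note o = trD[OF A(3)]
  have "tr (shpow T (- i) A) X (shpow T (- i) B)" using tr_shpow[OF A(3), of "- i"] shpow_inv(1)[OF X] by simp
  moreover have "le M i (shpow T (- i) A)" using A(1) le_shpow[OF o(1), of M i "- i"] by simp
  moreover have "ge M (i + 1) (shpow T (- i) B)" using A(2) ge_shpow[OF o(3), of M "i + 1" "- i"] by simp
  ultimately show thesis using that by blast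
qed

end

context linear_triangulated_category
begin

text \<open>The condition quantifies over all targets, so a suspension on the left can be traded for
  a desuspension of the target; this makes the class thick.\<close>

lemma fg_closure:
  assumes M: "M \<in> Obj T" and f: "\<And>X. X \<in> Obj T \<Longrightarrow> fg M X" and Y: "Y \<in> thick_closure T M" and X: "X \<in> Obj T"
  shows "fg Y X"
proof -
  let ?C = "{Y\<in>Obj T. \<forall>X\<in>Obj T. fg Y X}"
  have shX: "fg (sh T A) X" if A: "A \<in> ?C" and X: "X \<in> Obj T" for A X
    using A fg_sh[OF unsh(1)[OF X], of A] unsh[OF X] by simp
  have "thick T ?C"
  proof (rule thickI)
    show "?C \<subseteq> Obj T" by blast
    show "?C \<noteq> {}" using M f by blast
    show "\<And>A. A \<in> ?C \<Longrightarrow> sh T A \<in> ?C" using shX by simp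
    show "\<And>A. A \<in> Obj T \<Longrightarrow> sh T A \<in> ?C \<Longrightarrow> A \<in> ?C" using fg_sh[THEN iffD1] sh_Obj by blast
    show "\<And>A B C. tr A B C \<Longrightarrow> A \<in> ?C \<Longrightarrow> B \<in> ?C \<Longrightarrow> C \<in> ?C" using fg_cone shX trD(3) by blast
    fix A B assume A: "A \<in> ?C" "isomorphic T A B" "B \<in> Obj T"
    then obtain g where g: "is_iso T A B g" unfolding isomorphic_def by blast
    obtain h where h: "arr A B g" "arr B A h" "g \<cdot> h = idn T B" using is_isoD[OF g] A by blast
    show "B \<in> ?C" using fg_retract[OF _ h(2,1,3)] A by blast
  next
    fix A B assume B: "B \<in> ?C" "A \<in> Obj T" "summand T A B"
    obtain i p where "arr A B i" "arr B A p" "p \<cdot> i = idn T A" using summandE[OF B(3)] .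
    then show "A \<in> ?C" using fg_retract B by blast
  qed
  then have "Y \<in> ?C" by (rule thick_closure_least[OF Y]) (use M f in blast)
  then show ?thesis using X by blast
qed

text \<open>Coning off generators of \<open>Hom (M, X)\<close> one at a time.\<close>

lemma kill_finite:
  assumes M: "M \<in> Obj T" and X: "X \<in> Obj T" and "finite F" "F \<subseteq> Hom T M X"
  shows "\<exists>E Z e q r. E \<in> filt M \<and> dt E X Z e q r \<and> (\<forall>s\<in>F. q \<cdot> s = zr M Z)"
  using assms(3,4)
proof (induction F rule: finite_induct)
  case empty
  obtain N where N: "is_zero T N" using zero_exists by blast
  then show ?case using dt_zero_id[OF X N] filt_zero[OF N] by blast
next
  case (insert s F)
  obtain E Z e q r where E: "E \<in> filt M" "dt E X Z e q r" "\<forall>s\<in>F. q \<cdot> s = zr M Z"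
    using insert.IH insert.prems by blast
  note d = dtD[OF E(2)]
  have s: "arr M X s" using insert.prems M X by (simp add: arr_def)
  \<comment> \<open>The image of the next generator in \<open>Z\<close> is coned off; the octahedron
    for \<open>q\<close> followed by \<open>q'\<close> makes the new cocone an extension of
    \<open>E\<close> by \<open>M\<close>.\<close>
  obtain Z' q' r' where Z': "dt M Z Z' (q \<cdot> s) q' r'" using cone_exists[OF arr_comp[OF s d(7)]] by blast
  note d' = dtD[OF Z']
  obtain Y k k' where Y: "dt X Z' Y (q' \<cdot> q) k k'" using cone_exists[OF arr_comp[OF d(7) d'(7)]] by blast
  obtain f' g' t' where o: "dt (sh T E) Y (sh T M) f' g' t'"
    using octa[OF rotate[OF E(2)] rotate[OF Z'] Y] by metis
  obtain E' where E': "E' \<in> Obj T" "Y = sh T E'" using sh_surj dtD(3)[OF Y] by blast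
  obtain e' where e': "dt E' X Z' e' (q' \<cdot> q) k" using unrotate[of X Z' E' "q' \<cdot> q" k k'] Y E' by blast
  have "tr E E' M" using tr_unshift[of E E' M] trI[OF o] E' d(1) M by blast
  then have "E' \<in> filt M" by (rule filt_step[OF E(1)])
  moreover have "(q' \<cdot> q) \<cdot> x = zr M Z'" if "x \<in> insert s F" for x
  proof -
    have x: "arr M X x" using that insert.prems M X by (auto simp: arr_def)
    have "q' \<cdot> (q \<cdot> x) = zr M Z'"
      using that tri_comp1[OF Z'] E(3) comp_zr_right[OF d'(7) M] by (cases "x = s") simp_all
    then show ?thesis using comp_assoc[OF x d(7) d'(7)] by simp
  qed
  ultimately show ?case using e' by blast
qed

text \<open>Maps from \<open>M\<close> to the cone lift to \<open>X\<close>, since there are none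
  from \<open>M\<close> to the suspension of an iterated extension of \<open>M\<close>. The lifts
  are spanned by the generators, which have been killed.\<close>

lemma kill:
  assumes f: "fg M X" and p: "hom_zero T M (sh T M)"
  obtains E Z where "E \<in> filt M" "tr E X Z" "hom_zero T M Z"
proof -
  obtain S where S: "M \<in> Obj T" "X \<in> Obj T" "finite S" "S \<subseteq> Hom T M X"
    "Hom T M X \<subseteq> kspace.span (hgrp T M X) (scl T) S" using fgE[OF f] .
  note M = S(1) and X = S(2)
  obtain E Z e q r where E: "E \<in> filt M" "dt E X Z e q r" "\<forall>s\<in>S. q \<cdot> s = zr M Z"
    using kill_finite[OF S(1-4)] by blast
  note d = dtD[OF E(2)]
  interpret X: kspace "hgrp T M X" "scl T" by (rule hom_kspace[OF M X])
  interpret Z: kspace "hgrp T M Z" "scl T" by (rule hom_kspace[OF M d(3)])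
  let ?K = "{k \<in> Hom T M X. q \<cdot> k = zr M Z}"
  have "X.subspace ?K"
    unfolding X.subspace_def
  proof (intro conjI ballI allI)
    show "zr M X \<in> ?K" using comp_zr_right[OF d(7) M] by simp
    fix x assume x: "x \<in> ?K"
    then have xa: "arr M X x" using M X by (simp add: arr_def)
    show "scl T c x \<in> ?K" for c
      using x scl_cmp_right[OF M d(2,3) arrD(3)[OF xa] arrD(3)[OF d(7)]] Z.sc_one by simp
    fix y assume y: "y \<in> ?K"
    then have ya: "arr M X y" using M X by (simp add: arr_def)
    show "add M X x y \<in> ?K" using x y comp_add_right[OF xa ya d(7)] by simp
  qed blast
  moreover have "S \<subseteq> ?K" using S(4) E(3) by blast
  ultimately have K: "Hom T M X \<subseteq> ?K" using X.span_least S(5) by blast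
  have "hom_zero T M (shpow T 1 E)" by (rule filt_hom_zero_right[OF E(1) M]) (use p shpow_1[OF M] in simp)
  then have e: "hom_zero T M (sh T E)" using shpow_1[OF d(1)] by simp
  have "hom_zero T M Z"
  proof (rule hom_zeroI[OF M d(3)])
    fix h assume h: "arr M Z h"
    have "r \<cdot> h = zr M (sh T E)" by (rule hom_zeroD[OF e arr_comp[OF h d(8)]])
    then obtain k where k: "arr M X k" "q \<cdot> k = h" using tri_lift2[OF E(2) h] by blast
    then show "h = zr M Z" using K arrD(3)[OF k(1)] by blast
  qed
  then show thesis using that E(1) trI[OF E(2)] by blast
qed

lemma presilting_filt:
  assumes p: "presilting T M" and E: "E \<in> filt M" and j: "0 < j" shows "hom_zero T M (shpow T j E)"
  by (rule filt_hom_zero_right[OF E]) (use p j in \<open>auto simp: presilting_def\<close>)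

lemma kill_degree:
  assumes p: "presilting T M" and f: "\<And>X. X \<in> Obj T \<Longrightarrow> fg M X" and X: "X \<in> Obj T"
  obtains E Z where "E \<in> filt M" "tr (shpow T c E) X Z" "hom_zero T M (shpow T (- c) Z)"
proof -
  have M: "M \<in> Obj T" and "hom_zero T M (shpow T 1 M)" using p unfolding presilting_def by auto
  then have h: "hom_zero T M (sh T M)" using shpow_1 by simp
  obtain E Z where E: "E \<in> filt M" "tr E (shpow T (- c) X) Z" "hom_zero T M Z"
    by (rule kill[OF f[OF shpow_Obj[OF X]] h])
  have "tr (shpow T c E) X (shpow T c Z)" using tr_shpow[OF E(2), of c] shpow_inv(2)[OF X] by simp
  moreover have "hom_zero T M (shpow T (- c) (shpow T c Z))" using E(3) shpow_inv(1)[OF trD(3)[OF E(2)]] by simp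
  ultimately show thesis using that E(1) by blast
qed

text \<open>Step \<open>c\<close> kills the maps of degree \<open>- c\<close>. The pieces glued into
  \<open>E\<close> are iterated extensions of \<open>M\<close> suspended \<open>c\<close> times, and
  these have no maps to an object in degrees at least 1.\<close>

lemma silting_approx_above:
  assumes p: "presilting T M" and f: "\<And>X. X \<in> Obj T \<Longrightarrow> fg M X" and X: "le M 0 X" and Y: "ge M 1 Y"
  shows "\<exists>E X'. tr E X X' \<and> hom_zero T E Y \<and> le M (- int c) X'"
proof (induction c)
  case 0
  obtain N where N: "is_zero T N" using zero_exists by blast
  show ?case using tr_zero_id(1)[OF leD(1)[OF X] N] is_zeroD[OF N geD(1)[OF Y]] X by auto
next
  case (Suc c)
  have M: "M \<in> Obj T" using p unfolding presilting_def by blast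
  obtain E X' where E: "tr E X X'" "hom_zero T E Y" "le M (- int c) X'" using Suc by blast
  obtain F Z where F: "F \<in> filt M" "tr (shpow T (int c) F) X' Z" "hom_zero T M (shpow T (- int c) Z)"
    using kill_degree[OF p f trD(3)[OF E(1)]] .
  note FO = filt_Obj[OF F(1)]
  have "le M (- int (Suc c)) Z"
  proof (rule leI[OF trD(3)[OF F(2)]])
    fix j assume j: "- int (Suc c) < j"
    show "hom_zero T M (shpow T j Z)"
    proof (cases "j = - int c")
      case True then show ?thesis using F(3) by simp
    next
      case False
      then have "- int c < j" using j by simp
      then show ?thesis
        using hom_zero_tr(2)[OF F(2) M, of j] leD(2)[OF E(3)] presilting_filt[OF p F(1), of "j + 1 + int c"]
          shpow_add[OF FO, of "j + 1" "int c"] by simp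
    qed
  qed
  moreover have "hom_zero T F (shpow T (- int c) Y)"
    by (rule filt_hom_zero_left[OF F(1) shpow_Obj[OF geD(1)[OF Y]] geD(2)[OF Y]]) simp
  then have "hom_zero T (shpow T (int c) F) Y" using hom_zero_shpow2[OF FO geD(1)[OF Y], of "int c" 0] by simp
  moreover obtain E' where "tr E E' (shpow T (int c) F)" "tr E' X Z" by (rule tr_octa_b[OF E(1) F(2)])
  ultimately show ?case using hom_zero_mid(2)[of E E' "shpow T (int c) F" Y] E(2) geD(1)[OF Y] by blast
qed

text \<open>The same process without an upper bound on \<open>X\<close>: only a window of
  \<open>c\<close> degrees downwards from 0 is cleared, while \<open>E\<close> stays in degrees at
  most 0.\<close>

lemma silting_approx_below:
  assumes p: "presilting T M" and f: "\<And>X. X \<in> Obj T \<Longrightarrow> fg M X" and X: "X \<in> Obj T"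
  shows "\<exists>E Z. tr E X Z \<and> le M 0 E \<and> (\<forall>j. 0 \<le> j \<longrightarrow> j < int c \<longrightarrow> hom_zero T M (shpow T (- j) Z))"
proof (induction c)
  case 0
  have M: "M \<in> Obj T" using p unfolding presilting_def by blast
  obtain N where N: "is_zero T N" using zero_exists by blast
  show ?case using tr_zero_id(1)[OF X N] le_ge_zero(1)[OF M N] by auto
next
  case (Suc c)
  have M: "M \<in> Obj T" using p unfolding presilting_def by blast
  obtain E Z where E: "tr E X Z" "le M 0 E" "\<And>j. 0 \<le> j \<Longrightarrow> j < int c \<Longrightarrow> hom_zero T M (shpow T (- j) Z)"
    using Suc by blast
  obtain F Z' where F: "F \<in> filt M" "tr (shpow T (int c) F) Z Z'" "hom_zero T M (shpow T (- int c) Z')"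
    using kill_degree[OF p f trD(3)[OF E(1)]] .
  note FO = filt_Obj[OF F(1)]
  have "hom_zero T M (shpow T (- j) Z')" if j: "0 \<le> j" "j < int (Suc c)" for j
  proof (cases "j = int c")
    case True then show ?thesis using F(3) by simp
  next
    case False
    then have "j < int c" using j by simp
    then show ?thesis
      using hom_zero_tr(2)[OF F(2) M, of "- j"] E(3)[OF j(1)] presilting_filt[OF p F(1), of "- j + 1 + int c"]
        shpow_add[OF FO, of "- j + 1" "int c"] by simp
  qed
  moreover have "le M 0 (shpow T (int c) F)"
  proof (rule leI[OF shpow_Obj[OF FO]])
    fix j :: int assume "0 < j"
    then show "hom_zero T M (shpow T j (shpow T (int c) F))"
      using presilting_filt[OF p F(1), of "j + int c"] shpow_add[OF FO, of j "int c"] by simp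
  qed
  moreover obtain E' where "tr E E' (shpow T (int c) F)" "tr E' X Z'" by (rule tr_octa_b[OF E(1) F(2)])
  ultimately show ?case using le_ge_tr(1)[OF M, of E E' "shpow T (int c) F" 0] E(2) by blast
qed

text \<open>\<open>M\<close> and \<open>N\<close> see each other's degrees with an error of at most
  \<open>a\<close>. An approximation by \<open>M\<close> that clears a wide enough window can
  therefore be completed by truncating its remainder with the t-structure of
  \<open>N\<close>.\<close>

theorem silting_tst:
  assumes p: "presilting T M" and f: "\<And>X. X \<in> Obj T \<Longrightarrow> fg M X" and t: "tstr N"
    and a: "amplitude a M N" "amplitude a N M" and a0: "0 \<le> a"
  shows "tstr M"
  unfolding tstr_def
proof (intro conjI allI impI ballI)
  show M: "M \<in> Obj T" using p unfolding presilting_def by blast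
  fix X Y assume X: "le M 0 X" and Y: "ge M 1 Y"
  \<comment> \<open>Degrees at most \<open>- 2 * a\<close> for \<open>M\<close> become at most
    \<open>- a\<close> for \<open>N\<close>, while \<open>Y\<close> is in degrees at least
    \<open>1 - a\<close> for \<open>N\<close>.\<close>
  obtain E X' where E: "tr E X X'" "hom_zero T E Y" "le M (- int (nat (2 * a))) X'"
    using silting_approx_above[OF p f X Y] by blast
  have "le N (- a) X'" using amplitude_le[OF a(1) E(3)] a0 by simp
  moreover have "ge N (- a + 1) Y" using amplitude_ge[OF a(1) Y] by (simp add: add.commute)
  ultimately have "hom_zero T X' Y" by (rule tstr_orth[OF t])
  then show "hom_zero T X Y" by (rule hom_zero_mid(2)[OF E(1) geD(1)[OF Y] E(2)])
next
  fix X assume X: "X \<in> Obj T"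
  have M: "M \<in> Obj T" using p unfolding presilting_def by blast
  \<comment> \<open>The cleared degrees \<open>- 4 * a\<close> to 0 for \<open>M\<close> clear
    \<open>- 3 * a\<close> to \<open>- a\<close> for \<open>N\<close>. Truncating at
    \<open>- a - 1\<close> thus leaves \<open>W\<close> in degrees at most
    \<open>- 3 * a - 1\<close> for \<open>N\<close>, so at most \<open>- 2 * a - 1\<close> for
    \<open>M\<close>, while \<open>B\<close> starts at \<open>- 2 * a\<close> for \<open>M\<close>;
    between there and 0, both \<open>Z\<close> and \<open>W\<close> contribute nothing to
    \<open>B\<close>.\<close>
  let ?c = "4 * a"
  obtain E Z where E: "tr E X Z" "le M 0 E"
    and Z: "\<And>j. 0 \<le> j \<Longrightarrow> j < ?c + 1 \<Longrightarrow> hom_zero T M (shpow T (- j) Z)"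
    using silting_approx_below[OF p f X, of "nat (?c + 1)"] a0 by auto
  note ZO = trD(3)[OF E(1)]
  obtain W B where W: "le N (- a - 1) W" "ge N (- a - 1 + 1) B" "tr W Z B" using tstr_decomp[OF t ZO] .
  have NO: "N \<in> Obj T" using t unfolding tstr_def by blast
  have W2: "le N (a - ?c - 1) W"
  proof (rule leI[OF trD(1)[OF W(3)]])
    fix i assume i: "a - ?c - 1 < i"
    show "hom_zero T N (shpow T i W)"
    proof (cases "- a - 1 < i")
      case True then show ?thesis using leD(2)[OF W(1)] by blast
    next
      case False
      have "hom_zero T N (shpow T i Z)"
      proof (rule amplitudeD[OF a(1) ZO])
        fix k assume "\<bar>k - i\<bar> \<le> a"
        then show "hom_zero T M (shpow T k Z)" using Z[of "- k"] i False by simp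
      qed
      moreover have "hom_zero T N (shpow T (i - 1) B)" using geD(2)[OF W(2)] False by simp
      ultimately show ?thesis by (rule hom_zero_tr(3)[OF W(3) NO])
    qed
  qed
  have W3: "le M (2 * a - ?c - 1) W" using amplitude_le[OF a(2) W2] by (simp add: algebra_simps)
  have B2: "ge M (- 2 * a) B" using amplitude_ge[OF a(2) W(2)] by simp
  have "ge M 1 B"
  proof (rule geI[OF trD(3)[OF W(3)]])
    fix i :: int assume i: "i < 1"
    show "hom_zero T M (shpow T i B)"
    proof (cases "i < - 2 * a")
      case True then show ?thesis using geD(2)[OF B2] by blast
    next
      case False
      have "hom_zero T M (shpow T i Z)" using Z[of "- i"] i False a0 by simp
      moreover have "hom_zero T M (shpow T (i + 1) W)" using leD(2)[OF W3] False a0 by simp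
      ultimately show ?thesis by (rule hom_zero_tr(2)[OF W(3) M])
    qed
  qed
  moreover obtain A where A: "tr E A W" "tr A X B" by (rule tr_octa_b[OF E(1) W(3)])
  moreover have "le M 0 A" by (rule le_ge_tr(1)[OF M A(1) E(2) le_mono[OF W3]]) (use a0 in simp)
  ultimately show "\<exists>A B. le M 0 A \<and> ge M 1 B \<and> tr A X B" by blast
qed

lemma fg_dsum:
  assumes s: "is_dsum T J Y A" and f: "\<And>k. k \<in> J \<Longrightarrow> fg (Y k) X" and X: "X \<in> Obj T"
  shows "fg A X"
proof (rule is_dsumE[OF s])
  fix \<iota> \<pi>
  assume d: "finite J" "A \<in> Obj T" "\<And>k. k \<in> J \<Longrightarrow> Y k \<in> Obj T"
    "\<And>k. k \<in> J \<Longrightarrow> arr (Y k) A (\<iota> k)" "\<And>k. k \<in> J \<Longrightarrow> arr A (Y k) (\<pi> k)"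
    "finprod (hgrp T A A) (\<lambda>k. \<iota> k \<cdot> \<pi> k) J = idn T A"
  interpret A: kspace "hgrp T A X" "scl T" by (rule hom_kspace[OF d(2) X])
  have "\<exists>S. finite S \<and> S \<subseteq> Hom T (Y k) X \<and> Hom T (Y k) X \<subseteq> kspace.span (hgrp T (Y k) X) (scl T) S"
    if "k \<in> J" for k
    by (rule fgE[OF f[OF that]]) blast
  then obtain S where S: "\<And>k. k \<in> J \<Longrightarrow> finite (S k)" "\<And>k. k \<in> J \<Longrightarrow> S k \<subseteq> Hom T (Y k) X"
    "\<And>k. k \<in> J \<Longrightarrow> Hom T (Y k) X \<subseteq> kspace.span (hgrp T (Y k) X) (scl T) (S k)" by metis
  let ?S = "\<Union>k\<in>J. (\<lambda>g. g \<cdot> \<pi> k) ` S k"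
  have fin: "finite ?S" using d(1) S(1) by simp
  have sub: "?S \<subseteq> Hom T A X"
  proof (rule UN_least)
    fix k assume k: "k \<in> J"
    show "(\<lambda>g. g \<cdot> \<pi> k) ` S k \<subseteq> Hom T A X"
      using hom_in_carrier[OF hom_comp_right[OF X d(5)[OF k]]] S(2)[OF k] by blast
  qed
  have "Hom T A X \<subseteq> A.span ?S"
  proof
    fix h assume "h \<in> Hom T A X"
    then have h: "arr A X h" using d(2) X by (simp add: arr_def)
    have t: "h \<cdot> (\<iota> k \<cdot> \<pi> k) \<in> A.span ?S" if k: "k \<in> J" for k
    proof -
      have hk: "arr (Y k) X (h \<cdot> \<iota> k)" by (rule arr_comp[OF d(4)[OF k] h])
      have "(h \<cdot> \<iota> k) \<cdot> \<pi> k \<in> A.span ((\<lambda>g. g \<cdot> \<pi> k) ` S k)"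
        by (rule kspace_hom_span[OF hom_kspace[OF d(3)[OF k] X] A.kspace_axioms S(2)[OF k] hom_comp_right[OF X d(5)[OF k]]])
          (use scl_cmp_left[OF d(2) d(3)[OF k] X arrD(3)[OF d(5)[OF k]]] S(3)[OF k] arrD(3)[OF hk] in auto)
      then have "(h \<cdot> \<iota> k) \<cdot> \<pi> k \<in> A.span ?S" using A.span_mono[of "(\<lambda>g. g \<cdot> \<pi> k) ` S k" ?S] sub k by blast
      then show ?thesis using comp_assoc[OF d(5)[OF k] d(4)[OF k] h] by simp
    qed
    have a: "arr A X (h \<cdot> (\<iota> k \<cdot> \<pi> k))" if "k \<in> J" for k
      by (rule arr_comp[OF arr_comp[OF d(5)[OF that] d(4)[OF that]] h])
    have "finprod (hgrp T A X) (\<lambda>k. h \<cdot> (\<iota> k \<cdot> \<pi> k)) F \<in> A.span ?S" if "F \<subseteq> J" for F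
    proof -
      have "finite F" using d(1) that finite_subset by blast
      then show ?thesis using that
      proof (induction F rule: finite_induct)
        case empty then show ?case using A.span_one finprod_empty_arr[OF d(2) X] by simp
      next
        case (insert k F)
        have "finprod (hgrp T A X) (\<lambda>k. h \<cdot> (\<iota> k \<cdot> \<pi> k)) (insert k F) =
          add A X (h \<cdot> (\<iota> k \<cdot> \<pi> k)) (finprod (hgrp T A X) (\<lambda>k. h \<cdot> (\<iota> k \<cdot> \<pi> k)) F)"
          by (rule finprod_insert_arr[OF insert(1,2) d(2) X]) (use a insert in blast)
        then show ?case using A.span_mult[OF _ t sub, of _ k] insert by simp
      qed
    qed
    from this[OF subset_refl] have "finprod (hgrp T A X) (\<lambda>k. h \<cdot> (\<iota> k \<cdot> \<pi> k)) J \<in> A.span ?S" .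
    moreover have "h \<cdot> finprod (hgrp T A A) (\<lambda>k. \<iota> k \<cdot> \<pi> k) J = finprod (hgrp T A X) (\<lambda>k. h \<cdot> (\<iota> k \<cdot> \<pi> k)) J"
      using d(4,5) arr_comp by (intro finprod_comp_left[OF d(1,2) h]) blast
    ultimately show "h \<in> A.span ?S" using d(6) id_right[OF h] by simp
  qed
  then show "fg A X" using fgI[OF d(2) X fin sub] by blast
qed

section \<open>The heart and its simple quotients\<close>

definition ht :: "'o \<Rightarrow> 'o set" where "ht M = {X. le M 0 X \<and> ge M 0 X}"

lemma htD: "X \<in> ht M \<Longrightarrow> le M 0 X" "X \<in> ht M \<Longrightarrow> ge M 0 X" "X \<in> ht M \<Longrightarrow> X \<in> Obj T"
  unfolding ht_def using leD by blast+

lemma htI: "le M 0 X \<Longrightarrow> ge M 0 X \<Longrightarrow> X \<in> ht M"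
  unfolding ht_def by blast

lemma le_sh: "X \<in> Obj T \<Longrightarrow> le M i (sh T X) \<longleftrightarrow> le M (i + 1) X"
  using le_shpow[of X M i 1] shpow_1[of X] by simp

lemma ge_sh: "X \<in> Obj T \<Longrightarrow> ge M i (sh T X) \<longleftrightarrow> ge M (i + 1) X"
  using ge_shpow[of X M i 1] shpow_1[of X] by simp

lemma tstr_zero:
  assumes t: "tstr M" and l: "le M i X" and g: "ge M (i + 1) X" shows "is_zero T X"
  using tstr_orth[OF t l g] is_zero_iff[OF leD(1)[OF l]] by blast

text \<open>\<open>M\<close> sees an object of the heart only in degree 0, so the object lies in
  degrees at most -1 and at least 0.\<close>

lemma ht_hz: 
  assumes t: "tstr M" and X: "X \<in> ht M" and h: "hom_zero T M X" shows "is_zero T X"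
proof (rule tstr_zero[OF t, of "- 1"])
  show "le M (- 1) X"
  proof (rule leI[OF htD(3)[OF X]])
    fix j :: int assume "- 1 < j"
    then show "hom_zero T M (shpow T j X)" using leD(2)[OF htD(1)[OF X], of j] h by (cases "j = 0") simp_all
  qed
  show "ge M (- 1 + 1) X" using htD(2)[OF X] by simp
qed

text \<open>The drop in the number of generators replaces the finite length of the heart in the
  search for a simple quotient.\<close>

lemma proper_quotient:
  assumes t: "tstr M" and y: "y \<in> ht M" and f: "fgn n M y"
    and A: "A \<in> ht M" and g: "is_mono (fullsub T (ht M)) A y g" and nz: "\<not> is_zero T A"
    and ni: "\<not> is_iso T A y g"
  obtains x z m where "x \<in> ht M" "z \<in> ht M" "tr x y z" "\<not> is_zero T z" "m < n" "fgn m M z"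
proof -
  have M: "M \<in> Obj T" using t unfolding tstr_def by blast
  note AO = htD(3)[OF A] and yO = htD(3)[OF y]
  have ga: "arr A y g" using g AO yO unfolding is_mono_def fullsub_simps arr_def by blast
  have mono: "h = k" if "V \<in> ht M" "arr V A h" "arr V A k" "g \<cdot> h = g \<cdot> k" for V h k
    using g that arrD(3) unfolding is_mono_def fullsub_simps by blast
  \<comment> \<open>The cocone of \<open>g\<close> has degrees 0 and 1 only. Its truncation
    \<open>V\<close> is the kernel of \<open>g\<close> in the heart, and the suspension of the other
    end \<open>B\<close> is the cokernel.\<close>
  obtain P p w where P: "dt P A y p g w" using cocone_exists[OF ga] by blast
  note d = dtD[OF P]
  have Pge: "ge M 0 P" by (rule le_ge_tr(6)[OF M trI[OF P] htD(2)[OF A]]) (rule ge_mono[OF htD(2)[OF y]], simp)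
  have Ple: "le M 1 P"
    by (rule le_ge_tr(3)[OF M trI[OF P] le_mono[OF htD(1)[OF A]]]) (use htD(1)[OF y] in simp_all)
  obtain V B where V: "le M 0 V" "ge M (0 + 1) B" "tr V P B" using tstr_decomp[OF t d(1)] .
  obtain v b b' where vb: "dt V P B v b b'" using V(3) unfolding tr_def by blast
  note e = dtD[OF vb]
  have VH: "V \<in> ht M"
    by (rule htI[OF V(1) le_ge_tr(6)[OF M V(3) Pge]]) (rule ge_mono[OF V(2)], simp)
  have Ble: "le M 1 B" by (rule le_ge_tr(2)[OF M V(3) Ple]) (rule le_mono[OF V(1)], simp)
  define z where "z = sh T B"
  have zH: "z \<in> ht M"
    unfolding z_def by (rule htI) (use le_sh[OF e(3), of M 0] ge_sh[OF e(3), of M 0] Ble V(2) in simp_all)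
  \<comment> \<open>\<open>g\<close> kills this composite and is a monomorphism of the
    heart.\<close>
  have pv: "p \<cdot> v = zr V A"
  proof (rule mono[OF VH arr_comp[OF e(6) d(6)] arr_zr[OF e(1) d(2)]])
    show "g \<cdot> (p \<cdot> v) = g \<cdot> zr V A"
      using comp_assoc[OF e(6) d(6,7)] tri_comp1[OF P] comp_zr_left[OF e(6) d(3)] comp_zr_right[OF d(7) e(1)] by simp
  qed
  \<comment> \<open>The octahedron on \<open>y\<close> to \<open>sh T P\<close> to
    \<open>sh T B\<close> produces the kernel \<open>x\<close> of the quotient map. The rotations
    provide a triangle in which \<open>shm T b\<close> carries no sign.\<close>
  obtain x s q where x: "dt x y z s (shm T b \<cdot> w) q" "tr A x (sh T V)"
  proof -
    obtain v' w' where sv: "dt (sh T V) (sh T P) (sh T B) (shm T v) v' w'" using dt_shift[OF vb] .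
    have "dt (sh T V) (sh T P) (sh T B) (neg (sh T V) (sh T P) (shm T v)) (neg (sh T P) (sh T B) (shm T b))
        (neg (sh T B) (sh T (sh T V)) (shm T b'))"
      using rotate[OF rotate[OF rotate[OF vb]]] .
    have r3: "dt (sh T P) (sh T B) (sh T (sh T V)) (neg (sh T P) (sh T B) (shm T b))
        (neg (sh T B) (sh T (sh T V)) (shm T b')) (neg (sh T (sh T V)) (sh T (sh T P)) (shm T (neg (sh T V) (sh T P) (shm T v))))"
      using rotate[OF rotate[OF rotate[OF rotate[OF vb]]]] .
    obtain w2 where "dt (sh T P) (sh T B) (sh T (sh T V)) (shm T b)
        (neg (sh T B) (sh T (sh T V)) (shm T b')) w2"
      by (rule tri_neg_first[OF r3 shm_arr[OF e(7)]])
    then obtain v3 where "dt (sh T V) (sh T P) (sh T B) v3 (shm T b) (neg (sh T B) (sh T (sh T V)) (shm T b'))"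
      using unrotate[of "sh T P" "sh T B" "sh T V"] e(1) by (metis sh_Obj)
    then obtain x s q where "dt x y (sh T B) s (shm T b \<cdot> w) q" "tr A x (sh T V)"
      using dt_octa_b[OF rotate[OF P]] by metis
    then show thesis using that unfolding z_def by blast
  qed
  note dx = dtD[OF x(1)]
  have sVle: "le M 0 (sh T V)" using le_sh[OF e(1), of M 0] le_mono[OF V(1), of 1] by simp
  have xle: "le M 0 x" by (rule le_ge_tr(1)[OF M x(2) htD(1)[OF A] sVle])
  have xge: "ge M 0 x"
    by (rule le_ge_tr(6)[OF M trI[OF x(1)] htD(2)[OF y]]) (rule ge_mono[OF htD(2)[OF zH]], simp)
  have xH: "x \<in> ht M" by (rule htI[OF xle xge])
  have "hom_zero T M (shpow T 1 x)" using leD(2)[OF xle, of 1] by simp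
  then have hx: "hom_zero T M (sh T x)" using shpow_1[OF dx(1)] by simp
  have lift: "\<exists>k. arr M y k \<and> (shm T b \<cdot> w) \<cdot> k = h" if h: "arr M z h" for h
  proof -
    have "q \<cdot> h = zr M (sh T x)" by (rule hom_zeroD[OF hx arr_comp[OF h dx(8)]])
    then show ?thesis using tri_lift2[OF x(1) h] by blast
  qed
  \<comment> \<open>A nonzero map from \<open>M\<close> to \<open>A\<close> stays nonzero in
    \<open>y\<close> and dies in \<open>z\<close>; this lowers the number of generators.\<close>
  obtain a where a: "arr M A a" "a \<noteq> zr M A"
  proof -
    have "\<not> hom_zero T M A" using ht_hz[OF t A] nz by blast
    then show thesis using that hom_zeroI[OF M AO] by blast
  qed
  have ga0: "g \<cdot> a \<noteq> zr M y"
  proof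
    assume "g \<cdot> a = zr M y"
    then obtain k where k: "arr M P k" "p \<cdot> k = a" using tri_lift[OF P a(1)] by blast
    have "hom_zero T M B" using geD(2)[OF V(2), of 0] by simp
    then have "b \<cdot> k = zr M B" using hom_zeroD arr_comp[OF k(1) e(7)] by blast
    then obtain l where l: "arr M V l" "v \<cdot> l = k" using tri_lift[OF vb k(1)] by blast
    have "a = (p \<cdot> v) \<cdot> l" using comp_assoc[OF l(1) e(6) d(6)] l(2) k(2) by simp
    then show False using pv comp_zr_left[OF l(1) AO] a(2) by simp
  qed
  note gaa = arr_comp[OF a(1) ga]
  have "(shm T b \<cdot> w) \<cdot> (g \<cdot> a) = zr M z"
  proof -
    have sb: "arr (sh T P) z (shm T b)" unfolding z_def by (rule shm_arr[OF e(7)])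
    have "w \<cdot> (g \<cdot> a) = zr M (sh T P)"
      using comp_assoc[OF a(1) ga d(8)] tri_comp2[OF P] comp_zr_left[OF a(1)] d(5) by simp
    then show ?thesis using comp_assoc[OF gaa d(8) sb] comp_zr_right[OF sb M] by simp
  qed
  then obtain m where m: "m < n" "fgn m M z" using fgn_quotient[OF f dx(7) lift gaa ga0] by blast
  \<comment> \<open>If \<open>z\<close> were zero, \<open>v\<close> would be invertible, so
    \<open>p\<close> would vanish and \<open>g\<close> would be an isomorphism.\<close>
  have "\<not> is_zero T z"
  proof
    assume "is_zero T z"
    then have "is_zero T B"
      using is_zero_iff[OF e(3)] is_zero_iff[of z] hom_zero_sh[OF e(3,3)] e(3) unfolding z_def by simp
    then have iv: "is_iso T V P v" by (rule iso_of_zero_cone[OF vb])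
    obtain v' where v': "arr P V v'" "v \<cdot> v' = idn T P" using is_isoD[OF iv e(1,2)] by metis
    have "p = (p \<cdot> v) \<cdot> v'" using comp_assoc[OF v'(1) e(6) d(6)] v'(2) id_right[OF d(6)] by simp
    then have p0: "p = zr P A" using pv comp_zr_left[OF v'(1) AO] by simp
    have "idn T A \<cdot> p = zr P A" using p0 id_left[OF d(6)] by simp
    then obtain r where r: "arr y A r" "r \<cdot> g = idn T A" using tri_ext[OF P arr_id[OF AO]] by blast
    have "le M (- 1) (sh T P)"
      using le_sh[OF d(1), of M "- 1"] le_ge_iso(1)[OF M _ d(1) V(1)] iv unfolding isomorphic_def by auto
    then have "hom_zero T (sh T P) y" using tstr_orth[OF t, of "- 1"] htD(2)[OF y] by simp
    moreover have "(g \<cdot> r) \<cdot> g = idn T y \<cdot> g"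
      using comp_assoc[OF ga r(1) ga] r(2) id_right[OF ga] id_left[OF ga] by simp
    ultimately have "g \<cdot> r = idn T y"
      using tri_cancel_ext[OF P _ arr_comp[OF r(1) ga] arr_id[OF yO]] by blast
    then show False using ni is_isoI[OF ga r(1) r(2)] by blast
  qed
  then show thesis using that xH zH trI[OF x(1)] m by blast
qed

text \<open>Passing to proper quotients terminates because each time fewer generators remain. The
  clause on \<open>W\<close> records that absence of maps to \<open>y\<close> is inherited by each
  quotient; it is applied to the summand \<open>NJ\<close>.\<close>

lemma simple_quotient:
  assumes t: "tstr M" and f: "fg M y" and y: "y \<in> ht M" and nz: "\<not> is_zero T y"
    and S: "\<S> \<subseteq> Obj T" and c: "\<And>X. simple_object (fullsub T (ht M)) X \<Longrightarrow> \<exists>S\<in>\<S>. isomorphic T X S"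
  shows "\<exists>S\<in>\<S>. S \<in> ht M \<and> \<not> hom_zero T y S \<and> \<not> is_zero T S \<and>
    (\<forall>W\<in>Obj T. (\<forall>V\<in>ht M. hom_zero T W (sh T V)) \<longrightarrow> hom_zero T W y \<longrightarrow> hom_zero T W S)"
proof -
  have M: "M \<in> Obj T" using t unfolding tstr_def by blast
  have htO: "ht M \<subseteq> Obj T" using htD(3) by blast
  obtain n where "fgn n M y" using f unfolding fg_def by blast
  then show ?thesis using y nz
  proof (induction n arbitrary: y rule: less_induct)
    case (less n)
    note yO = htD(3)[OF less.prems(2)]
    show ?case
    proof (cases "simple_object (fullsub T (ht M)) y")
      case True
      then obtain S' where S': "S' \<in> \<S>" "isomorphic T y S'" using c by blast
      then have SO: "S' \<in> Obj T" using S by blast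
      have SH: "S' \<in> ht M" by (rule htI) (use le_ge_iso[OF M S'(2) SO] htD less.prems(2) in blast)+
      have z: "\<not> is_zero T S'" using less.prems(3) is_zero_iso isomorphic_sym S'(2) yO SO by blast
      then have "\<not> hom_zero T y S'" using hom_zero_iso_left[OF S'(2) yO SO SO] is_zero_iff[OF SO] by blast
      moreover have "hom_zero T W S'" if "W \<in> Obj T" "hom_zero T W y" for W
        using hom_zero_iso_right[OF S'(2) yO SO that(1)] that(2) by blast
      ultimately show ?thesis using S'(1) SH z by blast
    next
      case False
      then obtain A g where A: "A \<in> ht M" "is_mono (fullsub T (ht M)) A y g"
        "\<not> is_zero (fullsub T (ht M)) A" "\<not> is_iso T A y g"
        using less.prems(2,3) is_zero_fullsub[OF htO, of y]
        unfolding simple_object_def fullsub_simps is_iso_fullsub by blast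
      have "\<not> is_zero T A" using A(1,3) is_zero_fullsub[OF htO, of A] by blast
      then obtain x z m where q: "x \<in> ht M" "z \<in> ht M" "tr x y z" "\<not> is_zero T z" "m < n" "fgn m M z"
        using proper_quotient[OF t less.prems(2,1) A(1,2) _ A(4)] by metis
      obtain S' where S': "S' \<in> \<S>" "S' \<in> ht M" "\<not> hom_zero T z S'" "\<not> is_zero T S'"
        "\<And>W. W \<in> Obj T \<Longrightarrow> (\<forall>V\<in>ht M. hom_zero T W (sh T V)) \<Longrightarrow> hom_zero T W z \<Longrightarrow> hom_zero T W S'"
        using less.IH[OF q(5,6,2,4)] by blast
      note o = trD[OF q(3)]
      have SO: "S' \<in> Obj T" using S'(1) S by blast
      have "le M (- 1) (sh T x)" using le_sh[OF o(1), of M "- 1"] htD(1)[OF q(1)] by simp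
      then have "hom_zero T (sh T x) S'" using tstr_orth[OF t, of "- 1"] htD(2)[OF S'(2)] by simp
      then have "\<not> hom_zero T y S'" using hom_zero_mid(2)[OF tr_rot[OF q(3)] SO] S'(3) by blast
      moreover have "hom_zero T W S'"
        if W: "W \<in> Obj T" "\<forall>V\<in>ht M. hom_zero T W (sh T V)" "hom_zero T W y" for W
      proof -
        have "hom_zero T W (sh T x)" using W(2) q(1) by blast
        then have "hom_zero T W z" by (rule hom_zero_mid(1)[OF tr_rot[OF q(3)] W(1,3)])
        then show ?thesis using S'(5) W by blast
      qed
      ultimately show ?thesis using S'(1,2,4) by blast
    qed
  qed
qed

end

section \<open>Mutations and tilts\<close>

text \<open>\<open>NJ\<close> and \<open>NI\<close> are the two complementary summands of the silting object \<open>M\<close>, \<open>Q\<close> is the cone of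
  the approximation of \<open>NI\<close>, and \<open>M'\<close> behaves like the sum of \<open>Q\<close> and \<open>NJ\<close>.  The last assumption
  says that the simple objects killed by \<open>NJ\<close> are the summands of \<open>SI\<close>.\<close>

locale mutation_setup = linear_triangulated_category T for T :: "('o, 'm, 'k::field) kcat" +
  fixes M NI NJ E Q M' SI :: 'o and f :: 'm and \<S> :: "'o set"
  assumes tstM: "tstr M" and fgM: "\<And>X. X \<in> Obj T \<Longrightarrow> fg M X" and fgJ: "\<And>X. X \<in> Obj T \<Longrightarrow> fg NJ X"
    and NO: "NI \<in> Obj T" "NJ \<in> Obj T"
    and M_split: "\<And>W. W \<in> Obj T \<Longrightarrow> hom_zero T M W \<longleftrightarrow> hom_zero T NI W \<and> hom_zero T NJ W"
    and M_NJ: "\<And>j. 0 < j \<Longrightarrow> hom_zero T M (shpow T j NJ)"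
    and E_NJ: "\<And>W. W \<in> Obj T \<Longrightarrow> hom_zero T NJ W \<Longrightarrow> hom_zero T E W"
    and cone: "\<exists>v w. dt NI E Q f v w"
    and approx: "\<And>h. arr NI NJ h \<Longrightarrow> \<exists>k. arr E NJ k \<and> k \<cdot> f = h"
    and M'O: "M' \<in> Obj T"
    and M'_split: "\<And>W. W \<in> Obj T \<Longrightarrow> hom_zero T M' W \<longleftrightarrow> hom_zero T Q W \<and> hom_zero T NJ W"
    and SO: "\<S> \<subseteq> Obj T" and simples: "\<And>X. simple_object (fullsub T (ht M)) X \<Longrightarrow> \<exists>S\<in>\<S>. isomorphic T X S"
    and SI: "SI \<in> ht M" "hom_zero T NJ SI"
    and SI_S: "\<And>S X. S \<in> \<S> \<Longrightarrow> \<not> is_zero T S \<Longrightarrow> S \<in> ht M \<Longrightarrow> hom_zero T NJ S \<Longrightarrow> X \<in> Obj T \<Longrightarrow> hom_zero T X SI \<Longrightarrow> hom_zero T X S"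
begin

lemma MO: "M \<in> Obj T" using tstM unfolding tstr_def by blast

lemma le_NJ: "le M i X \<Longrightarrow> i < j \<Longrightarrow> hom_zero T NJ (shpow T j X)"
  and le_NI: "le M i X \<Longrightarrow> i < j \<Longrightarrow> hom_zero T NI (shpow T j X)"
  and ge_NJ: "ge M i X \<Longrightarrow> j < i \<Longrightarrow> hom_zero T NJ (shpow T j X)"
  and ge_NI: "ge M i X \<Longrightarrow> j < i \<Longrightarrow> hom_zero T NI (shpow T j X)"
  using leD(1)[of M i X] leD(2)[of M i X j] geD(1)[of M i X] geD(2)[of M i X j] M_split[of "shpow T j X"] by simp_all

lemma NJ_le: "le M 0 NJ"
  by (rule leI[OF NO(2) M_NJ])

lemma filt_le: "F \<in> filt NJ \<Longrightarrow> le M 0 F"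
  using leI[OF filt_Obj filt_hom_zero_right[OF _ MO M_NJ]] by blast

text \<open>Coning off the maps from \<open>NJ\<close> to \<open>A\<close> gives \<open>Z\<close>,
  whose part \<open>y\<close> in degree 0 receives no maps from \<open>NJ\<close>; \<open>x\<close>
  is the cocone of \<open>A\<close> to \<open>y\<close>. The presentation of \<open>x\<close> by
  copies of \<open>NJ\<close> and an object in negative degrees is what makes it behave like a
  trace.\<close>

lemma trace_tr:
  assumes A: "A \<in> ht M"
  obtains x y F W where "x \<in> ht M" "y \<in> ht M" "tr x A y" "hom_zero T NJ y" "F \<in> filt NJ" "tr F x W" "le M (- 1) W"
proof -
  note AO = htD(3)[OF A]
  have "hom_zero T NJ (shpow T 1 NJ)" by (rule le_NJ[OF NJ_le]) simp
  then have "hom_zero T NJ (sh T NJ)" using shpow_1[OF NO(2)] by simp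
  then obtain F Z where F: "F \<in> filt NJ" "tr F A Z" "hom_zero T NJ Z" by (rule kill[OF fgJ[OF AO]])
  note ZO = trD(3)[OF F(2)]
  have Z: "le M 0 Z" by (rule le_ge_tr(2)[OF MO F(2) htD(1)[OF A]]) (rule le_mono[OF filt_le[OF F(1)]], simp)
  obtain W y where W: "le M (- 1) W" "ge M (- 1 + 1) y" "tr W Z y" using tstr_decomp[OF tstM ZO] .
  have "le M 0 y" by (rule le_ge_tr(2)[OF MO W(3) Z]) (rule le_mono[OF W(1)], simp)
  then have yH: "y \<in> ht M" using W(2) by (intro htI) simp_all
  obtain x where x: "tr F x W" "tr x A y" by (rule tr_octa_b[OF F(2) W(3)])
  have "le M 0 x" by (rule le_ge_tr(1)[OF MO x(1) filt_le[OF F(1)]]) (rule le_mono[OF W(1)], simp)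
  moreover have "ge M 0 x" by (rule le_ge_tr(6)[OF MO x(2) htD(2)[OF A]]) (rule ge_mono[OF htD(2)[OF yH]], simp)
  ultimately have xH: "x \<in> ht M" by (rule htI)
  have "hom_zero T NJ (shpow T 1 W)" by (rule le_NJ[OF W(1)]) simp
  then have "hom_zero T NJ y"
    using hom_zero_tr(2)[OF W(3) NO(2), of 0] F(3) by simp
  then show thesis using that xH yH x(2) F(1) x(1) W(1) by blast
qed

text \<open>\<open>F\<close> is built from copies of \<open>NJ\<close>, and \<open>W\<close> lies in
  negative degrees.\<close>

lemma trace_hz:
  assumes F: "F \<in> filt NJ" "tr F x W" "le M (- 1) W" and S: "S \<in> ht M" "hom_zero T NJ S"
  shows "hom_zero T x S"
proof (rule hom_zero_mid(2)[OF F(2) htD(3)[OF S(1)]])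
  show "hom_zero T F S" by (rule filt_hom_zero_left[OF F(1) htD(3)[OF S(1)] S(2)])
  show "hom_zero T W S" using tstr_orth[OF tstM F(3)] htD(2)[OF S(1)] by simp
qed

definition tors where "tors = {X \<in> ht M. hom_zero T X SI}"

text \<open>A nonzero \<open>y\<close> would have a nonzero map to a simple object \<open>S\<close>
  killed by \<open>NJ\<close>. As \<open>A\<close> has no maps to \<open>SI\<close> it has none to
  \<open>S\<close>; neither has the suspension of \<open>x\<close>, and so neither has
  \<open>y\<close>.\<close>

lemma tors_trace:
  assumes A: "A \<in> tors" and t: "tr x A y" "x \<in> ht M" "y \<in> ht M" "hom_zero T NJ y"
  shows "is_zero T y"
proof (rule ccontr)
  assume nz: "\<not> is_zero T y"
  obtain S where S: "S \<in> \<S>" "S \<in> ht M" "\<not> hom_zero T y S" "\<not> is_zero T S"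
    "\<And>W. W \<in> Obj T \<Longrightarrow> (\<forall>V\<in>ht M. hom_zero T W (sh T V)) \<Longrightarrow> hom_zero T W y \<Longrightarrow> hom_zero T W S"
    using simple_quotient[OF tstM fgM[OF htD(3)[OF t(3)]] t(3) nz SO simples] by blast
  have AH: "A \<in> ht M" "hom_zero T A SI" using A unfolding tors_def by auto
  have "hom_zero T NJ (sh T V)" if "V \<in> ht M" for V
    using le_NJ[OF htD(1)[OF that], of 1] shpow_1[OF htD(3)[OF that]] by simp
  then have "hom_zero T NJ S" using S(5)[OF NO(2)] t(4) by blast
  then have AS: "hom_zero T A S" using SI_S S(1,2,4) AH htD(3) by blast
  note o = trD[OF t(1)]
  have "le M (- 1) (sh T x)" using le_sh[OF o(1), of M "- 1"] htD(1)[OF t(2)] by simp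
  then have "hom_zero T (sh T x) S" using tstr_orth[OF tstM, of "- 1"] htD(2)[OF S(2)] by simp
  then show False using hom_zero_mid(2)[OF tr_rot[OF t(1)] htD(3)[OF S(2)] AS] S(3) by blast
qed

text \<open>Describes the torsion-free class by \<open>NJ\<close>, the form in which it is compared
  with the mutated object. If \<open>A\<close> is torsion-free, its trace \<open>x\<close> maps
  trivially to \<open>A\<close>, hence to itself, so it is zero and \<open>NJ\<close> cannot see
  \<open>A\<close>.\<close>

lemma perp_tors: "perp T (ht M) tors = {A \<in> ht M. hom_zero T NJ A}"
proof
  show "perp T (ht M) tors \<subseteq> {A \<in> ht M. hom_zero T NJ A}"
  proof
    fix A assume "A \<in> perp T (ht M) tors"
    then have A: "A \<in> ht M" and z: "\<And>X. X \<in> tors \<Longrightarrow> hom_zero T X A" unfolding perp_def by blast+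
    obtain x y F W where x: "x \<in> ht M" "y \<in> ht M" "tr x A y" "hom_zero T NJ y" "F \<in> filt NJ" "tr F x W" "le M (- 1) W"
      using trace_tr[OF A] .
    have "x \<in> tors" unfolding tors_def using x(1) trace_hz[OF x(5-7) SI] by blast
    then have xA: "hom_zero T x A" by (rule z)
    note o = trD[OF x(3)]
    have "hom_zero T x (shpow T (- 1) y)"
    proof (rule tstr_orth[OF tstM htD(1)[OF x(1)]])
      show "ge M (0 + 1) (shpow T (- 1) y)" using ge_shpow[OF o(3), of M 1 "- 1"] htD(2)[OF x(2)] by simp
    qed
    then have "hom_zero T x x" using hom_zero_tr(3)[OF x(3) o(1), of 0] xA by simp
    then have "is_zero T x" using is_zero_iff[OF o(1)] by blast
    then have "hom_zero T NJ x" using is_zeroD NO(2) by blast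
    then have "hom_zero T NJ A" by (rule hom_zero_mid(1)[OF x(3) NO(2) _ x(4)])
    then show "A \<in> {A \<in> ht M. hom_zero T NJ A}" using A by blast
  qed
  show "{A \<in> ht M. hom_zero T NJ A} \<subseteq> perp T (ht M) tors"
  proof
    fix A assume "A \<in> {A \<in> ht M. hom_zero T NJ A}"
    then have A: "A \<in> ht M" "hom_zero T NJ A" by auto
    note AO = htD(3)[OF A(1)]
    have "hom_zero T X A" if X: "X \<in> tors" for X
    proof -
      have XH: "X \<in> ht M" using X unfolding tors_def by blast
      obtain x y F W where x: "x \<in> ht M" "y \<in> ht M" "tr x X y" "hom_zero T NJ y" "F \<in> filt NJ" "tr F x W" "le M (- 1) W"
        using trace_tr[OF XH] .
      have "is_zero T y" by (rule tors_trace[OF X x(3,1,2,4)])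
      then have "hom_zero T y A" using is_zeroD AO by blast
      then show ?thesis by (rule hom_zero_mid(2)[OF x(3) AO trace_hz[OF x(5-7) A]])
    qed
    then show "A \<in> perp T (ht M) tors" using A(1) unfolding perp_def by blast
  qed
qed

lemma torsion_tr:
  assumes A: "A \<in> ht M"
  obtains x y where "x \<in> tors" "y \<in> perp T (ht M) tors" "tr x A y"
proof -
  obtain x y F W where x: "x \<in> ht M" "y \<in> ht M" "tr x A y" "hom_zero T NJ y" "F \<in> filt NJ" "tr F x W" "le M (- 1) W"
    using trace_tr[OF A] .
  have "x \<in> tors" unfolding tors_def using x(1) trace_hz[OF x(5-7) SI] by blast
  then show thesis using that x perp_tors by blast
qed

section \<open>Comparison of the mutated object with the tilt\<close>

lemma QO: "Q \<in> Obj T" "E \<in> Obj T" using cone dtD by blast+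

lemma Q_hz:
  assumes W: "W \<in> Obj T" "hom_zero T NJ (shpow T j W)" "hom_zero T NI (shpow T (j - 1) W)"
  shows "hom_zero T Q (shpow T j W)"
proof -
  obtain v w where d: "dt NI E Q f v w" using cone by blast
  have "hom_zero T (sh T NI) (shpow T j W)"
    using W(3) hom_zero_sh[OF NO(1) shpow_Obj[OF W(1)], of "j - 1"] shpow_suc[OF W(1), of "j - 1"] by simp
  then show ?thesis
    using hom_zero_mid(2)[OF tr_rot[OF trI[OF d]] shpow_Obj[OF W(1)]] E_NJ[OF shpow_Obj[OF W(1)] W(2)] by blast
qed

text \<open>A map from \<open>Q\<close> to the suspension of \<open>NJ\<close> vanishes on
  \<open>E\<close>, so it comes from the suspension of a map from \<open>NI\<close> to
  \<open>NJ\<close>. The latter extends along the approximation \<open>f\<close>, and the suspension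
  of \<open>f\<close> kills \<open>w\<close>.\<close>

lemma Q_NJ: "hom_zero T Q (sh T NJ)"
proof (rule hom_zeroI[OF QO(1) sh_Obj[OF NO(2)]])
  obtain v w where d: "dt NI E Q f v w" using cone by blast
  note dd = dtD[OF d]
  fix h assume h: "arr Q (sh T NJ) h"
  have "hom_zero T NJ (sh T NJ)" using le_NJ[OF NJ_le, of 1] shpow_1[OF NO(2)] by simp
  then have "hom_zero T E (sh T NJ)" using E_NJ[OF sh_Obj[OF NO(2)]] by blast
  then have "h \<cdot> v = zr E (sh T NJ)" using hom_zeroD arr_comp[OF dd(7) h] by blast
  then obtain k where k: "arr (sh T NI) (sh T NJ) k" "k \<cdot> w = h" using tri_ext2[OF d h] by blast
  obtain k' where k': "arr NI NJ k'" "shm T k' = k" using shm_surj[OF k(1) NO] by blast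
  obtain l where l: "arr E NJ l" "l \<cdot> f = k'" using approx[OF k'(1)] by blast
  have "neg (sh T NI) (sh T E) (shm T f) \<cdot> w = zr Q (sh T E)" by (rule tri_comp1[OF rotate[OF rotate[OF d]]])
  then have fw: "shm T f \<cdot> w = zr Q (sh T E)"
    using comp_neg_left[OF dd(8) shm_arr[OF dd(6)]] neg_eq_zr[OF arr_comp[OF dd(8) shm_arr[OF dd(6)]]] by simp
  have "h = shm T l \<cdot> (shm T f \<cdot> w)"
    using comp_assoc[OF dd(8) shm_arr[OF dd(6)] shm_arr[OF l(1)]] shm_comp[OF dd(6) l(1)] l(2) k'(2) k(2) by simp
  then show "h = zr Q (sh T NJ)" using fw comp_zr_right[OF shm_arr[OF l(1)] QO(1)] by simp
qed

text \<open>Degree 1 is the delicate one, since there \<open>Q\<close> sees degree 0 of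
  \<open>NI\<close>. It is settled by replacing \<open>X\<close> by its trace, which is built from
  copies of \<open>NJ\<close>, where \<open>Q_NJ\<close> applies, and an object in negative
  degrees.\<close>

lemma tors_le: assumes X: "X \<in> tors" shows "le M' 0 X"
proof -
  have XH: "X \<in> ht M" using X unfolding tors_def by blast
  note XO = htD(3)[OF XH]
  obtain x y F W where x: "x \<in> ht M" "y \<in> ht M" "tr x X y" "hom_zero T NJ y" "F \<in> filt NJ" "tr F x W" "le M (- 1) W"
    using trace_tr[OF XH] .
  have yz: "is_zero T y" by (rule tors_trace[OF X x(3,1,2,4)])
  show ?thesis
  proof (rule leI[OF XO])
    fix j :: int assume j: "0 < j"
    have "hom_zero T Q (shpow T j X)"
    proof (cases "j = 1")
      case True
      have "hom_zero T Q (shpow T 1 F)"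
        by (rule filt_hom_zero_right[OF x(5) QO(1)]) (use Q_NJ shpow_1[OF NO(2)] in simp)
      moreover have "hom_zero T Q (shpow T 1 W)"
        by (rule Q_hz[OF leD(1)[OF x(7)] le_NJ[OF x(7)] le_NI[OF x(7)]]) simp_all
      ultimately have "hom_zero T Q (shpow T 1 x)" by (rule hom_zero_tr(1)[OF x(6) QO(1)])
      moreover have "hom_zero T Q (shpow T 1 y)" using is_zeroD[OF is_zero_shpow[OF yz] QO(1)] by blast
      ultimately show ?thesis using hom_zero_tr(1)[OF x(3) QO(1)] True by blast
    next
      case False
      show ?thesis
        by (rule Q_hz[OF XO le_NJ[OF htD(1)[OF XH]] le_NI[OF htD(1)[OF XH]]]) (use j False in simp_all)
    qed
    then show "hom_zero T M' (shpow T j X)"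
      using M'_split[OF shpow_Obj[OF XO]] le_NJ[OF htD(1)[OF XH] j] by blast
  qed
qed

lemma le_M': assumes A: "le M (- 1) A" shows "le M' 0 A"
proof (rule leI[OF leD(1)[OF A]])
  fix j :: int assume j: "0 < j"
  have "hom_zero T Q (shpow T j A)"
    by (rule Q_hz[OF leD(1)[OF A] le_NJ[OF A] le_NI[OF A]]) (use j in simp_all)
  then show "hom_zero T M' (shpow T j A)"
    using M'_split[OF shpow_Obj[OF leD(1)[OF A]]] le_NJ[OF A, of j] j by simp
qed

lemma ge_M': assumes B: "ge M i B" shows "ge M' i B"
proof (rule geI[OF geD(1)[OF B]])
  fix j assume j: "j < i"
  have "hom_zero T Q (shpow T j B)"
    by (rule Q_hz[OF geD(1)[OF B] ge_NJ[OF B] ge_NI[OF B]]) (use j in simp_all)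
  then show "hom_zero T M' (shpow T j B)"
    using M'_split[OF shpow_Obj[OF geD(1)[OF B]]] ge_NJ[OF B j] by blast
qed

lemma Y_ge: assumes V: "V \<in> perp T (ht M) tors" shows "ge M' 1 V"
proof -
  have VH: "V \<in> ht M" "hom_zero T NJ V" using V perp_tors by auto
  note VO = htD(3)[OF VH(1)]
  show ?thesis
  proof (rule geI[OF VO])
    fix j :: int assume j: "j < 1"
    have J: "hom_zero T NJ (shpow T j V)"
      using VH(2) ge_NJ[OF htD(2)[OF VH(1)], of j] j by (cases "j = 0") simp_all
    have "hom_zero T Q (shpow T j V)"
      by (rule Q_hz[OF VO J ge_NI[OF htD(2)[OF VH(1)]]]) (use j in simp)
    then show "hom_zero T M' (shpow T j V)" using M'_split[OF shpow_Obj[OF VO]] J by blast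
  qed
qed

text \<open>Vanishing of all maps from \<open>Q\<close> and \<open>NJ\<close> forces it for
  \<open>E\<close>, hence for \<open>NI\<close> and for \<open>M\<close>; then \<open>B\<close> lies
  in degrees at most 0 and at least 1 for \<open>M\<close>.\<close>

lemma M'_generates:
  assumes B: "le M' i B" "ge M' (i + 1) B" shows "is_zero T B"
proof -
  note BO = leD(1)[OF B(1)]
  have all: "hom_zero T Q (shpow T j B) \<and> hom_zero T NJ (shpow T j B)" for j
    using leD(2)[OF B(1), of j] geD(2)[OF B(2), of j] M'_split[OF shpow_Obj[OF BO], of j] by (cases "i < j") auto
  obtain v w where d: "dt NI E Q f v w" using cone by blast
  have "hom_zero T NI (shpow T j B)" for j
  proof -
    let ?W = "shpow T j B"
    have W: "?W \<in> Obj T" using BO by simp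
    have "hom_zero T E ?W" using E_NJ[OF W] all by blast
    then have e: "hom_zero T (sh T E) (sh T ?W)" using hom_zero_sh[OF QO(2) W] by blast
    have "hom_zero T Q (sh T ?W)" using all[of "j + 1"] shpow_suc[OF BO, of j] by simp
    then have "hom_zero T (sh T NI) (sh T ?W)" using hom_zero_mid(2)[OF tr_rot[OF tr_rot[OF trI[OF d]]] sh_Obj[OF W]] e by blast
    then show ?thesis using hom_zero_sh[OF NO(1) W] by blast
  qed
  then have "hom_zero T M (shpow T j B)" for j using M_split[OF shpow_Obj[OF BO]] all by blast
  then have "le M 0 B" "ge M (0 + 1) B" using leI[OF BO] geI[OF BO] by blast+
  then show ?thesis by (rule tstr_zero[OF tstM])
qed

text \<open>Cuts \<open>X\<close> into negative degrees, an object of the heart and positive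
  degrees, splits the middle piece by the torsion pair, and regroups by octahedra so that the
  torsion part joins the left side and the torsion-free part the right.\<close>

lemma tilt_decomp:
  assumes X: "X \<in> Obj T"
  obtains A0 x A y P C where "le M (- 1) A0" "x \<in> tors" "tr A0 A x" "tr A X C" "y \<in> perp T (ht M) tors" "ge M 1 P" "tr y C P"
    "le M' 0 A" "ge M' 1 C"
proof -
  obtain P P' where P: "le M 0 P" "ge M (0 + 1) P'" "tr P X P'" using tstr_decomp[OF tstM X] .
  obtain A0 H where A0: "le M (- 1) A0" "ge M (- 1 + 1) H" "tr A0 P H" using tstr_decomp[OF tstM trD(1)[OF P(3)]] .
  have "le M 0 H" by (rule le_ge_tr(2)[OF MO A0(3) P(1)]) (rule le_mono[OF A0(1)], simp)
  then have H: "H \<in> ht M" using A0(2) by (intro htI) simp_all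
  obtain x y where x: "x \<in> tors" "y \<in> perp T (ht M) tors" "tr x H y" using torsion_tr[OF H] .
  obtain A where A: "tr A0 A x" "tr A P y" by (rule tr_octa_b[OF A0(3) x(3)])
  obtain C where C: "tr A X C" "tr y C P'" by (rule tr_octa_a[OF A(2) P(3)])
  have "le M' 0 A" by (rule le_ge_tr(1)[OF M'O A(1) le_M'[OF A0(1)] tors_le[OF x(1)]])
  moreover have "ge M' 1 C" by (rule le_ge_tr(4)[OF M'O C(2) Y_ge[OF x(2)]]) (use ge_M'[OF P(2)] in simp)
  ultimately show thesis using that[OF A0(1) x(1) A(1) C(1) x(2) _ C(2)] P(2) by simp
qed

text \<open>The right end of the decomposition of \<open>X\<close> lies in degrees at most 0 and at
  least 1 for \<open>M'\<close>, hence is zero.\<close>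

theorem tilt_le: "le M' 0 X \<longleftrightarrow> (\<exists>A B. le M (- 1) A \<and> B \<in> tors \<and> tr A X B)"
proof
  assume "\<exists>A B. le M (- 1) A \<and> B \<in> tors \<and> tr A X B"
  then show "le M' 0 X" using le_ge_tr(1)[OF M'O] le_M' tors_le by blast
next
  assume X: "le M' 0 X"
  obtain A0 x A y P C where d: "le M (- 1) A0" "x \<in> tors" "tr A0 A x" "tr A X C" "le M' 0 A" "ge M' 1 C"
    using tilt_decomp[OF leD(1)[OF X]] .
  have "le M' 0 C" by (rule le_ge_tr(2)[OF M'O d(4) X]) (rule le_mono[OF d(5)], simp)
  then have "is_zero T C" using M'_generates[of 0 C] d(6) by simp
  then have "isomorphic T A X" by (rule tr_zero_right[OF d(4)])
  then show "\<exists>A B. le M (- 1) A \<and> B \<in> tors \<and> tr A X B" using tr_iso2[OF d(3) _ leD(1)[OF X]] d(1,2) by blast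
qed

text \<open>The decomposition is made for the desuspension of \<open>X\<close>, which lies in
  degrees at least 1 for \<open>M'\<close>, so that its left end vanishes; the result is then
  suspended.\<close>

theorem tilt_ge: "ge M' 0 X \<longleftrightarrow> (\<exists>V B. V \<in> perp T (ht M) tors \<and> ge M 0 B \<and> tr (sh T V) X B)"
proof
  assume "\<exists>V B. V \<in> perp T (ht M) tors \<and> ge M 0 B \<and> tr (sh T V) X B"
  then obtain V B where V: "V \<in> perp T (ht M) tors" "ge M 0 B" "tr (sh T V) X B" by blast
  have VO: "V \<in> Obj T" using V(1) htD(3) unfolding perp_def by blast
  show "ge M' 0 X"
    by (rule le_ge_tr(4)[OF M'O V(3) _ ge_M'[OF V(2)]]) (use ge_sh[OF VO, of M' 0] Y_ge[OF V(1)] in simp)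
next
  assume X: "ge M' 0 X"
  note XO = geD(1)[OF X]
  note u = unsh(1,2)[OF XO]
  obtain A0 x A y P C where d: "tr A (unsh X) C" "y \<in> perp T (ht M) tors" "ge M 1 P" "tr y C P" "le M' 0 A" "ge M' 1 C"
    using tilt_decomp[OF u(1)] .
  have "ge M' 1 (unsh X)" using ge_sh[OF u(1), of M' 0] u(2) X by simp
  then have "ge M' 1 A" by (rule le_ge_tr(6)[OF M'O d(1)]) (rule ge_mono[OF d(6)], simp)
  then have "is_zero T A" using M'_generates[of 0 A] d(5) by simp
  then have "isomorphic T (unsh X) C" by (rule tr_zero_left[OF d(1)])
  then have "isomorphic T C (unsh X)" using isomorphic_sym u(1) trD(3)[OF d(1)] by blast
  then have "tr y (unsh X) P" using tr_iso2[OF d(4) _ u(1)] by blast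
  then have "tr (sh T y) X (sh T P)" using tr_shift u(2) by metis
  moreover have "ge M 0 (sh T P)" using ge_sh[OF geD(1)[OF d(3)], of M 0] d(3) by simp
  ultimately show "\<exists>V B. V \<in> perp T (ht M) tors \<and> ge M 0 B \<and> tr (sh T V) X B" using d(2) by blast
qed

text \<open>Orthogonality is checked on the pieces \<open>A\<close>, \<open>B\<close> of
  \<open>X\<close> and \<open>V\<close>, \<open>P'\<close> of \<open>Y\<close>. Three of the four
  pairs are separated by degree, and \<open>B\<close> and \<open>V\<close> by the torsion
  pair.\<close>

theorem tstr_M': "tstr M'"
  unfolding tstr_def
proof (intro conjI allI impI ballI M'O)
  fix X Y assume X: "le M' 0 X" and Y: "ge M' 1 Y"
  note XO = leD(1)[OF X] and YO = geD(1)[OF Y]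
  obtain A B where A: "le M (- 1) A" "B \<in> tors" "tr A X B" using X unfolding tilt_le by blast
  have BH: "B \<in> ht M" using A(2) unfolding tors_def by blast
  have "ge M' 0 (sh T Y)" using ge_sh[OF YO, of M' 0] Y by simp
  then obtain V P where V: "V \<in> perp T (ht M) tors" "ge M 0 P" "tr (sh T V) (sh T Y) P" unfolding tilt_ge by blast
  have VH: "V \<in> ht M" using V(1) unfolding perp_def by blast
  obtain P' where P': "P' \<in> Obj T" "P = sh T P'" using sh_surj trD(3)[OF V(3)] by blast
  have t: "tr V Y P'" using tr_unshift[of V Y P'] V(3) P' htD(3)[OF VH] YO by simp
  have P1: "ge M 1 P'" using ge_sh[OF P'(1), of M 0] V(2) P'(2) by simp
  have hz: "hom_zero T Z Y" if "hom_zero T Z V" "hom_zero T Z P'" "Z \<in> Obj T" for Z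
    by (rule hom_zero_mid(1)[OF t that(3,1,2)])
  have "hom_zero T A V" using tstr_orth[OF tstM A(1)] htD(2)[OF VH] by simp
  moreover have "hom_zero T A P'" using tstr_orth[OF tstM A(1)] ge_mono[OF P1, of 0] by simp
  ultimately have 1: "hom_zero T A Y" using hz trD(1)[OF A(3)] by blast
  have "hom_zero T B V" using V(1) A(2) unfolding perp_def by blast
  moreover have "hom_zero T B P'" using tstr_orth[OF tstM htD(1)[OF BH]] P1 by simp
  ultimately have 2: "hom_zero T B Y" using hz trD(3)[OF A(3)] by blast
  show "hom_zero T X Y" by (rule hom_zero_mid(2)[OF A(3) YO 1 2])
next
  fix X assume X: "X \<in> Obj T"
  obtain A0 x A y P C where "tr A X C" "le M' 0 A" "ge M' 1 C" using tilt_decomp[OF X] .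
  then show "\<exists>A B. le M' 0 A \<and> ge M' 1 B \<and> tr A X B" by blast
qed

end

section \<open>Metrics generated by an object\<close>

context triangulated_category
begin

section \<open>Degree conditions and metrics in a full subcategory\<close>

lemma shsub_1:
  assumes "V \<subseteq> Obj T" shows "shsub T 1 V = {X \<in> Obj T. \<exists>A\<in>V. isomorphic T X (sh T A)}"
proof -
  have "(\<exists>A\<in>V. isomorphic T X (shpow T 1 A)) \<longleftrightarrow> (\<exists>A\<in>V. isomorphic T X (sh T A))" for X
    using assms shpow_1 by (intro bex_cong refl) auto
  then show ?thesis unfolding shsub_def by blast
qed

lemma shsub_fullsub:
  assumes D: "thick T D" and V: "V \<subseteq> D"
  shows "shsub (fullsub T D) 1 V = {X \<in> D. \<exists>A\<in>V. isomorphic T X (sh T A)}"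
proof -
  interpret D: triangulated_category "fullsub T D" by (rule triangulated_fullsub[OF D])
  show ?thesis using D.shsub_1[of V] V by simp
qed

lemma star_fullsub:
  assumes "D \<subseteq> Obj T" "P \<subseteq> D" "Q \<subseteq> D"
  shows "star (fullsub T D) P Q = {Z \<in> D. \<exists>A\<in>P. \<exists>B\<in>Q. tr A Z B}"
  unfolding star_def fullsub_simps tr_def dt_def using assms by blast

lemma perp_fullsub: "perp (fullsub T D) = perp T"
  by (intro ext) (simp add: perp_def)

text \<open>The shift is moved to \<open>M\<close>, so that the direct sum itself need not be
  suspended.\<close>

lemma le_dsum:
  assumes "M \<in> Obj T" "is_dsum T J Y X" shows "le M i X \<longleftrightarrow> (\<forall>k\<in>J. le M i (Y k))" "ge M i X \<longleftrightarrow> (\<forall>k\<in>J. ge M i (Y k))"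
proof -
  have o: "X \<in> Obj T" "\<forall>k\<in>J. Y k \<in> Obj T" using assms(2) unfolding is_dsum_def by auto
  have h: "hom_zero T M (shpow T j X) \<longleftrightarrow> (\<forall>k\<in>J. hom_zero T M (shpow T j (Y k)))" for j
  proof -
    have e: "hom_zero T M (shpow T j Z) \<longleftrightarrow> hom_zero T (shpow T (- j) M) Z" if "Z \<in> Obj T" for Z
      using hom_zero_shpow2[OF assms(1) that, of "- j" 0] by simp
    show ?thesis using dsum_hom_zero_right[OF assms(2) shpow_Obj[OF assms(1)], of "- j"] e o by simp
  qed
  show "le M i X \<longleftrightarrow> (\<forall>k\<in>J. le M i (Y k))" "ge M i X \<longleftrightarrow> (\<forall>k\<in>J. ge M i (Y k))"
    unfolding le_def ge_def using h o by blast+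
qed

lemma le_summand:
  assumes M: "M \<in> Obj T" and s: "summand T A X" and l: "le M i X" shows "le M i A"
proof -
  obtain B where "is_dsum T (UNIV :: bool set) (\<lambda>b. if b then A else B) X"
    using s unfolding summand_def is_dsum2_def by blast
  then have "\<forall>k\<in>(UNIV :: bool set). le M i (if k then A else B)" using le_dsum(1)[OF M] l by blast
  from bspec[OF this UNIV_I[of True]] show ?thesis by simp
qed

lemma summand_fullsub:
  assumes "D \<subseteq> Obj T" "summand (fullsub T D) A X" shows "summand T A X"
  using assms(2) is_dsum_fullsub[OF assms(1)] unfolding summand_def is_dsum2_def by blast

lemma le_smd:
  assumes M: "M \<in> Obj T" and D: "D \<subseteq> Obj T" and U: "\<And>X. X \<in> U \<Longrightarrow> le M i X" and A: "A \<in> smd (fullsub T D) U"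
  shows "le M i A"
  using A U le_summand[OF M] summand_fullsub[OF D] unfolding smd_def by blast

lemma le_coprod:
  assumes M: "M \<in> Obj T" and D: "D \<subseteq> Obj T" and U: "\<And>X. X \<in> U \<Longrightarrow> le M i X"
  shows "A \<in> coprod (fullsub T D) U c \<Longrightarrow> le M i A"
proof (induction c arbitrary: A rule: less_induct)
  case (less c)
  have a: "le M i A" if "A \<in> addcl (fullsub T D) U" for A
  proof (rule le_smd[OF M D _ that[unfolded addcl_def]])
    fix X assume "X \<in> {Z. \<exists>(m::nat) Y. (\<forall>k\<in>{..<m}. Y k \<in> U) \<and> is_dsum (fullsub T D) {..<m} Y Z}"
    then obtain m :: nat and Y where Y: "\<forall>k\<in>{..<m}. Y k \<in> U" "is_dsum (fullsub T D) {..<m} Y X" by blast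
    have "is_dsum T {..<m} Y X" using Y(2) is_dsum_fullsub[OF D] by blast
    then show "le M i X" using le_dsum(1)[OF M] Y(1) U by blast
  qed
  show ?case
  proof (cases c)
    case 0 then show ?thesis using less.prems by simp
  next
    case (Suc k)
    show ?thesis
    proof (cases k)
      case 0 then show ?thesis using less.prems Suc a by simp
    next
      case (Suc l)
      then have "A \<in> star (fullsub T D) (addcl (fullsub T D) U) (coprod (fullsub T D) U (Suc l))"
        using less.prems \<open>c = Suc k\<close> by simp
      then obtain P Q u v w where P: "P \<in> addcl (fullsub T D) U" "Q \<in> coprod (fullsub T D) U (Suc l)"
        "A \<in> D" "tri T P A Q u v w" unfolding star_def fullsub_simps by blast
      have PQ: "le M i P" "le M i Q" using a[OF P(1)] less.IH[OF _ P(2)] \<open>c = Suc k\<close> Suc by simp_all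
      then have "tr P A Q" using P(3,4) D leD(1) unfolding tr_def dt_def by blast
      then show ?thesis using le_ge_tr(1)[OF M] PQ by blast
    qed
  qed
qed

text \<open>The generators are suspensions of \<open>G\<close> by at least \<open>k\<close>, and
  sums, summands and extensions respect the bound. This is how the metric reaches arbitrarily deep
  into the aisle.\<close>

lemma generated_metric_le:
  assumes M: "M \<in> Obj T" and D: "thick T D" and G: "G \<in> D" "le M g G" and X: "X \<in> generated_metric (fullsub T D) G k"
  shows "le M (g - int k) X"
proof -
  note D' = thickD(1)[OF D]
  have GO: "G \<in> Obj T" using G(1) D' by blast
  have u: "le M (g - int k) Y" if "Y \<in> {shpow (fullsub T D) (- j) G |j. j \<le> - int k}" for Y
  proof -
    obtain j where j: "Y = shpow T (- j) G" "j \<le> - int k" using \<open>Y \<in> _\<close> shpow_fullsub[OF D G(1)] by auto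
    show ?thesis unfolding j(1) le_shpow[OF GO] using le_mono[OF G(2), of "g - int k + - j"] j(2) by simp
  qed
  obtain c where "X \<in> smd (fullsub T D) (coprod (fullsub T D) {shpow (fullsub T D) (- j) G |j. j \<le> - int k} c)"
    using X unfolding generated_metric_def by blast
  from le_smd[OF M D' _ this] show ?thesis using le_coprod[OF M D' u] by blast
qed

section \<open>From degree conditions to t-structures on the subcategory\<close>

lemma sub_le_iff: "D \<subseteq> Obj T \<Longrightarrow> X \<in> sub_le T D M i \<longleftrightarrow> X \<in> D \<and> le M i X"
  and sub_ge_iff: "D \<subseteq> Obj T \<Longrightarrow> X \<in> sub_ge T D M i \<longleftrightarrow> X \<in> D \<and> ge M i X"
  unfolding sub_le_def sub_ge_def le_def ge_def by blast+

text \<open>Translates from degrees -1 and 0, as in the definition of a t-structure, to degrees 0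
  and 1, as in \<open>tstr\<close>.\<close>

lemma tstr_of_t_structure:
  assumes M: "M \<in> Obj T" and t: "t_structure T (sub_le T (Obj T) M 0, sub_ge T (Obj T) M 0)"
  shows "tstr M"
proof -
  let ?L = "sub_le T (Obj T) M 0" and ?R = "sub_ge T (Obj T) M 0"
  have LR: "X \<in> ?L \<longleftrightarrow> le M 0 X" "X \<in> ?R \<longleftrightarrow> ge M 0 X" for X
    using sub_le_iff[OF subset_refl] sub_ge_iff[OF subset_refl] leD(1) geD(1) by blast+
  have LO: "?L \<subseteq> Obj T" unfolding sub_le_def by blast
  have U: "X \<in> shsub T 1 ?L \<longleftrightarrow> le M (- 1) X" for X
  proof
    assume "X \<in> shsub T 1 ?L"
    then obtain A where A: "X \<in> Obj T" "A \<in> ?L" "isomorphic T X (sh T A)" unfolding shsub_1[OF LO] by blast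
    have A': "le M 0 A" using A(2) LR(1) by blast
    note AO = leD(1)[OF A']
    have "le M (- 1) (sh T A)" using le_shpow[OF AO, of M "- 1" 1] shpow_1[OF AO] A' by simp
    then show "le M (- 1) X" using le_ge_iso(1)[OF M isomorphic_sym[OF A(3) A(1) sh_Obj[OF AO]] A(1)] by blast
  next
    assume X: "le M (- 1) X"
    note XO = leD(1)[OF X] and u = unsh(1,2)[OF leD(1)[OF X]]
    have "le M 0 (unsh X)" using le_shpow[OF u(1), of M "- 1" 1] shpow_1[OF u(1)] u(2) X by simp
    then show "X \<in> shsub T 1 ?L" unfolding shsub_1[OF LO] using LR(1) XO u(2) isomorphic_refl[OF XO] by force
  qed
  have o: "\<And>X Y. le M (- 1) X \<Longrightarrow> ge M 0 Y \<Longrightarrow> hom_zero T X Y"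
    and s: "star T (shsub T 1 ?L) ?R = Obj T"
    using t U LR(2) unfolding t_structure_def case_prod_conv by blast+
  show ?thesis
    unfolding tstr_def
  proof (intro conjI allI impI ballI M)
    fix X Y assume X: "le M 0 X" and Y: "ge M 1 Y"
    note XO = leD(1)[OF X] and YO = geD(1)[OF Y]
    have "hom_zero T (shpow T 1 X) (shpow T 1 Y)"
      by (rule o) (use X Y le_shpow[OF XO, of M "- 1" 1] ge_shpow[OF YO, of M 0 1] in simp_all)
    then show "hom_zero T X Y" using hom_zero_shpow[OF XO YO] by blast
  next
    fix X assume X: "X \<in> Obj T"
    then have "shpow T 1 X \<in> star T (shsub T 1 ?L) ?R" using s by simp
    then obtain A B u v w where A: "le M (- 1) A" "ge M 0 B" "tri T A (shpow T 1 X) B u v w"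
      unfolding star_def U LR Bex_def by blast
    have t: "tr A (shpow T 1 X) B" using A X leD(1) geD(1) shpow_Obj unfolding tr_def dt_def by blast
    note o = trD[OF t]
    have "tr (shpow T (- 1) A) X (shpow T (- 1) B)" using tr_shpow[OF t, of "- 1"] shpow_inv(1)[OF X, of 1] by simp
    moreover have "le M 0 (shpow T (- 1) A)" "ge M 1 (shpow T (- 1) B)"
      using A(1,2) le_shpow[OF o(1), of M 0 "- 1"] ge_shpow[OF o(3), of M 1 "- 1"] by simp_all
    ultimately show "\<exists>A B. le M 0 A \<and> ge M 1 B \<and> tr A X B" by blast
  qed
qed

text \<open>The right truncation lies in \<open>D\<close> by hypothesis, so for an object of
  \<open>D\<close> the left one does as well, and the decomposition restricts to
  \<open>D\<close>.\<close>

lemma t_structure_of_tst: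
  assumes t: "tstr M" and D: "thick T D" and ge: "\<And>i X. ge M i X \<Longrightarrow> X \<in> D"
  shows "t_structure (fullsub T D) (sub_le T D M 0, sub_ge T D M 0)"
    "shsub (fullsub T D) 1 (sub_le T D M 0) = {X \<in> D. le M (- 1) X}"
proof -
  note D' = thickD(1)[OF D]
  have M: "M \<in> Obj T" using t unfolding tstr_def by blast
  let ?L = "sub_le T D M 0" and ?R = "sub_ge T D M 0"
  note L = sub_le_iff[OF D', of _ M 0] and R = sub_ge_iff[OF D', of _ M 0]
  have LD: "?L \<subseteq> D" "?R \<subseteq> D" using L R by blast+
  \<comment> \<open>One argument for aisle and coaisle: if suspending turns \<open>Q\<close> into
    \<open>P\<close> and \<open>P\<close> respects isomorphism, then \<open>P\<close> describes the
    suspended class.\<close>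
  have shift: "(\<exists>A. A \<in> D \<and> Q A \<and> isomorphic T X (sh T A)) \<longleftrightarrow> P X"
    if "X \<in> D" "\<And>A. A \<in> Obj T \<Longrightarrow> P (sh T A) \<longleftrightarrow> Q A"
      "\<And>A B. isomorphic T A B \<Longrightarrow> A \<in> Obj T \<Longrightarrow> B \<in> Obj T \<Longrightarrow> P A \<Longrightarrow> P B" for X P Q
  proof
    assume "\<exists>A. A \<in> D \<and> Q A \<and> isomorphic T X (sh T A)"
    then obtain A where A: "A \<in> Obj T" "Q A" "isomorphic T X (sh T A)" using D' by blast
    have "X \<in> Obj T" using that(1) D' by blast
    then show "P X" using that(2)[OF A(1)] that(3)[OF isomorphic_sym[OF A(3) _ sh_Obj[OF A(1)]] sh_Obj[OF A(1)]] A(2) by blast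
  next
    assume "P X"
    have XO: "X \<in> Obj T" using that(1) D' by blast
    have "unsh X \<in> D" using thickD(2)[OF D unsh(1)[OF XO]] unsh(2)[OF XO] that(1) by simp
    moreover have "Q (unsh X)" using that(2)[OF unsh(1)[OF XO]] unsh(2)[OF XO] \<open>P X\<close> by simp
    moreover have "isomorphic T X (sh T (unsh X))" using isomorphic_refl[OF XO] unsh(2)[OF XO] by simp
    ultimately show "\<exists>A. A \<in> D \<and> Q A \<and> isomorphic T X (sh T A)" by blast
  qed
  have "X \<in> shsub (fullsub T D) 1 ?L \<longleftrightarrow> X \<in> {X \<in> D. le M (- 1) X}" for X
  proof (cases "X \<in> D")
    case True
    have "(\<exists>A. A \<in> D \<and> le M 0 A \<and> isomorphic T X (sh T A)) \<longleftrightarrow> le M (- 1) X"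
      by (rule shift[OF True]) (use le_shpow[of _ M "- 1" 1] shpow_1 le_ge_iso(1)[OF M] in auto)
    then show ?thesis unfolding shsub_fullsub[OF D LD(1)] using True L by blast
  next
    case False then show ?thesis unfolding shsub_fullsub[OF D LD(1)] by blast
  qed
  then show U: "shsub (fullsub T D) 1 ?L = {X \<in> D. le M (- 1) X}" by blast
  have VR: "X \<in> shsub (fullsub T D) 1 ?R \<longleftrightarrow> ge M (- 1) X" if X: "X \<in> D" for X
  proof -
    have "(\<exists>A. A \<in> D \<and> ge M 0 A \<and> isomorphic T X (sh T A)) \<longleftrightarrow> ge M (- 1) X"
      by (rule shift[OF X]) (use ge_shpow[of _ M "- 1" 1] shpow_1 le_ge_iso(2)[OF M] in auto)
    then show ?thesis unfolding shsub_fullsub[OF D LD(2)] using X R by blast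
  qed
  have sc: "subcat (fullsub T D) V"
    if "\<And>X. X \<in> V \<longleftrightarrow> X \<in> D \<and> P X" "\<And>A B. isomorphic T A B \<Longrightarrow> B \<in> Obj T \<Longrightarrow> P A \<Longrightarrow> P B" for V P
    unfolding subcat_def fullsub_simps isomorphic_fullsub using that D' by blast
  have UD: "{X \<in> D. le M (- 1) X} \<subseteq> D" by blast
  have star: "\<exists>A\<in>{X \<in> D. le M (- 1) X}. \<exists>B\<in>?R. tr A X B" if X: "X \<in> D" for X
  proof -
    have XO: "X \<in> Obj T" using X D' by blast
    obtain A B where A: "le M (- 1) A" "ge M (- 1 + 1) B" "tr A X B" by (rule tstr_decomp[OF t XO])
    have B: "B \<in> D" by (rule ge[OF A(2)])
    have "A \<in> D" using thickD(6)[OF D A(3) X B] .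
    moreover have "B \<in> ?R" using A(2) B R[of B] by simp
    ultimately show ?thesis using A(1,3) by blast
  qed
  show "t_structure (fullsub T D) (?L, ?R)"
    unfolding t_structure_def case_prod_conv
  proof (intro conjI ballI)
    show "subcat (fullsub T D) ?L" by (rule sc[OF L]) (rule le_ge_iso(1)[OF M])
    show "subcat (fullsub T D) ?R" by (rule sc[OF R]) (rule le_ge_iso(2)[OF M])
    show "shsub (fullsub T D) 1 ?L \<subseteq> ?L" unfolding U using L le_mono[of M "- 1" _ 0] by auto
    show "?R \<subseteq> shsub (fullsub T D) 1 ?R"
    proof
      fix X assume "X \<in> ?R"
      then have X: "X \<in> D" "ge M 0 X" using R by blast+
      show "X \<in> shsub (fullsub T D) 1 ?R" using VR[OF X(1)] ge_mono[OF X(2), of "- 1"] by simp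
    qed
    show "hom_zero (fullsub T D) X Y" if "X \<in> shsub (fullsub T D) 1 ?L" "Y \<in> ?R" for X Y
      using that tstr_orth[OF t, of "- 1" X Y] R[of Y] unfolding U by simp
    show "star (fullsub T D) (shsub (fullsub T D) 1 ?L) ?R = Obj (fullsub T D)"
      unfolding U star_fullsub[OF D' UD LD(2)] fullsub_simps using star by blast
  qed
qed

text \<open>\<open>deep\<close> is the case \<open>- 1\<close> of the hypothesis on the metric; for
  \<open>bounded\<close>, a neighbourhood below the lowest degree of \<open>X\<close> is
  chosen.\<close>

lemma tstr_metric_of_tst:
  assumes t: "tstr M" and D: "thick T D" and D_ge: "\<And>X. X \<in> D \<longleftrightarrow> (\<exists>i. ge M i X)"
    and g: "good_metric (fullsub T D) \<BB>" and k: "\<And>k. \<exists>m. \<forall>X\<in>\<BB> m. le M k X"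
  shows "tstr_metric (fullsub T D) \<BB> (sub_le T D M 0) (sub_ge T D M 0)"
proof (intro tstr_metric.intro metric_category.intro tstr_metric_axioms.intro metric_category_axioms.intro)
  show "triangulated_category (fullsub T D)" by (rule triangulated_fullsub[OF D])
  show "good_metric (fullsub T D) \<BB>" by (rule g)
  have ge: "\<And>i X. ge M i X \<Longrightarrow> X \<in> D" using D_ge by blast
  note s = t_structure_of_tst[OF t D ge]
  show "t_structure (fullsub T D) (sub_le T D M 0, sub_ge T D M 0)" by (rule s(1))
  have B: "\<BB> m \<subseteq> D" for m using g unfolding good_metric_def subcat_def fullsub_simps by blast
  obtain m where "\<forall>X\<in>\<BB> m. le M (- 1) X" using k by blast
  then have "\<BB> m \<subseteq> {X \<in> D. le M (- 1) X}" using B by blast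
  then have "\<BB> m \<subseteq> shsub (fullsub T D) 1 (sub_le T D M 0)" using s(2) by simp
  then show "\<exists>m. \<BB> m \<subseteq> shsub (fullsub T D) 1 (sub_le T D M 0)" by (rule exI)
  fix X assume "X \<in> Obj (fullsub T D)"
  then obtain i where "ge M i X" using D_ge by auto
  then have i: "ge M (i - 1 + 1) X" by simp
  obtain m where "\<forall>B\<in>\<BB> m. le M (i - 1) B" using k by blast
  then show "\<exists>m. \<forall>B\<in>\<BB> m. hom_zero (fullsub T D) B X" using tstr_orth[OF t _ i] unfolding hom_zero_fullsub by blast
qed

end

theorem corollary4p5:
  fixes T :: "('o, 'm, 'k::field) kcat"
    and C D :: "'o set"
    and M M\<^sub>\<mu> G S\<^sub>I :: 'o
    and N S :: "nat \<Rightarrow> 'o"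
    and n :: nat
    and I :: "nat set"
    and \<BB> :: "nat \<Rightarrow> 'o set"
  defines "\<D> \<equiv> fullsub T D"
  defines "\<G> \<equiv> completion \<D> \<BB>"
  defines "\<X> \<equiv> {X \<in> sub_eq T D M 0. hom_zero T X S\<^sub>I}"
  defines "\<t> \<equiv> (GG \<D> \<BB> (sub_le T D M 0), GG \<D> \<BB> (sub_ge T D M 0))"
  defines "\<t>\<^sub>\<mu> \<equiv> (GG \<D> \<BB> (sub_le T D M\<^sub>\<mu> 0), GG \<D> \<BB> (sub_ge T D M\<^sub>\<mu> 0))"
  assumes "linear_triangulated_category T"
    and "krull_schmidt T"
    and "ST_pair T C D"
    and "silting T C M"
    and "basic_decomposition T n N M"
    and "G \<in> D"
    and "G_good_metric \<D> G \<BB>"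
    and "I \<subseteq> {1..n}"
    and "left_mutation T n N I M\<^sub>\<mu>"
    and "complete_simples (fullsub T (sub_eq T D M 0)) n S"
    and "\<forall>i\<in>{1..n}. \<forall>j\<in>{1..n}. i \<noteq> j \<longrightarrow> hom_zero T (N i) (S j)"
    and "is_dsum T I S S\<^sub>I"
  shows "t_structure \<G> \<t>
    \<and> torsion_class (fullsub \<G> (heart \<t>)) (GG \<D> \<BB> \<X>)
    \<and> t_structure \<G> \<t>\<^sub>\<mu>
    \<and> \<t>\<^sub>\<mu> = HRS_tilt \<G> \<t> (GG \<D> \<BB> \<X>)"
proof -
  interpret linear_triangulated_category T by fact
  obtain M0 where D: "thick T D" and M0: "silting T C M0" "\<And>X. X \<in> Obj T \<Longrightarrow> hom_finite_dim T M0 X"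
    "t_structure T (sub_le T (Obj T) M0 0, sub_ge T (Obj T) M0 0)"
    "Obj T = (\<Union>i. sub_le T (Obj T) M0 i)" "D = (\<Union>i. sub_ge T (Obj T) M0 i)"
    using \<open>ST_pair T C D\<close> unfolding ST_pair_def by blast
  note D' = thickD(1)[OF D]
  have M: "M \<in> Obj T" "presilting T M" "thick_closure T M = C"
    using \<open>silting T C M\<close> unfolding silting_def presilting_def by blast+
  have M0': "M0 \<in> Obj T" "thick_closure T M0 = C" using M0(1) unfolding silting_def presilting_def by blast+
  \<comment> \<open>Both silting objects generate \<open>C\<close>, so each lies in the thick
    closure of the other, and both amplitudes are finite.\<close>
  have cl: "M \<in> thick_closure T M0" "M0 \<in> thick_closure T M"
    unfolding M(3) M0'(2) using M(3) M0'(2) unfolding thick_closure_def by blast+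
  obtain a1 where a1: "0 \<le> a1" "amplitude a1 M M0" using amplitude_closure[OF M(1) cl(2)] by blast
  obtain a2 where a2: "0 \<le> a2" "amplitude a2 M0 M" using amplitude_closure[OF M0'(1) cl(1)] by blast
  define a where "a = max a1 a2"
  have a: "amplitude a M M0" "amplitude a M0 M" "0 \<le> a"
    using amplitude_mono[OF a1(2), of a] amplitude_mono[OF a2(2), of a] a1(1) unfolding a_def by auto
  have "fg M0 X" if "X \<in> Obj T" for X by (rule hom_finite_dim_fg[OF M0'(1) that M0(2)[OF that]])
  then have fgM: "fg M X" if "X \<in> Obj T" for X using fg_closure[OF M0'(1) _ cl(1) that] by blast
  have tM0: "tstr M0" by (rule tstr_of_t_structure[OF M0'(1) M0(3)])
  have tM: "tstr M" by (rule silting_tst[OF M(2) fgM tM0 a])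
  \<comment> \<open>The ST-pair describes \<open>D\<close> through \<open>M0\<close>; finite
    amplitude lets \<open>M\<close> describe it as well.\<close>
  have D_ge0: "X \<in> D \<longleftrightarrow> (\<exists>i. ge M0 i X)" for X
  proof -
    have "X \<in> D \<longleftrightarrow> (\<exists>i. X \<in> sub_ge T (Obj T) M0 i)" unfolding M0(5) by simp
    then show ?thesis using sub_ge_iff[OF subset_refl, of X M0] geD(1)[of M0 _ X] by auto
  qed
  have D_ge: "X \<in> D \<longleftrightarrow> (\<exists>i. ge M i X)" for X
    unfolding D_ge0 using amplitude_ge[OF a(1), of _ X] amplitude_ge[OF a(2), of _ X] by blast
  have le_ex: "\<exists>i. le M i X" if "X \<in> Obj T" for X
  proof -
    have "\<exists>i. X \<in> sub_le T (Obj T) M0 i" using that equalityD1[OF M0(4)] by blast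
    then obtain i where "le M0 i X" using sub_le_iff[OF subset_refl, of X M0] by blast
    from amplitude_le[OF a(2) this] show ?thesis by blast
  qed
  \<comment> \<open>Objects of the heart are bounded below and so belong to \<open>D\<close>; the
    heart may be computed in \<open>T\<close>.\<close>
  have ht: "sub_eq T D M 0 = ht M" "sub_le T D M 0 \<inter> sub_ge T D M 0 = ht M"
    unfolding sub_eq_def ht_def using sub_le_iff[OF D', of _ M 0] sub_ge_iff[OF D', of _ M 0] D_ge by (auto simp: set_eq_iff)
  have dM: "is_dsum T {1..n} N M" using \<open>basic_decomposition T n N M\<close> unfolding basic_decomposition_def by blast
  obtain NI NJ E f Q v w where mu: "is_dsum T I N NI" "is_dsum T ({1..n} - I) N NJ"
    "minimal_left_approx T (addcl T {NJ}) NI E f" "Q \<in> Obj T" "tri T NI E Q f v w" "is_dsum2 T Q NJ M\<^sub>\<mu>"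
    using \<open>left_mutation T n N I M\<^sub>\<mu>\<close> unfolding left_mutation_def by blast
  have NO: "NI \<in> Obj T" "NJ \<in> Obj T" "M\<^sub>\<mu> \<in> Obj T" using mu unfolding is_dsum_def is_dsum2_def by blast+
  have E: "E \<in> addcl T {NJ}" "E \<in> Obj T" using mu(3) addcl_Obj unfolding minimal_left_approx_def by blast+
  have SIO: "S\<^sub>I \<in> Obj T" "\<And>k. k \<in> I \<Longrightarrow> S k \<in> Obj T" using \<open>is_dsum T I S S\<^sub>I\<close> unfolding is_dsum_def by blast+
  have simp: "\<And>k. k \<in> {1..n} \<Longrightarrow> simple_object (fullsub T (ht M)) (S k)"
    "\<And>X. simple_object (fullsub T (ht M)) X \<Longrightarrow> \<exists>i\<in>{1..n}. isomorphic T X (S i)"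
    using \<open>complete_simples (fullsub T (sub_eq T D M 0)) n S\<close>
    unfolding complete_simples_def ht isomorphic_fullsub by blast+
  have Sk: "S k \<in> ht M" if "k \<in> {1..n}" for k using simp(1)[OF that] unfolding simple_object_def fullsub_simps by blast
  have split: "hom_zero T M W \<longleftrightarrow> hom_zero T NI W \<and> hom_zero T NJ W" if "W \<in> Obj T" for W
    using dsum_hom_zero_left[OF dM that] dsum_hom_zero_left[OF mu(1) that] dsum_hom_zero_left[OF mu(2) that]
      \<open>I \<subseteq> {1..n}\<close> by blast
  have N_S: "hom_zero T (N i) (S j)" if "i \<in> {1..n}" "j \<in> {1..n}" "i \<noteq> j" for i j
    using \<open>\<forall>i\<in>{1..n}. \<forall>j\<in>{1..n}. i \<noteq> j \<longrightarrow> hom_zero T (N i) (S j)\<close> that by blast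
  have NJ_S: "hom_zero T NJ (S k)" if "k \<in> I" for k
    unfolding dsum_hom_zero_left[OF mu(2) SIO(2)[OF that]] using that N_S \<open>I \<subseteq> {1..n}\<close> by blast
  interpret mutation_setup T M NI NJ E Q M\<^sub>\<mu> S\<^sub>I f "S ` {1..n}"
  proof
    show "tstr M" "NI \<in> Obj T" "NJ \<in> Obj T" "M\<^sub>\<mu> \<in> Obj T" using tM NO .
    show "\<And>X. X \<in> Obj T \<Longrightarrow> fg M X" by (rule fgM)
    show "\<And>W. W \<in> Obj T \<Longrightarrow> hom_zero T M W \<longleftrightarrow> hom_zero T NI W \<and> hom_zero T NJ W" by (rule split)
    fix X assume X: "X \<in> Obj T"
    show "fg NJ X"
    proof (rule fg_dsum[OF mu(2) _ X])
      fix k assume "k \<in> {1..n} - I"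
      then have k: "k \<in> {1..n}" by blast
      show "fg (N k) X"
        by (rule is_dsumE[OF dM]) (use fg_retract[OF fgM[OF X]] k in blast)
    qed
  next
    fix j :: int assume "0 < j"
    then have "hom_zero T M (shpow T j M)" using M(2) unfolding presilting_def by blast
    \<comment> \<open>The shift is moved to the left argument, so that summands can be split off on
      the right.\<close>
    then have "hom_zero T (shpow T (- j) M) M" using hom_zero_shpow2[OF M(1,1), of "- j" 0] by simp
    then have "hom_zero T (shpow T (- j) M) NJ"
      using dsum_hom_zero_right[OF dM shpow_Obj[OF M(1)]] dsum_hom_zero_right[OF mu(2) shpow_Obj[OF M(1)]] by blast
    then show "hom_zero T M (shpow T j NJ)" using hom_zero_shpow2[OF M(1) NO(2), of "- j" 0] by simp
  next
    fix W assume W: "W \<in> Obj T" "hom_zero T NJ W"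
    show "hom_zero T E W" by (rule addcl_hom_zero(1)[OF E(1) W(1)]) (use W(2) in simp)
  next
    show "\<exists>v w. dt NI E Q f v w" using mu(4,5) NO E(2) unfolding dt_def by blast
  next
    fix h assume "arr NI NJ h"
    then have h: "h \<in> Hom T NI NJ" by (rule arrD)
    have "NJ \<in> addcl T {NJ}" by (rule addcl_base[OF NO(2)]) simp
    then obtain k where "k \<in> Hom T E NJ" "k \<cdot> f = h" using mu(3) h unfolding minimal_left_approx_def by blast
    then show "\<exists>k. arr E NJ k \<and> k \<cdot> f = h" using E(2) NO(2) by (auto simp: arr_def)
  next
    fix W assume W: "W \<in> Obj T"
    show "hom_zero T M\<^sub>\<mu> W \<longleftrightarrow> hom_zero T Q W \<and> hom_zero T NJ W"
      using dsum_hom_zero_left[OF mu(6)[unfolded is_dsum2_def] W] by (auto simp: all_bool_eq)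
  next
    show "S ` {1..n} \<subseteq> Obj T" using Sk htD(3) by blast
    show "\<And>X. simple_object (fullsub T (ht M)) X \<Longrightarrow> \<exists>S\<in>S ` {1..n}. isomorphic T X S" using simp(2) by blast
    show "S\<^sub>I \<in> ht M"
      by (rule htI) (use le_dsum[OF M(1) \<open>is_dsum T I S S\<^sub>I\<close>] Sk htD \<open>I \<subseteq> {1..n}\<close> in blast)+
    show "hom_zero T NJ S\<^sub>I" using dsum_hom_zero_right[OF \<open>is_dsum T I S S\<^sub>I\<close> NO(2)] NJ_S by blast
  next
    fix S' X assume S': "S' \<in> S ` {1..n}" "\<not> is_zero T S'" "S' \<in> ht M" "hom_zero T NJ S'"
      and X: "X \<in> Obj T" "hom_zero T X S\<^sub>I"
    obtain k where k: "k \<in> {1..n}" "S' = S k" using S'(1) by blast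
    note SO = htD(3)[OF S'(3)]
    \<comment> \<open>Otherwise every \<open>N i\<close> kills \<open>S k\<close>: for
      \<open>i \<noteq> k\<close> by the indexing of the simples, and \<open>N k\<close> as a
      summand of \<open>NJ\<close>. Then \<open>M\<close> kills it too, although it is a nonzero
      object of the heart.\<close>
    have "k \<in> I"
    proof (rule ccontr)
      assume "k \<notin> I"
      then have "hom_zero T (N i) (S k)" if "i \<in> {1..n}" for i
        using S'(4) dsum_hom_zero_left[OF mu(2) SO] k that N_S by (cases "i = k") auto
      then have "hom_zero T M S'" using dsum_hom_zero_left[OF dM SO] k(2) by blast
      then show False using ht_hz[OF tM S'(3)] S'(2) by blast
    qed
    then show "hom_zero T X S'" using dsum_hom_zero_right[OF \<open>is_dsum T I S S\<^sub>I\<close> X(1)] X(2) k(2) by blast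
  qed
  have X: "\<X> = tors" unfolding \<X>_def tors_def ht by (rule refl)
  \<comment> \<open>The old coaisle lies in the tilted one, and the tilted one is built from objects
    of \<open>D\<close>; so the mutated object describes the same \<open>D\<close>.\<close>
  have D_ge\<mu>: "X \<in> D \<longleftrightarrow> (\<exists>i. ge M\<^sub>\<mu> i X)" for X
  proof
    assume "X \<in> D"
    then show "\<exists>i. ge M\<^sub>\<mu> i X" unfolding D_ge using ge_M' by blast
  next
    assume "\<exists>i. ge M\<^sub>\<mu> i X"
    then obtain i where i: "ge M\<^sub>\<mu> i X" by blast
    note XO = geD(1)[OF i]
    have "ge M\<^sub>\<mu> 0 (shpow T i X)" using ge_shpow[OF XO, of M\<^sub>\<mu> 0 i] i by simp
    then obtain V B where V: "V \<in> perp T (ht M) tors" "ge M 0 B" "tr (sh T V) (shpow T i X) B"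
      unfolding tilt_ge by blast
    have VH: "V \<in> ht M" using V(1) unfolding perp_def by blast
    have "V \<in> D" "B \<in> D" unfolding D_ge using htD(2)[OF VH] V(2) by blast+
    then have "shpow T i X \<in> D" using thickD(5)[OF D V(3)] thickD(2)[OF D htD(3)[OF VH]] by blast
    then show "X \<in> D" unfolding thick_shpow[OF D XO] .
  qed
  have good: "good_metric (fullsub T D) \<BB>" and eq: "equivalent_metrics \<BB> (generated_metric (fullsub T D) G)"
    using \<open>G_good_metric \<D> G \<BB>\<close> unfolding G_good_metric_def \<D>_def by blast+
  have k: "\<exists>m. \<forall>X\<in>\<BB> m. le M k X" for k
  proof -
    obtain g where g: "le M g G" using le_ex \<open>G \<in> D\<close> D' by blast
    \<comment> \<open>\<open>G\<close> has degrees at most \<open>g\<close>; suspending it at least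
      \<open>g - k\<close> times brings it to degrees at most \<open>k\<close>, and for
      \<open>g < k\<close> no suspension is required.\<close>
    obtain m where m: "\<BB> m \<subseteq> generated_metric (fullsub T D) G (nat (g - k))"
      using eq unfolding equivalent_metrics_def by blast
    have "le M k X" if "X \<in> \<BB> m" for X
      using le_mono[OF generated_metric_le[OF M(1) D \<open>G \<in> D\<close> g, of X "nat (g - k)"], of k] m that by auto
    then show ?thesis by blast
  qed
  have k\<mu>: "\<exists>m. \<forall>X\<in>\<BB> m. le M\<^sub>\<mu> k X" for k
  proof -
    \<comment> \<open>The tilted aisle is only known to contain the suspension of the old one, hence
      \<open>k - 1\<close>.\<close>
    obtain m where m: "\<forall>X\<in>\<BB> m. le M (k - 1) X" using k by blast
    have "le M\<^sub>\<mu> k X" if l: "le M (k - 1) X" for X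
    proof -
      note XO = leD(1)[OF l]
      have "le M (- 1) (shpow T k X)" using le_shpow[OF XO, of M "- 1" k] l by simp
      from le_M'[OF this] show ?thesis using le_shpow[OF XO, of M\<^sub>\<mu> 0 k] by simp
    qed
    then show ?thesis using m by blast
  qed
  let ?L = "sub_le T D M 0" and ?R = "sub_ge T D M 0"
  have tm: "tstr_metric (fullsub T D) \<BB> ?L ?R" by (rule tstr_metric_of_tst[OF tM D D_ge good k])
  have tm\<mu>: "tstr_metric (fullsub T D) \<BB> (sub_le T D M\<^sub>\<mu> 0) (sub_ge T D M\<^sub>\<mu> 0)"
    by (rule tstr_metric_of_tst[OF tstr_M' D D_ge\<mu> good k\<mu>])
  have ge: "\<And>i X. ge M i X \<Longrightarrow> X \<in> D" using D_ge by blast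
  have htD': "ht M \<subseteq> D" using ge htD(2) by blast
  have torsH: "tors \<subseteq> ht M" unfolding tors_def by blast
  let ?Y = "perp T (ht M) tors"
  have YH: "?Y \<subseteq> ht M" unfolding perp_def by blast
  have tors_sc: "subcat (fullsub T D) tors"
    unfolding subcat_def fullsub_simps isomorphic_fullsub
  proof (intro conjI ballI impI)
    show "tors \<subseteq> D" using torsH htD' by blast
    fix A B assume A: "A \<in> tors" "B \<in> D" "isomorphic T A B"
    have AH: "A \<in> ht M" "hom_zero T A S\<^sub>I" using A(1) unfolding tors_def by blast+
    have BO: "B \<in> Obj T" using A(2) D' by blast
    have "B \<in> ht M" by (rule htI) (use le_ge_iso[OF M(1) A(3) BO] htD[OF AH(1)] in blast)+
    moreover have "hom_zero T B S\<^sub>I"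
      using hom_zero_iso_left[OF A(3) htD(3)[OF AH(1)] BO SIO(1)] AH(2) by blast
    ultimately show "B \<in> tors" unfolding tors_def by blast
  qed
  have tors_0: "Z \<in> tors" if "is_zero (fullsub T D) Z" for Z
  proof -
    have Z: "is_zero T Z" using that is_zero_fullsub[OF D'] by blast
    show ?thesis unfolding tors_def using htI[OF le_ge_zero[OF M(1) Z]] is_zeroD[OF Z SIO(1)] by blast
  qed
  have tors_tr: "\<exists>x\<in>tors. \<exists>y\<in>perp (fullsub T D) (?L \<inter> ?R) tors. triangulated_category.tr (fullsub T D) x A y"
    if "A \<in> ?L \<inter> ?R" for A
  proof -
    interpret D: triangulated_category "fullsub T D" by (rule triangulated_fullsub[OF D])
    have A: "A \<in> ht M" using that unfolding ht .
    obtain x y where x: "x \<in> tors" "y \<in> ?Y" "tr x A y" by (rule torsion_tr[OF A])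
    have "D.tr x A y"
      using x A YH torsH htD' unfolding D.tr_def D.dt_def tr_def dt_def fullsub_simps by blast
    then show ?thesis using x(1,2) unfolding perp_fullsub ht by blast
  qed
  have L\<mu>: "sub_le T D M\<^sub>\<mu> 0 = star (fullsub T D) (shsub (fullsub T D) 1 ?L) tors"
  proof -
    have UD: "{X \<in> D. le M (- 1) X} \<subseteq> D" "tors \<subseteq> D" using torsH htD' by blast+
    have U: "shsub (fullsub T D) 1 ?L = {X \<in> D. le M (- 1) X}" by (rule t_structure_of_tst(2)[OF tM D ge])
    have A: "A \<in> D" if "X \<in> D" "B \<in> tors" "tr A X B" for A X B
      using thickD(6)[OF D that(3,1)] that(2) UD(2) by blast
    have "le M\<^sub>\<mu> 0 X \<longleftrightarrow> (\<exists>A\<in>{X \<in> D. le M (- 1) X}. \<exists>B\<in>tors. tr A X B)" if "X \<in> D" for X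
      unfolding tilt_le using A[OF that] by blast
    then show ?thesis
      unfolding U star_fullsub[OF D' UD] by - (rule Set.set_eqI, simp add: sub_le_iff[OF D'] cong: conj_cong)
  qed
  have R\<mu>: "sub_ge T D M\<^sub>\<mu> 0 = star (fullsub T D) (shsub (fullsub T D) 1 (perp (fullsub T D) (?L \<inter> ?R) tors)) ?R"
  proof -
    let ?S = "{X \<in> D. \<exists>A\<in>?Y. isomorphic T X (sh T A)}"
    have YD: "?Y \<subseteq> D" using YH htD' by blast
    have SD: "?S \<subseteq> D" "?R \<subseteq> D" using sub_ge_iff[OF D', of _ M 0] by blast+
    have "ge M\<^sub>\<mu> 0 X \<longleftrightarrow> (\<exists>A\<in>?S. \<exists>B\<in>?R. tr A X B)" for X
    proof
      assume "ge M\<^sub>\<mu> 0 X"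
      then obtain V B where V: "V \<in> ?Y" "ge M 0 B" "tr (sh T V) X B" unfolding tilt_ge by blast
      have "V \<in> D" using V(1) YD by blast
      then have sV: "sh T V \<in> D" using thickD(2)[OF D] D' by blast
      have "isomorphic T (sh T V) (sh T V)" by (rule isomorphic_refl[OF trD(1)[OF V(3)]])
      then have "sh T V \<in> ?S" using sV V(1) by blast
      moreover have "B \<in> ?R" using sub_ge_iff[OF D', of B M 0] ge[OF V(2)] V(2) by blast
      ultimately show "\<exists>A\<in>?S. \<exists>B\<in>?R. tr A X B" using V(3) by blast
    next
      assume "\<exists>A\<in>?S. \<exists>B\<in>?R. tr A X B"
      then obtain A V B where A: "V \<in> ?Y" "isomorphic T A (sh T V)" "B \<in> ?R" "tr A X B" by blast
      have VO: "sh T V \<in> Obj T" using A(1) YD D' sh_Obj by blast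
      have "ge M 0 B" using sub_ge_iff[OF D', of B M 0] A(3) by blast
      moreover have "tr (sh T V) X B" by (rule tr_iso1[OF A(4,2) VO])
      ultimately show "ge M\<^sub>\<mu> 0 X" unfolding tilt_ge using A(1) by blast
    qed
    then show ?thesis
      unfolding perp_fullsub ht shsub_fullsub[OF D YD] star_fullsub[OF D' SD]
      by - (rule Set.set_eqI, simp add: sub_ge_iff[OF D'] cong: conj_cong)
  qed
  have torsLR: "tors \<subseteq> ?L \<inter> ?R" using torsH unfolding ht .
  show ?thesis
    unfolding \<t>_def \<t>\<^sub>\<mu>_def \<G>_def \<D>_def X
  proof (intro conjI)
    show "t_structure (completion (fullsub T D) \<BB>) (GG (fullsub T D) \<BB> ?L, GG (fullsub T D) \<BB> ?R)"
      by (rule tstr_metric.GG_t_structure[OF tm])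
    show "t_structure (completion (fullsub T D) \<BB>)
        (GG (fullsub T D) \<BB> (sub_le T D M\<^sub>\<mu> 0), GG (fullsub T D) \<BB> (sub_ge T D M\<^sub>\<mu> 0))"
      by (rule tstr_metric.GG_t_structure[OF tm\<mu>])
    show "torsion_class (fullsub (completion (fullsub T D) \<BB>) (heart (GG (fullsub T D) \<BB> ?L, GG (fullsub T D) \<BB> ?R)))
        (GG (fullsub T D) \<BB> tors)"
      by (rule tstr_metric.GG_torsion[OF tm torsLR tors_tr])
    show "(GG (fullsub T D) \<BB> (sub_le T D M\<^sub>\<mu> 0), GG (fullsub T D) \<BB> (sub_ge T D M\<^sub>\<mu> 0)) =
        HRS_tilt (completion (fullsub T D) \<BB>) (GG (fullsub T D) \<BB> ?L, GG (fullsub T D) \<BB> ?R) (GG (fullsub T D) \<BB> tors)"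
      by (rule GG_HRS_tilt[OF tm tm\<mu> torsLR tors_sc tors_0 L\<mu> R\<mu>])
  qed
qed

end
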